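(* Let $b\ge1$, $a>0$, let $p_1,p_2\in\mathbb{S}^2$ be the points with $\phi(p_1)=ib$, $\phi(p_2)=-ib$, let $\sigma=a\delta_{p_1}+a\delta_{p_2}$ and $D=\operatorname{supp}(\mu_\sigma)$. Let $\sigma^*=\frac{1}{2a}(\phi^{-1})_*(\mu_V)$, where $\mu_V$ is the equilibrium measure on $\mathbb{R}$ in the external field $V(x)=\frac{1+a}{2}\log(x^2+b^{-2})-\frac a2\log(x^2+b^2)$. Set $Q^*(x)=U^{\sigma^*}(x)$ and $D^*=\overline{\mathbb{S}^2\setminus D}$. Then $$\mu_{\sigma^*}=\lambda(D^* )^{-1}\lambda_{D^*};$$ that is, the probability measure $\lambda(D^* )^{-1}\lambda_{D^*}$ minimizes the weighted energy functional $I_{Q^*}[\mu]$ among probability measures $\mu$ on $\mathbb{S}^2$.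
   Context: $\mathbb{S}^2=\{x\in\mathbb{R}^3:\|x\|=1\}$; $\lambda$ is Lebesgue (surface) measure on $\mathbb{S}^2$ normalized so that $\lambda(\mathbb{S}^2)=1$, and $\lambda_E$ is the restriction of $\lambda$ to a closed set $E$. The stereographic projection $\phi:\mathbb{S}^2\to\mathbb{C}\cup\{\infty\}$ is $\phi(x_1,x_2,x_3)=\frac{x_1+ix_2}{1-x_3}$ for $x_3\ne1$, and $\phi(0,0,1)=\infty$. $(\phi^{-1})_*$ denotes pushforward by $\phi^{-1}$. For a positive measure $\tau$ on $\mathbb{S}^2$, $U^\tau(x)=\int\log\frac{1}{\|x-y\|}d\tau(y)$. For an external field $Q$ on $\mathbb{S}^2$, $$I_Q[\mu]=\iint\log\frac{1}{\|x-y\|}\,d\mu(x)d\mu(y)+2\int Q\,d\mu ,$$ and for a charge distribution $\tau$ on $\mathbb{S}^2$, $\mu_\tau$ denotes the equilibrium measure in the external field $U^\tau$, i.e. the unique minimizer of $I_{U^\tau}$ among probability measures on $\mathbb{S}^2$. The equilibrium measure $\mu_V$ in the external field $V$ on $\mathbb{R}$ is the unique minimizer of $I_V[\mu]=\iint\log\frac1{|x-y|}d\mu(x)d\mu(y)+2\int V\,d\mu$ among probability measures $\mu$ on $\mathbb{R}$, where $I_V[\mu]$ is understood as $\iint\left[\log\frac1{|x-y|}+V(x)+V(y)\right]d\mu(x)d\mu(y)$ when the integrals are not separately defined. *)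

theory Defs
  imports "HOL-Probability.Probability"
begin

section \<open>Extended-real integrals\<close>

text \<open>
  The Bochner integral returns \<open>0\<close> for non-integrable functions, which would make measures of
  infinite energy look favourable. Energies and potentials are therefore integrals with values in
  the extended reals, positive part minus negative part. (The convention \<open>\<infinity> - \<infinity> = \<infinity>\<close> of
  \<^typ>\<open>ereal\<close> is never used for the energies of probability measures on the unit sphere or of the
  line energy with the external field at hand, whose integrands are bounded below.)
\<close>

definition ereal_integral :: "'a measure \<Rightarrow> ('a \<Rightarrow> ereal) \<Rightarrow> ereal" where
  "ereal_integral M f =
     enn2ereal (\<integral>\<^sup>+x. e2ennreal (f x) \<partial>M) - enn2ereal (\<integral>\<^sup>+x. e2ennreal (- f x) \<partial>M)"

lemma ereal_integral_eq_lebesgue_integral: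
  fixes f :: "'a \<Rightarrow> real"
  assumes "integrable M f"
  shows "ereal_integral M (\<lambda>x. ereal (f x)) = ereal (integral\<^sup>L M f)"
proof -
  have "(\<integral>\<^sup>+x. ennreal (f x) \<partial>M) < \<top>" "(\<integral>\<^sup>+x. ennreal (- f x) \<partial>M) < \<top>"
    using assms unfolding real_integrable_def by (auto simp: top.not_eq_extremum)
  then show ?thesis
    unfolding real_lebesgue_integral_def[OF assms] ereal_integral_def
    by (cases "\<integral>\<^sup>+x. ennreal (f x) \<partial>M"; cases "\<integral>\<^sup>+x. ennreal (- f x) \<partial>M")
       (auto simp: enn2ereal_ennreal)
qed


section \<open>Potentials, energies and equilibrium measures\<close>

definition log_kernel :: "'a::metric_space \<Rightarrow> 'a \<Rightarrow> ereal" where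
  "log_kernel x y = (if x = y then \<infinity> else ereal (ln (1 / dist x y)))"

definition log_potential :: "'a::metric_space measure \<Rightarrow> 'a \<Rightarrow> ereal" where
  "log_potential \<tau> x = ereal_integral \<tau> (\<lambda>y. log_kernel x y)"

text \<open>A probability measure on a Borel set \<open>K\<close> is a Borel probability measure on the ambient
  space that gives full mass to \<open>K\<close>.\<close>

definition prob_on :: "'a::topological_space set \<Rightarrow> 'a measure \<Rightarrow> bool" where
  "prob_on K \<mu> \<longleftrightarrow> prob_space \<mu> \<and> sets \<mu> = sets borel \<and> emeasure \<mu> K = 1"

definition measure_support :: "'a::topological_space measure \<Rightarrow> 'a set" where
  "measure_support \<mu> = {x. \<forall>U. open U \<longrightarrow> x \<in> U \<longrightarrow> emeasure \<mu> U > 0}"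

definition weighted_energy :: "('a::metric_space \<Rightarrow> ereal) \<Rightarrow> 'a measure \<Rightarrow> ereal" where
  "weighted_energy Q \<mu> =
     ereal_integral (\<mu> \<Otimes>\<^sub>M \<mu>) (\<lambda>(x, y). log_kernel x y) + 2 * ereal_integral \<mu> Q"

text \<open>
  On the unbounded line the two terms of \<^const>\<open>weighted_energy\<close> need not be defined separately, and
  the energy is the integral of the combined kernel. By \<open>line_energy_eq_weighted_energy\<close> below this
  is the sum of the two terms whenever that sum is meaningful.
\<close>

definition line_energy :: "(real \<Rightarrow> real) \<Rightarrow> real measure \<Rightarrow> ereal" where
  "line_energy V \<mu> =
     ereal_integral (\<mu> \<Otimes>\<^sub>M \<mu>) (\<lambda>(x, y). log_kernel x y + ereal (V x) + ereal (V y))"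

definition line_equilibrium :: "(real \<Rightarrow> real) \<Rightarrow> real measure" where
  "line_equilibrium V = (THE \<mu>. is_arg_min (line_energy V) (prob_on UNIV) \<mu>)"


section \<open>The unit sphere\<close>

abbreviation S2 :: "(real^3) set" where
  "S2 \<equiv> sphere 0 1"

definition sphere_equilibrium :: "(real^3) measure \<Rightarrow> (real^3) measure" where
  "sphere_equilibrium \<tau> =
     (THE \<mu>. is_arg_min (weighted_energy (log_potential \<tau>)) (prob_on S2) \<mu>)"

text \<open>
  Normalized surface measure: since the surface area of \<open>A \<subseteq> S2\<close> is three times the volume of the
  cone \<open>{t *\<^sub>R x |t x. 0 < t \<and> t < 1 \<and> x \<in> A}\<close>, it is the image of the uniform distribution on the
  unit ball under radial projection. It is the rotation-invariant probability measure on the sphere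
  (\<open>surface_measure_prob_on\<close>, \<open>surface_measure_rotation_invariant\<close>).
\<close>

definition surface_measure :: "(real^3) measure" where
  "surface_measure = distr (uniform_measure lborel (ball 0 1)) borel (\<lambda>x. x /\<^sub>R norm x)"

text \<open>The point \<open>\<infinity>\<close> of the extended complex plane is \<^const>\<open>None\<close>.\<close>

definition stereo :: "real^3 \<Rightarrow> complex option" where
  "stereo x = (if x $ 3 = 1 then None
     else Some ((of_real (x $ 1) + \<i> * of_real (x $ 2)) / of_real (1 - x $ 3)))"

definition inv_stereo :: "complex option \<Rightarrow> real^3" where
  "inv_stereo = the_inv_into S2 stereo"

definition measure_plus :: "'a measure \<Rightarrow> 'a measure \<Rightarrow> 'a measure" where
  "measure_plus M N = measure_of (space M) (sets M) (\<lambda>A. emeasure M A + emeasure N A)"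

lemma emeasure_measure_plus:
  assumes "sets M = sets N" "A \<in> sets M"
  shows "emeasure (measure_plus M N) A = emeasure M A + emeasure N A"
  unfolding measure_plus_def
proof (rule emeasure_measure_of_sigma)
  show "sigma_algebra (space M) (sets M)" ..
  show "positive (sets M) (\<lambda>A. emeasure M A + emeasure N A)"
    by (simp add: positive_def)
  show "countably_additive (sets M) (\<lambda>A. emeasure M A + emeasure N A)"
    using assms(1)
    by (auto simp: countably_additive_def suminf_emeasure suminf_add[symmetric, OF summableI summableI])
qed fact


section \<open>Consistency of the definitions\<close>

lemma ereal_integral_add:
  fixes f :: "'a \<Rightarrow> ereal" and g :: "'a \<Rightarrow> real"
  assumes [measurable]: "f \<in> borel_measurable M" "g \<in> borel_measurable M"
    and fin: "(\<integral>\<^sup>+x. e2ennreal (f x) \<partial>M) < \<top> \<and> (\<integral>\<^sup>+x. ennreal (g x) \<partial>M) < \<top> \<or>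
      (\<integral>\<^sup>+x. e2ennreal (- f x) \<partial>M) < \<top> \<and> (\<integral>\<^sup>+x. ennreal (- g x) \<partial>M) < \<top>"
  shows "ereal_integral M (\<lambda>x. f x + ereal (g x))
    = ereal_integral M f + ereal_integral M (\<lambda>x. ereal (g x))"
proof -
  let ?I = "\<lambda>h. \<integral>\<^sup>+x. e2ennreal (h x) \<partial>M"
  have mx: "ennreal x = ennreal (max 0 x)" for x by (simp add: max_def ennreal_neg)
  have real_eq: "ennreal (u + v) + ennreal (- u) + ennreal (- v)
     = ennreal (- (u + v)) + ennreal u + ennreal v" for u v :: real
    by (subst (1 2 3 4 5 6) mx) (simp add: ennreal_plus[symmetric] max_def del: ennreal_plus)
  have real_le: "ennreal (u + v) \<le> ennreal u + ennreal v" for u v :: real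
    by (subst (1 2 3) mx) (simp add: ennreal_plus[symmetric] max_def del: ennreal_plus)
  have neg: "- (f x + ereal (g x)) = - f x + - ereal (g x)" for x
    by (cases "f x") auto
  have pt: "e2ennreal (f x + ereal (g x)) + e2ennreal (- f x) + e2ennreal (- ereal (g x))
     = e2ennreal (- (f x + ereal (g x))) + e2ennreal (f x) + e2ennreal (ereal (g x))" for x
    using real_eq by (cases "f x") (auto simp: e2ennreal_neg)
  have leP: "e2ennreal (f x + ereal (g x)) \<le> e2ennreal (f x) + ennreal (g x)" for x
    using real_le by (cases "f x") (auto simp: e2ennreal_neg)
  have leM: "e2ennreal (- (f x + ereal (g x))) \<le> e2ennreal (- f x) + ennreal (- g x)" for x
    unfolding neg using real_le[of _ "- g x"] by (cases "f x") (auto simp: e2ennreal_neg)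
  define P where "P = ?I (\<lambda>x. f x + ereal (g x))"
  define N where "N = ?I (\<lambda>x. - (f x + ereal (g x)))"
  define fp where "fp = ?I f"
  define fm where "fm = ?I (\<lambda>x. - f x)"
  define gp where "gp = (\<integral>\<^sup>+x. ennreal (g x) \<partial>M)"
  define gm where "gm = (\<integral>\<^sup>+x. ennreal (- g x) \<partial>M)"
  have eq: "P + fm + gm = N + fp + gp"
  proof -
    have "P + fm + gm = (\<integral>\<^sup>+x. e2ennreal (f x + ereal (g x)) + e2ennreal (- f x)
        + e2ennreal (- ereal (g x)) \<partial>M)"
      by (simp add: P_def fm_def gm_def nn_integral_add)
    also have "\<dots> = (\<integral>\<^sup>+x. e2ennreal (- (f x + ereal (g x))) + e2ennreal (f x)
        + e2ennreal (ereal (g x)) \<partial>M)"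
      by (simp only: pt)
    also have "\<dots> = N + fp + gp"
      by (simp add: N_def fp_def gp_def nn_integral_add)
    finally show ?thesis .
  qed
  have P: "P \<le> fp + gp"
    unfolding P_def fp_def gp_def
    by (subst nn_integral_add[symmetric]) (auto intro!: nn_integral_mono leP)
  have N: "N \<le> fm + gm"
    unfolding N_def fm_def gm_def
    by (subst nn_integral_add[symmetric]) (auto intro!: nn_integral_mono leM)
  have "enn2ereal P - enn2ereal N = (enn2ereal fp - enn2ereal fm) + (enn2ereal gp - enn2ereal gm)"
    using fin[folded fp_def fm_def gp_def gm_def] eq P N
    by (cases P; cases N; cases fp; cases fm; cases gp; cases gm)
       (auto simp: enn2ereal_ennreal ennreal_plus[symmetric] top_unique
             simp del: ennreal_plus)
  then show ?thesis
    by (simp add: ereal_integral_def P_def N_def fp_def fm_def gp_def gm_def)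
qed

lemma borel_measurable_log_kernel [measurable]:
  "(\<lambda>(x, y). log_kernel x (y :: 'a::{metric_space, second_countable_topology}))
     \<in> borel_measurable (borel \<Otimes>\<^sub>M borel)"
  unfolding log_kernel_def by (simp add: split_def) measurable

lemma line_energy_eq_weighted_energy:
  assumes "prob_on UNIV \<mu>" and [measurable]: "V \<in> borel_measurable borel"
    and "(\<integral>\<^sup>+(x, y). e2ennreal (log_kernel x y) \<partial>(\<mu> \<Otimes>\<^sub>M \<mu>)) < \<top> \<and> (\<integral>\<^sup>+x. ennreal (V x) \<partial>\<mu>) < \<top> \<or>
      (\<integral>\<^sup>+(x, y). e2ennreal (- log_kernel x y) \<partial>(\<mu> \<Otimes>\<^sub>M \<mu>)) < \<top> \<and> (\<integral>\<^sup>+x. ennreal (- V x) \<partial>\<mu>) < \<top>"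
  shows "line_energy V \<mu> = weighted_energy (\<lambda>x. ereal (V x)) \<mu>"
proof -
  have [measurable_cong]: "sets \<mu> = sets borel" and "prob_space \<mu>"
    using assms(1) by (auto simp: prob_on_def)
  interpret prob_space \<mu> by fact
  let ?P = "\<mu> \<Otimes>\<^sub>M \<mu>"
  have fst: "(\<integral>\<^sup>+x. h (fst x) \<partial>?P) = (\<integral>\<^sup>+x. h x \<partial>\<mu>)" 
    if [measurable]: "h \<in> borel_measurable borel" for h :: "real \<Rightarrow> ennreal"
    by (simp add: nn_integral_fst[symmetric] emeasure_space_1)
  have snd: "(\<integral>\<^sup>+x. h (snd x) \<partial>?P) = (\<integral>\<^sup>+x. h x \<partial>\<mu>)" 
    if [measurable]: "h \<in> borel_measurable borel" for h :: "real \<Rightarrow> ennreal"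
    by (simp add: nn_integral_fst[symmetric] emeasure_space_1)
  let ?k = "\<lambda>p :: real \<times> real. log_kernel (fst p) (snd p)"
  have [measurable]: "?k \<in> borel_measurable ?P"
    using borel_measurable_log_kernel[where 'a = real] by (simp add: split_def cong: measurable_cong_sets)
  have fin: "(\<integral>\<^sup>+p. e2ennreal (?k p) \<partial>?P) < \<top> \<and> (\<integral>\<^sup>+x. ennreal (V x) \<partial>\<mu>) < \<top> \<or>
      (\<integral>\<^sup>+p. e2ennreal (- ?k p) \<partial>?P) < \<top> \<and> (\<integral>\<^sup>+x. ennreal (- V x) \<partial>\<mu>) < \<top>"
    using assms(3) by (simp add: split_def)
  have le: "ennreal (u + v) \<le> ennreal u + ennreal v" for u v :: real
    by (cases "0 \<le> u"; cases "0 \<le> v")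
       (auto simp: ennreal_plus[symmetric] ennreal_neg intro!: ennreal_leI simp del: ennreal_plus)
  let ?W = "\<lambda>p. V (fst p) + V (snd p)"
  have Wp: "(\<integral>\<^sup>+p. ennreal (?W p) \<partial>?P) \<le> (\<integral>\<^sup>+x. ennreal (V x) \<partial>\<mu>) + (\<integral>\<^sup>+x. ennreal (V x) \<partial>\<mu>)"
  proof -
    have "(\<integral>\<^sup>+p. ennreal (?W p) \<partial>?P) \<le> (\<integral>\<^sup>+p. ennreal (V (fst p)) + ennreal (V (snd p)) \<partial>?P)"
      using le by (intro nn_integral_mono) simp
    then show ?thesis by (simp add: nn_integral_add fst[of "\<lambda>x. ennreal (V x)"] snd[of "\<lambda>x. ennreal (V x)"])
  qed
  have Wm: "(\<integral>\<^sup>+p. ennreal (- ?W p) \<partial>?P) \<le> (\<integral>\<^sup>+x. ennreal (- V x) \<partial>\<mu>) + (\<integral>\<^sup>+x. ennreal (- V x) \<partial>\<mu>)"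
  proof -
    have "(\<integral>\<^sup>+p. ennreal (- ?W p) \<partial>?P) \<le> (\<integral>\<^sup>+p. ennreal (- V (fst p)) + ennreal (- V (snd p)) \<partial>?P)"
      using le[of "- V _" "- V _"] by (intro nn_integral_mono) simp
    then show ?thesis by (simp add: nn_integral_add fst[of "\<lambda>x. ennreal (- V x)"] snd[of "\<lambda>x. ennreal (- V x)"])
  qed
  have "line_energy V \<mu> = ereal_integral ?P (\<lambda>p. ?k p + ereal (?W p))"
    unfolding line_energy_def by (simp add: split_def add.assoc)
  also have "\<dots> = ereal_integral ?P ?k + ereal_integral ?P (\<lambda>p. ereal (?W p))"
    using fin Wp Wm by (intro ereal_integral_add) (auto simp: top.not_eq_extremum[symmetric] top_unique)
  also have "ereal_integral ?P (\<lambda>p. ereal (?W p)) =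
      ereal_integral ?P (\<lambda>p. ereal (V (fst p))) + ereal_integral ?P (\<lambda>p. ereal (V (snd p)))"
    using fin ereal_integral_add[of "\<lambda>p. ereal (V (fst p))" ?P "\<lambda>p. V (snd p)"]
    by (auto simp: fst[of "\<lambda>x. ennreal (- V x)"] snd[of "\<lambda>x. ennreal (- V x)"]
        fst[of "\<lambda>x. ennreal (V x)"] snd[of "\<lambda>x. ennreal (V x)"])
  also have "\<dots> = 2 * ereal_integral \<mu> (\<lambda>x. ereal (V x))"
    by (simp add: ereal_integral_def fst[of "\<lambda>x. ennreal (- V x)"] snd[of "\<lambda>x. ennreal (- V x)"]
        fst[of "\<lambda>x. ennreal (V x)"] snd[of "\<lambda>x. ennreal (V x)"] mult_2_ereal)
  finally show ?thesis by (simp add: weighted_energy_def split_def)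
qed

lemma borel_measurable_radial [measurable]:
  "(\<lambda>x :: real^3. x /\<^sub>R norm x) \<in> borel_measurable borel"
  by measurable

lemma surface_measure_prob_on: "prob_on S2 surface_measure"
proof -
  have fin: "emeasure lborel (ball (0 :: real^3) 1) \<noteq> 0" "emeasure lborel (ball (0 :: real^3) 1) \<noteq> \<infinity>"
    using emeasure_lborel_ball_finite[of "0 :: real^3" 1] content_ball_pos[of 1 "0 :: real^3"]
    by (auto simp: measure_def top.not_eq_extremum)
  then interpret U: prob_space "uniform_measure lborel (ball (0 :: real^3) 1)"
    by (rule prob_space_uniform_measure)
  have "emeasure surface_measure S2
    = emeasure (uniform_measure lborel (ball (0 :: real^3) 1)) ((\<lambda>x. x /\<^sub>R norm x) -` S2)"
    unfolding surface_measure_def by (subst emeasure_distr) auto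
  also have "(\<lambda>x. x /\<^sub>R norm x) -` S2 = - {0 :: real^3}"
    by (auto simp: divide_simps)
  also have "emeasure (uniform_measure lborel (ball (0 :: real^3) 1)) (- {0}) = 1"
  proof -
    have "AE x in uniform_measure lborel (ball (0 :: real^3) 1). x \<in> - {0}"
      using AE_lborel_singleton[of "0 :: real^3"] fin
      by (intro AE_uniform_measureI) auto
    then show ?thesis by (intro U.emeasure_eq_1_AE) auto
  qed
  finally show ?thesis
    unfolding prob_on_def by (auto simp: surface_measure_def intro!: U.prob_space_distr)
qed

lemma surface_measure_rotation_invariant:
  assumes "orthogonal_transformation f"
  shows "distr surface_measure borel f = surface_measure"
proof -
  have lin: "linear f" and nf: "norm (f x) = norm x" for x
    using assms by (auto simp: orthogonal_transformation)
  have [measurable]: "f \<in> borel_measurable borel"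
    using lin by (intro borel_measurable_continuous_onI linear_continuous_on) (simp add: linear_conv_bounded_linear)
  let ?g = "inv f"
  have bij: "bij f" using assms orthogonal_transformation_bij by blast
  have og: "orthogonal_transformation ?g" using assms orthogonal_transformation_inv by blast
  have inv: "distr lborel borel f = lborel"
  proof (rule measure_eqI)
    fix A assume "A \<in> sets (distr lborel borel f)"
    then have A [measurable]: "A \<in> sets borel" by simp
    have pre: "f -` A = ?g ` A" using bij by (simp add: bij_vimage_eq_inv_image)
    have [measurable]: "f -` A \<in> sets borel" using measurable_sets[of f borel borel A] by simp
    have lm: "emeasure lborel (f -` B) = emeasure lborel B" if "B \<in> sets borel" "bounded B" for B
    proof -
      have B: "B \<in> lmeasurable" using that by (intro bounded_set_imp_lmeasurable) auto
      have pre: "f -` B = ?g ` B" using bij by (simp add: bij_vimage_eq_inv_image)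
      have mB: "f -` B \<in> sets borel" using measurable_sets[of f borel borel B] that by simp
      have gl: "?g ` B \<in> lmeasurable" "measure lebesgue (?g ` B) = measure lebesgue B"
        using measurable_orthogonal_image[OF og B] measure_orthogonal_image[OF og B] by auto
      have "emeasure lebesgue (f -` B) = emeasure lebesgue B"
        using gl B unfolding pre by (simp add: emeasure_eq_measure2 fmeasurableD2)
      then show ?thesis using that mB by simp
    qed
    have "emeasure lborel (f -` A) = (SUP n::nat. emeasure lborel (f -` (A \<inter> ball 0 (real n))))"
    proof -
      have "f -` A = (\<Union>n::nat. f -` (A \<inter> ball 0 (real n)))"
        by (auto intro: reals_Archimedean2)
      moreover have "(SUP n::nat. emeasure lborel (f -` (A \<inter> ball 0 (real n)))) = emeasure lborel (\<Union>n::nat. f -` (A \<inter> ball 0 (real n)))"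
        using measurable_sets[of f borel borel "A \<inter> ball 0 (real _)"]
        by (intro SUP_emeasure_incseq) (auto simp: incseq_def)
      ultimately show ?thesis by simp
    qed
    also have "\<dots> = (SUP n::nat. emeasure lborel (A \<inter> ball 0 (real n)))"
      by (intro SUP_cong lm) auto
    also have "\<dots> = emeasure lborel (\<Union>n::nat. A \<inter> ball 0 (real n))"
      by (intro SUP_emeasure_incseq) (auto simp: incseq_def)
    also have "(\<Union>n::nat. A \<inter> ball 0 (real n)) = A"
      by (auto intro: reals_Archimedean2)
    finally show "emeasure (distr lborel borel f) A = emeasure lborel A"
      by (simp add: emeasure_distr)
  qed simp
  have U: "distr (uniform_measure lborel (ball 0 1)) borel f = uniform_measure lborel (ball 0 1)"
  proof (rule measure_eqI)
    fix A assume "A \<in> sets (distr (uniform_measure lborel (ball 0 1)) borel f)"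
    then have A [measurable]: "A \<in> sets borel" by simp
    have [measurable]: "f -` A \<in> sets borel" using measurable_sets[of f borel borel A] by simp
    have "emeasure lborel (ball 0 1 \<inter> A) = emeasure (distr lborel borel f) (ball 0 1 \<inter> A)"
      by (simp add: inv)
    also have "\<dots> = emeasure lborel (ball 0 1 \<inter> f -` A)"
      by (subst emeasure_distr) (auto simp: nf intro!: arg_cong[where f = "emeasure lborel"])
    finally show "emeasure (distr (uniform_measure lborel (ball 0 1)) borel f) A
        = emeasure (uniform_measure lborel (ball 0 1)) A"
      by (simp add: emeasure_distr)
  qed simp
  have comm: "f \<circ> (\<lambda>x. x /\<^sub>R norm x) = (\<lambda>x. x /\<^sub>R norm x) \<circ> f"
    using lin by (auto simp: fun_eq_iff linear_cmul nf)
  have "distr surface_measure borel f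
      = distr (uniform_measure lborel (ball 0 1)) borel (f \<circ> (\<lambda>x. x /\<^sub>R norm x))"
    unfolding surface_measure_def by (subst distr_distr) auto
  also have "\<dots> = distr (distr (uniform_measure lborel (ball 0 1)) borel f) borel (\<lambda>x. x /\<^sub>R norm x)"
    unfolding comm by (subst distr_distr) auto
  finally show ?thesis by (simp add: U surface_measure_def)
qed

lemma norm3_sq: "(norm (x :: real^3))\<^sup>2 = (x $ 1)\<^sup>2 + (x $ 2)\<^sup>2 + (x $ 3)\<^sup>2"
  by (simp add: norm_vec_def L2_set_def sum_3 real_sqrt_pow2)

lemma S2_iff: "x \<in> S2 \<longleftrightarrow> (x $ 1)\<^sup>2 + (x $ 2)\<^sup>2 + (x $ 3)\<^sup>2 = 1"
  unfolding norm3_sq[symmetric] by (simp add: abs_square_eq_1)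

lemma bij_betw_stereo: "bij_betw stereo S2 UNIV"
  and inv_stereo_Some: "inv_stereo (Some z) =
     vector [2 * Re z / ((cmod z)\<^sup>2 + 1), 2 * Im z / ((cmod z)\<^sup>2 + 1),
             ((cmod z)\<^sup>2 - 1) / ((cmod z)\<^sup>2 + 1)]" (is "_ = ?g z")
  and inv_stereo_None: "inv_stereo None = axis 3 1"
proof -
  have pos: "(cmod z)\<^sup>2 + 1 > 0" for z by (simp add: add_nonneg_pos)
  have sg: "?g z \<in> S2" for z
  proof -
    have "(2 * u / (u\<^sup>2 + v\<^sup>2 + 1))\<^sup>2 + (2 * v / (u\<^sup>2 + v\<^sup>2 + 1))\<^sup>2
        + ((u\<^sup>2 + v\<^sup>2 - 1) / (u\<^sup>2 + v\<^sup>2 + 1))\<^sup>2 = 1" for u v :: real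
    proof -
      have "u\<^sup>2 + v\<^sup>2 + 1 \<noteq> 0" by (smt (verit) zero_le_power2)
      then have nz: "(u\<^sup>2 + v\<^sup>2 + 1)\<^sup>2 \<noteq> 0" by simp
      have "(2 * u)\<^sup>2 + (2 * v)\<^sup>2 + (u\<^sup>2 + v\<^sup>2 - 1)\<^sup>2 = (u\<^sup>2 + v\<^sup>2 + 1)\<^sup>2"
        by (simp add: power2_eq_square algebra_simps)
      with nz show ?thesis by (simp add: power_divide add_divide_distrib[symmetric])
    qed
    then show ?thesis unfolding S2_iff by (simp add: cmod_power2 vector_3)
  qed
  have stg: "stereo (?g z) = Some z" for z
  proof -
    have 1: "1 - ((cmod z)\<^sup>2 - 1) / ((cmod z)\<^sup>2 + 1) = 2 / ((cmod z)\<^sup>2 + 1)"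
      using pos[of z] by (simp add: field_simps)
    have 2: "((cmod z)\<^sup>2 - 1) / ((cmod z)\<^sup>2 + 1) \<noteq> 1"
      using pos[of z] by (simp add: field_simps)
    show ?thesis
      using pos[of z] 2 unfolding stereo_def vector_3 1
      by (auto simp: complex_eq_iff Re_divide_of_real Im_divide_of_real)
  qed
  have gst: "?g w = x" if "x \<in> S2" "stereo x = Some w" for x w
  proof -
    have sq: "(x $ 1)\<^sup>2 + (x $ 2)\<^sup>2 = 1 - (x $ 3)\<^sup>2" using that(1) unfolding S2_iff by simp
    have n: "1 - x $ 3 \<noteq> 0" and w: "Re w = x $ 1 / (1 - x $ 3)" "Im w = x $ 2 / (1 - x $ 3)"
      using that(2) by (auto simp: stereo_def Re_divide_of_real Im_divide_of_real split: if_splits)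
    have "(cmod w)\<^sup>2 = (1 - (x $ 3)\<^sup>2) / (1 - x $ 3)\<^sup>2"
      unfolding cmod_power2 w sq[symmetric] by (simp add: power_divide add_divide_distrib)
    also have "\<dots> = (1 + x $ 3) / (1 - x $ 3)"
      using n by (simp add: divide_simps) (simp add: power2_eq_square algebra_simps)
    finally have c: "(cmod w)\<^sup>2 = (1 + x $ 3) / (1 - x $ 3)" .
    have c1: "(cmod w)\<^sup>2 + 1 = 2 / (1 - x $ 3)" "(cmod w)\<^sup>2 - 1 = 2 * x $ 3 / (1 - x $ 3)"
      unfolding c using n by (simp_all add: field_simps)
    show ?thesis unfolding c1 w using n by (simp add: vec_eq_iff forall_3 vector_3)
  qed
  have N: "x = axis 3 1" if "x \<in> S2" "stereo x = None" for x
    using that unfolding S2_iff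
    by (auto simp: stereo_def vec_eq_iff forall_3 axis_def split: if_splits)
  have N1: "axis 3 1 \<in> S2"
    unfolding S2_iff by (simp add: axis_def)
  have N2: "stereo (axis 3 1) = None"
    by (simp add: stereo_def axis_def)
  have inj: "inj_on stereo S2"
    by (rule inj_onI) (metis N gst not_Some_eq)
  moreover have "o' \<in> stereo ` S2" for o'
    by (cases o') (metis N1 N2 image_eqI, metis sg stg image_eqI)
  ultimately show "bij_betw stereo S2 UNIV" by (auto simp: bij_betw_def)
  show "inv_stereo (Some z) = ?g z"
    unfolding inv_stereo_def using the_inv_into_f_eq[OF inj stg sg] .
  show "inv_stereo None = axis 3 1"
    unfolding inv_stereo_def using the_inv_into_f_eq[OF inj N2 N1] .
qed

lemma borel_measurable_inv_stereo [measurable]: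
  "(\<lambda>z. inv_stereo (Some z)) \<in> borel_measurable borel"
proof (rule borel_measurable_continuous_onI)
  have nz: "(cmod z)\<^sup>2 + 1 \<noteq> 0" for z by (smt (verit) zero_le_power2)
  have c: "continuous_on UNIV (\<lambda>z. 2 * Re z / ((cmod z)\<^sup>2 + 1))"
    "continuous_on UNIV (\<lambda>z. 2 * Im z / ((cmod z)\<^sup>2 + 1))"
    "continuous_on UNIV (\<lambda>z. ((cmod z)\<^sup>2 - 1) / ((cmod z)\<^sup>2 + 1))"
    using nz by (auto intro!: continuous_intros)
  have "continuous_on UNIV (\<lambda>z. inv_stereo (Some z) $ i)" for i :: 3
    using exhaust_3[of i]
    by (elim disjE; hypsubst) (simp_all only: inv_stereo_Some vector_3 c)
  then show "continuous_on UNIV (\<lambda>z. inv_stereo (Some z))"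
    using continuous_on_vec_lambda[of UNIV "\<lambda>i z. inv_stereo (Some z) $ i"] by simp
qed

end

theory Submission
  imports Defs "HOL-Complex_Analysis.Cauchy_Integral_Formula"
begin

text \<open>
  By Frostman's criterion a probability measure is the equilibrium measure in a given field as soon
  as the sum of its potential and the field is constant on its support and not smaller elsewhere.
  Put \<open>W = 1 / (1 + 2 a)\<close>. The set \<open>D\<close> has surface measure \<open>W\<close>, and both equilibrium problems on the
  sphere follow from two sweeping relations: the surface measure of the complement of \<open>D\<close> has, up
  to a constant, the potential of the charges \<open>W a\<close> at \<open>p1\<close> and \<open>p2\<close> on \<open>D\<close>, and the surface measure
  of \<open>D\<close> has, up to a constant, the potential of \<open>W \<mu>_V\<close> off \<open>D\<close>, with inequalities elsewhere.

  If \<open>a b\<^sup>2 \<le> 1 + a\<close>, the complement of \<open>D\<close> consists of two disjoint caps, the relations are mean value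
  properties over circles, and \<open>\<mu>_V\<close> is a difference of Cauchy densities. Otherwise take
  the caps around \<open>p1\<close> and \<open>p2\<close> that touch each other at infinity. In the plane the region between them
  is a strip foliated by ellipses, and \<open>D\<close> is one of the regions that the ellipses bound. The surface measure disintegrates along this foliation
  into Poisson kernels of the Joukowski parameter, whose logarithmic potentials are explicit. Every
  leaf is equivalent to half a charge at each of \<open>p1\<close>, \<open>p2\<close> for the points inside of it and to a measure
  on a segment of the line for the points outside of it; integrating the latter over the leaves in
  \<open>D\<close> gives \<open>W \<mu>_V\<close>, because the densities are the derivative of that of \<open>w \<mu>_V\<close> in the level \<open>w\<close>.
\<close>

section \<open>The logarithmic kernel on the sphere\<close>

text \<open>Why the leaves behave as stated: the law on a leaf is the mean of the Poisson kernels at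
  two points of the disk whose mirror images in the circle are mapped to \<open>p1\<close> and
  \<open>p2\<close>. It is thus the harmonic measure of the exterior of the ellipse seen from the
  two charges, and inside it looks like two half charges. Shrinking the ellipse to its focal segment
  keeps the outer potential up to a constant and gives the sweep of the sources 1/2 at the pair
  +-i/b and 1/2 at the pair +-ib. On the other hand w mu_V is the sweep of (1 + w)/2 at +-i/b and
  -(1 - w)/2 at +-ib; both coefficients have w-derivative 1/2, and the moving ends of the segment
  contribute nothing because the density vanishes there. Potentials may be infinite, so constants
  are not subtracted: sweeping relations have the form A x + B x0 = A x0 + B x with a reference
  point x0. No change of variables leads from the radial projection to coordinates on the sphere:
  two measures whose energies and mutual energy agree are equal, and this identifies the surface
  measure.\<close>

text \<open>The shift by \<open>ln 2\<close> makes the kernel nonnegative on the sphere, so that potentials and energies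
  become integrals with values in \<^typ>\<open>ennreal\<close>.\<close>

definition skernel :: "real^3 \<Rightarrow> real^3 \<Rightarrow> ennreal" where
  "skernel x y = e2ennreal (log_kernel x y + ereal (ln 2))"

lemma skernel_refl [simp]: "skernel x x = \<top>"
  by (simp add: skernel_def log_kernel_def)

lemma skernel_neq: "x \<noteq> y \<Longrightarrow> skernel x y = ennreal (ln (2 / dist x y))"
  by (simp add: skernel_def log_kernel_def ln_div)

lemma skernel_commute: "skernel x y = skernel y x"
  by (cases "x = y") (auto simp: skernel_neq dist_commute)

lemma measurable_skernel [measurable (raw)]:
  assumes [measurable]: "f \<in> borel_measurable M" "g \<in> borel_measurable M"
  shows "(\<lambda>x. skernel (f x) (g x)) \<in> borel_measurable M"
  unfolding skernel_def log_kernel_def by measurable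

text \<open>Height of \<open>x\<close> in direction \<open>y\<close>, rescaled so that on the sphere
  it runs from 0 at \<open>-y\<close> to 1 at \<open>y\<close>. The squared chord is 4 (1 - t) in
  this variable t, caps are its superlevel sets, and the surface measure makes it uniformly
  distributed.\<close>

definition half_inner :: "real^3 \<Rightarrow> real^3 \<Rightarrow> real" where
  "half_inner x y = (1 + x \<bullet> y) / 2"

lemma half_inner_bounds:
  assumes "x \<in> S2" "y \<in> S2"
  shows "0 \<le> half_inner x y" "half_inner x y \<le> 1"
  using Cauchy_Schwarz_ineq2[of x y] assms by (auto simp: half_inner_def)

lemma dist_S2:
  assumes "x \<in> S2" "y \<in> S2"
  shows "(dist x y)\<^sup>2 = 4 * (1 - half_inner x y)"
  using assms by (simp add: dist_norm power2_norm_eq_inner inner_diff half_inner_def inner_commute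
     norm_eq_1 field_simps)

lemma sums_neg_ln:
  fixes t :: real
  assumes "0 \<le> t" "t < 1"
  shows "(\<lambda>n. t ^ Suc n / Suc n) sums (- ln (1 - t))"
proof -
  have "(\<lambda>n. - ((- (- t)) ^ n) / real n) sums ln (1 + (- t))"
    using assms by (intro ln_series') simp
  from sums_minus[OF this] have "(\<lambda>n. t ^ n / real n) sums (- ln (1 - t))" by simp
  then show ?thesis using sums_Suc_iff[of "\<lambda>n. t ^ n / real n"] by simp
qed

text \<open>The kernel is -ln (1 - t) / 2 with t = \<open>half_inner x y\<close>, a power series
  with positive coefficients only; this is the source of positive definiteness. On the diagonal both
  sides are infinite because the harmonic series diverges.\<close>

lemma skernel_series:
  assumes "x \<in> S2" "y \<in> S2"
  shows "skernel x y = (\<Sum>n. ennreal (half_inner x y ^ Suc n / (2 * Suc n)))"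
proof (cases "x = y")
  case True
  then have "half_inner x y = 1" using assms by (simp add: half_inner_def norm_eq_1)
  moreover have "(\<Sum>n. ennreal (1 / (2 * real (Suc n)))) = \<top>"
  proof (rule ccontr)
    assume "(\<Sum>n. ennreal (1 / (2 * real (Suc n)))) \<noteq> \<top>"
    then have "summable (\<lambda>n. 1 / (2 * real (Suc n)))"
      by (intro summable_suminf_not_top) auto
    from summable_mult[OF this, of 2] have "summable (\<lambda>n. 1 / real (Suc n))"
      by (rule summable_cong[THEN iffD1, rotated]) (auto simp: field_simps)
    then show False
      using not_summable_harmonic[where 'a = real] summable_Suc_iff[of "\<lambda>n. inverse (of_nat n) :: real"]
      by (simp add: inverse_eq_divide)
  qed
  ultimately show ?thesis using True by simp
next
  case False
  let ?t = "half_inner x y"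
  have t: "0 \<le> ?t" "?t < 1"
    using half_inner_bounds[OF assms] dist_S2[OF assms] False
    by (auto simp: less_le)
  have "ln (2 / dist x y) = - ln (1 - ?t) / 2"
  proof -
    have "ln ((dist x y)\<^sup>2) = ln 4 + ln (1 - ?t)"
      unfolding dist_S2[OF assms] using t by (subst ln_mult) auto
    moreover have "ln ((dist x y)\<^sup>2) = 2 * ln (dist x y)" using False by (simp add: ln_realpow)
    moreover have "ln (4::real) = 2 * ln 2" using ln_realpow[of 2 2] by simp
    ultimately show ?thesis using False by (simp add: ln_div)
  qed
  moreover have "(\<lambda>n. ?t ^ Suc n / (2 * Suc n)) sums (- ln (1 - ?t) / 2)"
    using sums_divide[OF sums_neg_ln[OF t], of 2] by (simp add: mult.commute)
  moreover have "(\<Sum>n. ennreal (?t ^ Suc n / (2 * Suc n))) = ennreal (- ln (1 - ?t) / 2)"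
    if "(\<lambda>n. ?t ^ Suc n / (2 * Suc n)) sums (- ln (1 - ?t) / 2)"
    using that t by (intro suminf_ennreal_eq) auto
  ultimately show ?thesis using False by (simp add: skernel_neq)
qed

section \<open>Powers of the kernel variable as sums of products of monomials\<close>

text \<open>The index \<open>None\<close> is a constant coordinate 1: \<open>half_inner x y\<close>
  is half the inner product of the vectors (1, x) and (1, y), so its n-th power expands over words
  of length n in four letters.\<close>

definition coord :: "3 option \<Rightarrow> real^3 \<Rightarrow> real" where
  "coord j x = (case j of None \<Rightarrow> 1 | Some i \<Rightarrow> x $ i)"

definition monom3 :: "nat \<Rightarrow> (nat \<Rightarrow> 3 option) \<Rightarrow> real^3 \<Rightarrow> real" where
  "monom3 n f x = (\<Prod>k<n. coord (f k) x)"

lemma continuous_on_monom3 [continuous_intros]: "continuous_on S (monom3 n f)"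
proof -
  have "continuous_on S (coord j)" for j
    by (cases j) (auto simp: coord_def[abs_def] intro!: continuous_intros)
  then show ?thesis unfolding monom3_def[abs_def] by (intro continuous_intros)
qed

lemma borel_measurable_monom3 [measurable]: "monom3 n f \<in> borel_measurable borel"
  by (intro borel_measurable_continuous_onI continuous_intros)

lemma monom3_bound:
  assumes "x \<in> S2" shows "\<bar>monom3 n f x\<bar> \<le> 1"
proof -
  have "\<bar>coord j x\<bar> \<le> 1" for j
    using assms component_le_norm_cart[of x] by (cases j) (auto simp: coord_def)
  then show ?thesis unfolding monom3_def abs_prod by (intro prod_le_1) auto
qed

lemma half_inner_power:
  "half_inner x y ^ n = (1/2) ^ n * (\<Sum>f\<in>PiE {..<n} (\<lambda>_. UNIV). monom3 n f x * monom3 n f y)"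
proof -
  have *: "half_inner x y = (1/2) * (\<Sum>j\<in>UNIV. coord j x * coord j y)"
    by (simp add: half_inner_def UNIV_option_conv coord_def inner_vec_def sum.reindex)
  have "half_inner x y ^ n = (1/2) ^ n * (\<Prod>k<n. \<Sum>j\<in>UNIV. coord j x * coord j y)"
    unfolding * by (simp only: power_mult_distrib) simp
  also have "(\<Prod>k<n. \<Sum>j\<in>UNIV. coord j x * coord j y)
      = (\<Sum>f\<in>PiE {..<n} (\<lambda>_. UNIV). \<Prod>k<n. coord (f k) x * coord (f k) y)"
    by (rule prod_sum_PiE) auto
  finally show ?thesis by (simp add: monom3_def prod.distrib)
qed

section \<open>Positive definiteness of the logarithmic energy\<close>

definition moment :: "nat \<Rightarrow> (nat \<Rightarrow> 3 option) \<Rightarrow> (real^3) measure \<Rightarrow> real" where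
  "moment n f \<mu> = (\<integral>x. monom3 n f x \<partial>\<mu>)"

definition senergy :: "(real^3) measure \<Rightarrow> (real^3) measure \<Rightarrow> ennreal" where
  "senergy \<mu> \<nu> = (\<integral>\<^sup>+x. \<integral>\<^sup>+y. skernel x y \<partial>\<nu> \<partial>\<mu>)"

definition moment_form :: "nat \<Rightarrow> (real^3) measure \<Rightarrow> (real^3) measure \<Rightarrow> real" where
  "moment_form n \<mu> \<nu> = (\<Sum>f\<in>PiE {..<n} (\<lambda>_. UNIV). moment n f \<mu> * moment n f \<nu>) * (1/2) ^ n"

lemma prob_onD:
  assumes "prob_on K \<mu>" "K \<in> sets borel"
  shows "prob_space \<mu>" "sets \<mu> = sets borel" "space \<mu> = UNIV" "AE x in \<mu>. x \<in> K"
proof -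
  show 1: "prob_space \<mu>" "sets \<mu> = sets borel" using assms by (auto simp: prob_on_def)
  then show "space \<mu> = UNIV" using sets_eq_imp_space_eq by force
  interpret prob_space \<mu> by fact
  show "AE x in \<mu>. x \<in> K"
    using assms 1 by (intro AE_in_set_eq_1[THEN iffD2]) (auto simp: prob_on_def emeasure_eq_measure)
qed

lemma borel_S2 [measurable, simp]: "S2 \<in> sets borel"
  by (simp add: borel_closed)

lemmas prob_on_S2 = prob_onD[OF _ borel_S2]

lemma integrable_bounded_S2:
  fixes g :: "real^3 \<Rightarrow> real"
  assumes "prob_on S2 \<mu>" and [measurable]: "g \<in> borel_measurable borel"
    and "\<And>x. x \<in> S2 \<Longrightarrow> \<bar>g x\<bar> \<le> B"
  shows "integrable \<mu> g"
proof -
  note [measurable_cong] = prob_on_S2(2)[OF assms(1)]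
  interpret prob_space \<mu> by (rule prob_on_S2[OF assms(1)])
  show ?thesis
    using prob_on_S2(4)[OF assms(1)] assms(3)
    by (intro integrable_const_bound[of _ B]) auto
qed

text \<open>A finite sum of products integrates to a bilinear form in the moments. Nonnegativity is
  that of the integrand on the sphere.\<close>

lemma moment_form_eq:
  assumes \<mu>: "prob_on S2 \<mu>" and \<nu>: "prob_on S2 \<nu>"
  shows "(\<integral>\<^sup>+x. \<integral>\<^sup>+y. ennreal (half_inner x y ^ n) \<partial>\<nu> \<partial>\<mu>) = ennreal (moment_form n \<mu> \<nu>)"
    and "0 \<le> moment_form n \<mu> \<nu>"
proof -
  note [measurable_cong] = prob_on_S2(2)[OF \<mu>] prob_on_S2(2)[OF \<nu>]
  interpret M: prob_space \<mu> by (rule prob_on_S2[OF \<mu>])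
  interpret N: prob_space \<nu> by (rule prob_on_S2[OF \<nu>])
  let ?F = "PiE {..<n} (\<lambda>_. UNIV :: 3 option set)"
  have int: "integrable \<mu> (monom3 n f)" "integrable \<nu> (monom3 n f)" for f
    using \<mu> \<nu> monom3_bound by (auto intro!: integrable_bounded_S2[where B = 1])
  let ?g = "\<lambda>x. (\<Sum>f\<in>?F. monom3 n f x * moment n f \<nu>) * (1/2) ^ n"
  have inner: "(\<integral>\<^sup>+y. ennreal (half_inner x y ^ n) \<partial>\<nu>) = ennreal (?g x) \<and> 0 \<le> ?g x" if "x \<in> S2" for x
  proof -
    have nn: "AE y in \<nu>. 0 \<le> half_inner x y ^ n"
      using prob_on_S2(4)[OF \<nu>] half_inner_bounds[OF that] by auto
    have i: "integrable \<nu> (\<lambda>y. half_inner x y ^ n)"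
      unfolding half_inner_power using int by (intro integrable_mult_right integrable_sum) auto
    have "(\<integral>y. half_inner x y ^ n \<partial>\<nu>) = ?g x"
      unfolding half_inner_power moment_def
      using int by (subst integral_mult_right_zero) (subst Bochner_Integration.integral_sum, auto)
    with nn_integral_eq_integral[OF i nn] integral_nonneg_AE[OF nn] show ?thesis by simp
  qed
  have nn: "AE x in \<mu>. 0 \<le> ?g x"
    using prob_on_S2(4)[OF \<mu>] inner by auto
  have i: "integrable \<mu> ?g" using int by (intro integrable_mult_left integrable_sum) auto
  have eq: "(\<integral>x. ?g x \<partial>\<mu>) = moment_form n \<mu> \<nu>"
    unfolding moment_form_def
    using int by (simp add: Bochner_Integration.integral_sum moment_def)
  have "(\<integral>\<^sup>+x. \<integral>\<^sup>+y. ennreal (half_inner x y ^ n) \<partial>\<nu> \<partial>\<mu>) = (\<integral>\<^sup>+x. ennreal (?g x) \<partial>\<mu>)"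
    using prob_on_S2(4)[OF \<mu>] inner by (intro nn_integral_cong_AE) auto
  with nn_integral_eq_integral[OF i nn] eq integral_nonneg_AE[OF nn]
  show "(\<integral>\<^sup>+x. \<integral>\<^sup>+y. ennreal (half_inner x y ^ n) \<partial>\<nu> \<partial>\<mu>) = ennreal (moment_form n \<mu> \<nu>)"
    "0 \<le> moment_form n \<mu> \<nu>" by auto
qed

lemma senergy_series:
  assumes \<mu>: "prob_on S2 \<mu>" and \<nu>: "prob_on S2 \<nu>"
  shows "senergy \<mu> \<nu> = (\<Sum>n. ennreal (moment_form (Suc n) \<mu> \<nu> / (2 * Suc n)))"
proof -
  note [measurable_cong] = prob_on_S2(2)[OF \<mu>] prob_on_S2(2)[OF \<nu>]
  interpret M: prob_space \<mu> by (rule prob_on_S2[OF \<mu>])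
  interpret N: prob_space \<nu> by (rule prob_on_S2[OF \<nu>])
  let ?h = "\<lambda>n x y. ennreal (half_inner x y ^ Suc n / (2 * Suc n))"
  have [measurable]: "(\<lambda>(x, y). ?h n x y) \<in> borel_measurable (borel \<Otimes>\<^sub>M borel)" for n
    unfolding half_inner_def by measurable
  have [measurable]: "?h n x \<in> borel_measurable borel" for n x
    unfolding half_inner_def by measurable
  have summand: "(\<integral>\<^sup>+x. \<integral>\<^sup>+y. ?h n x y \<partial>\<nu> \<partial>\<mu>) = ennreal (moment_form (Suc n) \<mu> \<nu> / (2 * Suc n))" for n
  proof -
    have quot: "ennreal (h / (2 * Suc n)) = ennreal (1 / (2 * Suc n)) * ennreal h" for h :: real
      by (subst ennreal_mult'[symmetric]) auto
    have [measurable]: "(\<lambda>(x, y). ennreal (half_inner x y ^ Suc n)) \<in> borel_measurable (borel \<Otimes>\<^sub>M borel)"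
      "(\<lambda>y. ennreal (half_inner x y ^ Suc n)) \<in> borel_measurable borel" for x
      unfolding half_inner_def by measurable
    have "(\<integral>\<^sup>+x. \<integral>\<^sup>+y. ?h n x y \<partial>\<nu> \<partial>\<mu>)
        = (\<integral>\<^sup>+x. \<integral>\<^sup>+y. ennreal (1 / (2 * Suc n)) * ennreal (half_inner x y ^ Suc n) \<partial>\<nu> \<partial>\<mu>)"
      by (intro nn_integral_cong quot)
    also have "\<dots> = ennreal (1 / (2 * Suc n)) * ennreal (moment_form (Suc n) \<mu> \<nu>)"
      by (simp add: nn_integral_cmult moment_form_eq(1)[OF \<mu> \<nu>, symmetric] del: power_Suc)
    finally show ?thesis unfolding quot[symmetric] .
  qed
  have "senergy \<mu> \<nu> = (\<integral>\<^sup>+x. \<integral>\<^sup>+y. (\<Sum>n. ?h n x y) \<partial>\<nu> \<partial>\<mu>)"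
    unfolding senergy_def
    by (rule nn_integral_cong_AE) (use prob_on_S2(4)[OF \<mu>] in eventually_elim,
        intro nn_integral_cong_AE, use prob_on_S2(4)[OF \<nu>] in eventually_elim, rule skernel_series)
  also have "\<dots> = (\<Sum>n. \<integral>\<^sup>+x. \<integral>\<^sup>+y. ?h n x y \<partial>\<nu> \<partial>\<mu>)"
    by (subst nn_integral_suminf, measurable) (subst nn_integral_suminf, measurable)
  finally show ?thesis unfolding summand .
qed

lemma moment_form_convex:
  "moment_form n \<mu> \<mu> + moment_form n \<nu> \<nu> - 2 * moment_form n \<mu> \<nu>
    = (\<Sum>f\<in>PiE {..<n} (\<lambda>_. UNIV). (moment n f \<mu> - moment n f \<nu>)\<^sup>2) * (1/2) ^ n"
  by (simp add: moment_form_def power2_eq_square algebra_simps sum.distrib sum_subtractf sum_distrib_left)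

text \<open>The energy of the signed measure \<mu> - \<nu> is nonnegative: term by term it is a
  positive multiple of a sum of squared moment differences. Written without subtraction, the
  inequality also covers infinite energies.\<close>

lemma senergy_convex:
  assumes \<mu>: "prob_on S2 \<mu>" and \<nu>: "prob_on S2 \<nu>"
  shows "2 * senergy \<mu> \<nu> \<le> senergy \<mu> \<mu> + senergy \<nu> \<nu>"
proof -
  note nn = moment_form_eq(2)[OF \<mu> \<nu>] moment_form_eq(2)[OF \<mu> \<mu>] moment_form_eq(2)[OF \<nu> \<nu>]
  have "2 * moment_form n \<mu> \<nu> \<le> moment_form n \<mu> \<mu> + moment_form n \<nu> \<nu>" for n
    using moment_form_convex[of n \<mu> \<nu>]
    by (smt (verit) sum_nonneg zero_le_power2 zero_le_power mult_nonneg_nonneg zero_le_divide_1_iff)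
  then have "2 * ennreal (moment_form (Suc n) \<mu> \<nu> / (2 * Suc n))
     \<le> ennreal (moment_form (Suc n) \<mu> \<mu> / (2 * Suc n)) + ennreal (moment_form (Suc n) \<nu> \<nu> / (2 * Suc n))" for n
  proof -
    have "2 * (moment_form (Suc n) \<mu> \<nu> / (2 * Suc n))
      \<le> moment_form (Suc n) \<mu> \<mu> / (2 * Suc n) + moment_form (Suc n) \<nu> \<nu> / (2 * Suc n)"
      using divide_right_mono[OF \<open>\<And>n. 2 * moment_form n \<mu> \<nu> \<le> _\<close>, of "2 * Suc n" "Suc n"]
      by (simp add: add_divide_distrib)
    from ennreal_leI[OF this] show ?thesis
      using nn by (subst numeral_mult_ennreal, simp, subst ennreal_plus[symmetric], auto simp del: ennreal_plus)
  qed
  then show ?thesis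
    unfolding senergy_series[OF \<mu> \<nu>] senergy_series[OF \<mu> \<mu>] senergy_series[OF \<nu> \<nu>]
    by (subst suminf_add, simp, simp, subst ennreal_suminf_cmult[symmetric]) (intro suminf_le, auto)
qed

text \<open>In the case of equality a series of nonnegative terms has sum zero, so every squared
  moment difference vanishes. Finiteness of the energies allows the subtraction.\<close>

lemma moment_eq_of_senergy_eq:
  assumes \<mu>: "prob_on S2 \<mu>" and \<nu>: "prob_on S2 \<nu>"
    and fin: "senergy \<mu> \<mu> < \<top>" "senergy \<nu> \<nu> < \<top>"
    and eq: "senergy \<mu> \<mu> + senergy \<nu> \<nu> \<le> 2 * senergy \<mu> \<nu>"
  shows "moment n f \<mu> = moment n f \<nu>"
proof -
  note nn = moment_form_eq(2)[OF \<mu> \<nu>] moment_form_eq(2)[OF \<mu> \<mu>] moment_form_eq(2)[OF \<nu> \<nu>]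
  let ?a = "\<lambda>\<mu> \<nu> n. moment_form (Suc n) \<mu> \<nu> / (2 * Suc n)"
  have fin': "senergy \<mu> \<nu> < \<top>"
    using senergy_convex[OF \<mu> \<nu>] fin by (auto simp: less_top[symmetric] ennreal_mult_eq_top_iff top_unique)
  have sums: "?a \<mu>' \<nu>' sums enn2real (senergy \<mu>' \<nu>')"
    if "prob_on S2 \<mu>'" "prob_on S2 \<nu>'" "senergy \<mu>' \<nu>' < \<top>" for \<mu>' \<nu>'
  proof -
    note * = senergy_series[OF that(1,2)]
    have nn: "0 \<le> ?a \<mu>' \<nu>' n" for n using moment_form_eq(2)[OF that(1,2)] by simp
    have "summable (?a \<mu>' \<nu>')"
      using nn that(3) unfolding * by (intro summable_suminf_not_top) auto
    moreover from this have "senergy \<mu>' \<nu>' = ennreal (suminf (?a \<mu>' \<nu>'))"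
      unfolding * using nn by (intro suminf_ennreal2)
    ultimately show ?thesis using nn by (simp add: suminf_nonneg summable_sums)
  qed
  let ?d = "\<lambda>n. ?a \<mu> \<mu> n + ?a \<nu> \<nu> n - 2 * ?a \<mu> \<nu> n"
  have d: "?d sums (enn2real (senergy \<mu> \<mu>) + enn2real (senergy \<nu> \<nu>) - 2 * enn2real (senergy \<mu> \<nu>))"
    using \<mu> \<nu> fin fin' by (intro sums_diff sums_add sums_mult sums) auto
  have d_eq: "?d m = (\<Sum>f\<in>PiE {..<Suc m} (\<lambda>_. UNIV). (moment (Suc m) f \<mu> - moment (Suc m) f \<nu>)\<^sup>2)
      * (1/2) ^ Suc m / (2 * Suc m)" for m
    unfolding moment_form_convex[symmetric] by (simp add: add_divide_distrib diff_divide_distrib)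
  have d_nn: "0 \<le> ?d m" for m unfolding d_eq by (intro divide_nonneg_nonneg mult_nonneg_nonneg sum_nonneg) auto
  have "enn2real (senergy \<mu> \<mu>) + enn2real (senergy \<nu> \<nu>) - 2 * enn2real (senergy \<mu> \<nu>) \<le> 0"
  proof -
    have "enn2real (senergy \<mu> \<mu> + senergy \<nu> \<nu>) \<le> enn2real (2 * senergy \<mu> \<nu>)"
      using eq fin' by (intro enn2real_mono) (auto simp: ennreal_mult_less_top)
    then show ?thesis using fin by (simp add: enn2real_plus enn2real_mult)
  qed
  then have "suminf ?d \<le> 0" using d by (simp add: sums_iff)
  then have d0: "?d m = 0" for m
    using suminf_eq_zero_iff[of ?d] d d_nn suminf_nonneg[of ?d] by (auto simp: sums_iff)
  show ?thesis
  proof (cases n)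
    \<comment> \<open>The series starts in degree one; the moment of degree zero is the total
      mass.\<close>
    case 0
    interpret M: prob_space \<mu> by (rule prob_on_S2[OF \<mu>])
    interpret N: prob_space \<nu> by (rule prob_on_S2[OF \<nu>])
    have "moment n f \<mu> = measure \<mu> (space \<mu>)" "moment n f \<nu> = measure \<nu> (space \<nu>)"
      by (simp_all add: 0 moment_def monom3_def)
    then show ?thesis by (simp only: M.prob_space N.prob_space)
  next
    case (Suc m)
    \<comment> \<open>The sum ranges over extensional functions, while \<open>monom3 n f\<close>
      reads \<open>f\<close> only below \<open>n\<close>.\<close>
    let ?f = "restrict f {..<n}"
    have "(\<Sum>f\<in>PiE {..<Suc m} (\<lambda>_. UNIV). (moment (Suc m) f \<mu> - moment (Suc m) f \<nu>)\<^sup>2) = 0"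
      using d0[of m] unfolding d_eq by simp
    then have "(moment n ?f \<mu> - moment n ?f \<nu>)\<^sup>2 = 0"
      unfolding Suc by (subst (asm) sum_nonneg_eq_0_iff) (auto intro!: finite_PiE)
    moreover have "moment n ?f = moment n f"
      by (intro ext) (simp add: moment_def monom3_def)
    ultimately show ?thesis by simp
  qed
qed

section \<open>Moments determine a measure on the sphere\<close>

text \<open>Moments give the integrals of polynomials, Stone-Weierstrass those of continuous
  functions, and these the masses of closed sets, an intersection-stable generator of the Borel
  sets.\<close>

lemma prob_on_S2_eqI:
  assumes \<mu>: "prob_on S2 \<mu>" and \<nu>: "prob_on S2 \<nu>"
    and mom: "\<And>n f. moment n f \<mu> = moment n f \<nu>"
  shows "\<mu> = \<nu>"
proof -
  note [measurable_cong] = prob_on_S2(2)[OF \<mu>] prob_on_S2(2)[OF \<nu>]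
  interpret M: prob_space \<mu> by (rule prob_on_S2[OF \<mu>])
  interpret N: prob_space \<nu> by (rule prob_on_S2[OF \<nu>])
  have int: "integrable \<mu> g" "integrable \<nu> g" if g: "continuous_on UNIV g" for g :: "real^3 \<Rightarrow> real"
  proof -
    have "compact (g ` S2)" by (intro compact_continuous_image continuous_on_subset[OF g]) auto
    then obtain B where "\<And>x. x \<in> S2 \<Longrightarrow> \<bar>g x\<bar> \<le> B"
      using compact_imp_bounded bounded_iff by (metis image_eqI real_norm_def)
    then show "integrable \<mu> g" "integrable \<nu> g"
      using \<mu> \<nu> g by (auto intro!: integrable_bounded_S2 borel_measurable_continuous_onI)
  qed
  \<comment> \<open>The arbitrary monomial factor makes the class stable under multiplication by a
    coordinate, which merely lengthens the monomial; this carries the induction over polynomial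
    functions.\<close>
  define G where "G = {g. continuous_on UNIV g \<and>
    (\<forall>n f. (\<integral>x. g x * monom3 n f x \<partial>\<mu>) = (\<integral>x. g x * monom3 n f x \<partial>\<nu>))}"
  have lin: "(\<lambda>x. p x * g x) \<in> G" if p: "bounded_linear p" and g: "g \<in> G" for p g
  proof -
    have c: "continuous_on UNIV p" "continuous_on UNIV g"
      using p g by (auto simp: G_def linear_continuous_on)
    have "(\<integral>x. (p x * g x) * monom3 n f x \<partial>\<mu>) = (\<integral>x. (p x * g x) * monom3 n f x \<partial>\<nu>)" for n f
    proof -
      have px: "p x = (\<Sum>i\<in>UNIV. p (axis i 1) * x $ i)" for x
      proof -
        have "x = (\<Sum>i\<in>UNIV. x $ i *\<^sub>R axis i 1)"
          using basis_expansion[of x] by (simp add: scalar_mult_eq_scaleR)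
        then have "p x = (\<Sum>i\<in>UNIV. p (x $ i *\<^sub>R axis i 1))"
          using p by (metis (no_types, lifting) bounded_linear.linear linear_sum sum.cong)
        also have "\<dots> = (\<Sum>i\<in>UNIV. p (axis i 1) * x $ i)"
          using p by (simp add: bounded_linear.linear linear_cmul mult.commute)
        finally show ?thesis .
      qed
      have m: "x $ i * monom3 n f x = monom3 (Suc n) (f(n := Some i)) x" for x i
        unfolding monom3_def by (simp add: coord_def)
      have e: "(p x * g x) * monom3 n f x = (\<Sum>i\<in>UNIV. p (axis i 1) * (g x * monom3 (Suc n) (f(n := Some i)) x))" for x
        unfolding m[symmetric] by (subst px, unfold sum_distrib_right, intro sum.cong) auto
      show ?thesis
        unfolding e using g c
        by (subst (1 2) Bochner_Integration.integral_sum)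
          (auto simp: G_def intro!: integrable_mult_right int continuous_intros)
    qed
    then show ?thesis using c by (auto simp: G_def intro!: continuous_intros)
  qed
  have poly: "real_polynomial_function p \<Longrightarrow> g \<in> G \<Longrightarrow> (\<lambda>x. p x * g x) \<in> G" for p g
  proof (induction arbitrary: g rule: real_polynomial_function.induct)
    case (linear p)
    then show ?case by (rule lin)
  next
    case (const c)
    then show ?case by (auto simp: G_def mult.assoc intro!: continuous_intros)
  next
    case (add p q)
    then have G: "(\<lambda>x. p x * g x) \<in> G" "(\<lambda>x. q x * g x) \<in> G" by auto
    then have c: "continuous_on UNIV (\<lambda>x. p x * g x)" "continuous_on UNIV (\<lambda>x. q x * g x)"
      by (auto simp: G_def)
    have i: "integrable \<mu> (\<lambda>x. (p x * g x) * monom3 n f x)" "integrable \<mu> (\<lambda>x. (q x * g x) * monom3 n f x)"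
      "integrable \<nu> (\<lambda>x. (p x * g x) * monom3 n f x)" "integrable \<nu> (\<lambda>x. (q x * g x) * monom3 n f x)" for n f
      by (intro int continuous_on_mult c continuous_intros)+
    show ?case using G continuous_on_add[OF c] i
      by (simp add: G_def distrib_right)
  next
    case (mult p q)
    then show ?case using mult.IH(1)[OF mult.IH(2)[OF mult.prems]] by (simp add: mult.assoc)
  qed
  have one: "(\<lambda>_. 1) \<in> G" using mom by (simp add: G_def moment_def)
  have polyeq: "(\<integral>x. p x \<partial>\<mu>) = (\<integral>x. p x \<partial>\<nu>)" if "real_polynomial_function p" for p
  proof -
    have "(\<integral>x. p x * 1 * monom3 0 (\<lambda>_. None) x \<partial>\<mu>) = (\<integral>x. p x * 1 * monom3 0 (\<lambda>_. None) x \<partial>\<nu>)"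
      using poly[OF that one] unfolding G_def by blast
    then show ?thesis by (simp add: monom3_def)
  qed
  have conteq: "(\<integral>x. g x \<partial>\<mu>) = (\<integral>x. g x \<partial>\<nu>)" if g: "continuous_on UNIV g" for g :: "real^3 \<Rightarrow> real"
  proof (rule antisym)
    have close: "\<bar>(\<integral>x. g x \<partial>\<mu>) - (\<integral>x. g x \<partial>\<nu>)\<bar> \<le> 2 * e" if "e > 0" for e
    proof -
      obtain p where p: "real_polynomial_function p" and pe: "\<And>x. x \<in> S2 \<Longrightarrow> \<bar>g x - p x\<bar> < e"
        using Stone_Weierstrass_real_polynomial_function[OF compact_sphere continuous_on_subset[OF g] \<open>e > 0\<close>]
        by (metis subset_UNIV)
      have cp: "continuous_on UNIV p" using p continuous_on_polymonial_function real_polynomial_function_eq by blast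
      have "\<bar>(\<integral>x. g x \<partial>M) - (\<integral>x. p x \<partial>M)\<bar> \<le> e"
        if "prob_space M" "integrable M g" "integrable M p" "AE x in M. x \<in> S2" for M
      proof -
        interpret prob_space M by fact
        have "\<bar>(\<integral>x. g x \<partial>M) - (\<integral>x. p x \<partial>M)\<bar> = \<bar>\<integral>x. g x - p x \<partial>M\<bar>"
          using that by (simp add: Bochner_Integration.integral_diff)
        also have "\<dots> \<le> (\<integral>x. \<bar>g x - p x\<bar> \<partial>M)" by (rule integral_abs_bound)
        also have "\<dots> \<le> e"
        proof (rule integral_le_const)
          show "AE x in M. \<bar>g x - p x\<bar> \<le> e"
            using that(4) by eventually_elim (use pe in \<open>simp add: less_imp_le\<close>)
        qed (use that in auto)
        finally show ?thesis .
      qed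
      from this[OF M.prob_space_axioms int(1)[OF g] int(1)[OF cp] prob_on_S2(4)[OF \<mu>]]
        this[OF N.prob_space_axioms int(2)[OF g] int(2)[OF cp] prob_on_S2(4)[OF \<nu>]]
      show ?thesis using polyeq[OF p] by linarith
    qed
    show "(\<integral>x. g x \<partial>\<mu>) \<le> (\<integral>x. g x \<partial>\<nu>)" (is "?L \<le> ?R")
    proof (rule field_le_epsilon)
      fix e :: real assume "e > 0"
      then show "?L \<le> ?R + e" using close[of "e / 2"] by (simp add: abs_le_iff)
    qed
    show "(\<integral>x. g x \<partial>\<nu>) \<le> (\<integral>x. g x \<partial>\<mu>)" (is "?L \<le> ?R")
    proof (rule field_le_epsilon)
      fix e :: real assume "e > 0"
      then show "?L \<le> ?R + e" using close[of "e / 2"] by (simp add: abs_le_iff)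
    qed
  qed
  have closed: "emeasure \<mu> F = emeasure \<nu> F" if F: "closed F" "F \<noteq> {}" for F
  proof -
    \<comment> \<open>Continuous functions that decrease to the indicator of the closed set
      \<open>F\<close>.\<close>
    let ?g = "\<lambda>n x. max 0 (1 - real n * infdist x F)"
    have cg: "continuous_on UNIV (?g n)" for n by (intro continuous_intros)
    have [measurable]: "F \<in> sets borel" using F by simp
    have [measurable]: "?g n \<in> borel_measurable borel" for n
      by (rule borel_measurable_continuous_onI[OF cg])
    have lim: "(\<lambda>n. \<integral>x. ?g n x \<partial>M) \<longlonglongrightarrow> measure M F"
      if "prob_space M" and [measurable_cong]: "sets M = sets borel" for M
    proof -
      interpret prob_space M by fact
      have "(\<lambda>n. \<integral>x. ?g n x \<partial>M) \<longlonglongrightarrow> (\<integral>x. indicator F x \<partial>M)"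
      proof (rule integral_dominated_convergence[where w = "\<lambda>_. 1"])
        have "(\<lambda>n. ?g n x) \<longlonglongrightarrow> indicator F x" for x
        proof (cases "x \<in> F")
          case False
          then have "infdist x F > 0"
            using F by (metis in_closed_iff_infdist_zero infdist_nonneg less_le)
          then have "eventually (\<lambda>n. ?g n x = 0) sequentially"
          proof -
            obtain N where N: "1 / infdist x F < real N" using reals_Archimedean2 by blast
            have "?g n x = 0" if "n \<ge> N" for n
            proof -
              have "1 / infdist x F < real n" using N that by simp
              then show ?thesis using \<open>infdist x F > 0\<close> by (simp add: field_simps)
            qed
            then show ?thesis by (auto simp: eventually_sequentially)
          qed
          then show ?thesis using False by (simp add: tendsto_eventually)
        qed auto
        then show "AE x in M. (\<lambda>n. ?g n x) \<longlonglongrightarrow> indicator F x" by auto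
        show "AE x in M. norm (?g n x) \<le> 1" for n by (auto simp: infdist_nonneg)
      qed auto
      then show ?thesis by simp
    qed
    have "measure \<mu> F = measure \<nu> F"
      using lim[OF M.prob_space_axioms prob_on_S2(2)[OF \<mu>]] lim[OF N.prob_space_axioms prob_on_S2(2)[OF \<nu>]]
      unfolding conteq[OF cg] by (rule LIMSEQ_unique)
    then show ?thesis by (simp add: M.emeasure_eq_measure N.emeasure_eq_measure)
  qed
  show ?thesis
  proof (rule measure_eqI_generator_eq[where E = "Collect closed" and \<Omega> = UNIV and A = "\<lambda>_. UNIV"])
    show "Int_stable (Collect closed)" by (auto simp: Int_stable_def)
    show "sets \<mu> = sigma_sets UNIV (Collect closed)" "sets \<nu> = sigma_sets UNIV (Collect closed)"
      using prob_on_S2(2)[OF \<mu>] prob_on_S2(2)[OF \<nu>] by (auto simp: borel_eq_closed)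
    show "emeasure \<mu> X = emeasure \<nu> X" if "X \<in> Collect closed" for X
      using closed[of X] that by (cases "X = {}") auto
  qed auto
qed

lemma senergy_unique:
  assumes "prob_on S2 \<mu>" "prob_on S2 \<nu>" "senergy \<mu> \<mu> < \<top>" "senergy \<nu> \<nu> < \<top>"
    and "senergy \<mu> \<mu> + senergy \<nu> \<nu> \<le> 2 * senergy \<mu> \<nu>"
  shows "\<mu> = \<nu>"
  using assms by (intro prob_on_S2_eqI moment_eq_of_senergy_eq)

section \<open>Variational characterization of equilibrium measures\<close>

definition spot :: "(real^3) measure \<Rightarrow> real^3 \<Rightarrow> ennreal" where
  "spot \<mu> x = (\<integral>\<^sup>+y. skernel x y \<partial>\<mu>)"

definition total_energy :: "(real^3 \<Rightarrow> ennreal) \<Rightarrow> (real^3) measure \<Rightarrow> ennreal" where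
  "total_energy R \<mu> = senergy \<mu> \<mu> + 2 * (\<integral>\<^sup>+x. R x \<partial>\<mu>)"

lemma measurable_spot [measurable (raw)]:
  assumes "sigma_finite_measure \<mu>" "sets \<mu> = sets borel" and [measurable]: "f \<in> borel_measurable M"
  shows "(\<lambda>x. spot \<mu> (f x)) \<in> borel_measurable M"
proof -
  interpret sigma_finite_measure \<mu> by fact
  note [measurable_cong] = assms(2)
  show ?thesis unfolding spot_def by measurable
qed

lemma senergy_spot: "senergy \<mu> \<nu> = (\<integral>\<^sup>+x. spot \<nu> x \<partial>\<mu>)"
  by (simp add: senergy_def spot_def)

lemma senergy_commute:
  assumes "sigma_finite_measure \<mu>" "sets \<mu> = sets borel" "sigma_finite_measure \<nu>" "sets \<nu> = sets borel"
  shows "senergy \<mu> \<nu> = senergy \<nu> \<mu>"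
proof -
  interpret M: sigma_finite_measure \<mu> by fact
  interpret N: sigma_finite_measure \<nu> by fact
  interpret pair_sigma_finite \<mu> \<nu> ..
  note [measurable_cong] = assms(2,4)
  have "senergy \<mu> \<nu> = (\<integral>\<^sup>+y. \<integral>\<^sup>+x. skernel x y \<partial>\<mu> \<partial>\<nu>)"
    unfolding senergy_def by (rule Fubini'[symmetric]) measurable
  also have "\<dots> = senergy \<nu> \<mu>"
    unfolding senergy_def by (intro nn_integral_cong skernel_commute)
  finally show ?thesis .
qed

text \<open>An atom at \<open>z\<close> would contribute a positive multiple of the infinite
  diagonal value to the energy.\<close>

lemma emeasure_singleton_eq_0:
  assumes [measurable_cong]: "sets \<mu> = sets borel" and fin: "senergy \<mu> \<mu> < \<top>"
  shows "emeasure \<mu> {z} = 0"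
proof (rule ccontr)
  assume nz: "emeasure \<mu> {z} \<noteq> 0"
  have top: "(\<integral>\<^sup>+x. \<top> * indicator {z} x \<partial>\<mu>) = \<top>"
    using nz by (subst nn_integral_cmult_indicator) (auto simp: ennreal_top_mult assms(1))
  have inner: "(\<integral>\<^sup>+y. skernel z y \<partial>\<mu>) = \<top>"
  proof -
    have "\<top> = (\<integral>\<^sup>+y. \<top> * indicator {z} y \<partial>\<mu>)" by (rule top[symmetric])
    also have "\<dots> \<le> (\<integral>\<^sup>+y. skernel z y \<partial>\<mu>)" by (intro nn_integral_mono) (auto split: split_indicator)
    finally show ?thesis by (simp add: top_unique)
  qed
  have "\<top> = (\<integral>\<^sup>+x. \<top> * indicator {z} x \<partial>\<mu>)" by (rule top[symmetric])
  also have "\<dots> \<le> senergy \<mu> \<mu>"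
    unfolding senergy_def using inner by (intro nn_integral_mono) (auto split: split_indicator)
  finally show False using fin by (simp add: top_unique)
qed

text \<open>Integrating the lower bound against the competitor compares the energy of
  \<open>\<mu>0\<close> with an expression in the mutual energy, and \<open>senergy_convex\<close>
  replaces the latter by the energy of the competitor; equality leads to
  \<open>senergy_unique\<close>. A competitor of finite energy has no atoms and ignores the finite
  set \<open>Z\<close>. The set \<open>X\<close> confines the competitors, so that the same
  criterion serves the line.\<close>

lemma frostman:
  assumes \<mu>0: "prob_on S2 \<mu>0" and [measurable]: "R \<in> borel_measurable borel" and Z: "finite Z"
    and ge: "\<And>x. x \<in> X \<Longrightarrow> x \<notin> Z \<Longrightarrow> ennreal F \<le> spot \<mu>0 x + R x"
    and eq: "AE x in \<mu>0. spot \<mu>0 x + R x = ennreal F"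
    and \<mu>: "prob_on S2 \<mu>" and X: "AE x in \<mu>. x \<in> X"
  shows "total_energy R \<mu>0 < \<top>" "total_energy R \<mu>0 \<le> total_energy R \<mu>"
    and "total_energy R \<mu> \<le> total_energy R \<mu>0 \<Longrightarrow> \<mu> = \<mu>0"
proof -
  note [measurable_cong] = prob_on_S2(2)[OF \<mu>] prob_on_S2(2)[OF \<mu>0]
  interpret M0: prob_space \<mu>0 by (rule prob_on_S2[OF \<mu>0])
  interpret M: prob_space \<mu> by (rule prob_on_S2[OF \<mu>])
  have [measurable]: "spot \<mu>0 \<in> borel_measurable borel"
    by (intro measurable_spot prob_on_S2(2)[OF \<mu>0]) (auto intro: M0.sigma_finite_measure_axioms)
  let ?R0 = "\<integral>\<^sup>+x. R x \<partial>\<mu>0" and ?R1 = "\<integral>\<^sup>+x. R x \<partial>\<mu>"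
  have F0: "senergy \<mu>0 \<mu>0 + ?R0 = ennreal F"
  proof -
    have "senergy \<mu>0 \<mu>0 + ?R0 = (\<integral>\<^sup>+x. spot \<mu>0 x + R x \<partial>\<mu>0)"
      unfolding senergy_spot by (subst nn_integral_add) auto
    also have "\<dots> = (\<integral>\<^sup>+x. ennreal F \<partial>\<mu>0)" using eq by (rule nn_integral_cong_AE)
    finally show ?thesis by (simp add: M0.emeasure_space_1)
  qed
  have fin0: "senergy \<mu>0 \<mu>0 < \<top>" "?R0 < \<top>"
    using F0 by (metis ennreal_add_eq_top ennreal_neq_top less_top)+
  then show "total_energy R \<mu>0 < \<top>" by (simp add: total_energy_def ennreal_mult_less_top)
  \<comment> \<open>One more copy of the energy of \<open>\<mu>0\<close> completes the total energy
    to twice the integral of potential plus field.\<close>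
  have sum: "total_energy R \<mu>0 + senergy \<mu>0 \<mu>0 = 2 * ennreal F"
    unfolding total_energy_def F0[symmetric] by (simp add: algebra_simps mult_2)
  have main: "2 * ennreal F \<le> 2 * senergy \<mu> \<mu>0 + 2 * ?R1" if fin: "senergy \<mu> \<mu> < \<top>"
  proof -
    have "AE x in \<mu>. x \<noteq> z" for z
      using emeasure_singleton_eq_0[OF prob_on_S2(2)[OF \<mu>] fin, of z]
      by (intro AE_I[of _ _ "{z}"]) auto
    then have "AE x in \<mu>. \<forall>z\<in>Z. x \<noteq> z" using Z by (simp add: AE_finite_all)
    then have "AE x in \<mu>. ennreal F \<le> spot \<mu>0 x + R x"
      using X by eventually_elim (use ge in auto)
    then have "(\<integral>\<^sup>+x. ennreal F \<partial>\<mu>) \<le> (\<integral>\<^sup>+x. spot \<mu>0 x + R x \<partial>\<mu>)" by (rule nn_integral_mono_AE)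
    also have "\<dots> = senergy \<mu> \<mu>0 + ?R1" unfolding senergy_spot by (subst nn_integral_add) auto
    finally have "ennreal F \<le> senergy \<mu> \<mu>0 + ?R1" by (simp add: M.emeasure_space_1)
    from mult_left_mono[OF this, of 2] show ?thesis by (simp add: distrib_left)
  qed
  have le: "total_energy R \<mu>0 + senergy \<mu>0 \<mu>0 \<le> 2 * senergy \<mu> \<mu>0 + 2 * ?R1" if "senergy \<mu> \<mu> < \<top>"
    unfolding sum by (rule main[OF that])
  also have conv: "2 * senergy \<mu> \<mu>0 + 2 * ?R1 \<le> total_energy R \<mu> + senergy \<mu>0 \<mu>0"
    using add_right_mono[OF senergy_convex[OF \<mu> \<mu>0], of "2 * ?R1"] by (simp add: total_energy_def ac_simps)
  finally have "total_energy R \<mu>0 \<le> total_energy R \<mu>" if "senergy \<mu> \<mu> < \<top>"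
    using that fin0 by (auto simp: ennreal_add_left_cancel_le add.commute[of _ "senergy \<mu>0 \<mu>0"])
  moreover have "total_energy R \<mu> = \<top>" if "\<not> senergy \<mu> \<mu> < \<top>"
    using that by (simp add: total_energy_def less_top[symmetric])
  ultimately show "total_energy R \<mu>0 \<le> total_energy R \<mu>"
    by (cases "senergy \<mu> \<mu> < \<top>") auto
  assume eq: "total_energy R \<mu> \<le> total_energy R \<mu>0"
  then have fin: "total_energy R \<mu> < \<top>" using \<open>total_energy R \<mu>0 < \<top>\<close> by (rule le_less_trans)
  then have fin1: "senergy \<mu> \<mu> < \<top>" "?R1 < \<top>"
    by (auto simp: total_energy_def less_top[symmetric] ennreal_mult_eq_top_iff)
  have "senergy \<mu> \<mu> + senergy \<mu>0 \<mu>0 + 2 * ?R1 \<le> 2 * senergy \<mu> \<mu>0 + 2 * ?R1"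
  proof -
    have "senergy \<mu> \<mu> + senergy \<mu>0 \<mu>0 + 2 * ?R1 = total_energy R \<mu> + senergy \<mu>0 \<mu>0"
      by (simp add: total_energy_def ac_simps)
    also have "\<dots> \<le> total_energy R \<mu>0 + senergy \<mu>0 \<mu>0" using eq by (rule add_right_mono)
    also have "\<dots> \<le> 2 * senergy \<mu> \<mu>0 + 2 * ?R1" by (rule le[OF fin1(1)])
    finally show ?thesis .
  qed
  then have "senergy \<mu> \<mu> + senergy \<mu>0 \<mu>0 \<le> 2 * senergy \<mu> \<mu>0"
    using fin1 by (auto simp: ennreal_add_left_cancel_le ennreal_mult_eq_top_iff add.commute[of _ "2 * ?R1"])
  then show "\<mu> = \<mu>0" using fin1 fin0 by (intro senergy_unique \<mu> \<mu>0)
qed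

section \<open>From extended-real energies to nonnegative integrals\<close>

text \<open>For a probability measure and an integrand bounded below, the integral of the negative
  part is at most \<bar>c\<bar>, so no difference of infinities arises.\<close>

lemma ereal_integral_shift:
  assumes "prob_space M" and [measurable]: "f \<in> borel_measurable M"
    and nn: "AE x in M. 0 \<le> f x + ereal c"
  shows "ereal_integral M f = enn2ereal (\<integral>\<^sup>+x. e2ennreal (f x + ereal c) \<partial>M) - ereal c"
proof -
  interpret prob_space M by fact
  have le: "AE x in M. e2ennreal (- f x) \<le> ennreal \<bar>c\<bar>"
    using nn
  proof eventually_elim
    case (elim x)
    then have "- f x \<le> ereal \<bar>c\<bar>" by (cases "f x") auto
    then show ?case by (metis e2ennreal_ereal e2ennreal_mono)
  qed
  have "(\<integral>\<^sup>+x. e2ennreal (- f x) \<partial>M) \<le> (\<integral>\<^sup>+x. ennreal \<bar>c\<bar> \<partial>M)" by (rule nn_integral_mono_AE[OF le])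
  then have fin: "(\<integral>\<^sup>+x. e2ennreal (- f x) \<partial>M) < \<top>"
    by (simp add: emeasure_space_1 le_less_trans[OF _ ennreal_less_top])
  have "ereal_integral M (\<lambda>x. f x + ereal c) = ereal_integral M f + ereal_integral M (\<lambda>x. ereal c)"
    using fin by (intro ereal_integral_add) (auto simp: emeasure_space_1)
  also have "ereal_integral M (\<lambda>x. ereal c) = ereal c"
    by (subst ereal_integral_eq_lebesgue_integral) (auto simp: prob_space)
  also have "ereal_integral M (\<lambda>x. f x + ereal c) = enn2ereal (\<integral>\<^sup>+x. e2ennreal (f x + ereal c) \<partial>M)"
  proof -
    have "(\<integral>\<^sup>+x. e2ennreal (- (f x + ereal c)) \<partial>M) = (\<integral>\<^sup>+x. 0 \<partial>M)"
      using nn by (intro nn_integral_cong_AE) (auto elim!: eventually_mono intro!: e2ennreal_neg)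
    then show ?thesis by (simp add: ereal_integral_def zero_ennreal.rep_eq)
  qed
  finally show ?thesis by (cases "ereal_integral M f") auto
qed

text \<open>The shift of the kernel enters once, through the double integral, and the shift of the
  field twice. The correction is the same for all measures, so both functionals have the same
  minimizers.\<close>

lemma weighted_energy_eq_total_energy:
  assumes \<mu>: "prob_on S2 \<mu>" and [measurable]: "Q \<in> borel_measurable borel"
    and nn: "\<And>x. x \<in> S2 \<Longrightarrow> 0 \<le> Q x + ereal c"
  shows "weighted_energy Q \<mu> = enn2ereal (total_energy (\<lambda>x. e2ennreal (Q x + ereal c)) \<mu>) - ereal (ln 2 + 2 * c)"
proof -
  note [measurable_cong] = prob_on_S2(2)[OF \<mu>]
  interpret prob_space \<mu> by (rule prob_on_S2[OF \<mu>])
  interpret P: pair_prob_space \<mu> \<mu> ..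
  let ?k = "\<lambda>p :: (real^3) \<times> (real^3). log_kernel (fst p) (snd p)"
  have [measurable]: "?k \<in> borel_measurable (\<mu> \<Otimes>\<^sub>M \<mu>)"
    using borel_measurable_log_kernel[where 'a = "real^3"] by (simp add: split_def cong: measurable_cong_sets)
  have le: "0 \<le> log_kernel x y + ereal (ln 2)" if "x \<in> S2" "y \<in> S2" for x y :: "real^3"
  proof (cases "x = y")
    case False
    have "dist x y \<le> dist x 0 + dist 0 y" by (rule dist_triangle)
    then have "dist x y \<le> 2" using that by (auto simp: dist_commute)
    then show ?thesis using False by (auto simp: log_kernel_def ln_div)
  qed (simp add: log_kernel_def)
  have ae: "AE p in \<mu> \<Otimes>\<^sub>M \<mu>. 0 \<le> ?k p + ereal (ln 2)"
  proof (rule AE_mp)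
    show "AE p in \<mu> \<Otimes>\<^sub>M \<mu>. fst p \<in> S2 \<and> snd p \<in> S2"
      by (rule P.AE_pair_measure, measurable) (use prob_on_S2(4)[OF \<mu>] in auto)
  qed (use le in auto)
  have e: "(\<integral>\<^sup>+p. e2ennreal (?k p + ereal (ln 2)) \<partial>(\<mu> \<Otimes>\<^sub>M \<mu>)) = senergy \<mu> \<mu>"
    by (subst nn_integral_fst[symmetric]) (auto simp: senergy_def skernel_def)
  have "ereal_integral (\<mu> \<Otimes>\<^sub>M \<mu>) ?k = enn2ereal (senergy \<mu> \<mu>) - ereal (ln 2)"
    using ereal_integral_shift[OF P.prob_space_axioms _ ae] unfolding e by simp
  moreover have "ereal_integral \<mu> Q = enn2ereal (\<integral>\<^sup>+x. e2ennreal (Q x + ereal c) \<partial>\<mu>) - ereal c"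
    using prob_on_S2(4)[OF \<mu>] nn
    by (intro ereal_integral_shift prob_space_axioms) (auto elim: eventually_mono)
  ultimately show ?thesis
    unfolding weighted_energy_def split_def total_energy_def
    by (cases "senergy \<mu> \<mu>"; cases "\<integral>\<^sup>+x. e2ennreal (Q x + ereal c) \<partial>\<mu>")
      (auto simp: enn2ereal_ennreal mult_2_ereal numeral_mult_ennreal ennreal_plus[symmetric] ennreal_mult_top
        ennreal_top_mult simp del: ennreal_plus)
qed

lemma enn2ereal_diff_le_iff:
  "enn2ereal u - ereal r \<le> enn2ereal v - ereal r \<longleftrightarrow> u \<le> v"
  by (cases u; cases v) (auto simp: enn2ereal_ennreal top_unique)

lemma sphere_equilibrium_eqI:
  assumes \<mu>0: "prob_on S2 \<mu>0" and Q: "log_potential \<tau> \<in> borel_measurable borel"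
    and nn: "\<And>x. x \<in> S2 \<Longrightarrow> 0 \<le> log_potential \<tau> x + ereal c"
    and Z: "finite Z"
    and ge: "\<And>x. x \<in> S2 \<Longrightarrow> x \<notin> Z \<Longrightarrow> ennreal F \<le> spot \<mu>0 x + e2ennreal (log_potential \<tau> x + ereal c)"
    and eq: "AE x in \<mu>0. spot \<mu>0 x + e2ennreal (log_potential \<tau> x + ereal c) = ennreal F"
  shows "is_arg_min (weighted_energy (log_potential \<tau>)) (prob_on S2) \<mu>0" "sphere_equilibrium \<tau> = \<mu>0"
proof -
  let ?Q = "log_potential \<tau>"
  let ?R = "\<lambda>x. e2ennreal (?Q x + ereal c)"
  have we: "weighted_energy ?Q \<mu> = enn2ereal (total_energy ?R \<mu>) - ereal (ln 2 + 2 * c)"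
    if "prob_on S2 \<mu>" for \<mu>
    by (rule weighted_energy_eq_total_energy[OF that Q nn])
  have [measurable]: "?R \<in> borel_measurable borel" using Q by measurable
  note fr = frostman[OF \<mu>0 _ Z ge eq _ prob_on_S2(4)]
  have le: "weighted_energy ?Q \<mu>0 \<le> weighted_energy ?Q \<mu>" if "prob_on S2 \<mu>" for \<mu>
    using fr(2)[of \<mu>] that unfolding we[OF that] we[OF \<mu>0] enn2ereal_diff_le_iff by simp
  have un: "\<mu> = \<mu>0" if "prob_on S2 \<mu>" "weighted_energy ?Q \<mu> \<le> weighted_energy ?Q \<mu>0" for \<mu>
    using fr(3)[of \<mu>] that unfolding we[OF that(1)] we[OF \<mu>0] enn2ereal_diff_le_iff by simp
  show 1: "is_arg_min (weighted_energy ?Q) (prob_on S2) \<mu>0"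
    using \<mu>0 le by (auto simp: is_arg_min_def not_less)
  show "sphere_equilibrium \<tau> = \<mu>0"
    unfolding sphere_equilibrium_def
  proof (rule the_equality, rule 1)
    show "\<mu> = \<mu>0" if "is_arg_min (weighted_energy ?Q) (prob_on S2) \<mu>" for \<mu>
      using that \<mu>0 by (intro un) (auto simp: is_arg_min_def not_less)
  qed
qed

section \<open>Planar coordinates\<close>

abbreviation sph :: "complex \<Rightarrow> real^3" where
  "sph z \<equiv> inv_stereo (Some z)"

lemma sph_in_S2: "sph z \<in> S2"
  using bij_betw_stereo unfolding inv_stereo_def
  by (metis UNIV_I bij_betw_def order_refl the_inv_into_into)

lemma stereo_sph: "stereo (sph z) = Some z"
  using bij_betw_stereo unfolding inv_stereo_def by (simp add: bij_betw_def f_the_inv_into_f)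

lemma sph_eq_iff [simp]: "sph z = sph w \<longleftrightarrow> z = w"
  by (metis option.inject stereo_sph)

lemma sph_surj:
  assumes "x \<in> S2" "x \<noteq> axis 3 1"
  obtains z where "x = sph z"
proof (cases "stereo x")
  case None
  then have "x = axis 3 1"
    using assms bij_betw_stereo inv_stereo_None unfolding inv_stereo_def
    by (metis bij_betw_def the_inv_into_f_f)
  then show ?thesis using assms by simp
next
  case (Some z)
  then have "x = sph z"
    using assms bij_betw_stereo unfolding inv_stereo_def
    by (metis bij_betw_def the_inv_into_f_f)
  then show ?thesis using that by blast
qed

lemma one_plus_cmod2_pos [simp]: "0 < 1 + (cmod z)\<^sup>2"
  by (simp add: add_pos_nonneg)

lemma dist_sph: "(dist (sph z) (sph w))\<^sup>2 = 4 * (cmod (z - w))\<^sup>2 / ((1 + (cmod z)\<^sup>2) * (1 + (cmod w)\<^sup>2))"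
proof -
  obtain a b c d where z: "z = Complex a b" and w: "w = Complex c d" by (metis complex.exhaust)
  have p: "a\<^sup>2 + b\<^sup>2 + 1 > 0" "c\<^sup>2 + d\<^sup>2 + 1 > 0" by (simp_all add: add_nonneg_pos)
  let ?P = "a\<^sup>2 + b\<^sup>2 + 1" and ?Q = "c\<^sup>2 + d\<^sup>2 + 1"
  have "sph z \<bullet> sph w = (2 * a / ?P) * (2 * c / ?Q) + (2 * b / ?P) * (2 * d / ?Q)
     + ((a\<^sup>2 + b\<^sup>2 - 1) / ?P) * ((c\<^sup>2 + d\<^sup>2 - 1) / ?Q)"
    by (simp add: inner_vec_def sum_3 inv_stereo_Some vector_3 cmod_power2 z w)
  also have "\<dots> = (4 * (a * c + b * d) + (?P - 2) * (?Q - 2)) / (?P * ?Q)"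
    by (simp add: add_divide_distrib)
  finally have i: "sph z \<bullet> sph w = (4 * (a * c + b * d) + (?P - 2) * (?Q - 2)) / (?P * ?Q)" .
  have "(dist (sph z) (sph w))\<^sup>2 = 2 - 2 * ((4 * (a * c + b * d) + (?P - 2) * (?Q - 2)) / (?P * ?Q))"
    unfolding dist_S2[OF sph_in_S2 sph_in_S2] half_inner_def i[symmetric] by (simp add: field_simps)
  also have "\<dots> = (2 * (?P * ?Q) - 2 * (4 * (a * c + b * d) + (?P - 2) * (?Q - 2))) / (?P * ?Q)"
    using p by (simp add: diff_divide_distrib)
  also have "2 * (?P * ?Q) - 2 * (4 * (a * c + b * d) + (?P - 2) * (?Q - 2)) = 4 * ((a - c)\<^sup>2 + (b - d)\<^sup>2)"
    by (simp add: power2_eq_square algebra_simps)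
  finally show ?thesis by (simp add: z w cmod_power2 add.commute)
qed

text \<open>The kernel ln (2 / dist) in the stereographic coordinate. For \<open>z = w\<close> the
  convention ln 0 = 0 yields a finite value in place of infinity, hence the hypotheses
  \<open>z \<noteq> w\<close> and the almost-everywhere arguments below.\<close>

definition kplane :: "complex \<Rightarrow> complex \<Rightarrow> real" where
  "kplane z w = ln (1 + (cmod z)\<^sup>2) / 2 + ln (1 + (cmod w)\<^sup>2) / 2 - ln (cmod (z - w))"

lemma ln_dist_sph:
  assumes "z \<noteq> w"
  shows "ln (2 / dist (sph z) (sph w)) = kplane z w"
proof -
  have d: "dist (sph z) (sph w) > 0" using assms by simp
  have "ln ((dist (sph z) (sph w))\<^sup>2) = ln 4 + ln ((cmod (z - w))\<^sup>2) - (ln (1 + (cmod z)\<^sup>2) + ln (1 + (cmod w)\<^sup>2))"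
    unfolding dist_sph using assms one_plus_cmod2_pos[of z] one_plus_cmod2_pos[of w]
    by (subst ln_div, simp, simp, subst (1 2) ln_mult) (simp_all add: less_imp_neq[symmetric])
  moreover have "ln ((dist (sph z) (sph w))\<^sup>2) = 2 * ln (dist (sph z) (sph w))" using d by (simp add: ln_realpow)
  moreover have "ln ((cmod (z - w))\<^sup>2) = 2 * ln (cmod (z - w))" using assms by (simp add: ln_realpow)
  moreover have "ln (4::real) = 2 * ln 2" using ln_realpow[of 2 2] by simp
  ultimately show ?thesis using d by (simp add: kplane_def ln_div)
qed

lemma skernel_sph: "z \<noteq> w \<Longrightarrow> skernel (sph z) (sph w) = ennreal (kplane z w)"
  by (simp add: skernel_neq ln_dist_sph)

lemma kplane_nonneg: "z \<noteq> w \<Longrightarrow> 0 \<le> kplane z w"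
proof -
  assume *: "z \<noteq> w"
  have "dist (sph z) (sph w) \<le> dist (sph z) 0 + dist 0 (sph w)" by (rule dist_triangle)
  then have "dist (sph z) (sph w) \<le> 2" using sph_in_S2[of z] sph_in_S2[of w] by (auto simp: dist_commute)
  then have "0 \<le> ln (2 / dist (sph z) (sph w))" using * by (intro ln_ge_zero) (simp add: divide_simps)
  then show ?thesis using ln_dist_sph[OF *] by simp
qed

section \<open>The real line as a circle on the sphere\<close>

definition line_pt :: "real \<Rightarrow> real^3" where
  "line_pt x = sph (complex_of_real x)"

lemma borel_measurable_line_pt [measurable]: "line_pt \<in> borel_measurable borel"
  unfolding line_pt_def[abs_def] by measurable

text \<open>A Borel left inverse of \<open>line_pt\<close> defined on the whole space; it carries
  fields from the line to the sphere and measures back.\<close>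

definition line_coord :: "real^3 \<Rightarrow> real" where
  "line_coord y = y $ 1 / (1 - y $ 3)"

lemma line_coord_line_pt [simp]: "line_coord (line_pt x) = x"
proof -
  have "x\<^sup>2 + 1 > 0" by (simp add: add_nonneg_pos)
  then show ?thesis
    by (simp add: line_coord_def line_pt_def inv_stereo_Some vector_3 field_simps)
qed

lemma borel_measurable_line_coord [measurable]: "line_coord \<in> borel_measurable borel"
  unfolding line_coord_def[abs_def] by measurable

lemma prob_on_distr_S2:
  assumes "prob_space M" and [measurable]: "f \<in> borel_measurable M" and "\<And>x. f x \<in> S2"
  shows "prob_on S2 (distr M borel f)"
proof -
  interpret prob_space M by fact
  have "emeasure (distr M borel f) S2 = emeasure M (f -` S2 \<inter> space M)"
    by (rule emeasure_distr) auto
  also have "f -` S2 \<inter> space M = space M" using assms(3) by auto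
  finally show ?thesis
    by (simp add: prob_on_def prob_space_distr emeasure_space_1)
qed

text \<open>The planar kernel differs from the spherical one by ln (1 + x^2) / 2 for each variable.
  Moved into the field, these summands turn the problem on the unbounded line into one on the sphere
  with a field bounded below, and the indefinite form of the energy disappears.\<close>

lemma line_energy_eq_total_energy:
  assumes \<mu>: "prob_on UNIV \<mu>" and [measurable]: "V \<in> borel_measurable borel"
    and nn: "\<And>x. 0 \<le> V x - ln (1 + x\<^sup>2) / 2 + c"
  shows "line_energy V \<mu> = enn2ereal (total_energy
      (\<lambda>y. ennreal (V (line_coord y) - ln (1 + (line_coord y)\<^sup>2) / 2 + c)) (distr \<mu> borel line_pt)) - ereal (2 * c)"
proof -
  have [measurable_cong]: "sets \<mu> = sets borel" and "prob_space \<mu>"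
    using \<mu> by (auto simp: prob_on_def)
  interpret prob_space \<mu> by fact
  interpret P: pair_prob_space \<mu> \<mu> ..
  let ?r = "\<lambda>x. V x - ln (1 + x\<^sup>2) / 2 + c"
  let ?k = "\<lambda>p :: real \<times> real. log_kernel (fst p) (snd p) + ereal (V (fst p)) + ereal (V (snd p))"
  have [measurable]: "?k \<in> borel_measurable (\<mu> \<Otimes>\<^sub>M \<mu>)"
    using borel_measurable_log_kernel[where 'a = real] by (simp add: split_def cong: measurable_cong_sets)
  have le: "0 \<le> ?k (x, y) + ereal (2 * c) \<and>
      e2ennreal (?k (x, y) + ereal (2 * c)) = skernel (line_pt x) (line_pt y) + ennreal (?r x) + ennreal (?r y)" for x y
  proof (cases "x = y")
    case False
    then have ne: "complex_of_real x \<noteq> of_real y" by simp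
    have "?k (x, y) + ereal (2 * c) = ereal (kplane (of_real x) (of_real y) + ?r x + ?r y)"
      using False by (simp add: log_kernel_def kplane_def ln_div dist_real_def norm_of_real
        of_real_diff[symmetric] del: of_real_diff)
    moreover have "0 \<le> kplane (of_real x) (of_real y)" by (rule kplane_nonneg[OF ne])
    ultimately show ?thesis using nn[of x] nn[of y]
      by (simp add: line_pt_def skernel_sph[OF ne] ennreal_plus[symmetric] del: ennreal_plus)
  qed (simp add: log_kernel_def)
  have "line_energy V \<mu> = enn2ereal (\<integral>\<^sup>+p. e2ennreal (?k p + ereal (2 * c)) \<partial>(\<mu> \<Otimes>\<^sub>M \<mu>)) - ereal (2 * c)"
    unfolding line_energy_def split_def
    by (rule ereal_integral_shift) (use P.prob_space_axioms le in auto)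
  also have "(\<integral>\<^sup>+p. e2ennreal (?k p + ereal (2 * c)) \<partial>(\<mu> \<Otimes>\<^sub>M \<mu>))
     = (\<integral>\<^sup>+x. \<integral>\<^sup>+y. skernel (line_pt x) (line_pt y) + ennreal (?r x) + ennreal (?r y) \<partial>\<mu> \<partial>\<mu>)"
    by (subst nn_integral_fst[symmetric]) (use le in \<open>auto intro!: nn_integral_cong\<close>)
  also have "\<dots> = (\<integral>\<^sup>+x. \<integral>\<^sup>+y. skernel (line_pt x) (line_pt y) \<partial>\<mu> \<partial>\<mu>) + 2 * (\<integral>\<^sup>+x. ennreal (?r x) \<partial>\<mu>)"
    by (simp add: nn_integral_add emeasure_space_1 mult_2 add.assoc)
  also have "\<dots> = total_energy (\<lambda>y. ennreal (?r (line_coord y))) (distr \<mu> borel line_pt)"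
    by (simp add: total_energy_def senergy_def nn_integral_distr)
  finally show ?thesis .
qed

text \<open>Frostman's criterion on the sphere with competitors confined to
  \<open>range line_pt\<close>. Uniqueness returns to the line because \<open>line_coord\<close>
  recovers a measure from its image.\<close>

lemma line_equilibrium_eqI:
  assumes \<rho>: "prob_on UNIV \<rho>" and [measurable]: "V \<in> borel_measurable borel"
    and nn: "\<And>x. 0 \<le> V x - ln (1 + x\<^sup>2) / 2 + c"
    and ge: "\<And>x. ennreal F \<le> spot (distr \<rho> borel line_pt) (line_pt x) + ennreal (V x - ln (1 + x\<^sup>2) / 2 + c)"
    and eq: "AE x in \<rho>. spot (distr \<rho> borel line_pt) (line_pt x) + ennreal (V x - ln (1 + x\<^sup>2) / 2 + c) = ennreal F"
  shows "line_equilibrium V = \<rho>"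
proof -
  let ?R = "\<lambda>y. ennreal (V (line_coord y) - ln (1 + (line_coord y)\<^sup>2) / 2 + c)"
  note le = line_energy_eq_total_energy[OF _ \<open>V \<in> borel_measurable borel\<close> nn]
  have pr: "prob_space \<mu>" "sets \<mu> = sets borel"
    if "prob_on UNIV \<mu>" for \<mu> :: "real measure"
    using that by (auto simp: prob_on_def)
  note [measurable_cong] = pr(2)[OF \<rho>]
  have push: "prob_on S2 (distr \<mu> borel line_pt)" if "prob_on UNIV \<mu>" for \<mu>
  proof -
    have "line_pt \<in> borel_measurable \<mu>" using pr(2)[OF that] by (simp cong: measurable_cong_sets)
    then show ?thesis using pr(1)[OF that] by (intro prob_on_distr_S2) (simp_all only: line_pt_def sph_in_S2)
  qed
  have AE_push: "(AE x in distr \<mu> borel line_pt. P x) \<longleftrightarrow> (AE x in \<mu>. P (line_pt x))"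
    if "prob_on UNIV \<mu>" "{x. P x} \<in> sets borel" for \<mu> P
    using that(2) pr(2)[OF that(1)] by (subst AE_distr_iff) (auto cong: measurable_cong_sets)
  have range: "range line_pt \<in> sets borel"
  proof -
    \<comment> \<open>The range is a Borel set, being the fixed-point set of a Borel map.\<close>
    have "range line_pt = {y. line_pt (line_coord y) = y}" by auto (metis rangeI)
    then show ?thesis by simp
  qed
  have [measurable]: "spot (distr \<rho> borel line_pt) \<in> borel_measurable borel"
    using prob_on_S2(1)[OF push[OF \<rho>]]
    by (intro measurable_spot) (auto intro: prob_space_imp_sigma_finite)
  have fr: "total_energy ?R (distr \<rho> borel line_pt) \<le> total_energy ?R (distr \<mu> borel line_pt)"
    "total_energy ?R (distr \<mu> borel line_pt) \<le> total_energy ?R (distr \<rho> borel line_pt)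
      \<Longrightarrow> distr \<mu> borel line_pt = distr \<rho> borel line_pt" if "prob_on UNIV \<mu>" for \<mu>
  proof -
    have ge': "ennreal F \<le> spot (distr \<rho> borel line_pt) x + ?R x" if "x \<in> range line_pt" for x
      using that ge by auto
    have eq': "AE x in distr \<rho> borel line_pt. spot (distr \<rho> borel line_pt) x + ?R x = ennreal F"
      using eq by (subst AE_push[OF \<rho>]) auto
    have X: "AE x in distr \<mu> borel line_pt. x \<in> range line_pt"
      using range by (subst AE_push[OF that]) auto
    note * = frostman[OF push[OF \<rho>] _ finite.emptyI ge' eq' push[OF that] X]
    show "total_energy ?R (distr \<rho> borel line_pt) \<le> total_energy ?R (distr \<mu> borel line_pt)"
      by (rule *(2)) auto
    show "distr \<mu> borel line_pt = distr \<rho> borel line_pt"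
      if "total_energy ?R (distr \<mu> borel line_pt) \<le> total_energy ?R (distr \<rho> borel line_pt)"
      by (rule *(3)) (use that in auto)
  qed
  have inj: "\<mu> = \<rho>" if \<mu>: "prob_on UNIV \<mu>" and "distr \<mu> borel line_pt = distr \<rho> borel line_pt" for \<mu>
  proof -
    have "distr (distr \<mu> borel line_pt) borel line_coord = \<mu>" if "prob_on UNIV \<mu>" for \<mu>
    proof -
      have "distr (distr \<mu> borel line_pt) borel line_coord = distr \<mu> borel (\<lambda>x. x)"
        using pr(2)[OF that] by (subst distr_distr) (auto simp: comp_def cong: measurable_cong_sets)
      also have "\<dots> = \<mu>" using pr(2)[OF that] by (intro distr_id2) simp
      finally show ?thesis .
    qed
    then show ?thesis using that \<rho> by metis
  qed
  have 1: "is_arg_min (line_energy V) (prob_on UNIV) \<rho>"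
    using \<rho> fr(1) by (auto simp: is_arg_min_def not_less le enn2ereal_diff_le_iff)
  show ?thesis
    unfolding line_equilibrium_def
  proof (rule the_equality, rule 1)
    show "\<mu> = \<rho>" if "is_arg_min (line_energy V) (prob_on UNIV) \<mu>" for \<mu>
    proof -
      have "prob_on UNIV \<mu>" "line_energy V \<mu> \<le> line_energy V \<rho>"
        using that \<rho> by (auto simp: is_arg_min_def not_less)
      then show ?thesis using \<rho> by (intro inj fr(2)) (auto simp: le enn2ereal_diff_le_iff)
    qed
  qed
qed

section \<open>Poisson integrals on the circle\<close>

definition uiv :: "real measure" where
  "uiv = density lborel (\<lambda>t. ennreal (indicator {0..1} t))"

lemma sets_uiv [measurable_cong, simp]: "sets uiv = sets borel"
  and space_uiv [simp]: "space uiv = UNIV"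
  by (simp_all add: uiv_def)

lemma nn_integral_uiv:
  assumes [measurable]: "f \<in> borel_measurable borel"
  shows "(\<integral>\<^sup>+t. f t \<partial>uiv) = (\<integral>\<^sup>+t. f t * indicator {0..1} t \<partial>lborel)"
  unfolding uiv_def by (subst nn_integral_density) (auto simp: ennreal_indicator mult.commute)

lemma prob_space_uiv: "prob_space uiv"
  by (rule prob_spaceI) (simp add: uiv_def emeasure_density ennreal_indicator)

interpretation uiv: prob_space uiv by (rule prob_space_uiv)

lemma AE_uiv: "(AE t in uiv. P t) \<longleftrightarrow> (AE t in lborel. t \<in> {0..1} \<longrightarrow> P t)"
  unfolding uiv_def by (subst AE_density) (auto simp: indicator_def intro!: AE_cong)

lemma AE_uiv_bounds: "AE t in uiv. 0 < t \<and> t < 1"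
proof -
  have "AE t in lborel. t \<noteq> (0::real)" "AE t in lborel. t \<noteq> (1::real)" by (rule AE_lborel_singleton)+
  then show ?thesis unfolding AE_uiv by eventually_elim auto
qed

lemma has_bochner_integral_uiv:
  fixes f :: "real \<Rightarrow> real"
  assumes c: "continuous_on {0..1} f" and [measurable]: "f \<in> borel_measurable borel"
    and i: "(f has_integral I) {0..1}"
  shows "has_bochner_integral uiv f I"
proof -
  have s: "set_integrable lborel {0..1} f" using c by (rule borel_integrable_atLeastAtMost')
  then have "integrable lborel (\<lambda>t. indicator {0..1} t * f t)" by (simp add: set_integrable_def)
  then have "integrable uiv f"
    unfolding uiv_def by (subst integrable_density) auto
  moreover have "(\<integral>t. f t \<partial>uiv) = I"
  proof -
    have "(\<integral>t. f t \<partial>uiv) = (\<integral>t. indicator {0..1} t * f t \<partial>lborel)"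
      unfolding uiv_def by (subst integral_density) auto
    also have "\<dots> = integral {0..1} f"
      using set_borel_integral_eq_integral(2)[OF s] by (simp add: set_lebesgue_integral_def)
    also have "\<dots> = I" using i by (rule integral_unique)
    finally show ?thesis .
  qed
  ultimately show ?thesis by (simp add: has_bochner_integral_iff)
qed

section \<open>The unit circle and the Poisson kernel\<close>

text \<open>Angles are measured in turns, so that the uniform distribution on the unit interval is
  normalized arc length.\<close>

definition circ :: "real \<Rightarrow> complex" where
  "circ t = exp (2 * of_real pi * \<i> * of_real t)"

lemma norm_circ [simp]: "cmod (circ t) = 1"
proof -
  have "circ t = exp (\<i> * of_real (2 * pi * t))" by (simp add: circ_def mult_ac)
  then show ?thesis by (simp only: norm_exp_i_times)
qed

lemma circ_nz [simp]: "circ t \<noteq> 0" by (simp add: circ_def)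

lemma continuous_on_circ [continuous_intros]: "continuous_on S circ"
  unfolding circ_def[abs_def] by (intro continuous_intros)

lemma measurable_circ [measurable]: "circ \<in> borel_measurable borel"
  by (intro borel_measurable_continuous_onI continuous_intros)

lemma cnj_circ: "cnj (circ t) = 1 / circ t"
  using complex_norm_square[of "circ t"] by (simp add: field_simps)

lemma circ_cis: "circ t = cis (2 * pi * t)"
  by (simp add: circ_def cis_conv_exp mult_ac)

text \<open>The fibres of \<open>circ\<close> are cosets of the integers or empty. This disposes of
  the logarithmic singularities in all later integrals.\<close>

lemma AE_circ_neq: "AE t in uiv. circ t \<noteq> c"
proof -
  have "countable {t. circ t = c}"
  proof (cases "\<exists>t0. circ t0 = c")
    case True
    then obtain t0 where t0: "circ t0 = c" by blast
    have "{t. circ t = c} \<subseteq> range (\<lambda>n :: int. t0 + of_int n)"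
    proof
      fix t assume "t \<in> {t. circ t = c}"
      then have "exp (2 * of_real pi * \<i> * of_real t) = exp (2 * of_real pi * \<i> * of_real t0)"
        using t0 by (simp add: circ_def)
      then obtain n :: int where
        n: "2 * of_real pi * \<i> * of_real t = 2 * of_real pi * \<i> * of_real t0 + of_int (2 * n) * (of_real pi * \<i>)"
        unfolding exp_eq by auto
      then have "(2 * of_real pi * \<i>) * complex_of_real t = (2 * of_real pi * \<i>) * complex_of_real (t0 + of_int n)"
        by (simp add: algebra_simps)
      then have "complex_of_real t = complex_of_real (t0 + of_int n)"
        by (subst (asm) mult_cancel_left) simp
      then show "t \<in> range (\<lambda>n :: int. t0 + of_int n)" by (simp only: of_real_eq_iff) blast
    qed
    then show ?thesis by (rule countable_subset) simp
  qed simp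
  then have "{t. circ t = c} \<in> null_sets lborel" by (rule countable_imp_null_set_lborel)
  then have "AE t in lborel. t \<notin> {t. circ t = c}" by (rule AE_not_in)
  then show ?thesis unfolding AE_uiv by eventually_elim simp
qed

definition poisson :: "complex \<Rightarrow> complex \<Rightarrow> real" where
  "poisson c v = (1 - (cmod c)\<^sup>2) / (cmod (v - c))\<^sup>2"

lemma poisson_pos: "cmod c < 1 \<Longrightarrow> cmod v = 1 \<Longrightarrow> 0 < poisson c v"
proof -
  assume "cmod c < 1" "cmod v = 1"
  moreover from this have "v \<noteq> c" by auto
  moreover have "(cmod c)\<^sup>2 < 1" using \<open>cmod c < 1\<close> by (simp add: power_less_one_iff abs_square_less_1)
  ultimately show ?thesis by (simp add: poisson_def)
qed

lemma measurable_poisson [measurable (raw)]: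
  assumes [measurable]: "f \<in> borel_measurable M"
  shows "(\<lambda>x. poisson c (f x)) \<in> borel_measurable M"
  unfolding poisson_def by measurable

text \<open>On the circle the conjugate of \<open>v\<close> is 1 / v, so the kernel agrees there
  with a rational function whose only pole in the closed disk is \<open>c\<close>: the form needed
  for Cauchy's formula.\<close>

lemma poisson_eq:
  assumes "cmod v = 1" "cmod c < 1"
  shows "complex_of_real (poisson c v) = of_real (1 - (cmod c)\<^sup>2) * v / ((v - c) * (1 - cnj c * v))"
proof -
  have v: "v * cnj v = 1" "v \<noteq> 0" using assms complex_norm_square[of v] by auto
  have "complex_of_real ((cmod (v - c))\<^sup>2) = (v - c) * (cnj v - cnj c)"
    by (simp only: complex_norm_square complex_cnj_diff)
  also have "cnj v = 1 / v" using v by (simp add: field_simps)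
  finally have "complex_of_real ((cmod (v - c))\<^sup>2) = (v - c) * (1 - cnj c * v) / v"
    using v by (simp add: field_simps)
  then show ?thesis unfolding poisson_def of_real_divide using v by simp
qed

text \<open>Cauchy's formula for \<open>f\<close> times a holomorphic factor that has the value 1 at
  \<open>c\<close>.\<close>

lemma poisson_mean:
  assumes f: "f holomorphic_on cball 0 1" and c: "cmod c < 1"
  shows "has_bochner_integral uiv (\<lambda>t. Re (f (circ t)) * poisson c (circ t)) (Re (f c))"
proof -
  have nz: "1 - cnj c * v \<noteq> 0" if "cmod v \<le> 1" for v
  proof
    assume "1 - cnj c * v = 0"
    then have "cmod (cnj c * v) = 1" by (metis eq_iff_diff_eq_0 norm_one)
    moreover have "cmod c * cmod v \<le> cmod c * 1" using that by (intro mult_left_mono) auto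
    ultimately show False using c by (simp add: norm_mult)
  qed
  define g where "g = (\<lambda>u. f u * (of_real (1 - (cmod c)\<^sup>2) / (1 - cnj c * u)))"
  have "g holomorphic_on cball 0 1"
    unfolding g_def using nz by (intro holomorphic_intros f) auto
  then have "((\<lambda>u. g u / (u - c)) has_contour_integral (2 * of_real pi * \<i> * g c)) (circlepath 0 1)"
    using c by (intro Cauchy_integral_circlepath_simple) auto
  then have "((\<lambda>t. g (circ t) / (circ t - c) * (2 * pi * \<i> * circ t)) has_integral (2 * of_real pi * \<i> * g c)) {0..1}"
    unfolding has_contour_integral_def
    by (rule has_integral_cong[THEN iffD1, rotated])
      (simp only: atLeastAtMost_iff vector_derivative_circlepath01, simp add: circlepath circ_def)
  from has_integral_mult_right[OF this, of "1 / (2 * of_real pi * \<i>)"]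
  have "((\<lambda>t. g (circ t) / (circ t - c) * circ t) has_integral g c) {0..1}"
    by (simp add: mult.commute[of "g _"] mult.assoc)
  moreover have "g (circ t) / (circ t - c) * circ t = f (circ t) * of_real (poisson c (circ t))" for t
    unfolding poisson_eq[OF norm_circ c] g_def by (simp add: mult_ac)
  ultimately have "((\<lambda>t. f (circ t) * of_real (poisson c (circ t))) has_integral g c) {0..1}"
    by simp
  also have "g c = f c"
  proof -
    have "cnj c * c = of_real ((cmod c)\<^sup>2)" using complex_norm_square[of c] by (simp add: mult.commute)
    then show ?thesis using nz[of c] c by (simp add: g_def)
  qed
  finally have "((\<lambda>t. f (circ t) * of_real (poisson c (circ t))) has_integral f c) {0..1}" .
  from has_integral_Re[OF this]
  have i: "((\<lambda>t. Re (f (circ t)) * poisson c (circ t)) has_integral Re (f c)) {0..1}" by simp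
  have cf: "continuous_on UNIV (\<lambda>t. f (circ t))"
    by (rule continuous_on_compose2[OF holomorphic_on_imp_continuous_on[OF f] continuous_on_circ]) auto
  have cont: "continuous_on UNIV (\<lambda>t. Re (f (circ t)) * poisson c (circ t))"
  proof -
    have "circ t \<noteq> c" for t using c norm_circ[of t] by auto
    then show ?thesis unfolding poisson_def by (intro continuous_intros cf) auto
  qed
  then show ?thesis using i
    by (intro has_bochner_integral_uiv continuous_on_subset[OF cont] borel_measurable_continuous_onI) auto
qed

lemma poisson_total: "cmod c < 1 \<Longrightarrow> has_bochner_integral uiv (\<lambda>t. poisson c (circ t)) 1"
  using poisson_mean[of "\<lambda>_. 1" c] by simp

text \<open>For \<bar>u\<bar> < 1 the values 1 - u w stay in the right half-plane, where the
  principal logarithm is holomorphic.\<close>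

lemma log_poisson_inside:
  assumes u: "cmod u < 1" and c: "cmod c < 1"
  shows "has_bochner_integral uiv (\<lambda>t. ln (cmod (1 - u * circ t)) * poisson c (circ t)) (ln (cmod (1 - u * c)))"
proof -
  have re: "Re (1 - u * w) > 0" if "cmod w \<le> 1" for w
  proof -
    have "Re (u * w) \<le> cmod (u * w)" by (rule complex_Re_le_cmod)
    also have "\<dots> \<le> cmod u * 1" using that by (simp add: norm_mult mult_left_le)
    finally show ?thesis using u by simp
  qed
  have "(\<lambda>w. Ln (1 - u * w)) holomorphic_on cball 0 1"
    using re by (intro holomorphic_intros) (auto simp: complex_nonpos_Reals_iff dest: leD)
  moreover have reln: "Re (Ln (1 - u * w)) = ln (cmod (1 - u * w))" if "cmod w \<le> 1" for w
    using re[OF that] by (intro Re_Ln) (metis less_irrefl zero_complex.simps(1))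
  ultimately show ?thesis using poisson_mean[of "\<lambda>w. Ln (1 - u * w)" c] c
    by (simp add: reln c)
qed

text \<open>The singularity now lies on the circle. It is approached along the radius by r u with r
  < 1: Fatou's lemma first gives integrability of the limit, which then provides the dominating
  function.\<close>

lemma log_poisson_aux:
  assumes c: "cmod c < 1" and u: "cmod u = 1"
  shows "has_bochner_integral uiv (\<lambda>t. ln (cmod (1 - u * circ t)) * poisson c (circ t)) (ln (cmod (1 - u * c)))"
proof -
  define r where "r = (\<lambda>n::nat. 1 - inverse (real (Suc n)) :: real)"
  have r: "0 \<le> r n" "r n < 1" "\<bar>r n\<bar> = r n" for n by (auto simp: r_def divide_simps)
  have rl: "r \<longlonglongrightarrow> 1"
    unfolding r_def using tendsto_diff[OF tendsto_const[of 1] LIMSEQ_inverse_real_of_nat] by simp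
  let ?p = "\<lambda>t. poisson c (circ t)"
  \<comment> \<open>Subtracting from ln 2 makes the integrands nonnegative, since \<bar>1 - w\<bar>
    is at most 2 in the disk.\<close>
  let ?h = "\<lambda>n t. (ln 2 - ln (cmod (1 - r n * u * circ t))) * ?p t"
  let ?H = "\<lambda>t. (ln 2 - ln (cmod (1 - u * circ t))) * ?p t"
  have p: "0 < ?p t" for t using c by (simp add: poisson_pos)
  have ne: "AE t in uiv. 1 - u * circ t \<noteq> 0"
    using AE_circ_neq[of "1 / u"] by eventually_elim (use u in \<open>auto simp: eq_divide_eq mult.commute split: if_splits\<close>)
  have nr: "cmod (r n * u) < 1" for n using r[of n] u by (simp add: norm_mult)
  have n0: "1 - r n * u * circ t \<noteq> 0" for n t
  proof
    assume "1 - r n * u * circ t = 0"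
    then have "cmod (r n * u * circ t) = 1" by (metis eq_iff_diff_eq_0 norm_one)
    then show False using nr[of n] by (simp add: norm_mult)
  qed
  have ub: "cmod (1 - w) \<le> 2" if "cmod w \<le> 1" for w
    using norm_triangle_ineq4[of 1 w] that by simp
  have hn: "has_bochner_integral uiv (?h n) (ln 2 - ln (cmod (1 - r n * u * c)))" for n
    using has_bochner_integral_diff[OF has_bochner_integral_mult_right[OF poisson_total[OF c], of "ln 2"]
        log_poisson_inside[OF nr[of n] c]] c
    by (simp add: left_diff_distrib)
  have hnn: "0 \<le> ?h n t" for n t
  proof -
    have "cmod (1 - r n * u * circ t) \<le> 2" using nr[of n] by (intro ub) (simp add: norm_mult)
    then show ?thesis using n0[of n t] p[of t] by (simp add: ln_le_cancel_iff)
  qed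
  have Hnn: "0 \<le> ?H t" if "1 - u * circ t \<noteq> 0" for t
  proof -
    have "cmod (1 - u * circ t) \<le> 2" using u by (intro ub) (simp add: norm_mult)
    then show ?thesis using that p[of t] by (simp add: ln_le_cancel_iff)
  qed
  have lim: "(\<lambda>n. ?h n t) \<longlonglongrightarrow> ?H t" if "1 - u * circ t \<noteq> 0" for t
  proof -
    have "(\<lambda>n. 1 - of_real (r n) * u * circ t) \<longlonglongrightarrow> 1 - of_real 1 * u * circ t"
      by (intro tendsto_intros rl)
    then have L: "(\<lambda>n. cmod (1 - of_real (r n) * u * circ t)) \<longlonglongrightarrow> cmod (1 - u * circ t)"
      using tendsto_norm by fastforce
    show ?thesis using that by (intro tendsto_mult tendsto_diff tendsto_ln tendsto_const L) auto
  qed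
  have c0: "1 - u * c \<noteq> 0"
  proof
    assume "1 - u * c = 0"
    then have "cmod (u * c) = 1" by (metis eq_iff_diff_eq_0 norm_one)
    then show False using u c by (simp add: norm_mult)
  qed
  have liml: "(\<lambda>n. ln 2 - ln (cmod (1 - r n * u * c))) \<longlonglongrightarrow> ln 2 - ln (cmod (1 - u * c))"
  proof -
    have "(\<lambda>n. 1 - of_real (r n) * u * c) \<longlonglongrightarrow> 1 - of_real 1 * u * c"
      by (intro tendsto_intros rl)
    then have L: "(\<lambda>n. cmod (1 - of_real (r n) * u * c)) \<longlonglongrightarrow> cmod (1 - u * c)"
      using tendsto_norm by fastforce
    show ?thesis using c0 by (intro tendsto_diff tendsto_ln tendsto_const L) auto
  qed
  have nnh: "(\<integral>\<^sup>+t. ennreal (?h n t) \<partial>uiv) = ennreal (ln 2 - ln (cmod (1 - r n * u * c)))" for n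
    using hn[of n] hnn by (subst nn_integral_eq_integral) (auto simp: has_bochner_integral_iff)
  have Hint: "integrable uiv ?H"
  proof (rule integrableI_nonneg)
    have "(\<integral>\<^sup>+t. ennreal (?H t) \<partial>uiv) \<le> (\<integral>\<^sup>+t. liminf (\<lambda>n. ennreal (?h n t)) \<partial>uiv)"
    proof (rule nn_integral_mono_AE, use ne in eventually_elim)
      case (elim t)
      have "(\<lambda>n. ennreal (?h n t)) \<longlonglongrightarrow> ennreal (?H t)" by (intro tendsto_ennrealI lim elim)
      then show ?case by (simp add: lim_imp_Liminf)
    qed
    also have "\<dots> \<le> liminf (\<lambda>n. \<integral>\<^sup>+t. ennreal (?h n t) \<partial>uiv)"
      by (rule nn_integral_liminf) auto
    also have "\<dots> = ennreal (ln 2 - ln (cmod (1 - u * c)))"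
      unfolding nnh by (intro lim_imp_Liminf tendsto_ennrealI liml) auto
    finally show "(\<integral>\<^sup>+t. ennreal (?H t) \<partial>uiv) < \<infinity>" by (rule le_less_trans) simp
    show "AE t in uiv. 0 \<le> ?H t" using ne by eventually_elim (rule Hnn)
  qed auto
  \<comment> \<open>Moving from r u to u changes the factor by 1 - r, which is at most \<bar>1 - r u
    v\<bar>; so the limit factor is at most twice the approximating one, and the limit dominates up
    to ln 2.\<close>
  have dom: "norm (?h n t) \<le> ln 2 * ?p t + ?H t" if "1 - u * circ t \<noteq> 0" for n t
  proof -
    have "cmod (1 - u * circ t) \<le> cmod (1 - r n * u * circ t) + cmod ((r n - 1) * u * circ t)"
      using norm_triangle_ineq[of "1 - r n * u * circ t" "(r n - 1) * u * circ t"] by (simp add: algebra_simps)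
    also have "cmod ((r n - 1) * u * circ t) = 1 - r n"
    proof -
      have "cmod (of_real (r n) - 1) = \<bar>r n - 1\<bar>"
        by (metis norm_of_real of_real_1 of_real_diff)
      then show ?thesis using r[of n] u by (simp add: norm_mult)
    qed
    also have "1 - r n \<le> cmod (1 - r n * u * circ t)"
      using norm_triangle_ineq2[of 1 "r n * u * circ t"] r[of n] u by (simp add: norm_mult)
    finally have "cmod (1 - u * circ t) \<le> 2 * cmod (1 - r n * u * circ t)" by simp
    then have "ln (cmod (1 - u * circ t)) \<le> ln (2 * cmod (1 - r n * u * circ t))"
      using that n0[of n t] by (subst ln_le_cancel_iff) auto
    also have "\<dots> = ln 2 + ln (cmod (1 - r n * u * circ t))" using n0[of n t] by (subst ln_mult) auto
    finally have "(ln 2 - ln (cmod (1 - r n * u * circ t))) * ?p t \<le> (ln 2 + (ln 2 - ln (cmod (1 - u * circ t)))) * ?p t"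
      using p[of t] by (intro mult_right_mono) auto
    then show ?thesis using hnn[of n t] by (simp add: algebra_simps)
  qed
  have "(\<lambda>n. \<integral>t. ?h n t \<partial>uiv) \<longlonglongrightarrow> (\<integral>t. ?H t \<partial>uiv)"
  proof (rule integral_dominated_convergence[where w = "\<lambda>t. ln 2 * ?p t + ?H t"])
    show "integrable uiv (\<lambda>t. ln 2 * ?p t + ?H t)"
      using poisson_total[OF c] Hint by (intro Bochner_Integration.integrable_add integrable_mult_right)
        (auto simp: has_bochner_integral_iff)
    show "AE t in uiv. (\<lambda>n. ?h n t) \<longlonglongrightarrow> ?H t" using ne by eventually_elim (rule lim)
    show "AE t in uiv. norm (?h n t) \<le> ln 2 * ?p t + ?H t" for n using ne by eventually_elim (rule dom)
  qed auto
  moreover have "(\<integral>t. ?h n t \<partial>uiv) = ln 2 - ln (cmod (1 - r n * u * c))" for n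
    using hn[of n] by (simp add: has_bochner_integral_iff)
  ultimately have "(\<integral>t. ?H t \<partial>uiv) = ln 2 - ln (cmod (1 - u * c))"
    using liml LIMSEQ_unique by simp
  then have "has_bochner_integral uiv ?H (ln 2 - ln (cmod (1 - u * c)))"
    using Hint by (simp add: has_bochner_integral_iff)
  from has_bochner_integral_diff[OF has_bochner_integral_mult_right[OF poisson_total[OF c], of "ln 2"] this]
  show ?thesis by (simp add: algebra_simps)
qed

text \<open>Outside of the disk, \<open>u\<close> is replaced by its mirror image, for which the
  previous cases apply. By \<open>key\<close> the two entries of the maximum change order exactly
  when \<open>u\<close> crosses the circle.\<close>

lemma log_poisson:
  assumes c: "cmod c < 1"
  shows "has_bochner_integral uiv (\<lambda>t. ln (cmod (1 - u * circ t)) * poisson c (circ t))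
    (ln (max (cmod (1 - u * c)) (cmod (u - cnj c))))"
proof -
  have key: "(cmod (u - cnj c))\<^sup>2 - (cmod (1 - u * c))\<^sup>2 = ((cmod u)\<^sup>2 - 1) * (1 - (cmod c)\<^sup>2)"
    unfolding cmod_power2 by (simp add: power2_eq_square algebra_simps)
  have c2: "(cmod c)\<^sup>2 < 1" using c by (simp add: abs_square_less_1)
  show ?thesis
  proof (cases "cmod u \<le> 1")
    case True
    then have "(cmod u)\<^sup>2 \<le> 1" by (simp add: abs_square_le_1)
    then have "((cmod u)\<^sup>2 - 1) * (1 - (cmod c)\<^sup>2) \<le> 0" using c2 by (simp add: mult_nonpos_nonneg)
    then have "(cmod (u - cnj c))\<^sup>2 \<le> (cmod (1 - u * c))\<^sup>2" using key by linarith
    then have "cmod (u - cnj c) \<le> cmod (1 - u * c)" by (rule power2_le_imp_le) simp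
    then show ?thesis
      using True log_poisson_inside[OF _ c, of u] log_poisson_aux[OF c, of u]
      by (cases "cmod u = 1") (auto simp: max_def)
  next
    case False
    then have u: "cmod u > 1" "u \<noteq> 0" by auto
    then have "(cmod u)\<^sup>2 > 1" by (simp add: one_less_power)
    then have "((cmod u)\<^sup>2 - 1) * (1 - (cmod c)\<^sup>2) \<ge> 0" using c2 by simp
    then have "(cmod (1 - u * c))\<^sup>2 \<le> (cmod (u - cnj c))\<^sup>2" using key by linarith
    then have m: "cmod (1 - u * c) \<le> cmod (u - cnj c)" by (rule power2_le_imp_le) simp
    let ?u = "cnj (1 / u)"
    have "cmod ?u < 1" using u by (simp add: norm_divide)
    note i = log_poisson_inside[OF this c]
    have nz: "1 - ?u * w \<noteq> 0" if "cmod w \<le> 1" for w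
    proof
      assume "1 - ?u * w = 0"
      then have "cmod (?u * w) = 1" by (metis eq_iff_diff_eq_0 norm_one)
      then have "cmod w = cmod u" using u by (simp add: norm_mult norm_divide field_simps)
      then show False using u that by simp
    qed
    have split: "cmod (1 - u * circ t) = cmod u * cmod (1 - ?u * circ t)" for t
    proof -
      have "1 - u * circ t = - (u * circ t) * cnj (1 - ?u * circ t)"
        using u by (simp add: cnj_circ field_simps)
      then show ?thesis by (simp only: norm_mult norm_minus_cancel complex_mod_cnj norm_circ mult_1_right)
    qed
    have "cmod u * cmod (1 - ?u * c) = cmod (u * cnj (1 - ?u * c))"
      by (simp only: norm_mult complex_mod_cnj)
    also have "u * cnj (1 - ?u * c) = u - cnj c" using u by (simp add: field_simps)
    finally have val: "cmod u * cmod (1 - ?u * c) = cmod (u - cnj c)" .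
    have "has_bochner_integral uiv (\<lambda>t. ln (cmod u) * poisson c (circ t) + ln (cmod (1 - ?u * circ t)) * poisson c (circ t))
      (ln (cmod u) * 1 + ln (cmod (1 - ?u * c)))"
      by (intro has_bochner_integral_add has_bochner_integral_mult_right poisson_total c i)
    moreover have "ln (cmod u) + ln (cmod (1 - ?u * c)) = ln (cmod (u - cnj c))"
      unfolding val[symmetric] using u nz[of c] c by (subst ln_mult) auto
    moreover have "ln (cmod u) * poisson c (circ t) + ln (cmod (1 - ?u * circ t)) * poisson c (circ t)
      = ln (cmod (1 - u * circ t)) * poisson c (circ t)" for t
      unfolding split using u nz[of "circ t"] by (subst ln_mult) (auto simp: algebra_simps)
    ultimately show ?thesis using m by (simp add: max_def)
  qed
qed

section \<open>Symmetric pairs of poles\<close>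

text \<open>The mean of the Poisson kernels at the points +-i sqrt M (\<open>poisson2_eq\<close>).
  Pairs arise because the charges and the singularities of the field come in conjugate pairs on the
  imaginary axis.\<close>

definition poisson2 :: "real \<Rightarrow> complex \<Rightarrow> real" where
  "poisson2 M v = (1 - M\<^sup>2) / (cmod (v\<^sup>2 + of_real M))\<^sup>2"

lemma poisson2_eq:
  assumes "0 \<le> M" "M < 1" "cmod v = 1"
  shows "poisson2 M v = (poisson (\<i> * of_real (sqrt M)) v + poisson (- (\<i> * of_real (sqrt M))) v) / 2"
proof -
  define c where "c = \<i> * complex_of_real (sqrt M)"
  have c2: "c\<^sup>2 = - of_real M" using assms by (simp add: c_def power_mult_distrib flip: of_real_power)
  have nc: "(cmod c)\<^sup>2 = M" "cmod c < 1" using assms by (simp_all add: c_def norm_mult)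
  have pl: "(cmod (v - c))\<^sup>2 + (cmod (v + c))\<^sup>2 = 2 * (1 + M)"
  proof -
    have "(cmod (v - c))\<^sup>2 + (cmod (v + c))\<^sup>2 = 2 * ((cmod v)\<^sup>2 + (cmod c)\<^sup>2)"
      unfolding cmod_power2 by (simp add: power2_eq_square algebra_simps)
    then show ?thesis using nc assms by simp
  qed
  have pr: "(cmod (v - c))\<^sup>2 * (cmod (v + c))\<^sup>2 = (cmod (v\<^sup>2 + of_real M))\<^sup>2"
  proof -
    have "v\<^sup>2 + of_real M = (v - c) * (v + c)" using c2 by (simp add: algebra_simps power2_eq_square)
    then show ?thesis by (simp add: norm_mult power_mult_distrib)
  qed
  have nz: "v - c \<noteq> 0" "v + c \<noteq> 0"
    using nc assms(3) norm_minus_cancel[of c] by (auto simp: add_eq_0_iff2)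
  have "poisson c v + poisson (- c) v = (1 - M) * ((cmod (v - c))\<^sup>2 + (cmod (v + c))\<^sup>2) / ((cmod (v - c))\<^sup>2 * (cmod (v + c))\<^sup>2)"
    using nz nc by (simp add: poisson_def field_simps)
  also have "\<dots> = 2 * poisson2 M v"
    unfolding pl pr poisson2_def by (simp add: power2_eq_square algebra_simps)
  finally show ?thesis by (simp add: c_def)
qed

lemma measurable_poisson2 [measurable (raw)]:
  assumes [measurable]: "f \<in> borel_measurable M" "g \<in> borel_measurable M"
  shows "(\<lambda>x. poisson2 (g x) (f x)) \<in> borel_measurable M"
  unfolding poisson2_def by measurable

lemma poisson2_pos:
  assumes "0 \<le> M" "M < 1" "cmod v = 1"
  shows "0 < poisson2 M v"
  unfolding poisson2_eq[OF assms] using assms by (auto intro!: divide_pos_pos add_pos_pos poisson_pos simp: norm_mult)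

lemma poisson2_total:
  assumes "0 \<le> M" "M < 1"
  shows "has_bochner_integral uiv (\<lambda>t. poisson2 M (circ t)) 1"
proof -
  have c: "cmod (\<i> * of_real (sqrt M)) < 1" "cmod (- (\<i> * of_real (sqrt M))) < 1"
    using assms by (simp_all add: norm_mult)
  from has_bochner_integral_divide_zero[OF has_bochner_integral_add[OF c[THEN poisson_total]], of 2]
  show ?thesis by (simp add: poisson2_eq[OF assms])
qed

text \<open>Both poles have the same modulus, so the sign of \<bar>u\<bar> - 1 decides both maxima
  at once and their product is the maximum of the products.\<close>

lemma log_poisson2:
  assumes M: "0 \<le> M" "M < 1"
  shows "has_bochner_integral uiv (\<lambda>t. ln (cmod (1 - u * circ t)) * poisson2 M (circ t))
    (ln (max (cmod (1 + of_real M * u\<^sup>2)) (cmod (u\<^sup>2 + of_real M))) / 2)"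
proof -
  define c where "c = \<i> * complex_of_real (sqrt M)"
  have c2: "c\<^sup>2 = - of_real M" using assms by (simp add: c_def power_mult_distrib flip: of_real_power)
  have cc: "cnj c = - c" by (simp add: c_def)
  have nc: "(cmod c)\<^sup>2 = M" "cmod c < 1" "cmod (- c) < 1" using assms by (simp_all add: c_def norm_mult)
  let ?a = "max (cmod (1 - u * c)) (cmod (u + c))" and ?b = "max (cmod (1 + u * c)) (cmod (u - c))"
  have pos: "?a > 0" "?b > 0"
  proof -
    have "\<not> (1 - u * c = 0 \<and> u + c = 0)"
    proof
      assume *: "1 - u * c = 0 \<and> u + c = 0"
      then have "u = - c" by (simp add: add_eq_0_iff2)
      with * have "1 + c\<^sup>2 = 0" by (simp add: power2_eq_square)
      then have "complex_of_real (1 - M) = 0" using c2 by simp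
      then show False using M by (simp only: of_real_eq_0_iff)
    qed
    then show "?a > 0" by (auto simp: less_max_iff_disj)
    have "\<not> (1 + u * c = 0 \<and> u - c = 0)"
    proof
      assume *: "1 + u * c = 0 \<and> u - c = 0"
      then have "u = c" by simp
      with * have "1 + c\<^sup>2 = 0" by (simp add: power2_eq_square)
      then have "complex_of_real (1 - M) = 0" using c2 by simp
      then show False using M by (simp only: of_real_eq_0_iff)
    qed
    then show "?b > 0" by (auto simp: less_max_iff_disj)
  qed
  have p1: "cmod (1 - u * c) * cmod (1 + u * c) = cmod (1 + of_real M * u\<^sup>2)"
  proof -
    have "1 + of_real M * u\<^sup>2 = 1 - c\<^sup>2 * u\<^sup>2" using c2 by simp
    also have "\<dots> = (1 - u * c) * (1 + u * c)" by (simp add: power2_eq_square algebra_simps)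
    finally show ?thesis by (simp only: norm_mult)
  qed
  have p2: "cmod (u + c) * cmod (u - c) = cmod (u\<^sup>2 + of_real M)"
  proof -
    have "u\<^sup>2 + of_real M = (u + c) * (u - c)" using c2 by (simp add: power2_eq_square algebra_simps)
    then show ?thesis by (simp only: norm_mult)
  qed
  have key: "(cmod (u - cnj d))\<^sup>2 - (cmod (1 - u * d))\<^sup>2 = ((cmod u)\<^sup>2 - 1) * (1 - (cmod d)\<^sup>2)" for d
    unfolding cmod_power2 by (simp add: power2_eq_square algebra_simps)
  have k1: "(cmod (u + c))\<^sup>2 - (cmod (1 - u * c))\<^sup>2 = ((cmod u)\<^sup>2 - 1) * (1 - M)"
    using key[of c] nc cc by simp
  have k2: "(cmod (u - c))\<^sup>2 - (cmod (1 + u * c))\<^sup>2 = ((cmod u)\<^sup>2 - 1) * (1 - M)"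
    using key[of "- c"] nc cc by simp
  have "?a * ?b = max (cmod (1 + of_real M * u\<^sup>2)) (cmod (u\<^sup>2 + of_real M))"
  proof (cases "(cmod u)\<^sup>2 \<le> 1")
    case True
    then have "((cmod u)\<^sup>2 - 1) * (1 - M) \<le> 0" using M by (simp add: mult_nonpos_nonneg)
    then have "(cmod (u + c))\<^sup>2 \<le> (cmod (1 - u * c))\<^sup>2" "(cmod (u - c))\<^sup>2 \<le> (cmod (1 + u * c))\<^sup>2"
      using k1 k2 by linarith+
    then have l: "cmod (u + c) \<le> cmod (1 - u * c)" "cmod (u - c) \<le> cmod (1 + u * c)"
      by (auto intro: power2_le_imp_le)
    have "cmod (u + c) * cmod (u - c) \<le> cmod (1 - u * c) * cmod (1 + u * c)"
      using l by (intro mult_mono) auto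
    then show ?thesis unfolding p1 p2 using l p1 by (simp add: max_absorb1)
  next
    case False
    then have "0 \<le> ((cmod u)\<^sup>2 - 1) * (1 - M)" using M by simp
    then have "(cmod (1 - u * c))\<^sup>2 \<le> (cmod (u + c))\<^sup>2" "(cmod (1 + u * c))\<^sup>2 \<le> (cmod (u - c))\<^sup>2"
      using k1 k2 by linarith+
    then have l: "cmod (1 - u * c) \<le> cmod (u + c)" "cmod (1 + u * c) \<le> cmod (u - c)"
      by (auto intro: power2_le_imp_le)
    have "cmod (1 - u * c) * cmod (1 + u * c) \<le> cmod (u + c) * cmod (u - c)"
      using l by (intro mult_mono) auto
    then show ?thesis unfolding p1 p2 using l p2 by (simp add: max_absorb2)
  qed
  then have v: "ln (max (cmod (1 + of_real M * u\<^sup>2)) (cmod (u\<^sup>2 + of_real M))) = ln ?a + ln ?b"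
    using ln_mult_pos[OF pos] by simp
  have "has_bochner_integral uiv (\<lambda>t. (ln (cmod (1 - u * circ t)) * poisson c (circ t)
      + ln (cmod (1 - u * circ t)) * poisson (- c) (circ t)) / 2) ((ln ?a + ln ?b) / 2)"
    using log_poisson[OF nc(2), of u] log_poisson[OF nc(3), of u] cc
    by (intro has_bochner_integral_divide_zero has_bochner_integral_add) auto
  then show ?thesis
    unfolding v by (simp add: poisson2_eq[OF M] c_def algebra_simps add_divide_distrib)
qed

lemma cmod_circ_diff: "cmod (circ t - u) = cmod (1 - cnj u * circ t)"
proof -
  have "circ t - u = circ t * cnj (1 - cnj u * circ t)" by (simp add: cnj_circ field_simps)
  then show ?thesis by (simp only: norm_mult norm_circ complex_mod_cnj mult_1)
qed

lemma log_poisson_diff: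
  assumes c: "cmod c < 1"
  shows "has_bochner_integral uiv (\<lambda>t. ln (cmod (circ t - u)) * poisson c (circ t))
    (ln (max (cmod (1 - u * cnj c)) (cmod (u - c))))"
proof -
  have "cmod (1 - cnj u * c) = cmod (1 - u * cnj c)" "cmod (cnj u - cnj c) = cmod (u - c)"
    by (metis complex_cnj_cnj complex_cnj_diff complex_cnj_mult complex_cnj_one complex_mod_cnj)+
  then show ?thesis using log_poisson[OF c, of "cnj u"] by (simp add: cmod_circ_diff)
qed

lemma log_poisson2_diff:
  assumes M: "0 \<le> M" "M < 1"
  shows "has_bochner_integral uiv (\<lambda>t. ln (cmod (circ t - u)) * poisson2 M (circ t))
    (ln (max (cmod (1 + of_real M * u\<^sup>2)) (cmod (u\<^sup>2 + of_real M))) / 2)"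
proof -
  have "cmod (1 + of_real M * (cnj u)\<^sup>2) = cmod (cnj (1 + of_real M * u\<^sup>2))"
    "cmod ((cnj u)\<^sup>2 + of_real M) = cmod (cnj (u\<^sup>2 + of_real M))" by simp_all
  then show ?thesis using log_poisson2[OF M, of "cnj u"] by (simp only: cmod_circ_diff complex_mod_cnj)
qed

section \<open>Archimedes' parametrization of the surface measure\<close>

text \<open>Jensen's formula for a linear polynomial; the Poisson kernel at the centre is
  constant.\<close>

lemma circle_mean:
  assumes "\<alpha> \<noteq> 0 \<or> \<beta> \<noteq> 0"
  shows "has_bochner_integral uiv (\<lambda>t. ln (cmod (\<alpha> - \<beta> * circ t))) (ln (max (cmod \<alpha>) (cmod \<beta>)))"
proof (cases "\<alpha> = 0")
  case True
  have "has_bochner_integral uiv (\<lambda>t. ln (cmod \<beta>)) (ln (cmod \<beta>) *\<^sub>R measure uiv (space uiv))"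
    using uiv.integrable_const by (simp add: has_bochner_integral_iff)
  then show ?thesis using True by (simp add: norm_mult uiv.prob_space[simplified] max_absorb2)
next
  case False
  let ?u = "\<beta> / \<alpha>"
  have p: "poisson 0 (circ t) = 1" for t by (simp add: poisson_def)
  have i: "has_bochner_integral uiv (\<lambda>t. ln (cmod \<alpha>) + ln (cmod (1 - ?u * circ t))) (ln (cmod \<alpha>) + ln (max 1 (cmod ?u)))"
    using has_bochner_integral_add[OF has_bochner_integral_mult_right[OF poisson_total[of 0], of "ln (cmod \<alpha>)"]
        log_poisson[of 0 ?u]] by (simp add: p)
  have ae: "AE t in uiv. ln (cmod \<alpha>) + ln (cmod (1 - ?u * circ t)) = ln (cmod (\<alpha> - \<beta> * circ t))"
    using AE_circ_neq[of "\<alpha> / \<beta>"]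
  proof eventually_elim
    case (elim t)
    have e: "\<alpha> - \<beta> * circ t = \<alpha> * (1 - ?u * circ t)" using False by (simp add: field_simps)
    have "1 - ?u * circ t \<noteq> 0" using elim False by (auto simp: field_simps)
    then show ?case unfolding e norm_mult using False by (subst ln_mult) auto
  qed
  have "ln (cmod \<alpha>) + ln (max 1 (cmod ?u)) = ln (cmod \<alpha> * max 1 (cmod ?u))"
    using False by (subst ln_mult) (auto simp: max_def)
  also have "cmod \<alpha> * max 1 (cmod ?u) = max (cmod \<alpha>) (cmod \<beta>)"
    using False by (auto simp: max_def norm_divide field_simps)
  finally have "has_bochner_integral uiv (\<lambda>t. ln (cmod \<alpha>) + ln (cmod (1 - ?u * circ t))) (ln (max (cmod \<alpha>) (cmod \<beta>)))"
    using i by simp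
  then show ?thesis
    by (rule has_bochner_integral_cong_AE[OF _ _ ae, THEN iffD1, rotated 2]) measurable
qed

text \<open>\<open>s\<close> is the height rescaled to the unit interval and \<open>t\<close> the
  longitude in turns.\<close>

definition arch :: "real \<Rightarrow> real \<Rightarrow> real^3" where
  "arch s t = vector [2 * sqrt (s * (1 - s)) * Re (circ t), 2 * sqrt (s * (1 - s)) * Im (circ t), 2 * s - 1]"

lemma arch_nth [simp]: "arch s t $ 1 = 2 * sqrt (s * (1 - s)) * Re (circ t)"
  "arch s t $ 2 = 2 * sqrt (s * (1 - s)) * Im (circ t)" "arch s t $ 3 = 2 * s - 1"
  by (simp_all add: arch_def vector_3)

lemma measurable_arch [measurable]: "(\<lambda>(s, t). arch s t) \<in> borel_measurable (borel \<Otimes>\<^sub>M borel)"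
proof -
  have "(\<lambda>p. arch (fst p) (snd p)) = (\<lambda>p. \<chi> i. if i = 1 then 2 * sqrt (fst p * (1 - fst p)) * Re (circ (snd p)) else
    if i = 2 then 2 * sqrt (fst p * (1 - fst p)) * Im (circ (snd p)) else 2 * fst p - 1)"
    by (simp add: fun_eq_iff vec_eq_iff forall_3)
  also have "\<dots> \<in> borel_measurable (borel \<Otimes>\<^sub>M borel)"
    unfolding borel_prod
  proof (intro borel_measurable_continuous_onI continuous_on_vec_lambda)
    have "continuous_on UNIV (\<lambda>p :: real \<times> real. circ (snd p))"
      by (rule continuous_on_compose2[OF continuous_on_circ]) (auto intro: continuous_intros)
    then show "continuous_on UNIV (\<lambda>p. if i = 1 then 2 * sqrt (fst p * (1 - fst p)) * Re (circ (snd p)) else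
      if i = 2 then 2 * sqrt (fst p * (1 - fst p)) * Im (circ (snd p)) else 2 * fst p - 1)" for i :: 3
      by (cases "i = 1"; cases "i = 2") (auto intro!: continuous_intros)
  qed
  finally show ?thesis by (simp add: split_def)
qed

lemma circ_sq: "(Re (circ t))\<^sup>2 + (Im (circ t))\<^sup>2 = 1"
  using norm_circ[of t] by (simp flip: cmod_power2)

lemma arch_in_S2: "0 \<le> s \<Longrightarrow> s \<le> 1 \<Longrightarrow> arch s t \<in> S2"
proof -
  assume s: "0 \<le> s" "s \<le> 1"
  have "(2 * sqrt (s * (1 - s)) * Re (circ t))\<^sup>2 + (2 * sqrt (s * (1 - s)) * Im (circ t))\<^sup>2
     = 4 * (s * (1 - s)) * ((Re (circ t))\<^sup>2 + (Im (circ t))\<^sup>2)"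
    using s by (simp add: power_mult_distrib distrib_left)
  then show ?thesis unfolding S2_iff arch_nth circ_sq by (simp add: power2_eq_square algebra_simps)
qed

lemma half_inner_axis: "half_inner x (axis 3 1) = (1 + x $ 3) / 2"
  by (simp add: half_inner_def inner_axis)

lemma axis3_in_S2: "axis 3 1 \<in> S2"
  by (simp add: norm_axis_1)

text \<open>The mean of the kernel over the circle of latitude at height \<open>s\<close>, seen from
  height \<open>r\<close>. The symmetric form encodes the maximum of \<open>s * (1 - r)\<close> and
  \<open>(1 - s) * r\<close>.\<close>

definition mean_kernel :: "real \<Rightarrow> real \<Rightarrow> real" where
  "mean_kernel s r = - ln (max s r * (1 - min s r)) / 2"

lemma mean_kernel_nonneg: "0 \<le> s \<Longrightarrow> s \<le> 1 \<Longrightarrow> 0 \<le> r \<Longrightarrow> r \<le> 1 \<Longrightarrow> 0 \<le> mean_kernel s r"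
proof -
  assume *: "0 \<le> s" "s \<le> 1" "0 \<le> r" "r \<le> 1"
  then have "max s r * (1 - min s r) \<le> 1 * 1" by (intro mult_mono) auto
  then show ?thesis using * by (cases "max s r * (1 - min s r) = 0") (auto simp: mean_kernel_def ln_le_zero_iff)
qed

text \<open>Along a circle of latitude the distance to \<open>x\<close> is twice the modulus of an
  affine function of \<open>circ t\<close>, so Jensen's formula applies.\<close>

lemma arch_mean:
  assumes x: "x \<in> S2" and s: "0 < s" "s < 1"
  shows "(\<integral>\<^sup>+t. skernel x (arch s t) \<partial>uiv) = ennreal (mean_kernel s (half_inner x (axis 3 1)))"
proof -
  define r where "r = half_inner x (axis 3 1)"
  have r: "0 \<le> r" "r \<le> 1" using half_inner_bounds[OF x axis3_in_S2] by (auto simp: r_def)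
  have x3: "x $ 3 = 2 * r - 1" by (simp add: r_def half_inner_axis field_simps)
  \<comment> \<open>The conjugate of the horizontal part of \<open>x\<close>: multiplied by
    \<open>circ t\<close>, its real part is the horizontal part of the inner product.\<close>
  define w where "w = Complex (x $ 1) (- x $ 2)"
  have w2: "(cmod w)\<^sup>2 = 4 * (r * (1 - r))"
    using x unfolding S2_iff x3 w_def cmod_power2 by (simp add: power2_eq_square algebra_simps)
  have nw: "cmod w = 2 * sqrt (r * (1 - r))"
    using w2 r by (metis real_sqrt_four real_sqrt_mult real_sqrt_abs abs_of_nonneg norm_ge_zero real_sqrt_power)
  obtain \<phi> where \<phi>: "cmod \<phi> = 1" "w = of_real (cmod w) * \<phi>"
    using that[of "if w = 0 then 1 else w / of_real (cmod w)"] by (auto simp: norm_divide split: if_splits)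
  \<comment> \<open>The moduli are chosen such that the law of cosines for \<alpha> - \<beta> v
    reproduces a quarter of the squared distance; the phase of \<open>w\<close> goes into
    \<beta>.\<close>
  define \<alpha> where "\<alpha> = complex_of_real (sqrt (s * (1 - r)))"
  define \<beta> where "\<beta> = of_real (sqrt ((1 - s) * r)) * \<phi>"
  have na: "cmod \<alpha> = sqrt (s * (1 - r))" "cmod \<beta> = sqrt ((1 - s) * r)"
    using s r \<phi> by (simp_all add: \<alpha>_def \<beta>_def norm_mult)
  have nz: "\<alpha> \<noteq> 0 \<or> \<beta> \<noteq> 0"
    using s r \<phi> by (auto simp: \<alpha>_def \<beta>_def)
  have d: "dist x (arch s t) = 2 * cmod (\<alpha> - \<beta> * circ t)" for t
  proof -
    have "x \<bullet> arch s t = 2 * sqrt (s * (1 - s)) * Re (w * circ t) + (2 * r - 1) * (2 * s - 1)"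
      by (simp add: inner_vec_def sum_3 x3 w_def algebra_simps)
    also have "Re (w * circ t) = 2 * sqrt (r * (1 - r)) * Re (\<phi> * circ t)"
      by (subst \<phi>(2)) (simp add: nw mult.assoc)
    finally have i: "x \<bullet> arch s t = 4 * (sqrt (s * (1 - s)) * sqrt (r * (1 - r))) * Re (\<phi> * circ t) + (2 * r - 1) * (2 * s - 1)"
      by simp
    have "(dist x (arch s t))\<^sup>2 = 2 - 2 * (x \<bullet> arch s t)"
      using dist_S2[OF x arch_in_S2[of s t]] s by (simp add: half_inner_def field_simps)
    moreover have "(cmod (\<alpha> - \<beta> * circ t))\<^sup>2 = s * (1 - r) + (1 - s) * r - 2 * (sqrt (s * (1 - r)) * sqrt ((1 - s) * r)) * Re (\<phi> * circ t)"
    proof -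
      have "(cmod (\<alpha> - v))\<^sup>2 = (cmod \<alpha>)\<^sup>2 + (cmod v)\<^sup>2 - 2 * sqrt (s * (1 - r)) * Re v" for v
        unfolding cmod_power2 by (simp add: \<alpha>_def power2_eq_square algebra_simps)
      from this[of "\<beta> * circ t"] show ?thesis using s r na
        by (simp add: norm_mult \<beta>_def mult.assoc \<phi>)
    qed
    moreover have "sqrt (s * (1 - r)) * sqrt ((1 - s) * r) = sqrt (s * (1 - s)) * sqrt (r * (1 - r))"
      by (simp add: real_sqrt_mult)
    ultimately have "(dist x (arch s t))\<^sup>2 = (2 * cmod (\<alpha> - \<beta> * circ t))\<^sup>2"
      unfolding i by (simp add: algebra_simps power_mult_distrib)
    then show ?thesis by (rule power2_eq_imp_eq) auto
  qed
  have ne: "AE t in uiv. \<alpha> - \<beta> * circ t \<noteq> 0"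
    using AE_circ_neq[of "\<alpha> / \<beta>"]
  proof eventually_elim
    case (elim t)
    then show ?case using nz by (cases "\<beta> = 0") (auto simp: field_simps)
  qed
  have "(\<integral>\<^sup>+t. skernel x (arch s t) \<partial>uiv) = (\<integral>\<^sup>+t. ennreal (- ln (cmod (\<alpha> - \<beta> * circ t))) \<partial>uiv)"
    using ne
  proof (intro nn_integral_cong_AE, eventually_elim)
    case (elim t)
    then have "x \<noteq> arch s t" using d[of t] by (metis dist_self mult_eq_0_iff norm_eq_zero zero_neq_numeral)
    moreover have "2 / (2 * cmod (\<alpha> - \<beta> * circ t)) = inverse (cmod (\<alpha> - \<beta> * circ t))"
      by (simp add: field_simps)
    ultimately show ?case by (simp add: skernel_neq d ln_inverse)
  qed
  also have "\<dots> = ennreal (- ln (max (cmod \<alpha>) (cmod \<beta>)))"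
  proof -
    have hb: "has_bochner_integral uiv (\<lambda>t. - ln (cmod (\<alpha> - \<beta> * circ t))) (- ln (max (cmod \<alpha>) (cmod \<beta>)))"
      by (intro has_bochner_integral_minus circle_mean nz)
    have "AE t in uiv. 0 \<le> - ln (cmod (\<alpha> - \<beta> * circ t))"
      using ne
    proof eventually_elim
      case (elim t)
      have "dist x (arch s t) \<le> dist x 0 + dist 0 (arch s t)" by (rule dist_triangle)
      also have "\<dots> = 2" using x arch_in_S2[of s t] s by (simp add: dist_commute)
      finally show ?case using elim unfolding d by (simp add: ln_le_zero_iff)
    qed
    then show ?thesis using hb by (subst nn_integral_eq_integral) (auto simp: has_bochner_integral_iff)
  qed
  also have "max (cmod \<alpha>) (cmod \<beta>) = sqrt (max s r * (1 - min s r))"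
  proof -
    have "max (cmod \<alpha>) (cmod \<beta>) = sqrt (max (s * (1 - r)) ((1 - s) * r))"
      unfolding na by (simp add: max_def)
    also have "max (s * (1 - r)) ((1 - s) * r) = max s r * (1 - min s r)"
      by (auto simp: max_def min_def algebra_simps)
    finally show ?thesis .
  qed
  also have "- ln (sqrt (max s r * (1 - min s r))) = mean_kernel s r"
    unfolding mean_kernel_def using s r by (subst ln_sqrt) (auto simp: less_max_iff_disj)
  finally show ?thesis by (simp add: r_def)
qed

text \<open>The result does not depend on the height: a measure uniform in height and longitude has
  constant potential off the poles. The integral is split at s = r, where the formula for the mean
  changes.\<close>

lemma mean_kernel_integral:
  assumes r: "0 < r" "r < 1"
  shows "(\<integral>\<^sup>+s. ennreal (mean_kernel s r) \<partial>uiv) = ennreal (1 / 2)"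
proof -
  let ?F = "\<lambda>s. - (s * ln r - (1 - s) * ln (1 - s) - s) / 2" and ?G = "\<lambda>s. - (s * ln s - s + s * ln (1 - r)) / 2"
  have 1: "((\<lambda>s. mean_kernel s r) has_integral (?F r - ?F 0)) {0..r}"
  proof (rule fundamental_theorem_of_calculus)
    fix s assume s: "s \<in> {0..r}"
    then have "mean_kernel s r = - (ln r + ln (1 - s)) / 2"
      using r by (simp add: mean_kernel_def max_absorb2 min_absorb1 ln_mult)
    moreover have "(?F has_real_derivative - (ln r + ln (1 - s)) / 2) (at s within {0..r})"
      using s r by (auto intro!: derivative_eq_intros)
    ultimately have "(?F has_real_derivative mean_kernel s r) (at s within {0..r})"
      by (simp only:)
    then show "(?F has_vector_derivative mean_kernel s r) (at s within {0..r})"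
      by (simp add: has_real_derivative_iff_has_vector_derivative)
  qed (use r in auto)
  have 2: "((\<lambda>s. mean_kernel s r) has_integral (?G 1 - ?G r)) {r..1}"
  proof (rule fundamental_theorem_of_calculus)
    fix s assume s: "s \<in> {r..1}"
    then have "mean_kernel s r = - (ln s + ln (1 - r)) / 2"
      using r by (simp add: mean_kernel_def max_absorb1 min_absorb2 ln_mult)
    moreover have "(?G has_real_derivative - (ln s + ln (1 - r)) / 2) (at s within {r..1})"
      using s r by (auto intro!: derivative_eq_intros)
    ultimately have "(?G has_real_derivative mean_kernel s r) (at s within {r..1})"
      by (simp only:)
    then show "(?G has_vector_derivative mean_kernel s r) (at s within {r..1})"
      by (simp add: has_real_derivative_iff_has_vector_derivative)
  qed (use r in auto)
  have v: "?F r - ?F 0 + (?G 1 - ?G r) = 1 / 2" using r by (simp add: field_simps)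
  have "((\<lambda>s. mean_kernel s r) has_integral 1 / 2) {0..1}"
    using has_integral_combine[OF _ _ 1 2] r unfolding v by simp
  then have I: "((\<lambda>s. indicator {0..1} s * mean_kernel s r) has_integral 1 / 2) UNIV"
  proof -
    have "(\<lambda>s. indicator {0..1} s * mean_kernel s r) = (\<lambda>s. if s \<in> {0..1} then mean_kernel s r else 0)"
      by (auto simp: indicator_def)
    then show ?thesis
      using \<open>((\<lambda>s. mean_kernel s r) has_integral 1 / 2) {0..1}\<close> by (simp only: has_integral_restrict_UNIV)
  qed
  have [measurable]: "(\<lambda>s. mean_kernel s r) \<in> borel_measurable borel"
    unfolding mean_kernel_def by measurable
  have "(\<integral>\<^sup>+s. ennreal (mean_kernel s r) \<partial>uiv) = (\<integral>\<^sup>+s. ennreal (indicator {0..1} s * mean_kernel s r) \<partial>lborel)"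
    by (subst nn_integral_uiv) (auto intro!: nn_integral_cong split: split_indicator)
  also have "\<dots> = ennreal (1 / 2)"
    by (rule nn_integral_has_integral_lborel[OF _ _ I]) (use r in \<open>auto simp: mean_kernel_nonneg split: split_indicator\<close>)
  finally show ?thesis .
qed

section \<open>The measure uniform in height and longitude\<close>

definition arch_measure :: "(real^3) measure" where
  "arch_measure = distr (uiv \<Otimes>\<^sub>M uiv) borel (\<lambda>(s, t). arch s t)"

interpretation uiv2: pair_prob_space uiv uiv ..

lemma measurable_arch_uiv [measurable]: "(\<lambda>(s, t). arch s t) \<in> borel_measurable (uiv \<Otimes>\<^sub>M uiv)"
  using measurable_arch by (simp cong: measurable_cong_sets sets_pair_measure_cong)

lemma nn_integral_arch_measure:
  assumes [measurable]: "f \<in> borel_measurable borel"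
  shows "(\<integral>\<^sup>+x. f x \<partial>arch_measure) = (\<integral>\<^sup>+s. \<integral>\<^sup>+t. f (arch s t) \<partial>uiv \<partial>uiv)"
proof -
  have "(\<integral>\<^sup>+x. f x \<partial>arch_measure) = (\<integral>\<^sup>+p. (case p of (s, t) \<Rightarrow> f (arch s t)) \<partial>(uiv \<Otimes>\<^sub>M uiv))"
    unfolding arch_measure_def by (subst nn_integral_distr) (auto simp: split_def)
  also have "\<dots> = (\<integral>\<^sup>+s. \<integral>\<^sup>+t. f (arch s t) \<partial>uiv \<partial>uiv)"
    by (subst uiv.nn_integral_fst[symmetric]) auto
  finally show ?thesis .
qed

lemma prob_on_arch: "prob_on S2 arch_measure"
proof -
  interpret prob_space arch_measure
    unfolding arch_measure_def by (intro uiv2.prob_space_distr) simp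
  have "emeasure arch_measure S2 = (\<integral>\<^sup>+x. indicator S2 x \<partial>arch_measure)"
    by (simp add: arch_measure_def)
  also have "\<dots> = (\<integral>\<^sup>+s. \<integral>\<^sup>+t. indicator S2 (arch s t) \<partial>uiv \<partial>uiv)"
    by (rule nn_integral_arch_measure) simp
  also have "\<dots> = (\<integral>\<^sup>+s. \<integral>\<^sup>+t. 1 \<partial>uiv \<partial>uiv)"
    using AE_uiv_bounds
    by (intro nn_integral_cong_AE, eventually_elim) (simp add: arch_in_S2[simplified])
  also have "\<dots> = 1" using uiv.emeasure_space_1 by simp
  finally show ?thesis using prob_space_axioms by (simp add: prob_on_def arch_measure_def)
qed

lemma half_inner_arch: "half_inner (arch s t) (axis 3 1) = s"
  by (simp add: half_inner_axis)

lemma spot_arch: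
  assumes x: "x \<in> S2" "0 < half_inner x (axis 3 1)" "half_inner x (axis 3 1) < 1"
  shows "spot arch_measure x = ennreal (1 / 2)"
proof -
  have "spot arch_measure x = (\<integral>\<^sup>+s. \<integral>\<^sup>+t. skernel x (arch s t) \<partial>uiv \<partial>uiv)"
    unfolding spot_def by (rule nn_integral_arch_measure) measurable
  also have "\<dots> = (\<integral>\<^sup>+s. ennreal (mean_kernel s (half_inner x (axis 3 1))) \<partial>uiv)"
    using AE_uiv_bounds by (intro nn_integral_cong_AE, eventually_elim) (simp add: arch_mean[OF x(1)])
  finally show ?thesis using mean_kernel_integral[OF x(2,3)] by simp
qed

lemma half_inner_eq_1:
  assumes "x \<in> S2" "p \<in> S2" "half_inner x p = 1"
  shows "x = p"
  using dist_S2[OF assms(1,2)] assms(3) by simp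

lemma half_inner_minus: "half_inner x (- p) = 1 - half_inner x p"
  by (simp add: half_inner_def field_simps)

lemma half_inner_eq_0:
  assumes "x \<in> S2" "p \<in> S2" "half_inner x p = 0"
  shows "x = - p"
  using half_inner_eq_1[of x "- p"] assms by (simp add: half_inner_minus)

text \<open>The preimage of a point under radial projection is a ray, contained in the plane through
  the origin with normal \<open>w\<close>.\<close>

lemma surface_measure_singleton:
  assumes "z \<bullet> w = 0" "w \<noteq> 0" "z \<noteq> 0"
  shows "emeasure surface_measure {z} = 0"
proof -
  let ?U = "uniform_measure lborel (ball (0 :: real^3) 1)"
  have sub: "(\<lambda>x. x /\<^sub>R norm x) -` {z} \<subseteq> {x. w \<bullet> x = 0}"
  proof
    fix x assume "x \<in> (\<lambda>x. x /\<^sub>R norm x) -` {z}"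
    then have "z = x /\<^sub>R norm x" by simp
    then have "x = norm x *\<^sub>R z" using assms(3) by (cases "x = 0") auto
    then have "w \<bullet> x = norm x * (w \<bullet> z)" by (metis inner_scaleR_right)
    then show "x \<in> {x. w \<bullet> x = 0}" using assms by (simp add: inner_commute)
  qed
  have "{x. w \<bullet> x = 0} \<in> null_sets lebesgue"
    using negligible_hyperplane[of w 0] assms by (simp add: negligible_iff_null_sets)
  then have "emeasure lborel {x. w \<bullet> x = 0} = 0"
    by (simp add: null_sets_def closed_hyperplane borel_closed)
  then have "emeasure lborel (ball 0 1 \<inter> ((\<lambda>x. x /\<^sub>R norm x) -` {z})) = 0"
    by (rule emeasure_eq_0[rotated]) (use sub in \<open>auto intro!: borel_closed closed_hyperplane\<close>)
  moreover have "(\<lambda>x. x /\<^sub>R norm x) -` {z} \<in> sets borel"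
    using measurable_sets[OF borel_measurable_radial, of "{z}"] by simp
  ultimately have "emeasure ?U ((\<lambda>x. x /\<^sub>R norm x) -` {z}) = 0" by simp
  then show ?thesis unfolding surface_measure_def by (subst emeasure_distr) auto
qed

text \<open>Rotations act transitively on the sphere and preserve both the measure and the
  kernel.\<close>

lemma spot_surface_const:
  assumes "x \<in> S2" "y \<in> S2"
  shows "spot surface_measure x = spot surface_measure y"
proof -
  have "norm x = norm y" using assms by simp
  then obtain f where f: "orthogonal_transformation f" "f x = y"
    using orthogonal_transformation_exists by blast
  have lin: "linear f" using f by (simp add: orthogonal_transformation)
  have [measurable]: "f \<in> borel_measurable borel"
    using lin by (intro borel_measurable_continuous_onI linear_continuous_on) (simp add: linear_conv_bounded_linear)
  have sk: "skernel (f u) (f v) = skernel u v" for u v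
  proof -
    have "dist (f u) (f v) = norm (f (u - v))" using lin by (simp add: dist_norm linear_diff)
    also have "\<dots> = dist u v" using f(1) by (simp add: orthogonal_transformation dist_norm)
    finally have "dist (f u) (f v) = dist u v" .
    moreover from this have "f u = f v \<longleftrightarrow> u = v" by (metis dist_eq_0_iff)
    ultimately show ?thesis by (cases "u = v") (auto simp: skernel_neq)
  qed
  have [measurable_cong]: "sets surface_measure = sets borel" by (simp add: surface_measure_def)
  have "spot surface_measure y = (\<integral>\<^sup>+v. skernel y v \<partial>distr surface_measure borel f)"
    by (simp add: spot_def surface_measure_rotation_invariant[OF f(1)])
  also have "\<dots> = (\<integral>\<^sup>+v. skernel (f x) (f v) \<partial>surface_measure)"
    unfolding f(2) by (subst nn_integral_distr) measurable
  finally show ?thesis by (simp add: sk spot_def)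
qed

text \<open>Archimedes' theorem without computing an area. The potential of
  \<open>arch_measure\<close> is 1/2 off the poles, that of the surface measure is constant by
  symmetry, and the mutual energy computed in both orders shows that this constant is 1/2 too. So
  both energies and the mutual energy coincide, and \<open>senergy_unique\<close> identifies the
  measures.\<close>

lemma surface_measure_eq_arch: "surface_measure = arch_measure"
  and spot_surface: "x \<in> S2 \<Longrightarrow> spot surface_measure x = ennreal (1 / 2)"
proof -
  let ?n = "axis 3 1 :: real^3"
  note S = surface_measure_prob_on and A = prob_on_arch
  interpret S: prob_space surface_measure by (rule prob_on_S2[OF S])
  interpret A: prob_space arch_measure by (rule prob_on_S2[OF A])
  have pole: "emeasure surface_measure {?n} = 0" "emeasure surface_measure {- ?n} = 0"
    by (rule surface_measure_singleton[of _ "axis 1 1"]; simp add: inner_axis axis_eq_0_iff; simp add: axis_def)+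
  have aeS: "AE x in surface_measure. x \<in> S2 \<and> x \<noteq> ?n \<and> x \<noteq> - ?n"
  proof -
    have "AE x in surface_measure. x \<notin> {?n}" "AE x in surface_measure. x \<notin> {- ?n}"
      by (intro AE_not_in null_setsI pole; simp add: prob_on_S2(2)[OF S])+
    with prob_on_S2(4)[OF S] show ?thesis by eventually_elim auto
  qed
  have half: "spot arch_measure x = ennreal (1 / 2)" if "x \<in> S2" "x \<noteq> ?n" "x \<noteq> - ?n" for x
    using that half_inner_bounds[OF that(1) axis3_in_S2] half_inner_eq_1[OF that(1) axis3_in_S2]
      half_inner_eq_0[OF that(1) axis3_in_S2]
    by (intro spot_arch) (auto simp: less_le)
  have sf: "sigma_finite_measure surface_measure" "sigma_finite_measure arch_measure"
    by (auto intro: prob_space_imp_sigma_finite S.prob_space_axioms A.prob_space_axioms)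
  have SA: "senergy surface_measure arch_measure = ennreal (1 / 2)"
  proof -
    have "senergy surface_measure arch_measure = (\<integral>\<^sup>+x. ennreal (1 / 2) \<partial>surface_measure)"
      unfolding senergy_spot using aeS half by (intro nn_integral_cong_AE) (auto elim: eventually_mono)
    then show ?thesis by (simp add: S.emeasure_space_1)
  qed
  obtain c where c: "\<And>x. x \<in> S2 \<Longrightarrow> spot surface_measure x = c"
    using spot_surface_const axis3_in_S2 by metis
  have "senergy arch_measure surface_measure = (\<integral>\<^sup>+x. c \<partial>arch_measure)"
    unfolding senergy_spot using prob_on_S2(4)[OF A] c by (intro nn_integral_cong_AE) (auto elim: eventually_mono)
  also have "\<dots> = c" by (simp add: A.emeasure_space_1)
  finally have c_eq: "c = ennreal (1 / 2)"
    using SA senergy_commute[OF sf(1) prob_on_S2(2)[OF S] sf(2) prob_on_S2(2)[OF A]] by simp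
  then show spot: "spot surface_measure x = ennreal (1 / 2)" if "x \<in> S2" for x using c that by simp
  have SS: "senergy surface_measure surface_measure = ennreal (1 / 2)"
  proof -
    have "senergy surface_measure surface_measure = (\<integral>\<^sup>+x. ennreal (1 / 2) \<partial>surface_measure)"
      unfolding senergy_spot using prob_on_S2(4)[OF S] spot by (intro nn_integral_cong_AE) (auto elim: eventually_mono)
    then show ?thesis by (simp add: S.emeasure_space_1)
  qed
  have AA: "senergy arch_measure arch_measure = ennreal (1 / 2)"
  proof -
    have "senergy arch_measure arch_measure = (\<integral>\<^sup>+s. \<integral>\<^sup>+t. spot arch_measure (arch s t) \<partial>uiv \<partial>uiv)"
      unfolding senergy_spot
      by (intro nn_integral_arch_measure measurable_spot sf prob_on_S2(2)[OF A]) simp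
    also have "\<dots> = (\<integral>\<^sup>+s. \<integral>\<^sup>+t. ennreal (1 / 2) \<partial>uiv \<partial>uiv)"
      using AE_uiv_bounds
    proof (intro nn_integral_cong_AE, eventually_elim)
      case (elim s)
      have "spot arch_measure (arch s t) = ennreal (1 / 2)" for t
        by (rule spot_arch) (use elim arch_in_S2[of s t] in \<open>simp_all only: half_inner_arch less_imp_le\<close>)
      then show ?case by simp
    qed
    finally show ?thesis using uiv.emeasure_space_1 by simp
  qed
  show "surface_measure = arch_measure"
  proof (rule senergy_unique[OF S A])
    show "senergy surface_measure surface_measure + senergy arch_measure arch_measure
      \<le> 2 * senergy surface_measure arch_measure"
      unfolding SS AA SA by (simp only: mult_2)
  qed (simp_all only: SS AA ennreal_less_top)
qed

section \<open>Potentials of spherical caps\<close>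

lemma orthogonal_to_axis3:
  assumes "p \<in> S2"
  obtains f :: "real^3 \<Rightarrow> real^3" where "orthogonal_transformation f" "f (axis 3 1) = p" "f \<in> borel_measurable borel" "surj f"
    "\<And>u v. half_inner (f u) (f v) = half_inner u v" "\<And>u v. skernel (f u) (f v) = skernel u v"
    "\<And>u. f u \<in> S2 \<longleftrightarrow> u \<in> S2"
proof -
  have "norm (axis 3 1 :: real^3) = norm p" using assms by simp
  then obtain f :: "real^3 \<Rightarrow> real^3" where f: "orthogonal_transformation f" "f (axis 3 1) = p"
    using orthogonal_transformation_exists by blast
  have lin: "linear f" using f by (simp add: orthogonal_transformation)
  have m: "f \<in> borel_measurable borel"
    using lin by (intro borel_measurable_continuous_onI linear_continuous_on) (simp add: linear_conv_bounded_linear)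
  have n: "norm (f u) = norm u" for u using f(1) by (simp add: orthogonal_transformation)
  have h: "half_inner (f u) (f v) = half_inner u v" for u v
    using f(1) by (simp add: half_inner_def orthogonal_transformation_def)
  have sk: "skernel (f u) (f v) = skernel u v" for u v
  proof -
    have "dist (f u) (f v) = norm (f (u - v))" using lin by (simp add: dist_norm linear_diff)
    also have "\<dots> = dist u v" by (simp add: n dist_norm)
    finally have "dist (f u) (f v) = dist u v" .
    moreover from this have "f u = f v \<longleftrightarrow> u = v" by (metis dist_eq_0_iff)
    ultimately show ?thesis by (cases "u = v") (auto simp: skernel_neq)
  qed
  show ?thesis
    using f m h sk n orthogonal_transformation_surj[OF f(1)] by (intro that[of f]) auto
qed

lemma sets_surface_measure [measurable_cong, simp]: "sets surface_measure = sets borel"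
  and space_surface_measure [simp]: "space surface_measure = UNIV"
  by (simp_all add: surface_measure_def)

lemma nn_integral_surface:
  assumes f: "orthogonal_transformation f" and [measurable]: "f \<in> borel_measurable borel" "g \<in> borel_measurable borel"
  shows "(\<integral>\<^sup>+y. g y \<partial>surface_measure) = (\<integral>\<^sup>+s. \<integral>\<^sup>+t. g (f (arch s t)) \<partial>uiv \<partial>uiv)"
proof -
  have "(\<integral>\<^sup>+y. g y \<partial>surface_measure) = (\<integral>\<^sup>+y. g y \<partial>distr surface_measure borel f)"
    by (simp add: surface_measure_rotation_invariant[OF f])
  also have "\<dots> = (\<integral>\<^sup>+y. g (f y) \<partial>surface_measure)" by (subst nn_integral_distr) measurable
  also have "\<dots> = (\<integral>\<^sup>+s. \<integral>\<^sup>+t. g (f (arch s t)) \<partial>uiv \<partial>uiv)"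
    unfolding surface_measure_eq_arch by (intro nn_integral_arch_measure) measurable
  finally show ?thesis .
qed

lemma measurable_half_inner [measurable (raw)]:
  assumes [measurable]: "f \<in> borel_measurable M" "g \<in> borel_measurable M"
  shows "(\<lambda>x. half_inner (f x) (g x)) \<in> borel_measurable M"
  unfolding half_inner_def by measurable

lemma measurable_mean_kernel [measurable]: "(\<lambda>s. mean_kernel s r) \<in> borel_measurable borel"
  unfolding mean_kernel_def by measurable

section \<open>Functions of the height over an arbitrary centre\<close>

lemma zonal_potential:
  assumes x: "x \<in> S2" and p: "p \<in> S2" and [measurable]: "h \<in> borel_measurable borel"
  shows "(\<integral>\<^sup>+y. h (half_inner y p) * skernel x y \<partial>surface_measure)
    = (\<integral>\<^sup>+s. h s * ennreal (mean_kernel s (half_inner x p)) \<partial>uiv)"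
proof -
  obtain f :: "real^3 \<Rightarrow> real^3" where f: "orthogonal_transformation f" "f (axis 3 1) = p" and [measurable]: "f \<in> borel_measurable borel"
    and su: "surj f" and h: "\<And>u v. half_inner (f u) (f v) = half_inner u v"
    and sk: "\<And>u v. skernel (f u) (f v) = skernel u v" and S: "\<And>u. f u \<in> S2 \<longleftrightarrow> u \<in> S2"
    using orthogonal_to_axis3[OF p] by metis
  obtain x' where x': "x = f x'" using su by blast
  have x'S: "x' \<in> S2" using x x' S by simp
  have r: "half_inner x p = half_inner x' (axis 3 1)" unfolding x' f(2)[symmetric] h ..
  have hy: "half_inner (f (arch s t)) p = s" for s t unfolding f(2)[symmetric] h by (rule half_inner_arch)
  have "(\<integral>\<^sup>+y. h (half_inner y p) * skernel x y \<partial>surface_measure)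
     = (\<integral>\<^sup>+s. \<integral>\<^sup>+t. h s * skernel x' (arch s t) \<partial>uiv \<partial>uiv)"
    unfolding x' by (subst nn_integral_surface[OF f(1)]) (simp_all add: sk hy)
  also have "\<dots> = (\<integral>\<^sup>+s. h s * ennreal (mean_kernel s (half_inner x p)) \<partial>uiv)"
    unfolding r using AE_uiv_bounds
    by (intro nn_integral_cong_AE, eventually_elim) (simp add: nn_integral_cmult arch_mean[OF x'S])
  finally show ?thesis .
qed

lemma zonal_measure:
  assumes p: "p \<in> S2" and [measurable]: "h \<in> borel_measurable borel"
  shows "(\<integral>\<^sup>+y. h (half_inner y p) \<partial>surface_measure) = (\<integral>\<^sup>+s. h s \<partial>uiv)"
proof -
  obtain f :: "real^3 \<Rightarrow> real^3" where f: "orthogonal_transformation f" "f (axis 3 1) = p" and [measurable]: "f \<in> borel_measurable borel"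
    and h: "\<And>u v. half_inner (f u) (f v) = half_inner u v"
    using orthogonal_to_axis3[OF p] by metis
  have hy: "half_inner (f (arch s t)) p = s" for s t unfolding f(2)[symmetric] h by (rule half_inner_arch)
  show ?thesis
    by (subst nn_integral_surface[OF f(1)]) (simp_all add: hy uiv.emeasure_space_1[simplified])
qed

lemma emeasure_uiv_greaterThan:
  assumes "0 \<le> \<sigma>" "\<sigma> \<le> 1"
  shows "emeasure uiv {\<sigma><..} = ennreal (1 - \<sigma>)"
proof -
  have "emeasure uiv {\<sigma><..} = (\<integral>\<^sup>+s. indicator {\<sigma><..} s \<partial>uiv)"
    by (rule nn_integral_indicator[symmetric]) simp
  also have "\<dots> = (\<integral>\<^sup>+s. indicator {\<sigma><..1} s \<partial>lborel)"
    using assms by (subst nn_integral_uiv, simp, intro nn_integral_cong) (auto split: split_indicator)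
  also have "\<dots> = emeasure lborel {\<sigma><..1}" by (rule nn_integral_indicator) simp
  finally show ?thesis using assms by simp
qed

lemma emeasure_uiv_singleton: "emeasure uiv {\<sigma>} = 0"
proof -
  have "AE s in lborel. s \<noteq> \<sigma>" by (rule AE_lborel_singleton)
  then have "AE s in uiv. s \<notin> {\<sigma>}" unfolding AE_uiv by eventually_elim auto
  then show ?thesis by (subst (asm) AE_iff_measurable[OF _ refl]) auto
qed

lemma emeasure_zonal:
  assumes "p \<in> S2" and [measurable]: "S \<in> sets borel"
  shows "emeasure surface_measure {y. half_inner y p \<in> S} = emeasure uiv S"
proof -
  have "emeasure surface_measure {y. half_inner y p \<in> S} = (\<integral>\<^sup>+y. indicator {y. half_inner y p \<in> S} y \<partial>surface_measure)"
    by (rule nn_integral_indicator[symmetric]) measurable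
  also have "\<dots> = (\<integral>\<^sup>+y. indicator S (half_inner y p) \<partial>surface_measure)"
    by (simp only: indicator_def mem_Collect_eq)
  also have "\<dots> = (\<integral>\<^sup>+s. indicator S s \<partial>uiv)" by (rule zonal_measure[OF assms(1)]) simp
  also have "\<dots> = emeasure uiv S" by (rule nn_integral_indicator) simp
  finally show ?thesis .
qed

lemma emeasure_cap:
  assumes "p \<in> S2" "0 \<le> \<sigma>" "\<sigma> \<le> 1"
  shows "emeasure surface_measure {y. \<sigma> < half_inner y p} = ennreal (1 - \<sigma>)"
  using emeasure_zonal[OF assms(1), of "{\<sigma><..}"] emeasure_uiv_greaterThan[OF assms(2,3)] by simp

lemma emeasure_circle:
  assumes "p \<in> S2"
  shows "emeasure surface_measure {y. half_inner y p = \<sigma>} = 0"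
  using emeasure_zonal[OF assms, of "{\<sigma>}"] emeasure_uiv_singleton by simp

definition upot :: "(real^3) set \<Rightarrow> real^3 \<Rightarrow> ennreal" where
  "upot A x = (\<integral>\<^sup>+y. indicator A y * skernel x y \<partial>surface_measure)"

lemma skernel_half_inner:
  assumes "x \<in> S2" "p \<in> S2"
  shows "skernel x p = (if half_inner x p = 1 then \<top> else ennreal (- ln (1 - half_inner x p) / 2))"
proof (cases "x = p")
  case True
  then show ?thesis using assms by (simp add: half_inner_def norm_eq_1)
next
  case False
  then have ne: "half_inner x p < 1"
    using half_inner_bounds[OF assms] half_inner_eq_1[OF assms] by (auto simp: less_le)
  have d: "dist x p > 0" using False by simp
  have "ln ((dist x p)\<^sup>2) = ln 4 + ln (1 - half_inner x p)"
    unfolding dist_S2[OF assms] using ne by (subst ln_mult) auto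
  moreover have "ln ((dist x p)\<^sup>2) = 2 * ln (dist x p)" using d by (simp add: ln_realpow)
  moreover have "ln (4::real) = 2 * ln 2" using ln_realpow[of 2 2] by simp
  ultimately have "ln 2 - ln (dist x p) = - ln (1 - half_inner x p) / 2" by linarith
  then show ?thesis using ne False d by (simp add: skernel_neq ln_div)
qed

text \<open>The cap is a union of circles around \<open>p\<close>. Seen from a height r \<le> s, the
  circle at height s has mean kernel -(ln s + ln (1 - r)) / 2, the kernel of \<open>p\<close> plus a
  constant that depends on s only; seen from within, its potential is smaller than that of the point
  mass. Integration over s > \<sigma> collects the mass 1 - \<sigma> at \<open>p\<close>, and the
  reference point \<open>x0\<close> outside of the cap removes the constants.\<close>

lemma cap_balayage:
  assumes x: "x \<in> S2" and p: "p \<in> S2" and x0: "x0 \<in> S2" and \<sigma>: "0 \<le> \<sigma>" "\<sigma> < 1" and r0: "half_inner x0 p \<le> \<sigma>"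
  shows "upot {y. \<sigma> < half_inner y p} x + ennreal (1 - \<sigma>) * skernel x0 p
      \<le> upot {y. \<sigma> < half_inner y p} x0 + ennreal (1 - \<sigma>) * skernel x p"
    and "half_inner x p \<le> \<sigma> \<Longrightarrow> upot {y. \<sigma> < half_inner y p} x + ennreal (1 - \<sigma>) * skernel x0 p
      = upot {y. \<sigma> < half_inner y p} x0 + ennreal (1 - \<sigma>) * skernel x p"
proof -
  let ?C = "{y. \<sigma> < half_inner y p}" and ?I = "indicator {\<sigma><..} :: real \<Rightarrow> ennreal"
  \<comment> \<open>The point mass is distributed over the same heights, which reduces both claims
    to a comparison for each single circle.\<close>
  have U: "upot ?C z + ennreal (1 - \<sigma>) * k = (\<integral>\<^sup>+s. ?I s * (ennreal (mean_kernel s (half_inner z p)) + k) \<partial>uiv)"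
    if "z \<in> S2" for z k
  proof -
    have "upot ?C z = (\<integral>\<^sup>+s. ?I s * ennreal (mean_kernel s (half_inner z p)) \<partial>uiv)"
      unfolding upot_def using zonal_potential[OF that p, of ?I]
      by (simp add: indicator_def cong: nn_integral_cong)
    moreover have "ennreal (1 - \<sigma>) * k = (\<integral>\<^sup>+s. ?I s * k \<partial>uiv)"
      using \<sigma> by (subst nn_integral_multc) (auto simp: emeasure_uiv_greaterThan)
    ultimately show ?thesis
      by (simp add: distrib_left nn_integral_add)
  qed
  define r where "r = half_inner x p"
  define q where "q = half_inner x0 p"
  have r: "0 \<le> r" "r \<le> 1" and q: "0 \<le> q" "q \<le> \<sigma>"
    using half_inner_bounds[OF x p] half_inner_bounds[OF x0 p] r0 by (auto simp: r_def q_def)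
  have kq: "skernel x0 p = ennreal (- ln (1 - q) / 2)"
    using q \<sigma> by (simp add: skernel_half_inner[OF x0 p] flip: q_def)
  have lq: "0 \<le> - ln (1 - q) / 2" using q \<sigma> by (simp add: ln_le_zero_iff)
  have mq: "mean_kernel s q = - (ln s + ln (1 - q)) / 2" if "\<sigma> < s" "0 < s" for s
    using that q \<sigma> by (simp add: mean_kernel_def max_absorb1 min_absorb2 ln_mult)
  have out: "ennreal (mean_kernel s r) + skernel x0 p = ennreal (mean_kernel s q) + skernel x p"
    if "\<sigma> < s" "0 < s" "s < 1" "r \<le> s" for s
  proof -
    have "mean_kernel s r = - (ln s + ln (1 - r)) / 2"
      using that r by (simp add: mean_kernel_def max_absorb1 min_absorb2 ln_mult)
    moreover have "skernel x p = ennreal (- ln (1 - r) / 2)"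
      using that by (simp add: skernel_half_inner[OF x p] flip: r_def)
    moreover have "0 \<le> - ln (1 - r) / 2" using that r by (simp add: ln_le_zero_iff)
    moreover have "0 \<le> mean_kernel s r" "0 \<le> mean_kernel s q"
      using that r q \<sigma> by (auto intro!: mean_kernel_nonneg)
    ultimately show ?thesis
      using that lq unfolding kq by (simp add: ennreal_plus[symmetric] mq add_divide_distrib diff_divide_distrib del: ennreal_plus)
  qed
  have ins: "ennreal (mean_kernel s r) + skernel x0 p \<le> ennreal (mean_kernel s q) + skernel x p"
    if "\<sigma> < s" "0 < s" "s < 1" "s < r" for s
  proof (cases "r = 1")
    case True
    then show ?thesis by (simp add: skernel_half_inner[OF x p] flip: r_def)
  next
    case False
    then have r1: "r < 1" using r by simp
    have m: "mean_kernel s r = - (ln r + ln (1 - s)) / 2"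
      using that r by (simp add: mean_kernel_def max_absorb2 min_absorb1 ln_mult)
    have k: "skernel x p = ennreal (- ln (1 - r) / 2)"
      using False by (simp add: skernel_half_inner[OF x p] flip: r_def)
    have arith: "A + B \<le> C + D \<Longrightarrow> - (C + D) / 2 + - E / 2 \<le> - (A + E) / 2 + - B / 2" for A B C D E :: real
      by (simp add: field_simps)
    have "ln s + ln (1 - r) \<le> ln r + ln (1 - s)" using that r1 by (intro add_mono) auto
    then have "mean_kernel s r + (- ln (1 - q) / 2) \<le> mean_kernel s q + (- ln (1 - r) / 2)"
      unfolding m mq[OF that(1,2)] by (rule arith)
    moreover have "0 \<le> - ln (1 - r) / 2" using that r1 r by (simp add: ln_le_zero_iff)
    moreover have "0 \<le> mean_kernel s r" "0 \<le> mean_kernel s q"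
      using that r q \<sigma> by (auto intro!: mean_kernel_nonneg)
    ultimately show ?thesis
      using lq unfolding kq k by (simp add: ennreal_plus[symmetric] del: ennreal_plus)
  qed
  show "upot ?C x + ennreal (1 - \<sigma>) * skernel x0 p \<le> upot ?C x0 + ennreal (1 - \<sigma>) * skernel x p"
    unfolding U[OF x] U[OF x0] r_def[symmetric] q_def[symmetric] using AE_uiv_bounds
  proof (intro nn_integral_mono_AE, eventually_elim)
    case (elim s)
    then show ?case using out[of s] ins[of s] by (cases "r \<le> s") (auto split: split_indicator)
  qed
  show "upot ?C x + ennreal (1 - \<sigma>) * skernel x0 p = upot ?C x0 + ennreal (1 - \<sigma>) * skernel x p" if "half_inner x p \<le> \<sigma>"
    unfolding U[OF x] U[OF x0] r_def[symmetric] q_def[symmetric] using AE_uiv_bounds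
  proof (intro nn_integral_cong_AE, eventually_elim)
    case (elim s)
    then show ?case using out[of s] that by (auto simp: r_def split: split_indicator)
  qed
qed

section \<open>Reduction to potential-theoretic conditions\<close>

lemma sets_measure_plus [simp]: "sets (measure_plus M N) = sets M"
  by (simp add: measure_plus_def)

lemma nn_integral_measure_plus:
  assumes MN: "sets M = sets N" and f: "f \<in> borel_measurable M"
  shows "(\<integral>\<^sup>+x. f x \<partial>measure_plus M N) = (\<integral>\<^sup>+x. f x \<partial>M) + (\<integral>\<^sup>+x. f x \<partial>N)"
proof -
  have sp: "space M = space N" using MN by (rule sets_eq_imp_space_eq)
  have s [measurable_cong]: "sets (measure_plus M N) = sets M" and sp': "space (measure_plus M N) = space M"
    by (simp_all add: measure_plus_def)
  note [measurable_cong] = MN[symmetric]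
  show ?thesis using f
  proof (induction rule: borel_measurable_induct)
    case (cong f g)
    have "integral\<^sup>N K f = integral\<^sup>N K g" if "space K = space M" for K
      by (rule nn_integral_cong) (use cong(3) that in simp)
    from this[OF sp'] this[OF refl] this[OF sp[symmetric]] show ?case using cong(4) by (simp only:)
  next
    case (set A)
    have "A \<in> sets (measure_plus M N)" unfolding s by (rule set)
    moreover have "A \<in> sets N" unfolding MN[symmetric] by (rule set)
    ultimately show ?case using set emeasure_measure_plus[OF MN set] by (simp only: nn_integral_indicator)
  next
    case (mult u c)
    then show ?case by (simp add: nn_integral_cmult distrib_left)
  next
    case (add u v)
    then show ?case by (simp add: nn_integral_add ac_simps)
  next
    case (seq U)
    have [measurable]: "U i \<in> borel_measurable M" for i by fact
    have "(\<integral>\<^sup>+x. (SUP i. U i x) \<partial>measure_plus M N) = (SUP i. (\<integral>\<^sup>+x. U i x \<partial>M) + (\<integral>\<^sup>+x. U i x \<partial>N))"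
      using seq by (subst nn_integral_monotone_convergence_SUP) auto
    also have "\<dots> = (SUP i. \<integral>\<^sup>+x. U i x \<partial>M) + (SUP i. \<integral>\<^sup>+x. U i x \<partial>N)"
      using seq by (intro ennreal_SUP_add) (auto simp: incseq_def le_fun_def intro!: nn_integral_mono)
    also have "\<dots> = (\<integral>\<^sup>+x. (SUP i. U i x) \<partial>M) + (\<integral>\<^sup>+x. (SUP i. U i x) \<partial>N)"
      using seq by (subst (1 2) nn_integral_monotone_convergence_SUP) auto
    finally show ?case by (simp add: image_comp)
  qed
qed

lemma measurable_log_potential:
  assumes "sigma_finite_measure \<tau>" and [measurable_cong]: "sets \<tau> = sets (borel :: (real^3) measure)"
  shows "log_potential \<tau> \<in> borel_measurable borel"
proof -
  interpret sigma_finite_measure \<tau> by fact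
  have [measurable]: "(\<lambda>p :: (real^3) \<times> (real^3). log_kernel (fst p) (snd p)) \<in> borel_measurable (borel \<Otimes>\<^sub>M \<tau>)"
    using borel_measurable_log_kernel[where 'a = "real^3"]
    by (simp add: split_def cong: measurable_cong_sets sets_pair_measure_cong)
  show ?thesis unfolding log_potential_def[abs_def] ereal_integral_def by measurable
qed

lemma log_kernel_ge:
  assumes "x \<in> S2" "y \<in> S2"
  shows "0 \<le> log_kernel x y + ereal (ln 2)"
proof (cases "x = y")
  case False
  have "dist x y \<le> dist x 0 + dist 0 y" by (rule dist_triangle)
  then have "dist x y \<le> 2" using assms by (auto simp: dist_commute)
  then show ?thesis using False by (auto simp: log_kernel_def ln_div)
qed (simp add: log_kernel_def)

text \<open>The potential of a sum or a multiple of measures is computed for the positive and the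
  negative part separately; this relation reassembles the parts into the nonnegative
  potential.\<close>

lemma potential_parts:
  assumes \<nu>: "prob_on S2 \<nu>" and x: "x \<in> S2"
  shows "(\<integral>\<^sup>+y. e2ennreal (- log_kernel x y) \<partial>\<nu>) < \<top>"
    and "enn2ereal (\<integral>\<^sup>+y. e2ennreal (log_kernel x y) \<partial>\<nu>) + ereal (ln 2)
      = enn2ereal (spot \<nu> x) + enn2ereal (\<integral>\<^sup>+y. e2ennreal (- log_kernel x y) \<partial>\<nu>)"
proof -
  note [measurable_cong] = prob_on_S2(2)[OF \<nu>]
  interpret prob_space \<nu> by (rule prob_on_S2[OF \<nu>])
  have [measurable]: "(\<lambda>y. log_kernel x y) \<in> borel_measurable \<nu>" unfolding log_kernel_def by measurable
  have ae: "AE y in \<nu>. 0 \<le> log_kernel x y + ereal (ln 2)"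
    using prob_on_S2(4)[OF \<nu>] by eventually_elim (rule log_kernel_ge[OF x])
  have le: "AE y in \<nu>. e2ennreal (- log_kernel x y) \<le> ennreal (ln 2)"
    using ae
  proof eventually_elim
    case (elim y)
    then have "- log_kernel x y \<le> ereal (ln 2)" by (cases "log_kernel x y") auto
    then show ?case by (metis e2ennreal_ereal e2ennreal_mono)
  qed
  have "(\<integral>\<^sup>+y. e2ennreal (- log_kernel x y) \<partial>\<nu>) \<le> (\<integral>\<^sup>+y. ennreal (ln 2) \<partial>\<nu>)" by (rule nn_integral_mono_AE[OF le])
  then show fin: "(\<integral>\<^sup>+y. e2ennreal (- log_kernel x y) \<partial>\<nu>) < \<top>"
    by (simp add: emeasure_space_1 le_less_trans[OF _ ennreal_less_top])
  have "(\<integral>\<^sup>+y. e2ennreal (log_kernel x y) \<partial>\<nu>) + ennreal (ln 2)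
      = (\<integral>\<^sup>+y. e2ennreal (log_kernel x y) + ennreal (ln 2) \<partial>\<nu>)"
    by (simp add: nn_integral_add emeasure_space_1)
  also have "\<dots> = (\<integral>\<^sup>+y. skernel x y + e2ennreal (- log_kernel x y) \<partial>\<nu>)"
    using ae
  proof (intro nn_integral_cong_AE, eventually_elim)
    case (elim y)
    show ?case
    proof (cases "log_kernel x y")
      case (real k)
      then have "0 \<le> k + ln 2" using elim by simp
      then show ?thesis using real unfolding skernel_def
        by (cases "0 \<le> k") (auto simp: ennreal_plus[symmetric] ennreal_neg simp del: ennreal_plus)
    qed (use elim in \<open>auto simp: skernel_def\<close>)
  qed
  also have "\<dots> = spot \<nu> x + (\<integral>\<^sup>+y. e2ennreal (- log_kernel x y) \<partial>\<nu>)"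
    unfolding spot_def by (rule nn_integral_add) auto
  finally show "enn2ereal (\<integral>\<^sup>+y. e2ennreal (log_kernel x y) \<partial>\<nu>) + ereal (ln 2)
      = enn2ereal (spot \<nu> x) + enn2ereal (\<integral>\<^sup>+y. e2ennreal (- log_kernel x y) \<partial>\<nu>)"
    by (metis enn2ereal_ennreal ln_2_less_1 ln_ge_zero one_le_numeral plus_ennreal.rep_eq)
qed

text \<open>The negative part \<open>v\<close> is finite, so the difference is meaningful even if
  \<open>u\<close> and \<open>s\<close> are infinite.\<close>

lemma ereal_scale_shift:
  assumes "enn2ereal u + ereal l = enn2ereal s + enn2ereal v" "v < \<top>" "0 < t"
  shows "enn2ereal (ennreal t * u) - enn2ereal (ennreal t * v) + ereal (t * l) = enn2ereal (ennreal t * s)"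
proof (cases v)
  case (real v')
  show ?thesis
  proof (cases u)
    case (real u')
    then obtain s' where s': "s = ennreal s'" "0 \<le> s'" "u' + l = s' + v'"
      using assms(1) \<open>v = ennreal v'\<close> \<open>0 \<le> v'\<close> by (cases s) (auto simp: enn2ereal_ennreal)
    have "t * u' - t * v' + t * l = t * s'" using s'(3) by (metis add.commute add_diff_cancel_right' diff_add_eq distrib_left right_diff_distrib')
    then show ?thesis using real s' \<open>v = ennreal v'\<close> \<open>0 \<le> v'\<close> assms(3)
      by (simp add: enn2ereal_ennreal ennreal_mult[symmetric])
  next
    case top
    then have "s = \<top>" using assms(1) real by (cases s) (auto simp: enn2ereal_ennreal)
    then show ?thesis using top real assms(3)
      by (simp add: enn2ereal_ennreal ennreal_mult[symmetric] ennreal_mult_top)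
  qed
qed (use assms in simp)

lemma log_potential_scale:
  assumes \<nu>: "prob_on S2 \<nu>" and x: "x \<in> S2" and t: "0 < t"
  shows "log_potential (scale_measure (ennreal t) \<nu>) x + ereal (t * ln 2) = enn2ereal (ennreal t * spot \<nu> x)"
proof -
  note [measurable_cong] = prob_on_S2(2)[OF \<nu>]
  have [measurable]: "(\<lambda>y. log_kernel x y) \<in> borel_measurable \<nu>" unfolding log_kernel_def by measurable
  show ?thesis
    unfolding log_potential_def ereal_integral_def
    using ereal_scale_shift[OF potential_parts(2)[OF \<nu> x] potential_parts(1)[OF \<nu> x] t]
    by (simp add: nn_integral_scale_measure)
qed

lemma log_potential_two_points:
  assumes p: "p1 \<in> S2" "p2 \<in> S2" and x: "x \<in> S2" and a: "0 < a"
  shows "log_potential (measure_plus (scale_measure (ennreal a) (return borel p1)) (scale_measure (ennreal a) (return borel p2))) x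
     + ereal (a * (ln 2 + ln 2)) = enn2ereal (ennreal a * (skernel x p1 + skernel x p2))"
proof -
  have [measurable]: "(\<lambda>y. log_kernel x y) \<in> borel_measurable borel" unfolding log_kernel_def by measurable
  have ret: "prob_on S2 (return borel p)" if "p \<in> S2" for p :: "real^3"
  proof -
    interpret prob_space "return borel p" by (rule prob_space_return) simp
    show ?thesis using that prob_space_axioms by (simp add: prob_on_def)
  qed
  let ?u = "\<lambda>p. e2ennreal (log_kernel x p)" and ?v = "\<lambda>p. e2ennreal (- log_kernel x p)"
  have pt: "enn2ereal (?u p) + ereal (ln 2) = enn2ereal (skernel x p) + enn2ereal (?v p)" "?v p < \<top>" if "p \<in> S2" for p
    using potential_parts[OF ret[OF that] x] by (simp_all add: nn_integral_return spot_def)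
  have "enn2ereal (?u p1 + ?u p2) + ereal (ln 2 + ln 2)
      = (enn2ereal (?u p1) + ereal (ln 2)) + (enn2ereal (?u p2) + ereal (ln 2))"
    by (simp only: plus_ennreal.rep_eq plus_ereal.simps(1)[symmetric] ac_simps)
  also have "\<dots> = enn2ereal (skernel x p1 + skernel x p2) + enn2ereal (?v p1 + ?v p2)"
    unfolding pt(1)[OF p(1)] pt(1)[OF p(2)] by (simp only: plus_ennreal.rep_eq ac_simps)
  finally have sum: "enn2ereal (?u p1 + ?u p2) + ereal (ln 2 + ln 2)
      = enn2ereal (skernel x p1 + skernel x p2) + enn2ereal (?v p1 + ?v p2)" .
  have I: "(\<integral>\<^sup>+y. h y \<partial>measure_plus (scale_measure (ennreal a) (return borel p1)) (scale_measure (ennreal a) (return borel p2)))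
      = ennreal a * (h p1 + h p2)" if [measurable]: "h \<in> borel_measurable borel" for h
    by (subst nn_integral_measure_plus)
      (simp_all add: nn_integral_scale_measure nn_integral_return distrib_left cong: measurable_cong_sets)
  have "?v p1 + ?v p2 < \<top>" using pt(2) p by simp
  from ereal_scale_shift[OF sum this a] show ?thesis
    unfolding log_potential_def ereal_integral_def by (subst (1 2) I) simp_all
qed

text \<open>The open cone over \<open>U\<close> meets the ball in a nonempty open set. This is used
  to compute the support of a uniform distribution.\<close>

lemma surface_measure_open_pos:
  assumes U: "open U" and x: "x \<in> U" "x \<in> S2"
  shows "emeasure surface_measure U > 0"
proof -
  let ?g = "\<lambda>y :: real^3. y /\<^sub>R norm y"
  have c: "continuous_on (- {0}) ?g" by (intro continuous_intros) auto
  have op: "open ((- {0}) \<inter> ?g -` U)" by (rule continuous_open_preimage[OF c _ U]) auto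
  have m: "(1/2) *\<^sub>R x \<in> ball 0 1 \<inter> ((- {0}) \<inter> ?g -` U)" using x by auto
  have "\<not> negligible (ball 0 1 \<inter> ((- {0}) \<inter> ?g -` U))"
    by (intro open_not_negligible open_Int open_ball op) (use m in blast)
  moreover have "ball 0 1 \<inter> ((- {0}) \<inter> ?g -` U) \<in> sets borel"
    by (rule borel_open[OF open_Int[OF open_ball op]])
  ultimately have pos: "emeasure lborel (ball 0 1 \<inter> ((- {0}) \<inter> ?g -` U)) \<noteq> 0"
    by (auto simp: negligible_iff_null_sets null_sets_def)
  have [measurable]: "U \<in> sets borel" using U by simp
  have mU: "?g -` U \<in> sets borel" using measurable_sets[OF borel_measurable_radial, of U] by simp
  have le: "emeasure lborel (ball 0 1 \<inter> ((- {0}) \<inter> ?g -` U)) \<le> emeasure lborel (ball 0 1 \<inter> ?g -` U)"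
    using mU by (intro emeasure_mono) auto
  have "u \<noteq> 0 \<Longrightarrow> u \<le> v \<Longrightarrow> v \<noteq> 0" for u v :: ennreal by auto
  from this[OF pos le] have "emeasure lborel (ball 0 1 \<inter> ?g -` U) \<noteq> 0" .
  moreover have "emeasure lborel (ball (0 :: real^3) 1) < \<top>" using emeasure_lborel_ball_finite[of "0 :: real^3" 1] by simp
  ultimately have "emeasure (uniform_measure lborel (ball 0 1)) (?g -` U) > 0"
    using mU by (simp add: ennreal_divide_eq_0_iff zero_less_iff_neq_zero)
  then show ?thesis unfolding surface_measure_def by (subst emeasure_distr) auto
qed

lemma prob_on_uniform_surface:
  assumes [measurable]: "A \<in> sets borel" and A: "A \<subseteq> S2" "emeasure surface_measure A \<noteq> 0"
  shows "prob_on S2 (uniform_measure surface_measure A)"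
proof -
  interpret S: prob_space surface_measure by (rule prob_on_S2[OF surface_measure_prob_on])
  have fin: "emeasure surface_measure A \<noteq> \<infinity>" by (simp add: S.emeasure_eq_measure)
  interpret prob_space "uniform_measure surface_measure A" using A fin by (intro prob_space_uniform_measure)
  have "emeasure (uniform_measure surface_measure A) S2 = emeasure surface_measure A / emeasure surface_measure A"
    using A by (simp add: Int_absorb2)
  also have "\<dots> = 1"
  proof (rule ennreal_divide_self)
    show "emeasure surface_measure A < \<top>" by (simp add: S.emeasure_eq_measure)
  qed (rule A)
  finally show ?thesis using prob_space_axioms by (simp add: prob_on_def)
qed

lemma spot_uniform:
  assumes [measurable]: "A \<in> sets borel"
  shows "spot (uniform_measure surface_measure A) x = upot A x / emeasure surface_measure A"
proof -
  have "spot (uniform_measure surface_measure A) x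
      = (\<integral>\<^sup>+y. skernel x y * indicator A y \<partial>surface_measure) / emeasure surface_measure A"
    unfolding spot_def by (rule nn_integral_uniform_measure) measurable
  then show ?thesis by (simp add: upot_def mult.commute)
qed

lemma ennreal_divide_le_aux:
  fixes u v w z :: ennreal
  assumes "u + w \<le> v + z" "0 < c"
  shows "u / ennreal c + w / ennreal c \<le> v / ennreal c + z / ennreal c"
  using divide_right_mono_ennreal[OF assms(1)] by (simp add: add_divide_distrib_ennreal)

lemma divide_ennreal_less_top: "x < \<top> \<Longrightarrow> 0 < c \<Longrightarrow> x / ennreal c < \<top>"
  by (cases x) (auto simp: divide_ennreal)

text \<open>The function \<open>H\<close> separates D (negative) from its complement (positive), up
  to the null set where it vanishes. As \<open>upot N x + upot P x = 1/2\<close> on the sphere, a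
  sweeping relation for one region is a relation for the other with reversed sign: \<open>I\<close>
  and \<open>I'\<close> become Frostman's conditions for the uniform distribution on
  \<open>N\<close> in the field of the two charges, \<open>II\<close> and \<open>II'\<close> those
  for the uniform distribution on \<open>P\<close> in the field of the swept measure. The points
  \<open>x0\<close> and \<open>x1\<close> carry the constants, and the finite set \<open>Z\<close>
  leaves room for the point at infinity of the plane.\<close>

lemma reduction:
  fixes a :: real and p1 p2 x0 x1 :: "real^3" and V :: "real \<Rightarrow> real" and H :: "real^3 \<Rightarrow> real" and \<rho> :: "real measure"
    and W :: real and \<sigma> \<sigma>' \<rho>' :: "(real^3) measure" and D N P :: "(real^3) set"
  defines "W \<equiv> 1 / (1 + 2 * a)"
    and "\<sigma> \<equiv> measure_plus (scale_measure (ennreal a) (return borel p1)) (scale_measure (ennreal a) (return borel p2))"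
    and "D \<equiv> measure_support (sphere_equilibrium \<sigma>)"
    and "\<sigma>' \<equiv> scale_measure (ennreal (1 / (2 * a))) (distr (line_equilibrium V) borel (\<lambda>x. inv_stereo (Some (of_real x))))"
    and "N \<equiv> {x \<in> S2. H x < 0}" and "P \<equiv> {x \<in> S2. H x > 0}"
    and "\<rho>' \<equiv> distr \<rho> borel line_pt"
  assumes a: "a > 0" and p: "p1 \<in> S2" "p2 \<in> S2" and x0: "x0 \<in> S2" "x0 \<noteq> p1" "x0 \<noteq> p2" and x1: "x1 \<in> S2"
    and H: "continuous_on UNIV H" and H0: "emeasure surface_measure {x \<in> S2. H x = 0} = 0"
    and HN: "emeasure surface_measure N = ennreal W"
    and Z: "finite Z"
    and \<rho>: "prob_on UNIV \<rho>" and lin: "line_equilibrium V = \<rho>" and fin1: "spot \<rho>' x1 < \<top>"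
    and I: "\<And>x. x \<in> S2 \<Longrightarrow> x \<notin> Z \<Longrightarrow> upot P x + ennreal (a * W) * (skernel x0 p1 + skernel x0 p2)
        \<le> upot P x0 + ennreal (a * W) * (skernel x p1 + skernel x p2)"
    and I': "\<And>x. x \<in> S2 \<Longrightarrow> x \<notin> Z \<Longrightarrow> H x < 0 \<Longrightarrow> upot P x + ennreal (a * W) * (skernel x0 p1 + skernel x0 p2)
        = upot P x0 + ennreal (a * W) * (skernel x p1 + skernel x p2)"
    and II: "\<And>x. x \<in> S2 \<Longrightarrow> x \<notin> Z \<Longrightarrow> ennreal W * spot \<rho>' x1 + upot N x \<le> ennreal W * spot \<rho>' x + upot N x1"
    and II': "\<And>x. x \<in> S2 \<Longrightarrow> x \<notin> Z \<Longrightarrow> H x > 0 \<Longrightarrow> ennreal W * spot \<rho>' x1 + upot N x = ennreal W * spot \<rho>' x + upot N x1"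
  shows "sphere_equilibrium \<sigma>' = uniform_measure surface_measure (closure (S2 - D))
    \<and> is_arg_min (weighted_energy (log_potential \<sigma>')) (prob_on S2) (uniform_measure surface_measure (closure (S2 - D)))"
proof -
  have W: "0 < W" "W < 1" "1 - W = 2 * a * W" using a by (simp_all add: W_def field_simps)
  note S = surface_measure_prob_on
  interpret S: prob_space surface_measure by (rule prob_on_S2[OF S])
  have [measurable]: "H \<in> borel_measurable borel" using H by (rule borel_measurable_continuous_onI)
  have [measurable]: "N \<in> sets borel" "P \<in> sets borel" unfolding N_def P_def by measurable
  have aeH: "AE x in surface_measure. x \<in> N \<and> x \<notin> P \<or> x \<in> P \<and> x \<notin> N"
  proof -
    have "AE x in surface_measure. x \<notin> {x \<in> S2. H x = 0}"
      by (intro AE_not_in null_setsI H0) measurable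
    with prob_on_S2(4)[OF S] show ?thesis by eventually_elim (auto simp: N_def P_def)
  qed
  have half: "upot N x + upot P x = ennreal (1 / 2)" if "x \<in> S2" for x
  proof -
    have "upot N x + upot P x = (\<integral>\<^sup>+y. indicator N y * skernel x y + indicator P y * skernel x y \<partial>surface_measure)"
      unfolding upot_def by (rule nn_integral_add[symmetric]) measurable
    also have "\<dots> = spot surface_measure x"
      unfolding spot_def using aeH by (intro nn_integral_cong_AE) (auto elim!: eventually_mono)
    finally show ?thesis using spot_surface[OF that] by simp
  qed
  have fin: "upot N x < \<top>" "upot P x < \<top>" if "x \<in> S2" for x
    using half[OF that] by (metis ennreal_add_eq_top ennreal_neq_top less_top)+
  have HP: "emeasure surface_measure P = ennreal (2 * a * W)"
  proof -
    have "emeasure surface_measure P = emeasure surface_measure (UNIV - N)"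
      using aeH by (intro emeasure_eq_AE) (auto elim: eventually_mono)
    also have "\<dots> = 1 - ennreal W"
      using emeasure_compl[of N surface_measure] HN S.emeasure_space_1 by simp
    also have "\<dots> = ennreal (2 * a * W)" using W by (simp add: ennreal_minus flip: ennreal_1)
    finally show ?thesis .
  qed

  let ?k = "\<lambda>x. skernel x p1 + skernel x p2"
  have k0: "?k x0 < \<top>" using x0 by (simp add: skernel_neq)
  let ?\<mu>N = "uniform_measure surface_measure N"
  have \<mu>N: "prob_on S2 ?\<mu>N"
    using W HN by (intro prob_on_uniform_surface) (auto simp: N_def)
  have \<sigma>m: "log_potential \<sigma> \<in> borel_measurable borel"
  proof -
    have s: "sets \<sigma> = sets borel" by (simp add: \<sigma>_def)
    have "finite_measure \<sigma>"
    proof (rule finite_measureI)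
      have "emeasure \<sigma> UNIV = ennreal a + ennreal a"
        unfolding \<sigma>_def by (subst emeasure_measure_plus) auto
      moreover have "space \<sigma> = UNIV" using sets_eq_imp_space_eq[OF s] by simp
      ultimately show "emeasure \<sigma> (space \<sigma>) \<noteq> \<infinity>" by simp
    qed
    then show ?thesis using s by (intro measurable_log_potential finite_measure.sigma_finite_measure)
  qed
  have \<sigma>pot: "log_potential \<sigma> x + ereal (a * (ln 2 + ln 2)) = enn2ereal (ennreal a * ?k x)" if "x \<in> S2" for x
    unfolding \<sigma>_def by (rule log_potential_two_points[OF p that a])
  let ?F = "upot N x0 / ennreal W + ennreal a * ?k x0"
  have Ffin: "?F < \<top>"
    using divide_ennreal_less_top[OF fin(1)[OF x0(1)] W(1)] k0 by (simp add: ennreal_mult_less_top)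
  have aW: "ennreal (a * W) * y / ennreal W = ennreal a * y" for y
    using W a by (cases y)
      (auto simp: ennreal_mult_top ennreal_top_divide divide_ennreal ennreal_mult[symmetric])
  have geN: "?F \<le> upot N x / ennreal W + ennreal a * ?k x" if "x \<in> S2" "x \<notin> Z" for x
  proof -
    have "upot N x + (upot P x + ennreal (a * W) * ?k x0) \<le> upot N x + (upot P x0 + ennreal (a * W) * ?k x)"
      using I[OF that] by (rule add_left_mono)
    then have "upot P x0 + (upot N x0 + ennreal (a * W) * ?k x0) \<le> upot P x0 + (upot N x + ennreal (a * W) * ?k x)"
      using half[OF that(1)] half[OF x0(1)] by (metis (no_types, lifting) add.assoc add.commute)
    then have "upot N x0 + ennreal (a * W) * ?k x0 \<le> upot N x + ennreal (a * W) * ?k x"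
      using fin[OF x0(1)] by (auto simp: ennreal_add_left_cancel_le)
    from ennreal_divide_le_aux[OF this W(1)] show ?thesis by (simp only: aW)
  qed
  have eqN: "?F = upot N x / ennreal W + ennreal a * ?k x" if "x \<in> S2" "x \<notin> Z" "H x < 0" for x
  proof (rule antisym[OF geN[OF that(1,2)]])
    have "upot N x + (upot P x + ennreal (a * W) * ?k x0) = upot N x + (upot P x0 + ennreal (a * W) * ?k x)"
      using I'[OF that] by simp
    then have "upot P x0 + (upot N x + ennreal (a * W) * ?k x) \<le> upot P x0 + (upot N x0 + ennreal (a * W) * ?k x0)"
      using half[OF that(1)] half[OF x0(1)] by (metis (no_types, lifting) add.assoc add.commute order_refl)
    then have "upot N x + ennreal (a * W) * ?k x \<le> upot N x0 + ennreal (a * W) * ?k x0"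
      using fin[OF x0(1)] by (auto simp: ennreal_add_left_cancel_le)
    from ennreal_divide_le_aux[OF this W(1)] show "upot N x / ennreal W + ennreal a * ?k x \<le> ?F" by (simp only: aW)
  qed
  have nz: "emeasure surface_measure {z} = 0" for z
  proof (rule emeasure_singleton_eq_0)
    have "senergy surface_measure surface_measure = (\<integral>\<^sup>+x. ennreal (1 / 2) \<partial>surface_measure)"
      unfolding senergy_spot using prob_on_S2(4)[OF S] spot_surface
      by (intro nn_integral_cong_AE) (auto elim: eventually_mono)
    also have "\<dots> = ennreal (1 / 2)" using S.emeasure_space_1 by simp
    finally show "senergy surface_measure surface_measure < \<top>" by (simp only: ennreal_less_top)
  qed simp
  have aeZ: "AE x in surface_measure. x \<notin> Z"
  proof -
    have "AE x in surface_measure. x \<noteq> z" for z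
      using nz[of z] by (intro AE_I[of _ _ "{z}"]) auto
    then have "AE x in surface_measure. \<forall>z\<in>Z. x \<noteq> z" using Z by (simp add: AE_finite_all)
    then show ?thesis by eventually_elim auto
  qed
  have unifAE: "AE x in uniform_measure surface_measure A. x \<in> A \<and> x \<notin> Z" if [measurable]: "A \<in> sets borel" for A
    using aeZ by (intro AE_uniform_measureI) (auto elim: eventually_mono)
  have eqlN: "sphere_equilibrium \<sigma> = ?\<mu>N"
  proof (rule sphere_equilibrium_eqI(2)[OF \<mu>N \<sigma>m _ Z])
    show "0 \<le> log_potential \<sigma> x + ereal (a * (ln 2 + ln 2))" if "x \<in> S2" for x
      unfolding \<sigma>pot[OF that] by simp
    show "ennreal (enn2real ?F) \<le> spot ?\<mu>N x + e2ennreal (log_potential \<sigma> x + ereal (a * (ln 2 + ln 2)))"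
      if "x \<in> S2" "x \<notin> Z" for x
      using geN[OF that] Ffin unfolding \<sigma>pot[OF that(1)] by (simp add: spot_uniform HN less_top)
    show "AE x in ?\<mu>N. spot ?\<mu>N x + e2ennreal (log_potential \<sigma> x + ereal (a * (ln 2 + ln 2))) = ennreal (enn2real ?F)"
      using unifAE[OF \<open>N \<in> sets borel\<close>]
    proof eventually_elim
      case (elim x)
      then have x: "x \<in> S2" "H x < 0" "x \<notin> Z" by (auto simp: N_def)
      show ?case using eqN[OF x(1,3,2)] Ffin unfolding \<sigma>pot[OF x(1)] by (simp add: spot_uniform HN less_top)
    qed
  qed

  \<comment> \<open>The support contains the part of the sphere with \<open>H < 0\<close> and avoids
    the part with \<open>H > 0\<close>; points with \<open>H x = 0\<close> remain undecided, but
    they are a null set.\<close>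
  have D: "S2 - D \<subseteq> {x. 0 \<le> H x}" "P \<subseteq> S2 - D"
  proof -
    show "S2 - D \<subseteq> {x. 0 \<le> H x}"
    proof (rule ccontr)
      assume "\<not> S2 - D \<subseteq> {x. 0 \<le> H x}"
      then obtain x where "x \<in> S2 - D" "\<not> 0 \<le> H x" by blast
      then have x: "x \<in> S2" "x \<notin> D" "H x < 0" by simp_all
      have "emeasure ?\<mu>N U > 0" if U: "open U" "x \<in> U" for U
      proof -
        let ?V = "U \<inter> {x. H x < 0}"
        have "open {x. H x < 0}" using H by (intro open_Collect_less) auto
        then have V: "open ?V" using U by auto
        then have "0 < emeasure surface_measure ?V" using U x by (intro surface_measure_open_pos[of _ x]) auto
        also have "emeasure surface_measure ?V = emeasure surface_measure (N \<inter> U)"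
          using prob_on_S2(4)[OF S] V U
          by (intro emeasure_eq_AE) (auto simp: N_def borel_open elim!: eventually_mono)
        finally show ?thesis using U W HN
          by (simp add: ennreal_zero_less_divide borel_open)
      qed
      then have "x \<in> D" by (auto simp: D_def eqlN measure_support_def)
      then show False using x by simp
    qed
    show "P \<subseteq> S2 - D"
    proof
      fix x assume x: "x \<in> P"
      let ?U = "{x. 0 < H x}"
      have o: "open ?U" using H by (intro open_Collect_less) auto
      have "N \<inter> ?U = {}" by (auto simp: N_def)
      then have "emeasure ?\<mu>N ?U = 0" using o by (simp add: borel_open)
      then have "x \<notin> D" using o x by (force simp: D_def eqlN measure_support_def P_def)
      then show "x \<in> S2 - D" using x by (auto simp: P_def)
    qed
  qed
  let ?D' = "closure (S2 - D)"
  have D': "?D' \<subseteq> {x \<in> S2. 0 \<le> H x}" "P \<subseteq> ?D'"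
  proof -
    have "closed {x. 0 \<le> H x}" using H by (intro closed_Collect_le) auto
    then have "closed (S2 \<inter> {x. 0 \<le> H x})" by (intro closed_Int) auto
    then have "?D' \<subseteq> S2 \<inter> {x. 0 \<le> H x}" using D(1) by (intro closure_minimal) auto
    then show "?D' \<subseteq> {x \<in> S2. 0 \<le> H x}" by auto
    show "P \<subseteq> ?D'" using D(2) closure_subset by blast
  qed
  have unif: "uniform_measure surface_measure ?D' = uniform_measure surface_measure P"
  proof -
    have ae: "AE x in surface_measure. x \<in> ?D' \<longleftrightarrow> x \<in> P"
      using aeH by eventually_elim (use D' in \<open>auto simp: N_def\<close>)
    have "emeasure surface_measure (?D' \<inter> A) = emeasure surface_measure (P \<inter> A)" if "A \<in> sets borel" for A
      using ae that by (intro emeasure_eq_AE) (auto elim: eventually_mono)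
    from this[of UNIV] this show ?thesis
      by (intro measure_eqI) simp_all
  qed

  let ?\<mu>P = "uniform_measure surface_measure P"
  have pP: "0 < 2 * a * W" using a W by simp
  have \<mu>P: "prob_on S2 ?\<mu>P"
    using pP HP by (intro prob_on_uniform_surface) (auto simp: P_def)
  have [measurable_cong]: "sets \<rho> = sets borel" using \<rho> by (simp add: prob_on_def)
  have \<rho>': "prob_on S2 \<rho>'"
    unfolding \<rho>'_def using \<rho> by (intro prob_on_distr_S2) (auto simp: prob_on_def line_pt_def sph_in_S2[simplified])
  interpret R: prob_space \<rho>' by (rule prob_on_S2[OF \<rho>'])
  have \<sigma>'_eq: "\<sigma>' = scale_measure (ennreal (1 / (2 * a))) \<rho>'"
    by (simp add: \<sigma>'_def lin \<rho>'_def line_pt_def[abs_def])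
  have \<sigma>'m: "log_potential \<sigma>' \<in> borel_measurable borel"
  proof -
    have "finite_measure \<sigma>'"
      by (rule finite_measureI) (simp add: \<sigma>'_eq ennreal_mult_eq_top_iff R.emeasure_space_1 space_scale_measure)
    then show ?thesis
      by (intro measurable_log_potential finite_measure.sigma_finite_measure) (simp_all add: \<sigma>'_eq prob_on_S2(2)[OF \<rho>'])
  qed
  have \<sigma>'pot: "log_potential \<sigma>' x + ereal (1 / (2 * a) * ln 2) = enn2ereal (ennreal (1 / (2 * a)) * spot \<rho>' x)"
    if "x \<in> S2" for x
    unfolding \<sigma>'_eq using a by (intro log_potential_scale \<rho>' that) simp
  let ?G = "ennreal (1 / (2 * a)) * spot \<rho>' x1 + upot P x1 / ennreal (2 * a * W)"
  have Gfin: "?G < \<top>"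
    using divide_ennreal_less_top[OF fin(2)[OF x1] pP] fin1 by (simp add: ennreal_mult_less_top)
  have aW': "ennreal W * y / ennreal (2 * a * W) = ennreal (1 / (2 * a)) * y" for y
    using W a by (cases y)
      (auto simp: ennreal_mult_top ennreal_top_divide divide_ennreal ennreal_mult[symmetric])
  have geP: "?G \<le> ennreal (1 / (2 * a)) * spot \<rho>' x + upot P x / ennreal (2 * a * W)" if "x \<in> S2" "x \<notin> Z" for x
  proof -
    have "(ennreal W * spot \<rho>' x1 + upot N x) + upot P x \<le> (ennreal W * spot \<rho>' x + upot N x1) + upot P x"
      using II[OF that] by (rule add_right_mono)
    then have "upot N x1 + (ennreal W * spot \<rho>' x1 + upot P x1) \<le> upot N x1 + (ennreal W * spot \<rho>' x + upot P x)"
      using half[OF that(1)] half[OF x1] by (metis (no_types, lifting) add.assoc add.commute)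
    then have "ennreal W * spot \<rho>' x1 + upot P x1 \<le> ennreal W * spot \<rho>' x + upot P x"
      using fin[OF x1] by (auto simp: ennreal_add_left_cancel_le)
    from ennreal_divide_le_aux[OF this pP] show ?thesis by (simp only: aW')
  qed
  have eqP: "?G = ennreal (1 / (2 * a)) * spot \<rho>' x + upot P x / ennreal (2 * a * W)" if "x \<in> S2" "x \<notin> Z" "H x > 0" for x
  proof (rule antisym[OF geP[OF that(1,2)]])
    have "(ennreal W * spot \<rho>' x + upot N x1) + upot P x \<le> (ennreal W * spot \<rho>' x1 + upot N x) + upot P x"
      using II'[OF that] by simp
    then have "upot N x1 + (ennreal W * spot \<rho>' x + upot P x) \<le> upot N x1 + (ennreal W * spot \<rho>' x1 + upot P x1)"
      using half[OF that(1)] half[OF x1] by (metis (no_types, lifting) add.assoc add.commute)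
    then have "ennreal W * spot \<rho>' x + upot P x \<le> ennreal W * spot \<rho>' x1 + upot P x1"
      using fin[OF x1] by (auto simp: ennreal_add_left_cancel_le)
    from ennreal_divide_le_aux[OF this pP]
    show "ennreal (1 / (2 * a)) * spot \<rho>' x + upot P x / ennreal (2 * a * W) \<le> ?G" by (simp only: aW')
  qed
  have nn: "0 \<le> log_potential \<sigma>' x + ereal (1 / (2 * a) * ln 2)" if "x \<in> S2" for x
    unfolding \<sigma>'pot[OF that] by simp
  have ge: "ennreal (enn2real ?G) \<le> spot ?\<mu>P x + e2ennreal (log_potential \<sigma>' x + ereal (1 / (2 * a) * ln 2))"
    if "x \<in> S2" "x \<notin> Z" for x
    using geP[OF that] Gfin unfolding \<sigma>'pot[OF that(1)] by (simp add: spot_uniform HP less_top add.commute)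
  have eq: "AE x in ?\<mu>P. spot ?\<mu>P x + e2ennreal (log_potential \<sigma>' x + ereal (1 / (2 * a) * ln 2)) = ennreal (enn2real ?G)"
    using unifAE[OF \<open>P \<in> sets borel\<close>]
  proof eventually_elim
    case (elim x)
    then have x: "x \<in> S2" "H x > 0" "x \<notin> Z" by (auto simp: P_def)
    show ?case using eqP[OF x(1,3,2)] Gfin unfolding \<sigma>'pot[OF x(1)] by (simp add: spot_uniform HP less_top add.commute)
  qed
  show ?thesis
    unfolding unif using sphere_equilibrium_eqI[OF \<mu>P \<sigma>'m nn Z ge eq] by simp
qed

section \<open>Separated caps\<close>

lemma sph_nth: "sph z $ 1 = 2 * Re z / ((cmod z)\<^sup>2 + 1)" "sph z $ 2 = 2 * Im z / ((cmod z)\<^sup>2 + 1)"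
  "sph z $ 3 = ((cmod z)\<^sup>2 - 1) / ((cmod z)\<^sup>2 + 1)"
  by (simp_all add: inv_stereo_Some vector_3)

lemma half_inner_sph_imag:
  "half_inner x (sph (\<i> * of_real y)) = (1 + x $ 2 * (2 * y / (y\<^sup>2 + 1)) + x $ 3 * ((y\<^sup>2 - 1) / (y\<^sup>2 + 1))) / 2"
  by (simp add: half_inner_def inner_vec_def sum_3 sph_nth norm_mult)

text \<open>In the plane the antipodal map sends z to -1 divided by the conjugate of z. It links the
  charges at +-ib with the points +-i/b in the field on the line.\<close>

lemma sph_antipode:
  assumes "y \<noteq> 0"
  shows "sph (- (\<i> / of_real y)) = - sph (\<i> * of_real y)"
proof -
  have e: "1 / y\<^sup>2 + 1 = (y\<^sup>2 + 1) / y\<^sup>2" "1 / y\<^sup>2 - 1 = (1 - y\<^sup>2) / y\<^sup>2"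
    using assms by (simp_all add: field_simps)
  have "2 * (- (1 / y)) / (1 / y\<^sup>2 + 1) = - (2 * y / (y\<^sup>2 + 1))"
    using assms unfolding e by (simp add: power2_eq_square)
  moreover have "(1 / y\<^sup>2 - 1) / (1 / y\<^sup>2 + 1) = - ((y\<^sup>2 - 1) / (y\<^sup>2 + 1))"
    using assms unfolding e by (simp add: minus_divide_left)
  moreover have "Im (- (\<i> / of_real y)) = - (1 / y)" by (simp add: Im_divide_of_real)
  moreover have "Re (- (\<i> / of_real y)) = 0" by (simp add: Re_divide_of_real)
  moreover have "(cmod (- (\<i> / of_real y)))\<^sup>2 = 1 / y\<^sup>2" by (simp add: norm_divide power_divide)
  ultimately show ?thesis unfolding vec_eq_iff forall_3 vector_uminus_component sph_nth
    by (simp add: norm_mult)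
qed

lemma upot_orthogonal:
  assumes f: "orthogonal_transformation f" and [measurable]: "A \<in> sets borel"
    and A: "\<And>y. y \<in> S2 \<Longrightarrow> f y \<in> A \<longleftrightarrow> y \<in> A"
  shows "upot A (f x) = upot A x"
proof -
  have lin: "linear f" using f by (simp add: orthogonal_transformation)
  have [measurable]: "f \<in> borel_measurable borel"
    using lin by (intro borel_measurable_continuous_onI linear_continuous_on) (simp add: linear_conv_bounded_linear)
  have sk: "skernel (f u) (f v) = skernel u v" for u v
  proof -
    have "dist (f u) (f v) = norm (f (u - v))" using lin by (simp add: dist_norm linear_diff)
    also have "\<dots> = dist u v" using f by (simp add: orthogonal_transformation dist_norm)
    finally have "dist (f u) (f v) = dist u v" .
    moreover from this have "f u = f v \<longleftrightarrow> u = v" by (metis dist_eq_0_iff)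
    ultimately show ?thesis by (cases "u = v") (auto simp: skernel_neq)
  qed
  have "upot A (f x) = (\<integral>\<^sup>+y. indicator A y * skernel (f x) y \<partial>distr surface_measure borel f)"
    by (simp add: upot_def surface_measure_rotation_invariant[OF f])
  also have "\<dots> = (\<integral>\<^sup>+y. indicator A (f y) * skernel (f x) (f y) \<partial>surface_measure)"
    by (subst nn_integral_distr) measurable
  also have "\<dots> = upot A x"
    unfolding upot_def sk using prob_on_S2(4)[OF surface_measure_prob_on]
    by (intro nn_integral_cong_AE, eventually_elim) (simp add: A indicator_def)
  finally show ?thesis .
qed

text \<open>Complex conjugation on the sphere. It exchanges the two charges and reduces the
  relations for the line measure to the upper half-plane.\<close>

definition mirror2 :: "real^3 \<Rightarrow> real^3" where
  "mirror2 x = vector [x $ 1, - x $ 2, x $ 3]"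

lemma mirror2_nth [simp]: "mirror2 x $ 1 = x $ 1" "mirror2 x $ 2 = - x $ 2" "mirror2 x $ 3 = x $ 3"
  by (simp_all add: mirror2_def vector_3)

lemma mirror2_orthogonal: "orthogonal_transformation mirror2"
proof -
  have "linear mirror2"
    by (rule linearI) (simp_all add: vec_eq_iff forall_3)
  then show ?thesis by (simp add: orthogonal_transformation_def inner_vec_def sum_3)
qed

lemma mirror2_sph: "mirror2 (sph z) = sph (cnj z)"
  by (simp add: vec_eq_iff forall_3 sph_nth)

text \<open>The Cayley transform identifies the line with the unit circle and Cauchy densities with
  Poisson kernels.\<close>

definition cayley :: "complex \<Rightarrow> complex" where
  "cayley z = (1 + \<i> * z) / (1 - \<i> * z)"

text \<open>For uniform \<open>t\<close> the point tan (pi t) is Cauchy distributed, so densities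
  with respect to arc length become densities relative to the standard Cauchy law.\<close>

lemma circ_cayley:
  assumes "cos (pi * t) \<noteq> 0"
  shows "circ t = cayley (of_real (tan (pi * t)))"
proof -
  define \<psi> where "\<psi> = pi * t"
  have c: "complex_of_real (cos \<psi>) \<noteq> 0" using assms by (simp only: \<psi>_def of_real_eq_0_iff not_False_eq_True)
  have "circ t = cis \<psi> * cis \<psi>" by (simp add: circ_cis cis_mult \<psi>_def mult.assoc)
  also have "\<dots> = cis \<psi> / cis (- \<psi>)" by (simp add: cis_divide cis_mult)
  also have "cis \<psi> = of_real (cos \<psi>) * (1 + \<i> * of_real (tan \<psi>))"
    using assms by (simp add: complex_eq_iff tan_def \<psi>_def)
  also have "cis (- \<psi>) = of_real (cos \<psi>) * (1 - \<i> * of_real (tan \<psi>))"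
    using assms by (simp add: complex_eq_iff tan_def \<psi>_def)
  finally show ?thesis using c by (simp add: cayley_def \<psi>_def)
qed

lemma cayley_den: "0 \<le> Im z \<Longrightarrow> 1 - \<i> * z \<noteq> 0"
  by (auto simp: complex_eq_iff)

lemma cayley_le_1:
  assumes "0 \<le> Im z"
  shows "cmod (cayley z) \<le> 1"
proof -
  have "(cmod (1 + \<i> * z))\<^sup>2 \<le> (cmod (1 - \<i> * z))\<^sup>2"
    using assms unfolding cmod_power2 by (simp add: power2_eq_square algebra_simps)
  then have "cmod (1 + \<i> * z) \<le> cmod (1 - \<i> * z)" by (rule power2_le_imp_le) simp
  then show ?thesis using cayley_den[OF assms] by (simp add: cayley_def norm_divide)
qed

text \<open>A Moebius map changes the logarithmic kernel by summands in one variable each; the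
  summand in \<open>x\<close> cancels the term ln (1 + x^2) / 2.\<close>

lemma kplane_cayley:
  assumes z: "0 \<le> Im z" and ne: "z \<noteq> of_real x"
  shows "kplane z (of_real x) = ln 2 + ln (1 + (cmod z)\<^sup>2) / 2 - ln (cmod (1 - \<i> * z))
    - ln (cmod (cayley (of_real x) - cayley z))"
proof -
  have q: "1 - \<i> * z \<noteq> 0" "1 - \<i> * of_real x \<noteq> 0" using cayley_den[OF z] cayley_den[of "of_real x"] by auto
  have "cayley (of_real x) - cayley z = 2 * \<i> * (of_real x - z) / ((1 - \<i> * of_real x) * (1 - \<i> * z))"
    using q by (simp add: cayley_def field_simps)
  then have "cmod (cayley (of_real x) - cayley z) = 2 * cmod (z - of_real x) / (cmod (1 - \<i> * of_real x) * cmod (1 - \<i> * z))"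
    by (simp add: norm_divide norm_mult norm_minus_commute)
  then have "ln (cmod (cayley (of_real x) - cayley z))
      = ln 2 + ln (cmod (z - of_real x)) - (ln (cmod (1 - \<i> * of_real x)) + ln (cmod (1 - \<i> * z)))"
    using q ne by (simp add: ln_div ln_mult)
  moreover have "ln (cmod (1 - \<i> * of_real x)) = ln (1 + x\<^sup>2) / 2"
  proof -
    have "cmod (1 - \<i> * of_real x) = sqrt (1 + x\<^sup>2)" by (simp add: cmod_def)
    then show ?thesis by (simp add: ln_sqrt add_pos_nonneg)
  qed
  ultimately show ?thesis by (simp add: kplane_def norm_of_real)
qed

lemma kplane_cnj: "kplane (cnj z) (of_real x) = kplane z (of_real x)"
proof -
  have "cnj z - of_real x = cnj (z - of_real x)" by simp
  then show ?thesis unfolding kplane_def by (simp only: complex_mod_cnj)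
qed

lemma skernel_cnj: "skernel (sph (cnj z)) (line_pt x) = skernel (sph z) (line_pt x)"
proof (cases "z = of_real x")
  case False
  then have "cnj z \<noteq> of_real x" by (metis complex_cnj_cnj complex_cnj_complex_of_real)
  with False show ?thesis by (simp add: line_pt_def skernel_sph kplane_cnj)
qed simp

section \<open>Differences of Cauchy distributions and their potentials\<close>

lemma tan_meas [measurable]: "(\<lambda>t. tan (pi * t)) \<in> borel_measurable borel"
  unfolding tan_def by measurable

text \<open>With m = (b - 1) / (b + 1) the poles m and -m are the Cayley images of i/b and ib; the
  weights are those with which the two logarithms enter the external field.\<close>

definition cauchy_pair :: "real \<Rightarrow> real \<Rightarrow> real \<Rightarrow> real" where
  "cauchy_pair a m t = (1 + a) * poisson (of_real m) (circ t) - a * poisson (of_real (- m)) (circ t)"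

definition cauchy_measure :: "real \<Rightarrow> real \<Rightarrow> real measure" where
  "cauchy_measure a m = distr (density uiv (\<lambda>t. ennreal (cauchy_pair a m t))) borel (\<lambda>t. tan (pi * t))"

lemma measurable_cauchy_pair [measurable]: "cauchy_pair a m \<in> borel_measurable borel"
  unfolding cauchy_pair_def[abs_def] by measurable

context
  fixes a m :: real
  assumes a: "a > 0" and m: "0 \<le> m" "m < 1" and pos: "2 * m * (1 + 2 * a) \<le> 1 + m\<^sup>2"
begin

text \<open>The quotient of the two Poisson kernels is smallest at \<open>circ t = -1\<close>, the
  point at infinity of the line, and \<open>pos\<close> is the required inequality at that
  point.\<close>

lemma cauchy_pair_nonneg: "0 \<le> cauchy_pair a m t"
proof -
  let ?c = "Re (circ t)"
  have m2: "m\<^sup>2 < 1" using m by (simp add: power_less_one_iff abs_square_less_1)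
  have c: "-1 \<le> ?c" "?c \<le> 1" using abs_Re_le_cmod[of "circ t"] by auto
  have e: "(cmod (circ t - of_real m))\<^sup>2 = 1 + m\<^sup>2 - 2 * m * ?c" "(cmod (circ t + of_real m))\<^sup>2 = 1 + m\<^sup>2 + 2 * m * ?c"
    using circ_sq[of t] unfolding cmod_power2 by (simp_all add: power2_eq_square algebra_simps)
  have d: "circ t - of_real m \<noteq> 0" "circ t + of_real m \<noteq> 0"
  proof -
    have "circ t \<noteq> of_real r" if "\<bar>r\<bar> < 1" for r
      using that by (metis less_irrefl norm_circ norm_of_real)
    from this[of m] this[of "- m"] m show "circ t - of_real m \<noteq> 0" "circ t + of_real m \<noteq> 0"
      by (auto simp: add_eq_0_iff2)
  qed
  have pd: "0 < 1 + m\<^sup>2 - 2 * m * ?c" "0 < 1 + m\<^sup>2 + 2 * m * ?c"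
    using d unfolding e[symmetric] by simp_all
  have "m * (1 + 2 * a) * (- 1) \<le> m * (1 + 2 * a) * ?c"
    using c m a by (intro mult_left_mono) auto
  then have "a * (1 + m\<^sup>2 - 2 * m * ?c) \<le> (1 + a) * (1 + m\<^sup>2 + 2 * m * ?c)"
    using pos by (simp add: algebra_simps)
  then have "a / (1 + m\<^sup>2 + 2 * m * ?c) \<le> (1 + a) / (1 + m\<^sup>2 - 2 * m * ?c)"
    using pd by (simp add: divide_simps mult.commute)
  from mult_left_mono[OF this, of "1 - m\<^sup>2"] m2
  have "(1 - m\<^sup>2) * (a / (1 + m\<^sup>2 + 2 * m * ?c)) \<le> (1 - m\<^sup>2) * ((1 + a) / (1 + m\<^sup>2 - 2 * m * ?c))" by simp
  then have "0 \<le> (1 + a) * ((1 - m\<^sup>2) / (1 + m\<^sup>2 - 2 * m * ?c)) - a * ((1 - m\<^sup>2) / (1 + m\<^sup>2 + 2 * m * ?c))"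
    by (simp add: mult.commute)
  moreover have "(cmod (circ t - of_real (- m)))\<^sup>2 = 1 + m\<^sup>2 + 2 * m * ?c" using e(2) by simp
  ultimately show ?thesis
    unfolding cauchy_pair_def poisson_def norm_of_real power2_abs power2_minus e(1) by (simp only:)
qed

lemma cauchy_pair_total: "has_bochner_integral uiv (cauchy_pair a m) 1"
proof -
  have "has_bochner_integral uiv (cauchy_pair a m) ((1 + a) * 1 - a * 1)"
    unfolding cauchy_pair_def[abs_def] using m
    by (intro has_bochner_integral_diff has_bochner_integral_mult_right poisson_total) (auto simp: norm_of_real)
  then show ?thesis by simp
qed

lemma prob_space_cauchy_pair: "prob_space (density uiv (\<lambda>t. ennreal (cauchy_pair a m t)))"
proof (rule prob_spaceI)
  have "(\<integral>\<^sup>+t. ennreal (cauchy_pair a m t) \<partial>uiv) = ennreal 1"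
    using cauchy_pair_total cauchy_pair_nonneg by (subst nn_integral_eq_integral) (auto simp: has_bochner_integral_iff)
  then show "emeasure (density uiv (\<lambda>t. ennreal (cauchy_pair a m t))) (space (density uiv (\<lambda>t. ennreal (cauchy_pair a m t)))) = 1"
    by (simp add: emeasure_density)
qed

lemma prob_on_cauchy_measure: "prob_on UNIV (cauchy_measure a m)"
proof -
  interpret prob_space "density uiv (\<lambda>t. ennreal (cauchy_pair a m t))" by (rule prob_space_cauchy_pair)
  have "prob_space (cauchy_measure a m)" unfolding cauchy_measure_def by (rule prob_space_distr) simp
  then interpret C: prob_space "cauchy_measure a m" .
  show ?thesis using C.emeasure_space_1 C.prob_space_axioms by (simp add: prob_on_def cauchy_measure_def)
qed

text \<open>The closed upper half-plane corresponds to the closed disk, where the maximum in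
  \<open>log_poisson_diff\<close> is always its first entry.\<close>

lemma spot_cauchy:
  assumes z: "0 \<le> Im z"
  defines "S \<equiv> ln 2 + ln (1 + (cmod z)\<^sup>2) / 2 - ln (cmod (1 - \<i> * z))
    - (1 + a) * ln (cmod (1 - of_real m * cayley z)) + a * ln (cmod (1 + of_real m * cayley z))"
  shows "spot (distr (cauchy_measure a m) borel line_pt) (sph z) = ennreal S" "0 \<le> S"
proof -
  let ?u = "cayley z" and ?E = "ln 2 + ln (1 + (cmod z)\<^sup>2) / 2 - ln (cmod (1 - \<i> * z))"
  let ?g = "\<lambda>t. (?E - ln (cmod (circ t - ?u))) * cauchy_pair a m t"
  \<comment> \<open>Where the cosine vanishes the tangent has only a default value;
    \<open>circ t\<close> is -1 there, which happens on a null set.\<close>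
  have cosnz: "AE t in uiv. cos (pi * t) \<noteq> 0"
    using AE_circ_neq[of "-1"]
  proof eventually_elim
    case (elim t)
    have c: "circ t = cis (pi * t) * cis (pi * t)" by (simp add: circ_cis cis_mult mult.assoc)
    show ?case
    proof
      assume "cos (pi * t) = 0"
      then have "circ t = -1" using sin_cos_squared_add[of "pi * t"]
        unfolding c by (simp add: complex_eq_iff power2_eq_square)
      then show False using elim by simp
    qed
  qed
  have "spot (distr (cauchy_measure a m) borel line_pt) (sph z)
      = (\<integral>\<^sup>+t. ennreal (cauchy_pair a m t) * skernel (sph z) (line_pt (tan (pi * t))) \<partial>uiv)"
    unfolding spot_def cauchy_measure_def
    by (simp add: nn_integral_distr nn_integral_density)
  also have "\<dots> = (\<integral>\<^sup>+t. ennreal (?g t) \<partial>uiv)"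
    using cosnz AE_circ_neq[of ?u]
  proof (intro nn_integral_cong_AE, eventually_elim)
    case (elim t)
    then have c: "cos (pi * t) \<noteq> 0" and ne: "z \<noteq> of_real (tan (pi * t))" using circ_cayley[of t] by auto
    have "skernel (sph z) (line_pt (tan (pi * t))) = ennreal (kplane z (of_real (tan (pi * t))))"
      using ne by (simp add: line_pt_def skernel_sph)
    also have "kplane z (of_real (tan (pi * t))) = ?E - ln (cmod (circ t - ?u))"
      using kplane_cayley[OF z ne] circ_cayley[OF c] by simp
    finally show ?case using cauchy_pair_nonneg[of t] by (simp add: ennreal_mult'[symmetric] mult.commute)
  qed
  finally have spot: "spot (distr (cauchy_measure a m) borel line_pt) (sph z) = (\<integral>\<^sup>+t. ennreal (?g t) \<partial>uiv)" .
    have u1: "cmod ?u \<le> 1" by (rule cayley_le_1[OF z])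
    have max: "max (cmod (1 - ?u * cnj (of_real r))) (cmod (?u - of_real r)) = cmod (1 - of_real r * ?u)" if "\<bar>r\<bar> < 1" for r
    proof -
      have "(cmod ?u)\<^sup>2 \<le> 1" "r\<^sup>2 < 1" using u1 that by (simp_all add: abs_square_le_1 abs_square_less_1)
      then have "((cmod ?u)\<^sup>2 - 1) * (1 - r\<^sup>2) \<le> 0" by (intro mult_nonpos_nonneg) auto
      moreover have "(cmod (?u - of_real r))\<^sup>2 - (cmod (1 - of_real r * ?u))\<^sup>2 = ((cmod ?u)\<^sup>2 - 1) * (1 - r\<^sup>2)"
        unfolding cmod_power2 by (simp add: power2_eq_square algebra_simps)
      ultimately have "(cmod (?u - of_real r))\<^sup>2 \<le> (cmod (1 - of_real r * ?u))\<^sup>2" by linarith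
      then have "cmod (?u - of_real r) \<le> cmod (1 - of_real r * ?u)" by (rule power2_le_imp_le) simp
      then show ?thesis by (simp add: mult.commute max_absorb1)
    qed
    have lp: "has_bochner_integral uiv (\<lambda>t. ln (cmod (circ t - ?u)) * poisson (of_real r) (circ t)) (ln (cmod (1 - of_real r * ?u)))"
      if "\<bar>r\<bar> < 1" for r
      using log_poisson_diff[of "of_real r" ?u] that unfolding max[OF that] by (simp add: norm_of_real)
    have "has_bochner_integral uiv (\<lambda>t. ?E * cauchy_pair a m t
        - ((1 + a) * (ln (cmod (circ t - ?u)) * poisson (of_real m) (circ t))
           - a * (ln (cmod (circ t - ?u)) * poisson (of_real (- m)) (circ t))))
       (?E * 1 - ((1 + a) * ln (cmod (1 - of_real m * ?u)) - a * ln (cmod (1 - of_real (- m) * ?u))))"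
      using m by (intro has_bochner_integral_diff has_bochner_integral_mult_right cauchy_pair_total lp) auto
    moreover have "?E * cauchy_pair a m t
        - ((1 + a) * (ln (cmod (circ t - ?u)) * poisson (of_real m) (circ t))
           - a * (ln (cmod (circ t - ?u)) * poisson (of_real (- m)) (circ t))) = ?g t" for t
      unfolding cauchy_pair_def by (simp add: algebra_simps)
    ultimately have hb: "has_bochner_integral uiv ?g (?E - ((1 + a) * ln (cmod (1 - of_real m * ?u)) - a * ln (cmod (1 + of_real m * ?u))))"
      by simp
    have nn: "AE t in uiv. 0 \<le> ?g t"
      using cosnz AE_circ_neq[of ?u]
    proof eventually_elim
      case (elim t)
      then have c: "cos (pi * t) \<noteq> 0" and ne: "z \<noteq> of_real (tan (pi * t))" using circ_cayley[of t] by auto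
      have "0 \<le> ?E - ln (cmod (circ t - ?u))"
        using kplane_nonneg[OF ne] kplane_cayley[OF z ne] circ_cayley[OF c] by simp
      then show ?case using cauchy_pair_nonneg[of t] by simp
    qed
    have S: "S = ?E - ((1 + a) * ln (cmod (1 - of_real m * ?u)) - a * ln (cmod (1 + of_real m * ?u)))"
      by (simp add: S_def)
    show "spot (distr (cauchy_measure a m) borel line_pt) (sph z) = ennreal S"
      unfolding spot S using hb nn by (subst nn_integral_eq_integral) (auto simp: has_bochner_integral_iff)
    show "0 \<le> S"
      using integral_nonneg_AE[OF nn] hb unfolding S by (simp add: has_bochner_integral_iff)
qed

end

section \<open>The external field on the line\<close>

text \<open>On the line this is the planar potential of charges -(1 + a)/2 at each of +-i/b and a/2
  at each of +-ib; the equilibrium measure sweeps the opposite charges onto its support.\<close>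

definition ext_field :: "real \<Rightarrow> real \<Rightarrow> real \<Rightarrow> real" where
  "ext_field a b x = (1 + a) / 2 * ln (x\<^sup>2 + 1 / b\<^sup>2) - a / 2 * ln (x\<^sup>2 + b\<^sup>2)"

lemma measurable_ext_field [measurable]: "ext_field a b \<in> borel_measurable borel"
  unfolding ext_field_def[abs_def] by measurable

text \<open>For b \<ge> 1 both x^2 + b^2 and b^2 (x^2 + 1/b^2) lie between 1 + x^2 and (1 + x^2) b^2
  up to the factors used here; the weights (1 + a)/2 and -a/2 then leave exactly ln (1 + x^2) /
  2.\<close>

lemma ext_field_bound:
  assumes b: "b \<ge> 1" and a: "a > 0"
  shows "0 \<le> ext_field a b x - ln (1 + x\<^sup>2) / 2 + (1 + 2 * a) * ln b"
proof -
  have pos: "0 < 1 + x\<^sup>2" by (simp add: add_pos_nonneg)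
  have b2: "1 \<le> b\<^sup>2" using b by simp
  have "(1 + x\<^sup>2) / b\<^sup>2 \<le> x\<^sup>2 + 1 / b\<^sup>2"
    using b mult_right_mono[OF b2, of "x\<^sup>2"] by (simp add: add_divide_distrib divide_le_eq mult.commute)
  then have "ln ((1 + x\<^sup>2) / b\<^sup>2) \<le> ln (x\<^sup>2 + 1 / b\<^sup>2)"
    using pos b by (subst ln_le_cancel_iff) (auto intro!: add_nonneg_pos)
  then have 1: "ln (1 + x\<^sup>2) - 2 * ln b \<le> ln (x\<^sup>2 + 1 / b\<^sup>2)"
    using pos b by (simp add: ln_div ln_realpow)
  have "x\<^sup>2 + b\<^sup>2 \<le> (1 + x\<^sup>2) * b\<^sup>2"
    using b2 by (simp add: distrib_right mult_le_cancel_left1)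
  then have "ln (x\<^sup>2 + b\<^sup>2) \<le> ln ((1 + x\<^sup>2) * b\<^sup>2)"
    using pos b by (subst ln_le_cancel_iff) (auto intro!: add_nonneg_pos)
  then have 2: "ln (x\<^sup>2 + b\<^sup>2) \<le> ln (1 + x\<^sup>2) + 2 * ln b"
    using pos b by (simp add: ln_mult ln_realpow)
  have "(1 + a) / 2 * (ln (1 + x\<^sup>2) - 2 * ln b) - a / 2 * (ln (1 + x\<^sup>2) + 2 * ln b) \<le> ext_field a b x"
    unfolding ext_field_def using a by (intro diff_mono mult_left_mono 1 2) auto
  then show ?thesis by (simp add: field_simps)
qed

text \<open>The factors vanish at the mirror images -i/b and -ib of the points that the Cayley
  transform sends to m and -m.\<close>

lemma cayley_factors:
  assumes z: "0 \<le> Im z" and b: "b \<ge> 1" and m: "m = (b - 1) / (b + 1)"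
  shows "ln (cmod (1 - of_real m * cayley z)) = ln (2 * b / (b + 1)) + ln (cmod (z + \<i> / of_real b)) - ln (cmod (1 - \<i> * z))"
    and "ln (cmod (1 + of_real m * cayley z)) = ln (2 / (b + 1)) + ln (cmod (z + \<i> * of_real b)) - ln (cmod (1 - \<i> * z))"
proof -
  have q: "1 - \<i> * z \<noteq> 0" by (rule cayley_den[OF z])
  have b1: "complex_of_real b + 1 \<noteq> 0" "complex_of_real b \<noteq> 0"
  proof -
    have "complex_of_real (b + 1) \<noteq> 0" using b by (simp only: of_real_eq_0_iff)
    then show "complex_of_real b + 1 \<noteq> 0" by simp
  qed (use b in auto)
  have mc: "complex_of_real m = (of_real b - 1) / (of_real b + 1)" by (simp add: m)
  have n1: "z + \<i> / of_real b \<noteq> 0" "z + \<i> * of_real b \<noteq> 0"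
  proof -
    have "Im (z + \<i> / of_real b) > 0" "Im (z + \<i> * of_real b) > 0"
      using z b by (auto simp: Im_divide_of_real intro!: add_nonneg_pos)
    then show "z + \<i> / of_real b \<noteq> 0" "z + \<i> * of_real b \<noteq> 0" by (metis less_irrefl zero_complex.simps(2))+
  qed
  have "1 - of_real m * cayley z = of_real (2 * b / (b + 1)) * (- \<i>) * (z + \<i> / of_real b) / (1 - \<i> * z)"
    using q b1 unfolding mc cayley_def by (simp add: divide_simps) (simp add: algebra_simps)
  then have "cmod (1 - of_real m * cayley z) = 2 * b / (b + 1) * cmod (z + \<i> / of_real b) / cmod (1 - \<i> * z)"
    using b by (simp add: norm_mult norm_divide del: of_real_divide of_real_mult of_real_add)
  then show "ln (cmod (1 - of_real m * cayley z)) = ln (2 * b / (b + 1)) + ln (cmod (z + \<i> / of_real b)) - ln (cmod (1 - \<i> * z))"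
    using q n1 b by (subst (asm) ln_div[symmetric] | simp add: ln_div ln_mult)+
  have "1 + of_real m * cayley z = of_real (2 / (b + 1)) * (- \<i>) * (z + \<i> * of_real b) / (1 - \<i> * z)"
    using q b1 unfolding mc cayley_def by (simp add: divide_simps) (simp add: algebra_simps)
  then have "cmod (1 + of_real m * cayley z) = 2 / (b + 1) * cmod (z + \<i> * of_real b) / cmod (1 - \<i> * z)"
    using b by (simp add: norm_mult norm_divide del: of_real_divide of_real_mult of_real_add)
  then show "ln (cmod (1 + of_real m * cayley z)) = ln (2 / (b + 1)) + ln (cmod (z + \<i> * of_real b)) - ln (cmod (1 - \<i> * z))"
    using q n1 b by (simp add: ln_div ln_mult)
qed

text \<open>The horizontal contributions of the two conjugate centres cancel; what remains depends
  on the third coordinate only and is bounded by its value at the north pole, the image of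
  infinity.\<close>

lemma half_inner_two_caps:
  fixes b :: real
  assumes b: "b \<ge> 1" and x: "x \<in> S2"
  shows "half_inner x (sph (\<i> * of_real b)) + half_inner x (sph (- (\<i> * of_real b))) \<le> 1 + (b\<^sup>2 - 1) / (b\<^sup>2 + 1)"
proof -
  have e: "- (\<i> * complex_of_real b) = \<i> * of_real (- b)" by simp
  have "x $ 3 \<le> 1" using component_le_norm_cart[of x 3] x by simp
  moreover have "0 \<le> (b\<^sup>2 - 1) / (b\<^sup>2 + 1)" using b by (intro divide_nonneg_nonneg) auto
  ultimately have "x $ 3 * ((b\<^sup>2 - 1) / (b\<^sup>2 + 1)) \<le> 1 * ((b\<^sup>2 - 1) / (b\<^sup>2 + 1))" by (rule mult_right_mono)
  then have le: "x $ 3 * ((b\<^sup>2 - 1) / (b\<^sup>2 + 1)) \<le> (b\<^sup>2 - 1) / (b\<^sup>2 + 1)" by simp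
  have gen: "(1 + u * R + v * Q) / 2 + (1 + u * (- R) + v * Q) / 2 = 1 + v * Q" for u v R Q :: real
    by (simp add: field_simps)
  have r: "2 * - b / ((- b)\<^sup>2 + 1) = - (2 * b / (b\<^sup>2 + 1))" by simp
  have "half_inner x (sph (\<i> * of_real b)) + half_inner x (sph (- (\<i> * of_real b))) = 1 + x $ 3 * ((b\<^sup>2 - 1) / (b\<^sup>2 + 1))"
    unfolding e half_inner_sph_imag r by (simp only: power2_minus gen)
  then show ?thesis using le by linarith
qed

text \<open>The complement of the cap around \<open>p1\<close> is a cap around \<open>-p1\<close>,
  so D is a cap with another cap removed. For points of the upper half-plane,
  \<open>cap_balayage\<close> compares D with the charges (1 + a) W at \<open>-p1\<close> and -a W
  at \<open>p2\<close>. Both lie in the lower half-plane, and sweeping them onto the line gives W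
  times the difference of two Cauchy laws. The lower half-plane follows by reflection.\<close>

lemma separated_caps:
  fixes a b :: real and p1 p2 :: "real^3" and W :: real and \<sigma> \<sigma>' :: "(real^3) measure" and D :: "(real^3) set"
  assumes b: "b \<ge> 1" and a: "a > 0" and sep: "a * b\<^sup>2 \<le> 1 + a"
  defines "p1 \<equiv> sph (\<i> * of_real b)" and "p2 \<equiv> sph (- (\<i> * of_real b))"
    and "\<sigma> \<equiv> measure_plus (scale_measure (ennreal a) (return borel p1)) (scale_measure (ennreal a) (return borel p2))"
    and "D \<equiv> measure_support (sphere_equilibrium \<sigma>)"
    and "\<sigma>' \<equiv> scale_measure (ennreal (1 / (2 * a)))
      (distr (line_equilibrium (ext_field a b)) borel (\<lambda>x. inv_stereo (Some (of_real x))))"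
  shows "sphere_equilibrium \<sigma>' = uniform_measure surface_measure (closure (S2 - D))
    \<and> is_arg_min (weighted_energy (log_potential \<sigma>')) (prob_on S2) (uniform_measure surface_measure (closure (S2 - D)))"
proof -
  define W where "W = 1 / (1 + 2 * a)"
  \<comment> \<open>The height at which a cap has mass \<open>1 - s = a * W\<close>, that of one
    charge.\<close>
  define s where "s = (1 + a) * W"
  have W: "0 < W" "W < 1" "1 - s = a * W" "2 * s = 1 + W" using a by (simp_all add: W_def s_def field_simps)
  have s: "0 < s" "s < 1" using a W by (auto simp: s_def W_def field_simps)
  \<comment> \<open>The hypothesis \<open>sep\<close> in spherical form: the heights over the two
    centres then add up to at most \<open>2 * s\<close> everywhere, so the caps do not
    overlap.\<close>
  have bW: "(b\<^sup>2 - 1) / (b\<^sup>2 + 1) \<le> W"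
  proof -
    have "(b\<^sup>2 - 1) * (1 + 2 * a) \<le> b\<^sup>2 + 1" using sep by (simp add: algebra_simps)
    then show ?thesis using a by (simp add: W_def divide_simps add_pos_pos add_nonneg_pos)
  qed
  have p: "p1 \<in> S2" "p2 \<in> S2" unfolding p1_def p2_def by (rule sph_in_S2)+
  have mp: "- p1 \<in> S2" using p by simp
  let ?h1 = "\<lambda>x. half_inner x p1" and ?h2 = "\<lambda>x. half_inner x p2"
  have h12: "?h1 x + ?h2 x \<le> 2 * s" if "x \<in> S2" for x
    using half_inner_two_caps[OF b that] bW W by (simp add: p1_def p2_def)
  define H where "H = (\<lambda>x. max (?h1 x) (?h2 x) - s)"
  have Hc: "continuous_on UNIV H" unfolding H_def half_inner_def by (intro continuous_intros) auto
  have [measurable]: "H \<in> borel_measurable borel" using Hc by (rule borel_measurable_continuous_onI)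
  let ?N = "{x \<in> S2. H x < 0}" and ?P = "{x \<in> S2. H x > 0}"
  let ?C1 = "{y. s < ?h1 y}" and ?C2 = "{y. s < ?h2 y}" and ?C = "{y. 1 - s < half_inner y (- p1)}"
  note S = surface_measure_prob_on
  interpret S: prob_space surface_measure by (rule prob_on_S2[OF S])
  have circ: "AE y in surface_measure. half_inner y q \<noteq> s" if "q \<in> S2" for q
    using emeasure_circle[OF that, of s] by (intro AE_I[of _ _ "{y. half_inner y q = s}"]) auto
  have ae: "AE y in surface_measure. y \<in> S2 \<and> ?h1 y \<noteq> s \<and> ?h2 y \<noteq> s"
    using prob_on_S2(4)[OF S] circ[OF p(1)] circ[OF p(2)] by eventually_elim auto
  have disj: "\<not> (s \<le> ?h1 y \<and> s < ?h2 y) \<and> \<not> (s < ?h1 y \<and> s \<le> ?h2 y)" if "y \<in> S2" for y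
    using h12[OF that] by linarith
  have H0: "emeasure surface_measure {x \<in> S2. H x = 0} = 0"
  proof -
    have "AE y in surface_measure. y \<notin> {x \<in> S2. H x = 0}"
      using ae by eventually_elim (auto simp: H_def max_def split: if_splits)
    then show ?thesis by (subst (asm) AE_iff_measurable[OF _ refl]) auto
  qed
  have mC: "emeasure surface_measure ?C1 = ennreal (a * W)" "emeasure surface_measure ?C2 = ennreal (a * W)"
    using emeasure_cap[OF p(1), of s] emeasure_cap[OF p(2), of s] s W by simp_all
  have HN: "emeasure surface_measure ?N = ennreal W"
  proof -
    have "emeasure surface_measure (?C1 \<union> ?C2) = emeasure surface_measure ({y \<in> S2. s < ?h1 y} \<union> {y \<in> S2. s < ?h2 y})"
      using ae by (intro emeasure_eq_AE) (auto elim: eventually_mono)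
    also have "\<dots> = emeasure surface_measure {y \<in> S2. s < ?h1 y} + emeasure surface_measure {y \<in> S2. s < ?h2 y}"
    proof (rule plus_emeasure[symmetric])
      show "{y \<in> S2. s < ?h1 y} \<in> sets surface_measure" "{y \<in> S2. s < ?h2 y} \<in> sets surface_measure"
        unfolding sets_surface_measure by measurable
      show "{y \<in> S2. s < ?h1 y} \<inter> {y \<in> S2. s < ?h2 y} = {}" using disj less_imp_le by blast
    qed
    also have "\<dots> = emeasure surface_measure ?C1 + emeasure surface_measure ?C2"
      using ae by (intro arg_cong2[where f = "(+)"] emeasure_eq_AE) (auto elim: eventually_mono)
    also have "\<dots> = ennreal (2 * a * W)" unfolding mC using a W by (simp add: ennreal_plus[symmetric] del: ennreal_plus)
    finally have U: "emeasure surface_measure (?C1 \<union> ?C2) = ennreal (2 * a * W)" .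
    have "emeasure surface_measure ?N = emeasure surface_measure (UNIV - (?C1 \<union> ?C2))"
    proof (rule emeasure_eq_AE)
      show "AE y in surface_measure. y \<in> ?N \<longleftrightarrow> y \<in> UNIV - (?C1 \<union> ?C2)"
        using ae by eventually_elim (auto simp: H_def not_less le_less)
    qed simp_all
    also have "\<dots> = 1 - ennreal (2 * a * W)"
      using emeasure_compl[of "?C1 \<union> ?C2" surface_measure] U S.emeasure_space_1 by simp
    also have "\<dots> = ennreal (1 - 2 * a * W)" using a W by (simp add: ennreal_minus flip: ennreal_1)
    also have "1 - 2 * a * W = W" using W by (simp add: s_def algebra_simps)
    finally show ?thesis .
  qed
  have UP: "upot ?P x = upot ?C1 x + upot ?C2 x" for x
  proof -
    have "upot ?C1 x + upot ?C2 x = (\<integral>\<^sup>+y. indicator ?C1 y * skernel x y + indicator ?C2 y * skernel x y \<partial>surface_measure)"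
      unfolding upot_def by (rule nn_integral_add[symmetric]) measurable
    also have "\<dots> = upot ?P x"
      unfolding upot_def using ae
    proof (intro nn_integral_cong_AE, eventually_elim)
      case (elim y)
      then show ?case using disj[of y] by (auto simp: H_def less_max_iff_disj indicator_def)
    qed
    finally show ?thesis ..
  qed
  \<comment> \<open>Here ?C is the complement of the first cap up to a null set, described as a cap
    around the antipode.\<close>
  have UN: "upot ?N x + upot ?C2 x = upot ?C x" for x
  proof -
    have "upot ?N x + upot ?C2 x = (\<integral>\<^sup>+y. indicator ?N y * skernel x y + indicator ?C2 y * skernel x y \<partial>surface_measure)"
      unfolding upot_def by (rule nn_integral_add[symmetric]) measurable
    also have "\<dots> = upot ?C x"
      unfolding upot_def using ae
    proof (intro nn_integral_cong_AE, eventually_elim)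
      case (elim y)
      then show ?case using disj[of y] by (auto simp: H_def indicator_def half_inner_minus)
    qed
    finally show ?thesis .
  qed
  define x0 where "x0 = sph 0"
  have x0S: "x0 \<in> S2" unfolding x0_def by (rule sph_in_S2)
  have x0n: "x0 \<noteq> p1" "x0 \<noteq> p2" using b by (auto simp: x0_def p1_def p2_def)
  have r0: "?h1 x0 \<le> s" "?h2 x0 \<le> s"
  proof -
    have e: "- (\<i> * complex_of_real b) = \<i> * of_real (- b)" by simp
    define Q where "Q = (b\<^sup>2 - 1) / (b\<^sup>2 + 1)"
    have "0 \<le> Q" using b unfolding Q_def by (intro divide_nonneg_nonneg) auto
    moreover have x0c: "x0 $ 2 = 0" "x0 $ 3 = - 1" by (simp_all add: x0_def sph_nth)
    ultimately have "?h1 x0 \<le> 1 / 2" "?h2 x0 \<le> 1 / 2"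
      unfolding p1_def p2_def e half_inner_sph_imag x0c power2_minus Q_def[symmetric] by simp_all
    then show "?h1 x0 \<le> s" "?h2 x0 \<le> s" using W by linarith+
  qed
  have I: "upot ?P x + ennreal (a * W) * (skernel x0 p1 + skernel x0 p2)
        \<le> upot ?P x0 + ennreal (a * W) * (skernel x p1 + skernel x p2)" if "x \<in> S2" for x
    using add_mono[OF cap_balayage(1)[OF that p(1) x0S less_imp_le[OF s(1)] s(2) r0(1)]
        cap_balayage(1)[OF that p(2) x0S less_imp_le[OF s(1)] s(2) r0(2)], unfolded W(3)]
    unfolding UP distrib_left by (simp only: ac_simps)
  have I': "upot ?P x + ennreal (a * W) * (skernel x0 p1 + skernel x0 p2)
        = upot ?P x0 + ennreal (a * W) * (skernel x p1 + skernel x p2)" if "x \<in> S2" "H x < 0" for x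
  proof -
    have h: "?h1 x \<le> s" "?h2 x \<le> s" using that(2) by (auto simp: H_def)
    note e = cap_balayage(2)[OF that(1) p(1) x0S less_imp_le[OF s(1)] s(2) r0(1) h(1), unfolded W(3)]
      cap_balayage(2)[OF that(1) p(2) x0S less_imp_le[OF s(1)] s(2) r0(2) h(2), unfolded W(3)]
    from arg_cong2[where f = "(+)", OF e] show ?thesis
      unfolding UP distrib_left by (simp only: ac_simps)
  qed

  define m where "m = (b - 1) / (b + 1)"
  have m: "0 \<le> m" "m < 1" using b by (auto simp: m_def)
  have mpos: "2 * m * (1 + 2 * a) \<le> 1 + m\<^sup>2"
  proof -
    have "2 * (b - 1) * (b + 1) * (1 + 2 * a) \<le> (b + 1)\<^sup>2 + (b - 1)\<^sup>2"
      using sep by (simp add: power2_eq_square algebra_simps)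
    then have "2 * (b - 1) * (b + 1) * (1 + 2 * a) / (b + 1)\<^sup>2 \<le> ((b + 1)\<^sup>2 + (b - 1)\<^sup>2) / (b + 1)\<^sup>2"
      by (rule divide_right_mono) simp
    moreover have "2 * (b - 1) * (b + 1) * (1 + 2 * a) / (b + 1)\<^sup>2 = 2 * m * (1 + 2 * a)"
      using b by (simp add: m_def power2_eq_square)
    moreover have "((b + 1)\<^sup>2 + (b - 1)\<^sup>2) / (b + 1)\<^sup>2 = 1 + m\<^sup>2"
      using b by (simp add: m_def add_divide_distrib power_divide)
    ultimately show ?thesis by simp
  qed
  define \<rho> where "\<rho> = cauchy_measure a m"
  define \<rho>' where "\<rho>' = distr \<rho> borel line_pt"
  have \<rho>: "prob_on UNIV \<rho>" unfolding \<rho>_def by (rule prob_on_cauchy_measure[OF a m mpos])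
  define c0 where "c0 = ln 2 - (1 + a) * ln (2 * b / (b + 1)) + a * ln (2 / (b + 1))"
  \<comment> \<open>The potential of the line measure on the closed upper half-plane, with
    \<open>c0\<close> collecting the constants of \<open>cayley_factors\<close>.\<close>
  define T where "T = (\<lambda>z. c0 + ln (1 + (cmod z)\<^sup>2) / 2 - (1 + a) * ln (cmod (z + \<i> / of_real b)) + a * ln (cmod (z + \<i> * of_real b)))"
  have spot: "spot \<rho>' (sph z) = ennreal (T z)" "0 \<le> T z" if "0 \<le> Im z" for z
  proof -
    have "ln 2 + ln (1 + (cmod z)\<^sup>2) / 2 - ln (cmod (1 - \<i> * z))
      - (1 + a) * ln (cmod (1 - of_real m * cayley z)) + a * ln (cmod (1 + of_real m * cayley z)) = T z"
      unfolding cayley_factors[OF that b m_def] T_def c0_def by (simp add: algebra_simps)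
    then show "spot \<rho>' (sph z) = ennreal (T z)" "0 \<le> T z"
      using spot_cauchy[OF a m mpos that] by (simp_all add: \<rho>'_def \<rho>_def)
  qed
  \<comment> \<open>Potential and field add up to a constant at every point of the line, so
    Frostman's inequality is an equality throughout.\<close>
  have Treal: "T (of_real x) + (ext_field a b x - ln (1 + x\<^sup>2) / 2 + c) = c0 + c" for x c
  proof -
    have "cmod (of_real x + \<i> / of_real b) = sqrt (x\<^sup>2 + 1 / b\<^sup>2)" "cmod (of_real x + \<i> * of_real b) = sqrt (x\<^sup>2 + b\<^sup>2)"
      by (simp_all add: cmod_def Re_divide_of_real Im_divide_of_real power_divide)
    moreover have "0 < x\<^sup>2 + 1 / b\<^sup>2" "0 < x\<^sup>2 + b\<^sup>2" using b by (auto intro!: add_nonneg_pos)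
    ultimately show ?thesis by (simp add: T_def ext_field_def ln_sqrt norm_of_real field_simps)
  qed
  let ?c = "(1 + 2 * a) * ln b"
  have frost: "spot \<rho>' (line_pt x) + ennreal (ext_field a b x - ln (1 + x\<^sup>2) / 2 + ?c) = ennreal (c0 + ?c)" for x
    using spot[of "of_real x"] ext_field_bound[OF b a, of x] Treal[of x ?c]
    by (simp add: line_pt_def ennreal_plus[symmetric] del: ennreal_plus)
  have lin: "line_equilibrium (ext_field a b) = \<rho>"
  proof (rule line_equilibrium_eqI[OF \<rho> _ ext_field_bound[OF b a]])
    show "ennreal (c0 + ?c) \<le> spot (distr \<rho> borel line_pt) (line_pt x) + ennreal (ext_field a b x - ln (1 + x\<^sup>2) / 2 + ?c)" for x
      using frost[of x] by (simp add: \<rho>'_def)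
    show "AE x in \<rho>. spot (distr \<rho> borel line_pt) (line_pt x) + ennreal (ext_field a b x - ln (1 + x\<^sup>2) / 2 + ?c) = ennreal (c0 + ?c)"
      using frost by (simp add: \<rho>'_def)
  qed simp
  have fin1: "spot \<rho>' p1 < \<top>" using spot[of "\<i> * of_real b"] b by (simp add: p1_def)

  have upfin: "upot A x < \<top>" if "x \<in> S2" for A x
  proof -
    have "upot A x \<le> spot surface_measure x"
      unfolding upot_def spot_def by (intro nn_integral_mono) (auto split: split_indicator)
    also have "\<dots> < \<top>" unfolding spot_surface[OF that] by (rule ennreal_less_top)
    finally show ?thesis .
  qed
  let ?k1 = "\<lambda>z. kplane z (- (\<i> / of_real b))" and ?k2 = "\<lambda>z. kplane z (- (\<i> * of_real b))"
  define c1 where "c1 = c0 - (1 + a) / 2 * ln (1 + 1 / b\<^sup>2) + a / 2 * ln (1 + b\<^sup>2)"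
  have Tk: "T z = (1 + a) * ?k1 z - a * ?k2 z + c1" for z
    unfolding T_def kplane_def c1_def by (simp add: norm_divide norm_mult power_divide algebra_simps)
  have sk: "skernel (sph z) (- p1) = ennreal (?k1 z)" "0 \<le> ?k1 z" "skernel (sph z) p2 = ennreal (?k2 z)" "0 \<le> ?k2 z"
    if "0 \<le> Im z" for z
  proof -
    have n1: "z \<noteq> - (\<i> / of_real b)" "z \<noteq> - (\<i> * of_real b)"
    proof -
      have "Im (- (\<i> / of_real b)) < 0" "Im (- (\<i> * of_real b)) < 0" using b by (simp_all add: Im_divide_of_real)
      then show "z \<noteq> - (\<i> / of_real b)" "z \<noteq> - (\<i> * of_real b)" using that by (auto simp del: uminus_complex.simps)
    qed
    have "- p1 = sph (- (\<i> / of_real b))" unfolding p1_def using b by (subst sph_antipode) auto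
    then show "skernel (sph z) (- p1) = ennreal (?k1 z)" "0 \<le> ?k1 z" "skernel (sph z) p2 = ennreal (?k2 z)" "0 \<le> ?k2 z"
      using n1 by (simp_all add: p2_def skernel_sph kplane_nonneg)
  qed
  have upper: "ennreal W * spot \<rho>' p1 + upot ?N (sph z) \<le> ennreal W * spot \<rho>' (sph z) + upot ?N p1"
    "H (sph z) > 0 \<Longrightarrow> ennreal W * spot \<rho>' p1 + upot ?N (sph z) = ennreal W * spot \<rho>' (sph z) + upot ?N p1"
    if z: "0 \<le> Im z" for z
  proof -
    define x where "x = sph z"
    have xS: "x \<in> S2" unfolding x_def by (rule sph_in_S2)
    have up: "?h2 (sph w) \<le> ?h1 (sph w)" if "0 \<le> Im w" for w
    proof -
      have e: "- (\<i> * complex_of_real b) = \<i> * of_real (- b)" by simp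
      have "0 \<le> sph w $ 2 * (2 * b / (b\<^sup>2 + 1))" using that b by (simp add: sph_nth)
      then show ?thesis unfolding p1_def p2_def e half_inner_sph_imag by simp
    qed
    have h2: "?h2 x \<le> s" "?h2 p1 \<le> s"
      using up[OF z] up[of "\<i> * of_real b"] h12[OF xS] h12[OF p(1)] b by (simp_all add: x_def p1_def)
    have h11: "half_inner p1 (- p1) = 0" using p(1) by (simp add: half_inner_def norm_eq_1)
    have s1: "0 \<le> 1 - s" "1 - s < 1" using s by auto
    have z1: "0 \<le> Im (\<i> * of_real b)" using b by simp
    \<comment> \<open>Antipodal points are at distance 2, where the shifted kernel is zero.\<close>
    have k0: "skernel p1 (- p1) = 0" using h11 by (simp add: skernel_half_inner[OF p(1) mp])
    have A: "upot ?C x + ennreal s * skernel p1 (- p1) \<le> upot ?C p1 + ennreal s * skernel x (- p1)"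
      using cap_balayage(1)[OF xS mp p(1) s1] h11 s by simp
    have A': "upot ?C x + ennreal s * skernel p1 (- p1) = upot ?C p1 + ennreal s * skernel x (- p1)" if "H x > 0"
    proof -
      have "half_inner x (- p1) \<le> 1 - s"
        using that up[OF z] by (simp add: H_def x_def half_inner_minus)
      then show ?thesis using cap_balayage(2)[OF xS mp p(1) s1] h11 s by simp
    qed
    have B: "upot ?C2 x + ennreal (a * W) * skernel p1 p2 = upot ?C2 p1 + ennreal (a * W) * skernel x p2"
      using cap_balayage(2)[OF xS p(2) p(1) _ s(2) h2(2) h2(1)] s W by simp
    obtain n where n: "upot ?N x = ennreal n" "0 \<le> n" using upfin[OF xS, of ?N] by (cases "upot ?N x") auto
    obtain n1 where n1: "upot ?N p1 = ennreal n1" "0 \<le> n1" using upfin[OF p(1), of ?N] by (cases "upot ?N p1") auto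
    obtain c where c: "upot ?C2 x = ennreal c" "0 \<le> c" using upfin[OF xS, of ?C2] by (cases "upot ?C2 x") auto
    obtain d where d: "upot ?C2 p1 = ennreal d" "0 \<le> d" using upfin[OF p(1), of ?C2] by (cases "upot ?C2 p1") auto
    have e: "upot ?C x = ennreal (n + c)" "upot ?C p1 = ennreal (n1 + d)"
      using UN[of x] UN[of p1] n n1 c d by (simp_all add: ennreal_plus)
    note k = sk[OF z, folded x_def] sk[OF z1, folded p1_def]
    have k10: "?k1 (\<i> * of_real b) = 0" using k(5,6) k0 by (simp add: ennreal_eq_0_iff antisym)
    have B': "c + a * W * ?k2 (\<i> * of_real b) = d + a * W * ?k2 z"
      using B a W c d k unfolding k c(1) d(1)
      by (simp add: ennreal_mult[symmetric] ennreal_plus[symmetric] del: ennreal_plus)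
    have A1: "n + c \<le> n1 + d + s * ?k1 z"
      using A s n c n1 d k(2) unfolding e k(1) k0
      by (simp add: ennreal_mult[symmetric] ennreal_plus[symmetric] del: ennreal_plus)
    have A2: "n + c = n1 + d + s * ?k1 z" if "H x > 0"
      using A'[OF that] s n c n1 d k(2) unfolding e k(1) k0
      by (simp add: ennreal_mult[symmetric] ennreal_plus[symmetric] del: ennreal_plus)
    have TT: "W * T z - W * T (\<i> * of_real b) = s * ?k1 z - a * W * ?k2 z + a * W * ?k2 (\<i> * of_real b)"
      unfolding Tk k10 s_def by (simp add: algebra_simps)
    have "W * T (\<i> * of_real b) + n \<le> W * T z + n1" using TT A1 B' by linarith
    then show "ennreal W * spot \<rho>' p1 + upot ?N (sph z) \<le> ennreal W * spot \<rho>' (sph z) + upot ?N p1"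
      using spot[OF z] spot[OF z1] n n1 W
      by (simp add: x_def[symmetric] p1_def[symmetric] ennreal_mult[symmetric] ennreal_plus[symmetric] del: ennreal_plus)
    assume "H (sph z) > 0"
    then have "W * T (\<i> * of_real b) + n = W * T z + n1" using TT A2 B' by (simp add: x_def)
    then show "ennreal W * spot \<rho>' p1 + upot ?N (sph z) = ennreal W * spot \<rho>' (sph z) + upot ?N p1"
      using spot[OF z] spot[OF z1] n n1 W
      by (simp add: x_def[symmetric] p1_def[symmetric] ennreal_mult[symmetric] ennreal_plus[symmetric] del: ennreal_plus)
  qed
  have mir: "H (mirror2 x) = H x" for x
  proof -
    have e: "- (\<i> * complex_of_real b) = \<i> * of_real (- b)" by simp
    have "?h1 (mirror2 x) = ?h2 x" "?h2 (mirror2 x) = ?h1 x"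
      unfolding p1_def p2_def e half_inner_sph_imag by simp_all
    then show ?thesis by (simp add: H_def max.commute)
  qed
  have umir: "upot ?N (sph (cnj z)) = upot ?N (sph z)" for z
  proof -
    have "mirror2 y \<in> S2 \<longleftrightarrow> y \<in> S2" for y unfolding S2_iff by simp
    then have "upot ?N (mirror2 (sph z)) = upot ?N (sph z)"
      by (intro upot_orthogonal[OF mirror2_orthogonal]) (auto simp: mir)
    then show ?thesis by (simp add: mirror2_sph)
  qed
  have smir: "spot \<rho>' (sph (cnj z)) = spot \<rho>' (sph z)" for z
  proof -
    have [measurable_cong]: "sets \<rho> = sets borel" using \<rho> by (simp add: prob_on_def)
    show ?thesis unfolding spot_def \<rho>'_def by (simp add: nn_integral_distr skernel_cnj)
  qed
  have II: "ennreal W * spot \<rho>' p1 + upot ?N x \<le> ennreal W * spot \<rho>' x + upot ?N p1"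
    "H x > 0 \<Longrightarrow> ennreal W * spot \<rho>' p1 + upot ?N x = ennreal W * spot \<rho>' x + upot ?N p1"
    if x: "x \<in> S2" "x \<notin> {axis 3 1}" for x
  proof -
    obtain z where z: "x = sph z" using sph_surj[of x] x by auto
    have "\<exists>w. 0 \<le> Im w \<and> upot ?N (sph w) = upot ?N x \<and> spot \<rho>' (sph w) = spot \<rho>' x \<and> H (sph w) = H x"
    proof (cases "0 \<le> Im z")
      case False
      then show ?thesis using umir[of z] smir[of z] mir[of "sph z"]
        by (intro exI[of _ "cnj z"]) (simp add: z mirror2_sph)
    qed (auto simp: z)
    then obtain w where w: "0 \<le> Im w" "upot ?N (sph w) = upot ?N x" "spot \<rho>' (sph w) = spot \<rho>' x" "H (sph w) = H x" by blast
    show "ennreal W * spot \<rho>' p1 + upot ?N x \<le> ennreal W * spot \<rho>' x + upot ?N p1"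
      "H x > 0 \<Longrightarrow> ennreal W * spot \<rho>' p1 + upot ?N x = ennreal W * spot \<rho>' x + upot ?N p1"
      using upper[OF w(1)] unfolding w(2-4) by auto
  qed
  show ?thesis
    unfolding D_def \<sigma>'_def \<sigma>_def
    by (rule reduction[where a = a and H = H and Z = "{axis 3 1}" and \<rho> = \<rho> and ?x0.0 = x0 and ?x1.0 = p1,
          folded W_def \<rho>'_def])
      (rule a p x0S x0n Hc H0 HN \<rho> lin fin1 finite.insertI finite.emptyI | (rule I I' II; assumption))+
qed

section \<open>The foliation by confocal-type ellipses\<close>

locale ellipse_family =
  fixes b :: real
  assumes b: "1 < b"
begin

text \<open>For b = exp c these are cosh c and sinh c, and \<open>Wmax\<close> is tanh c, the level
  at which the ellipses degenerate to the strip of half-width \<open>sh\<close> around the real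
  axis.\<close>

definition ch :: real where "ch = (b + 1 / b) / 2"
definition sh :: real where "sh = (b - 1 / b) / 2"
definition kk :: real where "kk = ch * sh"
definition cc :: real where "cc = ch\<^sup>2"
definition Wmax :: real where "Wmax = kk / cc"

text \<open>As W increases from 0 to \<open>Wmax\<close>, \<open>ss W\<close> decreases from
  infinity to 0. With ss = sinh^2 y, \<open>rS\<close> and \<open>rT\<close> are sinh y and cosh y,
  the half-axes are ch / sinh y and sh / cosh y, and \<open>pM\<close> is exp (-2 y).\<close>

definition ss :: "real \<Rightarrow> real" where "ss W = kk / W - cc"
definition rS :: "real \<Rightarrow> real" where "rS W = sqrt (ss W)"
definition rT :: "real \<Rightarrow> real" where "rT W = sqrt (1 + ss W)"
definition axA :: "real \<Rightarrow> real" where "axA W = ch / rS W"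
definition axB :: "real \<Rightarrow> real" where "axB W = sh / rT W"
definition pM :: "real \<Rightarrow> real" where "pM W = (rT W - rS W)\<^sup>2"
definition gam :: "real \<Rightarrow> real \<Rightarrow> complex" where
  "gam W t = of_real (axA W * Re (circ t)) + \<i> * of_real (axB W * Im (circ t))"
definition qq :: "real \<Rightarrow> real" where
  "qq t = (Re (circ t))\<^sup>2 / cc + (Im (circ t))\<^sup>2 / (cc - 1)"
text \<open>In the plane the level set \<open>hlev = W\<close> is the ellipse with half-axes \<open>axA W\<close> and \<open>axB W\<close>; for
  \<open>0 < W < Wmax\<close> the surface measure of \<open>hlev < W\<close> is \<open>W\<close>.\<close>

definition hlev :: "real^3 \<Rightarrow> real" where
  "hlev y = kk / 2 * ((y $ 1)\<^sup>2 / cc + (y $ 2)\<^sup>2 / (cc - 1)) / (1 - y $ 3)"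

lemma ch_sh: "0 < ch" "0 < sh" "ch\<^sup>2 = sh\<^sup>2 + 1" "sh < ch" "ch + sh = b" "ch - sh = 1 / b"
proof -
  have i: "1 / b < 1" "0 < 1 / b" using b by simp_all
  show "0 < ch" using b by (simp add: ch_def add_pos_pos)
  have "1 / b < b" using i(1) b by (rule less_trans)
  then show "0 < sh" by (simp add: sh_def)
  have "- (1 / b) < 1 / b" using i(2) by (metis neg_less_0_iff_less less_trans)
  then have "b + - (1 / b) < b + 1 / b" by (rule add_strict_left_mono)
  then show "sh < ch" by (simp add: ch_def sh_def)
  show "ch + sh = b" "ch - sh = 1 / b" unfolding ch_def sh_def by (simp_all add: field_simps)
  show "ch\<^sup>2 = sh\<^sup>2 + 1" using b by (simp add: ch_def sh_def power2_eq_square field_simps)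
qed

lemma kk_pos: "0 < kk" and cc_gt: "1 < cc" and sh2: "sh\<^sup>2 = cc - 1" and kk2: "kk\<^sup>2 = cc * (cc - 1)"
proof -
  show "0 < kk" using ch_sh by (simp add: kk_def)
  show "1 < cc" unfolding cc_def using ch_sh(3,2) by simp
  show "sh\<^sup>2 = cc - 1" unfolding cc_def using ch_sh(3) by simp
  then show "kk\<^sup>2 = cc * (cc - 1)" by (simp add: kk_def cc_def power_mult_distrib)
qed

lemma Wmax: "0 < Wmax" "Wmax = sh / ch"
proof -
  show "0 < Wmax" unfolding Wmax_def using kk_pos cc_gt by simp
  show "Wmax = sh / ch" using ch_sh(1) by (simp add: Wmax_def kk_def cc_def power2_eq_square)
qed

lemma W_facts:
  assumes "0 < W" "W < Wmax"
  shows "0 < ss W" "W = kk / (ss W + cc)" "0 < rS W" "rS W < rT W" "(rS W)\<^sup>2 = ss W" "(rT W)\<^sup>2 = 1 + ss W"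
    "0 < axA W" "0 < axB W" "(axA W)\<^sup>2 = cc / ss W" "(axB W)\<^sup>2 = (cc - 1) / (1 + ss W)"
    "axA W * axB W = kk / (rS W * rT W)" "0 \<le> pM W" "pM W < 1" "0 < pM W"
proof -
  have "cc < kk / W" using assms cc_gt by (simp add: Wmax_def field_simps)
  then show s: "0 < ss W" by (simp add: ss_def)
  show "W = kk / (ss W + cc)" using assms kk_pos by (simp add: ss_def)
  show S: "0 < rS W" "rS W < rT W" "(rS W)\<^sup>2 = ss W" "(rT W)\<^sup>2 = 1 + ss W"
    using s by (simp_all add: rS_def rT_def)
  then have T: "0 < rT W" by linarith
  show "0 < axA W" "0 < axB W" using S T ch_sh by (simp_all add: axA_def axB_def)
  show "(axA W)\<^sup>2 = cc / ss W" "(axB W)\<^sup>2 = (cc - 1) / (1 + ss W)"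
    using S sh2 by (simp_all add: axA_def axB_def power_divide cc_def)
  show "axA W * axB W = kk / (rS W * rT W)" by (simp add: axA_def axB_def kk_def)
  show p: "0 < pM W" using S by (simp add: pM_def)
  then show "0 \<le> pM W" by simp
  have "(rT W - rS W) * (rT W + rS W) = 1" using S by (simp add: power2_eq_square algebra_simps)
  moreover have "rT W + rS W > 1"
  proof -
    have "1 < rT W" using s by (simp add: rT_def)
    then show ?thesis using S by linarith
  qed
  ultimately have "rT W - rS W < 1" using S by (smt (verit) mult_le_cancel_left1 mult.commute)
  then show "pM W < 1" using S by (simp add: pM_def power_less_one_iff abs_square_less_1)
qed

text \<open>The right-hand side is the Jacobian that the foliation produces in
  \<open>arch_gam\<close>; this recognizes it as a Poisson kernel in the Joukowski
  parameter.\<close>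

lemma poisson2_pM:
  assumes "0 < W" "W < Wmax"
  shows "poisson2 (pM W) (circ t) = rS W * rT W / (ss W + (Re (circ t))\<^sup>2)"
proof -
  note W = W_facts[OF assms]
  define e where "e = rT W - rS W"
  have e: "0 < e" "e * (rT W + rS W) = 1" using W by (auto simp: e_def power2_eq_square algebra_simps)
  have M: "pM W = e\<^sup>2" by (simp add: pM_def e_def)
  have f: "1 - e\<^sup>2 = 2 * e * rS W" "1 + e\<^sup>2 = 2 * e * rT W"
    using e(2) by (simp_all add: e_def power2_eq_square algebra_simps)
  have "(cmod ((circ t)\<^sup>2 + of_real (e\<^sup>2)))\<^sup>2 = (1 - e\<^sup>2)\<^sup>2 + 4 * e\<^sup>2 * (Re (circ t))\<^sup>2"
  proof -
    have i: "(Im (circ t))\<^sup>2 = 1 - (Re (circ t))\<^sup>2" using circ_sq[of t] by simp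
    have "(cmod ((circ t)\<^sup>2 + of_real (e\<^sup>2)))\<^sup>2
      = ((Re (circ t))\<^sup>2 - (Im (circ t))\<^sup>2 + e\<^sup>2)\<^sup>2 + 4 * (Re (circ t))\<^sup>2 * (Im (circ t))\<^sup>2"
      unfolding cmod_power2 by (simp add: power2_eq_square algebra_simps)
    also have "\<dots> = (1 - e\<^sup>2)\<^sup>2 + 4 * e\<^sup>2 * (Re (circ t))\<^sup>2"
      unfolding i by (simp add: power2_eq_square algebra_simps)
    finally show ?thesis .
  qed
  also have "\<dots> = 4 * e\<^sup>2 * (ss W + (Re (circ t))\<^sup>2)"
    unfolding f(1) by (simp add: power_mult_distrib W(5) algebra_simps)
  finally have d: "(cmod ((circ t)\<^sup>2 + of_real (e\<^sup>2)))\<^sup>2 = 4 * e\<^sup>2 * (ss W + (Re (circ t))\<^sup>2)" .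
  have n: "1 - (e\<^sup>2)\<^sup>2 = 4 * e\<^sup>2 * (rS W * rT W)"
  proof -
    have "1 - (e\<^sup>2)\<^sup>2 = (1 - e\<^sup>2) * (1 + e\<^sup>2)" by (simp add: power2_eq_square algebra_simps)
    then show ?thesis unfolding f by (simp add: power2_eq_square)
  qed
  show ?thesis unfolding poisson2_def M d n using e by simp
qed

lemma qq_pos: "1 / cc \<le> qq t" "0 < qq t"
proof -
  have "(Im (circ t))\<^sup>2 / cc \<le> (Im (circ t))\<^sup>2 / (cc - 1)"
    using cc_gt by (intro divide_left_mono) auto
  moreover have "1 / cc = (Re (circ t))\<^sup>2 / cc + (Im (circ t))\<^sup>2 / cc"
    using circ_sq[of t] by (simp add: add_divide_distrib[symmetric])
  ultimately show "1 / cc \<le> qq t" by (simp add: qq_def)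
  then show "0 < qq t" using cc_gt by (smt (verit) divide_pos_pos)
qed

text \<open>Along a meridian the level is proportional to the rescaled height, so changing from
  height to level is a linear substitution.\<close>

lemma hlev_arch:
  assumes "0 < s" "s < 1"
  shows "hlev (arch s t) = kk * qq t * s"
proof -
  have "(2 * sqrt (s * (1 - s)) * Re (circ t))\<^sup>2 = 4 * s * (1 - s) * (Re (circ t))\<^sup>2"
    "(2 * sqrt (s * (1 - s)) * Im (circ t))\<^sup>2 = 4 * s * (1 - s) * (Im (circ t))\<^sup>2"
    using assms by (simp_all add: power_mult_distrib)
  then have "hlev (arch s t) = kk / 2 * (4 * s * (1 - s) * (Re (circ t))\<^sup>2 / cc + 4 * s * (1 - s) * (Im (circ t))\<^sup>2 / (cc - 1)) / (1 - (2 * s - 1))"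
    unfolding hlev_def arch_nth by simp
  also have "\<dots> = kk / 2 * (4 * s * (1 - s) * qq t) / (2 * (1 - s))"
    unfolding qq_def by (simp add: distrib_left)
  also have "\<dots> = kk * qq t * s" using assms by (simp add: field_simps)
  finally show ?thesis .
qed

lemma gam_Re [simp]: "Re (gam W t) = axA W * Re (circ t)" and gam_Im [simp]: "Im (gam W t) = axB W * Im (circ t)"
  by (simp_all add: gam_def)

lemma gam_norm2: "(cmod (gam W t))\<^sup>2 = (axA W)\<^sup>2 * (Re (circ t))\<^sup>2 + (axB W)\<^sup>2 * (Im (circ t))\<^sup>2"
  unfolding cmod_power2 by (simp add: power_mult_distrib)

lemma one_plus_gam:
  assumes "0 < W" "W < Wmax"
  shows "1 + (cmod (gam W t))\<^sup>2 = (ss W + (Re (circ t))\<^sup>2) * (ss W + cc) / (ss W * (1 + ss W))"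
proof -
  note W = W_facts[OF assms]
  have i: "(Im (circ t))\<^sup>2 = 1 - (Re (circ t))\<^sup>2" using circ_sq[of t] by simp
  show ?thesis unfolding gam_norm2 W(9,10) i using W(1) by (simp add: divide_simps) (simp add: algebra_simps)
qed

lemma gam_pos:
  assumes "0 < W" "W < Wmax"
  shows "0 < cmod (gam W t)"
proof -
  have "gam W t \<noteq> 0"
  proof
    assume "gam W t = 0"
    then have "Re (circ t) = 0" "Im (circ t) = 0"
      using W_facts(7,8)[OF assms] by (auto simp: complex_eq_iff)
    then show False using circ_sq[of t] by simp
  qed
  then show ?thesis by simp
qed

text \<open>The argument of \<^term>\<open>gam W t\<close> in turns, made continuous in \<open>t\<close> by writing it as a deviation
  from \<open>t\<close>.\<close>

definition ang :: "real \<Rightarrow> real \<Rightarrow> real" where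
  "ang W t = t - arctan ((axA W - axB W) * (Im (circ t) * Re (circ t)) /
     (axA W * (Re (circ t))\<^sup>2 + axB W * (Im (circ t))\<^sup>2)) / (2 * pi)"

lemma circ_add: "circ (s + t) = circ s * circ t"
  by (simp add: circ_def exp_add[symmetric] algebra_simps)

text \<open>D and N are real and imaginary part of \<open>circ t\<close> times the conjugate of
  \<open>gam W t\<close>. As D > 0, their angle stays in (-pi/2, pi/2) and the arctangent needs no
  choice of branch.\<close>

lemma circ_ang:
  assumes "0 < W" "W < Wmax"
  shows "circ (ang W t) = gam W t / of_real (cmod (gam W t))"
proof -
  note W = W_facts[OF assms]
  define c where "c = Re (circ t)"
  define s where "s = Im (circ t)"
  define A where "A = axA W"
  define B where "B = axB W"
  define N where "N = (A - B) * (s * c)"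
  define D where "D = A * c\<^sup>2 + B * s\<^sup>2"
  have cs: "c\<^sup>2 + s\<^sup>2 = 1" unfolding c_def s_def by (rule circ_sq)
  have AB: "0 < A" "0 < B" using W by (simp_all add: A_def B_def)
  have D: "0 < D"
  proof (cases "c = 0")
    case True
    then show ?thesis using cs AB by (simp add: D_def)
  next
    case False
    then show ?thesis using AB by (simp add: D_def add_pos_nonneg)
  qed
  have DN: "D\<^sup>2 + N\<^sup>2 = (cmod (gam W t))\<^sup>2"
  proof -
    have "D\<^sup>2 + N\<^sup>2 = (A\<^sup>2 * c\<^sup>2 + B\<^sup>2 * s\<^sup>2) * (c\<^sup>2 + s\<^sup>2)"
      by (simp add: D_def N_def power2_eq_square algebra_simps)
    then show ?thesis unfolding cs gam_norm2 by (simp add: A_def B_def c_def s_def)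
  qed
  have R: "sqrt (1 + (N / D)\<^sup>2) = cmod (gam W t) / D"
  proof -
    have "1 + (N / D)\<^sup>2 = (cmod (gam W t) / D)\<^sup>2"
      unfolding power_divide DN[symmetric] using D by (simp add: field_simps)
    then show ?thesis using D by simp
  qed
  have "circ (ang W t) = circ t * cis (- arctan (N / D))"
  proof -
    have "ang W t = t + (- arctan (N / D) / (2 * pi))" by (simp add: ang_def N_def D_def A_def B_def c_def s_def)
    then have "circ (ang W t) = circ t * circ (- arctan (N / D) / (2 * pi))" by (simp only: circ_add)
    also have "circ (- arctan (N / D) / (2 * pi)) = cis (- arctan (N / D))" by (simp add: circ_cis)
    finally show ?thesis .
  qed
  also have "cis (- arctan (N / D)) = (of_real D - \<i> * of_real N) / of_real (cmod (gam W t))"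
    using D gam_pos[OF assms, of t]
    by (simp add: complex_eq_iff cos_arctan sin_arctan R Re_divide_of_real Im_divide_of_real)
  also have "circ t * ((of_real D - \<i> * of_real N) / of_real (cmod (gam W t))) = gam W t / of_real (cmod (gam W t))"
  proof -
    have 1: "c * D + s * N = A * c" and 2: "s * D - c * N = B * s"
    proof -
      have "c * D + s * N = A * c * (c\<^sup>2 + s\<^sup>2)" by (simp add: D_def N_def power2_eq_square algebra_simps)
      then show "c * D + s * N = A * c" by (simp add: cs)
      have "s * D - c * N = B * s * (c\<^sup>2 + s\<^sup>2)" by (simp add: D_def N_def power2_eq_square algebra_simps)
      then show "s * D - c * N = B * s" by (simp add: cs)
    qed
    have "circ t * (of_real D - \<i> * of_real N) = gam W t"
      using 1 2 by (simp add: complex_eq_iff A_def B_def c_def s_def)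
    then show ?thesis by simp
  qed
  finally show ?thesis .
qed

lemma Re_circ_deriv: "((\<lambda>t. Re (circ t)) has_real_derivative - 2 * pi * Im (circ t)) (at t)"
  and Im_circ_deriv: "((\<lambda>t. Im (circ t)) has_real_derivative 2 * pi * Re (circ t)) (at t)"
  by (auto simp: circ_cis intro!: derivative_eq_intros)

text \<open>The angular speed (x y' - y x') / (x^2 + y^2) of an ellipse in its standard
  parametrization, in turns: the numerator is constant.\<close>

lemma ang_deriv:
  assumes "0 < W" "W < Wmax"
  shows "(ang W has_real_derivative axA W * axB W / (cmod (gam W t))\<^sup>2) (at t)"
proof -
  note W = W_facts[OF assms]
  define c where "c = Re (circ t)"
  define s where "s = Im (circ t)"
  define A where "A = axA W"
  define B where "B = axB W"
  define N where "N = (A - B) * (s * c)"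
  define D where "D = A * c\<^sup>2 + B * s\<^sup>2"
  have cs: "c\<^sup>2 + s\<^sup>2 = 1" unfolding c_def s_def by (rule circ_sq)
  have AB: "0 < A" "0 < B" using W by (simp_all add: A_def B_def)
  have D: "0 < D"
  proof (cases "c = 0")
    case True
    then show ?thesis using cs AB by (simp add: D_def)
  next
    case False
    then show ?thesis using AB by (simp add: D_def add_pos_nonneg)
  qed
  define N' where "N' = 2 * pi * ((A - B) * (c\<^sup>2 - s\<^sup>2))"
  define D' where "D' = 2 * pi * (2 * (B - A) * (s * c))"
  let ?N = "\<lambda>t. (A - B) * (Im (circ t) * Re (circ t))" and ?D = "\<lambda>t. A * (Re (circ t))\<^sup>2 + B * (Im (circ t))\<^sup>2"
  have N': "(?N has_real_derivative N') (at t)"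
    by (rule derivative_eq_intros Re_circ_deriv Im_circ_deriv refl)+
      (simp add: N'_def c_def s_def power2_eq_square algebra_simps)
  have D': "(?D has_real_derivative D') (at t)"
    by (rule derivative_eq_intros Re_circ_deriv Im_circ_deriv refl)+
      (simp add: D'_def c_def s_def power2_eq_square algebra_simps)
  have Dt: "?D t = D" "?N t = N" by (simp_all add: D_def N_def c_def s_def)
  have "((\<lambda>t. ?N t / ?D t) has_real_derivative (N' * D - N * D') / (D * D)) (at t)"
    using DERIV_divide[OF N' D'] D unfolding Dt by simp
  from DERIV_chain2[OF DERIV_arctan this]
  have "((\<lambda>t. arctan (?N t / ?D t)) has_real_derivative inverse (1 + (N / D)\<^sup>2) * ((N' * D - N * D') / (D * D))) (at t)"
    unfolding Dt .
  from DERIV_diff[OF DERIV_ident DERIV_cdivide[OF this, of "2 * pi"]]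
  have d: "(ang W has_real_derivative 1 - inverse (1 + (N / D)\<^sup>2) * ((N' * D - N * D') / (D * D)) / (2 * pi)) (at t)"
    unfolding ang_def[abs_def] A_def B_def .
  have DN: "D\<^sup>2 + N\<^sup>2 = A\<^sup>2 * c\<^sup>2 + B\<^sup>2 * s\<^sup>2"
  proof -
    have "D\<^sup>2 + N\<^sup>2 = (A\<^sup>2 * c\<^sup>2 + B\<^sup>2 * s\<^sup>2) * (c\<^sup>2 + s\<^sup>2)"
      by (simp add: D_def N_def power2_eq_square algebra_simps)
    then show ?thesis by (simp add: cs)
  qed
  have g: "(cmod (gam W t))\<^sup>2 = D\<^sup>2 + N\<^sup>2" unfolding DN gam_norm2 by (simp add: A_def B_def c_def s_def)
  have num: "(N' * D - N * D') / (2 * pi) = D\<^sup>2 + N\<^sup>2 - A * B"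
  proof -
    have "(N' * D - N * D') / (2 * pi) = (A - B) * ((c\<^sup>2 - s\<^sup>2) * D) + 2 * (A - B)\<^sup>2 * (s * c)\<^sup>2"
      by (simp add: N'_def D'_def N_def power2_eq_square field_simps)
    also have "\<dots> = A\<^sup>2 * c\<^sup>2 + B\<^sup>2 * s\<^sup>2 - A * B"
    proof -
      have s2: "s\<^sup>2 = 1 - c\<^sup>2" using cs by simp
      show ?thesis unfolding D_def power_mult_distrib s2 by (simp add: power2_eq_square algebra_simps)
    qed
    finally show ?thesis unfolding DN .
  qed
  have "inverse (1 + (N / D)\<^sup>2) * ((N' * D - N * D') / (D * D)) / (2 * pi) = ((N' * D - N * D') / (2 * pi)) / (D\<^sup>2 + N\<^sup>2)"
  proof -
    have "1 + (N / D)\<^sup>2 = (D\<^sup>2 + N\<^sup>2) / D\<^sup>2" using D by (simp add: power_divide field_simps)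
    then show ?thesis using D by (simp add: power2_eq_square)
  qed
  also have "\<dots> = 1 - A * B / (D\<^sup>2 + N\<^sup>2)"
    unfolding num using D by (simp add: diff_divide_distrib add_pos_nonneg)
  finally have "1 - inverse (1 + (N / D)\<^sup>2) * ((N' * D - N * D') / (D * D)) / (2 * pi) = A * B / (cmod (gam W t))\<^sup>2"
    unfolding g by simp
  with d show ?thesis by (simp add: A_def B_def)
qed

end

lemma measurable_arch2 [measurable (raw)]:
  assumes [measurable]: "f \<in> borel_measurable M" "g \<in> borel_measurable M"
  shows "(\<lambda>x. arch (f x) (g x)) \<in> borel_measurable M"
proof -
  have "(\<lambda>p. arch (fst p) (snd p)) \<circ> (\<lambda>x. (f x, g x)) \<in> borel_measurable M"
    by (rule measurable_comp[of _ _ "borel \<Otimes>\<^sub>M borel"]) (use measurable_arch in \<open>simp_all add: split_def\<close>)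
  then show ?thesis by (simp add: comp_def)
qed

context ellipse_family
begin

lemma measurable_ellipse_params [measurable]:
  "ss \<in> borel_measurable borel" "rS \<in> borel_measurable borel" "rT \<in> borel_measurable borel"
  "axA \<in> borel_measurable borel" "axB \<in> borel_measurable borel" "pM \<in> borel_measurable borel"
  "qq \<in> borel_measurable borel" "hlev \<in> borel_measurable borel"
  unfolding ss_def[abs_def] rS_def[abs_def] rT_def[abs_def] axA_def[abs_def] axB_def[abs_def] pM_def[abs_def]
    qq_def[abs_def] hlev_def[abs_def] by measurable

lemma measurable_gam [measurable (raw)]:
  assumes [measurable]: "f \<in> borel_measurable M" "g \<in> borel_measurable M"
  shows "(\<lambda>x. gam (f x) (g x)) \<in> borel_measurable M"
  unfolding gam_def by measurable

text \<open>The point of the leaf with parameter \<open>t\<close> has longitude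
  \<open>ang W t\<close> and rescaled height \<open>W / (kk * qq (ang W t))\<close>. The product of
  the two one-dimensional Jacobians, of height against level and of longitude against
  \<open>t\<close>, is the Poisson kernel.\<close>

lemma arch_gam:
  assumes W: "0 < W" "W < Wmax"
  shows "arch (W / (kk * qq (ang W t))) (ang W t) = sph (gam W t)"
    and "axA W * axB W / (cmod (gam W t))\<^sup>2 / (kk * qq (ang W t)) = poisson2 (pM W) (circ t)"
    and "hlev (sph (gam W t)) = W" "sph (gam W t) $ 3 < 1"
proof -
  note F = W_facts[OF W]
  let ?R2 = "(cmod (gam W t))\<^sup>2" and ?c2 = "(Re (circ t))\<^sup>2"
  note g = gam_pos[OF W, of t]
  have i: "(Im (circ t))\<^sup>2 = 1 - ?c2" using circ_sq[of t] by simp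
  have re: "Re (circ (ang W t)) = axA W * Re (circ t) / cmod (gam W t)"
    "Im (circ (ang W t)) = axB W * Im (circ t) / cmod (gam W t)"
    by (simp_all add: circ_ang[OF W] Re_divide_of_real Im_divide_of_real)
  have q: "qq (ang W t) = (ss W + ?c2) / (ss W * (1 + ss W)) / ?R2"
  proof -
    have "qq (ang W t) = ((axA W)\<^sup>2 * ?c2 / cc + (axB W)\<^sup>2 * (Im (circ t))\<^sup>2 / (cc - 1)) / ?R2"
      unfolding qq_def re by (simp add: power_divide power_mult_distrib add_divide_distrib mult.commute)
    also have "(axA W)\<^sup>2 * ?c2 / cc + (axB W)\<^sup>2 * (Im (circ t))\<^sup>2 / (cc - 1) = ?c2 / ss W + (1 - ?c2) / (1 + ss W)"
      unfolding F(9,10) i using cc_gt by simp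
    also have "\<dots> = (ss W + ?c2) / (ss W * (1 + ss W))"
      using F(1) by (simp add: divide_simps) (simp add: algebra_simps)
    finally show ?thesis .
  qed
  have pos: "0 < ss W + ?c2" using F(1) by (simp add: add_pos_nonneg)
  \<comment> \<open>The rescaled height; for the image of z it has to be \<bar>z\<bar>^2 / (1 +
    \<bar>z\<bar>^2).\<close>
  define \<sigma> where "\<sigma> = W / (kk * qq (ang W t))"
  have \<sigma>: "\<sigma> = ?R2 / (1 + ?R2)"
  proof -
    have "\<sigma> = (kk / (ss W + cc)) / (kk * qq (ang W t))" unfolding \<sigma>_def using F(2) by simp
    also have "\<dots> = 1 / ((ss W + cc) * qq (ang W t))" using kk_pos by simp
    also have "(ss W + cc) * qq (ang W t) = (1 + ?R2) / ?R2"
      unfolding q one_plus_gam[OF W] using F(1) by (simp add: mult.commute)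
    finally show ?thesis by simp
  qed
  have R1: "0 < 1 + ?R2" by simp
  have s1: "1 - \<sigma> = 1 / (1 + ?R2)" unfolding \<sigma> using R1 by (simp add: field_simps del: one_plus_cmod2_pos)
  have sq: "sqrt (\<sigma> * (1 - \<sigma>)) = cmod (gam W t) / (1 + ?R2)"
  proof -
    have "\<sigma> * (1 - \<sigma>) = (cmod (gam W t) / (1 + ?R2))\<^sup>2" unfolding s1 unfolding \<sigma> by (simp add: power_divide power2_eq_square)
    then show ?thesis using R1 by simp
  qed
  show "arch (W / (kk * qq (ang W t))) (ang W t) = sph (gam W t)"
  proof -
    have "2 * \<sigma> - 1 = (?R2 - 1) / (?R2 + 1)" unfolding \<sigma> using R1 by (simp add: field_simps del: one_plus_cmod2_pos)
    then show ?thesis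
      unfolding \<sigma>_def[symmetric] vec_eq_iff forall_3 arch_nth sph_nth sq re gam_Re gam_Im using g by (simp add: add.commute)
  qed
  have "axA W * axB W / ?R2 / (kk * qq (ang W t)) = rS W * rT W / (ss W + ?c2)"
  proof -
    have "axA W * axB W / ?R2 / (kk * qq (ang W t)) = (kk / (rS W * rT W)) / (kk * ((ss W + ?c2) / (ss W * (1 + ss W))))"
      unfolding F(11) q using g by simp
    also have "\<dots> = (ss W * (1 + ss W)) / (rS W * rT W) / (ss W + ?c2)" using kk_pos by simp
    also have "ss W * (1 + ss W) = (rS W * rT W) * (rS W * rT W)"
      using F(5,6) by (simp add: power2_eq_square mult_ac)
    finally show ?thesis using F(3,4) by simp
  qed
  then show "axA W * axB W / (cmod (gam W t))\<^sup>2 / (kk * qq (ang W t)) = poisson2 (pM W) (circ t)"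
    by (simp add: poisson2_pM[OF W])
  have \<sigma>b: "0 < \<sigma>" "\<sigma> < 1" using g R1 unfolding \<sigma> by (simp_all add: divide_simps)
  have "hlev (sph (gam W t)) = hlev (arch \<sigma> (ang W t))"
    using \<open>arch (W / (kk * qq (ang W t))) (ang W t) = sph (gam W t)\<close> by (simp add: \<sigma>_def)
  also have "\<dots> = W" unfolding hlev_arch[OF \<sigma>b] using kk_pos qq_pos(2)[of "ang W t"] by (simp add: \<sigma>_def)
  finally show "hlev (sph (gam W t)) = W" .
  have "?R2 + 1 > 0" using R1 by (simp only: add.commute)
  then have "(?R2 - 1) / (?R2 + 1) < 1" by (subst divide_less_eq_1_pos) simp_all
  then show "sph (gam W t) $ 3 < 1" by (simp only: sph_nth)
qed

lemma ang_0 [simp]: "ang W 0 = 0" and ang_1 [simp]: "ang W 1 = 1"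
  by (simp_all add: ang_def circ_cis)

section \<open>Disintegration of the surface measure into leaves\<close>

lemma circle_substitution:
  assumes W: "0 < W" "W < Wmax" and [measurable]: "F \<in> borel_measurable borel"
  shows "(\<integral>\<^sup>+t. ennreal (1 / (kk * qq t)) * F (arch (W / (kk * qq t)) t) \<partial>uiv)
    = (\<integral>\<^sup>+t. ennreal (poisson2 (pM W) (circ t)) * F (sph (gam W t)) \<partial>uiv)"
proof -
  let ?f = "\<lambda>t. ennreal (1 / (kk * qq t)) * F (arch (W / (kk * qq t)) t)"
  have [measurable]: "?f \<in> borel_measurable borel" by measurable
  let ?g' = "\<lambda>t. axA W * axB W / (cmod (gam W t))\<^sup>2"
  have "continuous_on {0..1} ?g'"
  proof -
    have c: "continuous_on {0..1} (\<lambda>t. gam W t)"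
      unfolding gam_def by (intro continuous_intros continuous_on_Re continuous_on_Im)
    have "cmod (gam W t) \<noteq> 0" for t using gam_pos[OF W, of t] by simp
    then show ?thesis by (intro continuous_intros c) auto
  qed
  moreover have nn: "0 \<le> ?g' t" for t using W_facts(7,8)[OF W] by simp
  ultimately have "(\<integral>\<^sup>+t. ?f t * indicator {ang W 0..ang W 1} t \<partial>lborel)
      = (\<integral>\<^sup>+t. ?f (ang W t) * ennreal (?g' t) * indicator {0..1} t \<partial>lborel)"
    by (intro nn_integral_substitution_aux ang_deriv[OF W]) auto
  also have "\<dots> = (\<integral>\<^sup>+t. ennreal (poisson2 (pM W) (circ t)) * F (sph (gam W t)) * indicator {0..1} t \<partial>lborel)"
  proof (intro nn_integral_cong)
    fix t
    have e: "ennreal (1 / (kk * qq (ang W t))) * ennreal (?g' t) = ennreal (poisson2 (pM W) (circ t))"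
      unfolding arch_gam(2)[OF W, symmetric] using nn[of t] by (simp add: ennreal_mult''[symmetric] mult.commute)
    show "?f (ang W t) * ennreal (?g' t) * indicator {0..1} t
        = ennreal (poisson2 (pM W) (circ t)) * F (sph (gam W t)) * indicator {0..1} t"
      unfolding arch_gam(1)[OF W] e[symmetric] by (simp only: mult_ac)
  qed
  finally show ?thesis by (subst (1 2) nn_integral_uiv) simp_all
qed

text \<open>On each meridian the level replaces the height; after exchanging the integrals the
  Joukowski parameter replaces the longitude on each level. The leaf laws have total mass one, which
  is why a level equals the measure of the region below it.\<close>

lemma foliation:
  assumes [measurable]: "F \<in> borel_measurable borel"
  shows "(\<integral>\<^sup>+y. indicator {y. hlev y < Wmax} y * F y \<partial>surface_measure)
    = (\<integral>\<^sup>+W. indicator {0<..<Wmax} W * (\<integral>\<^sup>+t. ennreal (poisson2 (pM W) (circ t)) * F (sph (gam W t)) \<partial>uiv) \<partial>lborel)"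
proof -
  \<comment> \<open>The level at the upper end of any meridian is at least \<open>Wmax\<close>;
    hence all levels below \<open>Wmax\<close> occur on every meridian within
    \<open>s \<le> 1\<close>.\<close>
  have Wm: "Wmax < kk * qq t \<or> Wmax = kk * qq t" for t
    using mult_left_mono[OF qq_pos(1)[of t], of kk] kk_pos by (auto simp: Wmax_def le_less)
  have kq: "0 < kk * qq t" for t using kk_pos qq_pos(2) by simp
  have "(\<integral>\<^sup>+y. indicator {y. hlev y < Wmax} y * F y \<partial>surface_measure)
      = (\<integral>\<^sup>+s. \<integral>\<^sup>+t. indicator {y. hlev y < Wmax} (arch s t) * F (arch s t) \<partial>uiv \<partial>uiv)"
    unfolding surface_measure_eq_arch by (rule nn_integral_arch_measure) measurable
  also have "\<dots> = (\<integral>\<^sup>+s. \<integral>\<^sup>+t. indicator {..<Wmax} (kk * qq t * s) * F (arch s t) \<partial>uiv \<partial>uiv)"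
    using AE_uiv_bounds
    by (intro nn_integral_cong_AE, eventually_elim) (auto intro!: nn_integral_cong simp: hlev_arch indicator_def)
  also have "\<dots> = (\<integral>\<^sup>+t. \<integral>\<^sup>+s. indicator {..<Wmax} (kk * qq t * s) * F (arch s t) \<partial>uiv \<partial>uiv)"
    by (rule uiv2.Fubini'[symmetric]) measurable
  also have "\<dots> = (\<integral>\<^sup>+t. \<integral>\<^sup>+W. indicator {0<..<Wmax} W * (ennreal (1 / (kk * qq t)) * F (arch (W / (kk * qq t)) t)) \<partial>lborel \<partial>uiv)"
  proof (rule nn_integral_cong)
    fix t
    have "(\<integral>\<^sup>+s. indicator {..<Wmax} (kk * qq t * s) * F (arch s t) \<partial>uiv)
      = (\<integral>\<^sup>+s. indicator {..<Wmax} (kk * qq t * s) * F (arch s t) * indicator {0..1} s \<partial>lborel)"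
      by (rule nn_integral_uiv) measurable
    also have "\<dots> = (\<integral>\<^sup>+s. indicator {0<..<Wmax} (kk * qq t * s) * F (arch s t) \<partial>lborel)"
    proof (rule nn_integral_cong_AE)
      have "AE s in lborel. s \<noteq> (0::real)" by (rule AE_lborel_singleton)
      then show "AE s in lborel. indicator {..<Wmax} (kk * qq t * s) * F (arch s t) * indicator {0..1} s
          = indicator {0<..<Wmax} (kk * qq t * s) * F (arch s t)"
      proof eventually_elim
        case (elim s)
        have "kk * qq t * s < Wmax \<Longrightarrow> s \<le> 1"
        proof (rule ccontr)
          assume *: "kk * qq t * s < Wmax" "\<not> s \<le> 1"
          then have "kk * qq t * 1 < kk * qq t * s" using kq[of t] by (intro mult_strict_left_mono) auto
          then show False using * Wm[of t] by auto
        qed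
        moreover have "0 < a * s \<longleftrightarrow> 0 < s" if "0 < a" for a using that by (simp add: zero_less_mult_iff)
        from this[OF kq[of t]] have "0 < kk * qq t * s \<longleftrightarrow> 0 < s" .
        ultimately show ?case using elim by (auto simp: indicator_def)
      qed
    qed
    also have "\<dots> = ennreal \<bar>1 / (kk * qq t)\<bar> * (\<integral>\<^sup>+W. indicator {0<..<Wmax} (kk * qq t * (0 + 1 / (kk * qq t) * W)) * F (arch (0 + 1 / (kk * qq t) * W) t) \<partial>lborel)"
      using kq[of t] by (intro nn_integral_real_affine) auto
    also have "\<dots> = (\<integral>\<^sup>+W. indicator {0<..<Wmax} W * (ennreal (1 / (kk * qq t)) * F (arch (W / (kk * qq t)) t)) \<partial>lborel)"
      using kq[of t] kk_pos qq_pos(2)[of t]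
      by (subst nn_integral_cmult[symmetric]) (auto intro!: nn_integral_cong simp: mult_ac)
    finally show "(\<integral>\<^sup>+s. indicator {..<Wmax} (kk * qq t * s) * F (arch s t) \<partial>uiv)
      = (\<integral>\<^sup>+W. indicator {0<..<Wmax} W * (ennreal (1 / (kk * qq t)) * F (arch (W / (kk * qq t)) t)) \<partial>lborel)" .
  qed
  also have "\<dots> = (\<integral>\<^sup>+W. \<integral>\<^sup>+t. indicator {0<..<Wmax} W * (ennreal (1 / (kk * qq t)) * F (arch (W / (kk * qq t)) t)) \<partial>uiv \<partial>lborel)"
  proof -
    interpret p: pair_sigma_finite lborel uiv ..
    show ?thesis by (rule p.Fubini') (simp add: split_def)
  qed
  also have "\<dots> = (\<integral>\<^sup>+W. indicator {0<..<Wmax} W * (\<integral>\<^sup>+t. ennreal (poisson2 (pM W) (circ t)) * F (sph (gam W t)) \<partial>uiv) \<partial>lborel)"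
  proof (rule nn_integral_cong)
    fix W
    show "(\<integral>\<^sup>+t. indicator {0<..<Wmax} W * (ennreal (1 / (kk * qq t)) * F (arch (W / (kk * qq t)) t)) \<partial>uiv)
      = indicator {0<..<Wmax} W * (\<integral>\<^sup>+t. ennreal (poisson2 (pM W) (circ t)) * F (sph (gam W t)) \<partial>uiv)"
      using circle_substitution[of W F] by (cases "W \<in> {0<..<Wmax}") auto
  qed
  finally show ?thesis .
qed

section \<open>Logarithmic potentials of the leaves\<close>

definition al :: "real \<Rightarrow> real" where "al W = (axA W + axB W) / 2"
definition be :: "real \<Rightarrow> real" where "be W = (axA W - axB W) / 2"
definition eta :: "real \<Rightarrow> real" where "eta W = rS W + rT W"

text \<open>The two identities with b say that the Joukowski map of the leaf takes i eta to ib and i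
  / eta to -i/b. So the poles +-i / eta of the leaf law and their mirror images lie over the
  singularities of the field and over the charges, for every level.\<close>

lemma al_be:
  assumes W: "0 < W" "W < Wmax"
  shows "0 < be W" "be W < al W" "0 < al W" "1 < eta W" "pM W = 1 / (eta W)\<^sup>2" "al W * eta W - be W / eta W = b"
    "be W * eta W - al W / eta W = 1 / b" "axA W = al W + be W" "axB W = al W - be W"
proof -
  note F = W_facts[OF W]
  show AB: "axA W = al W + be W" "axB W = al W - be W" by (simp_all add: al_def be_def field_simps)
  have T: "0 < rT W" using F by linarith
  have "axB W < axA W"
  proof -
    have "sh / rT W < ch / rT W" using T ch_sh by (simp add: divide_strict_right_mono)
    also have "\<dots> < ch / rS W" using F T ch_sh by (intro divide_strict_left_mono) auto
    finally show ?thesis by (simp add: axA_def axB_def)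
  qed
  then show "0 < be W" by (simp add: be_def)
  show "be W < al W" "0 < al W" using F(7,8) by (simp_all add: al_def be_def)
  have "1 < rT W" using F(1) by (simp add: rT_def)
  then show "1 < eta W" using F by (simp add: eta_def)
  have e: "(rT W - rS W) * eta W = 1" using F(5,6) by (simp add: eta_def power2_eq_square algebra_simps)
  then have ie: "1 / eta W = rT W - rS W" using \<open>1 < eta W\<close> by (simp add: field_simps)
  show "pM W = 1 / (eta W)\<^sup>2" by (simp add: pM_def ie[symmetric] power_divide)
  have AS: "axA W * rS W = ch" "axB W * rT W = sh" using F T by (simp_all add: axA_def axB_def)
  have "al W * eta W - be W * (1 / eta W) = axA W * rS W + axB W * rT W"
    unfolding ie by (simp add: al_def be_def eta_def field_simps)
  then show "al W * eta W - be W / eta W = b" using AS ch_sh by simp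
  have "be W * eta W - al W * (1 / eta W) = axA W * rS W - axB W * rT W"
    unfolding ie by (simp add: al_def be_def eta_def field_simps)
  then show "be W * eta W - al W / eta W = 1 / b" using AS ch_sh by simp
qed

lemma gam_eq: "gam W t = of_real (al W) * circ t + of_real (be W) / circ t"
proof -
  have "1 / circ t = cnj (circ t)" by (simp add: cnj_circ)
  then have e: "of_real (be W) / circ t = of_real (be W) * cnj (circ t)" by (metis times_divide_eq_right mult.right_neutral)
  show ?thesis unfolding e by (simp add: complex_eq_iff al_def be_def field_simps)
qed

text \<open>The points \<open>u\<close> and \<open>v\<close> are the two preimages of \<open>z\<close> under the Joukowski map
  \<open>w \<mapsto> al W * w + be W / w\<close>, which sends the unit circle onto the leaf of level \<open>W\<close>.\<close>

definition rts :: "real \<Rightarrow> complex \<Rightarrow> complex \<Rightarrow> complex \<Rightarrow> bool" where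
  "rts W z u v \<longleftrightarrow> u * v = of_real (be W / al W) \<and> u + v = z / of_real (al W) \<and> cmod v \<le> cmod u"

lemma rts_exist:
  assumes W: "0 < W" "W < Wmax"
  obtains u v where "rts W z u v"
proof -
  note F = al_be[OF W]
  have a: "complex_of_real (al W) \<noteq> 0" using F by simp
  define d where "d = csqrt (z\<^sup>2 - 4 * of_real (al W * be W))"
  have d2: "d\<^sup>2 = z\<^sup>2 - 4 * of_real (al W * be W)" by (simp add: d_def)
  let ?r = "(z + d) / (2 * of_real (al W))" and ?q = "(z - d) / (2 * of_real (al W))"
  have s: "?r + ?q = z / of_real (al W)" using a by (simp add: field_simps)
  have "?r * ?q = (z\<^sup>2 - d\<^sup>2) / (4 * (of_real (al W))\<^sup>2)" by (simp add: power2_eq_square algebra_simps)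
  then have p: "?r * ?q = of_real (be W / al W)" unfolding d2 using a by (simp add: power2_eq_square)
  show ?thesis
  proof (cases "cmod ?q \<le> cmod ?r")
    case True
    then show ?thesis using s p by (intro that[of ?r ?q]) (simp add: rts_def)
  next
    case False
    then show ?thesis using s p by (intro that[of ?q ?r]) (simp add: rts_def add.commute mult.commute)
  qed
qed

text \<open>The preimages are separated by the circle of radius sqrt (be / al), which the map folds
  onto the focal segment. The last two factorizations hold because +-ib and +-i/b are values of the
  map at +-i eta and +-i / eta.\<close>

lemma rts_facts:
  assumes W: "0 < W" "W < Wmax" and r: "rts W z u v"
  shows "u \<noteq> 0" "v \<noteq> 0" "cmod v < 1" "be W / al W \<le> (cmod u)\<^sup>2" "(cmod v)\<^sup>2 \<le> be W / al W"
    "z = of_real (al W) * u + of_real (be W) / u"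
    "w \<noteq> 0 \<Longrightarrow> z - (of_real (al W) * w + of_real (be W) / w) = - (of_real (al W) / w) * (w - u) * (w - v)"
    "z\<^sup>2 + (of_real b)\<^sup>2 = of_real ((al W)\<^sup>2 * (eta W)\<^sup>2) * (1 + of_real (pM W) * u\<^sup>2) * (1 + of_real (pM W) * v\<^sup>2)"
    "z\<^sup>2 + (of_real (1 / b))\<^sup>2 = of_real ((al W)\<^sup>2 * (eta W)\<^sup>2) * (of_real (pM W) + u\<^sup>2) * (of_real (pM W) + v\<^sup>2)"
proof -
  note F = al_be[OF W]
  have a: "complex_of_real (al W) \<noteq> 0" using F by simp
  have p: "u * v = of_real (be W / al W)" and s: "u + v = z / of_real (al W)" and le: "cmod v \<le> cmod u"
    using r by (auto simp: rts_def)
  have R: "0 < be W / al W" "be W / al W < 1" using F by simp_all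
  have "u * v \<noteq> 0" unfolding p using F by simp
  then show u: "u \<noteq> 0" "v \<noteq> 0" by auto
  have pn: "cmod u * cmod v = be W / al W"
    using arg_cong[OF p, of cmod] R(1) unfolding norm_mult norm_of_real by (simp only: abs_of_pos)
  have "cmod v * cmod v \<le> cmod u * cmod v" using le by (rule mult_right_mono) simp
  then show v2: "(cmod v)\<^sup>2 \<le> be W / al W" by (simp add: pn power2_eq_square)
  have "cmod u * cmod v \<le> cmod u * cmod u" using le by (rule mult_left_mono) simp
  then show "be W / al W \<le> (cmod u)\<^sup>2" by (simp add: pn power2_eq_square)
  show "cmod v < 1" using v2 R by (smt (verit) one_le_power)
  have z: "z = of_real (al W) * (u + v)" using s a by simp
  have bu: "of_real (be W) = of_real (al W) * (u * v)" unfolding p using a by simp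
  show "z = of_real (al W) * u + of_real (be W) / u" unfolding z bu using u by (simp add: distrib_left)
  show "z - (of_real (al W) * w + of_real (be W) / w) = - (of_real (al W) / w) * (w - u) * (w - v)" if "w \<noteq> 0"
    unfolding z bu using that by (simp add: field_simps)
  have e: "0 < eta W" using F by simp
  have zz: "z\<^sup>2 = (of_real (al W))\<^sup>2 * (u\<^sup>2 + v\<^sup>2) + 2 * of_real (al W * be W)"
    unfolding z of_real_mult bu by (simp add: power2_eq_square algebra_simps)
  have uv2: "(of_real (al W))\<^sup>2 * (u\<^sup>2 * v\<^sup>2) = complex_of_real ((be W)\<^sup>2)"
    unfolding of_real_power bu by (simp add: power2_eq_square)
  have Mc: "complex_of_real (pM W) = 1 / (of_real (eta W))\<^sup>2" by (simp add: F(5))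
  have ec: "complex_of_real (eta W) \<noteq> 0" using e by simp
  have "of_real ((al W)\<^sup>2 * (eta W)\<^sup>2) * (1 + of_real (pM W) * u\<^sup>2) * (1 + of_real (pM W) * v\<^sup>2)
     = (of_real (al W * eta W))\<^sup>2 + (of_real (al W))\<^sup>2 * (u\<^sup>2 + v\<^sup>2) + (of_real (al W))\<^sup>2 * (u\<^sup>2 * v\<^sup>2) / (of_real (eta W))\<^sup>2"
    unfolding Mc using ec by (simp add: field_simps)
  also have "\<dots> = z\<^sup>2 + of_real ((al W * eta W - be W / eta W)\<^sup>2)"
    unfolding uv2 zz using ec by (simp add: power2_eq_square field_simps)
  finally show "z\<^sup>2 + (of_real b)\<^sup>2 = of_real ((al W)\<^sup>2 * (eta W)\<^sup>2) * (1 + of_real (pM W) * u\<^sup>2) * (1 + of_real (pM W) * v\<^sup>2)"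
    by (simp add: F(6))
  have "of_real ((al W)\<^sup>2 * (eta W)\<^sup>2) * (of_real (pM W) + u\<^sup>2) * (of_real (pM W) + v\<^sup>2)
     = (of_real (al W))\<^sup>2 / (of_real (eta W))\<^sup>2 + (of_real (al W))\<^sup>2 * (u\<^sup>2 + v\<^sup>2) + (of_real (al W))\<^sup>2 * (u\<^sup>2 * v\<^sup>2) * (of_real (eta W))\<^sup>2"
    unfolding Mc using ec by (simp add: field_simps)
  also have "\<dots> = z\<^sup>2 + of_real ((be W * eta W - al W / eta W)\<^sup>2)"
    unfolding uv2 zz using ec by (simp add: power2_eq_square field_simps)
  finally show "z\<^sup>2 + (of_real (1 / b))\<^sup>2 = of_real ((al W)\<^sup>2 * (eta W)\<^sup>2) * (of_real (pM W) + u\<^sup>2) * (of_real (pM W) + v\<^sup>2)"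
    by (simp only: F(7) of_real_power)
qed

lemma hlev_sph: "hlev (sph z) = kk * ((Re z)\<^sup>2 / cc + (Im z)\<^sup>2 / (cc - 1)) / (1 + (cmod z)\<^sup>2)"
proof -
  have *: "kk / 2 * ((2 * x / (n + 1))\<^sup>2 / cc + (2 * y / (n + 1))\<^sup>2 / (cc - 1)) / (1 - (n - 1) / (n + 1))
    = kk * (x\<^sup>2 / cc + y\<^sup>2 / (cc - 1)) / (1 + n)" if "0 < n + 1" for x y n :: real
  proof -
    have n: "1 - (n - 1) / (n + 1) = 2 / (n + 1)" using that by (simp add: field_simps)
    have s: "(2 * x / (n + 1))\<^sup>2 / cc + (2 * y / (n + 1))\<^sup>2 / (cc - 1) = 4 * (x\<^sup>2 / cc + y\<^sup>2 / (cc - 1)) / (n + 1)\<^sup>2"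
      by (simp add: power_divide power_mult_distrib add_divide_distrib mult.commute)
    have "kk / 2 * (4 * Z / m\<^sup>2) / (2 / m) = kk * Z / m" for Z m :: real by (simp add: power2_eq_square)
    then show ?thesis unfolding n s by (simp only: add.commute)
  qed
  have "0 < (cmod z)\<^sup>2 + 1" by (simp add: add_nonneg_pos)
  from *[OF this] show ?thesis unfolding hlev_def sph_nth .
qed

lemma hlev_compare:
  assumes W: "0 < W" "W < Wmax"
  shows "hlev (sph z) < W \<longleftrightarrow> (Re z)\<^sup>2 / (axA W)\<^sup>2 + (Im z)\<^sup>2 / (axB W)\<^sup>2 < 1"
    and "hlev (sph z) > W \<longleftrightarrow> (Re z)\<^sup>2 / (axA W)\<^sup>2 + (Im z)\<^sup>2 / (axB W)\<^sup>2 > 1"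
proof -
  note F = W_facts[OF W]
  define X where "X = (Re z)\<^sup>2"
  define Y where "Y = (Im z)\<^sup>2"
  have n: "1 + (cmod z)\<^sup>2 = 1 + X + Y" by (simp add: cmod_power2 X_def Y_def)
  have p: "0 < 1 + X + Y" by (simp add: X_def Y_def add_pos_nonneg)
  have c: "cc > 0" "cc - 1 > 0" "ss W + cc > 0" using cc_gt F by auto
  have key: "(X / cc + Y / (cc - 1)) * (ss W + cc) - (1 + X + Y) = X * ss W / cc + Y * (1 + ss W) / (cc - 1) - 1"
    using c by (simp add: field_simps)
  have e: "(Re z)\<^sup>2 / (axA W)\<^sup>2 + (Im z)\<^sup>2 / (axB W)\<^sup>2 = X * ss W / cc + Y * (1 + ss W) / (cc - 1)"
    unfolding F(9,10) X_def Y_def by simp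
  have "hlev (sph z) < W \<longleftrightarrow> kk * (X / cc + Y / (cc - 1)) / (1 + X + Y) < kk / (ss W + cc)"
    unfolding hlev_sph n using F(2) by (simp add: X_def Y_def)
  also have "\<dots> \<longleftrightarrow> (X / cc + Y / (cc - 1)) / (1 + X + Y) < 1 / (ss W + cc)"
    using kk_pos by (metis mult_less_cancel_left_pos times_divide_eq_right mult.right_neutral)
  also have "\<dots> \<longleftrightarrow> (X / cc + Y / (cc - 1)) * (ss W + cc) < 1 + X + Y"
    using p c by (simp add: divide_less_eq less_divide_eq mult.commute)
  also have "\<dots> \<longleftrightarrow> X * ss W / cc + Y * (1 + ss W) / (cc - 1) < 1" using key by linarith
  finally show "hlev (sph z) < W \<longleftrightarrow> (Re z)\<^sup>2 / (axA W)\<^sup>2 + (Im z)\<^sup>2 / (axB W)\<^sup>2 < 1" by (simp only: e)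
  have "hlev (sph z) > W \<longleftrightarrow> kk * (X / cc + Y / (cc - 1)) / (1 + X + Y) > kk / (ss W + cc)"
    unfolding hlev_sph n using F(2) by (simp add: X_def Y_def)
  also have "\<dots> \<longleftrightarrow> (X / cc + Y / (cc - 1)) / (1 + X + Y) > 1 / (ss W + cc)"
    using kk_pos by (metis mult_less_cancel_left_pos times_divide_eq_right mult.right_neutral)
  also have "\<dots> \<longleftrightarrow> (X / cc + Y / (cc - 1)) * (ss W + cc) > 1 + X + Y"
    using p c by (simp add: divide_less_eq less_divide_eq mult.commute)
  also have "\<dots> \<longleftrightarrow> X * ss W / cc + Y * (1 + ss W) / (cc - 1) > 1" using key by linarith
  finally show "hlev (sph z) > W \<longleftrightarrow> (Re z)\<^sup>2 / (axA W)\<^sup>2 + (Im z)\<^sup>2 / (axB W)\<^sup>2 > 1" by (simp only: e)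
qed

text \<open>The circle through \<open>u\<close> is mapped to an ellipse through \<open>z\<close>
  with half-axes p and q. Beyond the radius sqrt (be / al), p does not decrease and q increases with
  the radius, so comparing them with \<open>axA W\<close> and \<open>axB W\<close> compares
  \<bar>u\<bar> with 1.\<close>

lemma rts_level:
  assumes W: "0 < W" "W < Wmax" and r: "rts W z u v"
  shows "hlev (sph z) < W \<Longrightarrow> cmod u < 1" "hlev (sph z) > W \<Longrightarrow> cmod u > 1"
proof -
  note F = al_be[OF W] and R = rts_facts[OF W r]
  define \<rho> where "\<rho> = cmod u"
  define c where "c = Re u / \<rho>"
  define s where "s = Im u / \<rho>"
  have \<rho>: "0 < \<rho>" using R(1) by (simp add: \<rho>_def)
  have cs: "c\<^sup>2 + s\<^sup>2 = 1"
  proof -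
    have "(Re u)\<^sup>2 + (Im u)\<^sup>2 = \<rho>\<^sup>2" by (simp only: \<rho>_def cmod_power2)
    then show ?thesis unfolding c_def s_def power_divide add_divide_distrib[symmetric] using \<rho> by simp
  qed
  have u: "u = of_real \<rho> * Complex c s" using \<rho> by (simp add: complex_eq_iff c_def s_def)
  have iu: "1 / u = Complex c (- s) / of_real \<rho>"
  proof -
    have "u * (Complex c (- s) / of_real \<rho>) = 1"
      unfolding u using \<rho> cs by (simp add: complex_eq_iff power2_eq_square Re_divide_of_real Im_divide_of_real field_simps)
    then show ?thesis using R(1) by (simp add: field_simps)
  qed
  define p where "p = al W * \<rho> + be W / \<rho>"
  define q where "q = al W * \<rho> - be W / \<rho>"
  have z: "Re z = p * c" "Im z = q * s"
  proof -
    have "z = of_real (al W) * u + of_real (be W) * (1 / u)" using R(6) by simp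
    also have "\<dots> = of_real (al W) * (of_real \<rho> * Complex c s) + of_real (be W) * (Complex c (- s) / of_real \<rho>)"
      by (simp only: iu[symmetric] u[symmetric])
    finally show "Re z = p * c" "Im z = q * s"
      by (simp_all add: p_def q_def Re_divide_of_real Im_divide_of_real field_simps)
  qed
  have AB: "0 < axA W" "0 < axB W" using W_facts(7,8)[OF W] by auto
  have q0: "0 \<le> q"
  proof -
    have "be W \<le> al W * \<rho>\<^sup>2" using R(4) F by (simp add: \<rho>_def divide_le_eq mult.commute)
    then show ?thesis using \<rho> by (simp add: q_def field_simps power2_eq_square)
  qed
  have p0: "0 \<le> p" using F \<rho> by (simp add: p_def add_nonneg_nonneg)
  have pd: "p - axA W = (\<rho> - 1) * (al W - be W / \<rho>)" "q - axB W = (\<rho> - 1) * (al W + be W / \<rho>)"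
    using \<rho> by (simp_all add: p_def q_def F(8,9) field_simps)
  have lo: "be W / \<rho> \<le> al W"
  proof (cases "\<rho> \<ge> 1")
    case True
    then have "be W / \<rho> \<le> be W" using F by (simp add: divide_le_eq mult_left_le)
    then show ?thesis using F by simp
  next
    case False
    have "be W \<le> al W * \<rho>\<^sup>2" using R(4) F by (simp add: \<rho>_def divide_le_eq mult.commute)
    also have "\<dots> \<le> al W * \<rho>"
      using False \<rho> F by (intro mult_left_mono) (auto simp: power2_eq_square mult_left_le)
    finally show ?thesis using \<rho> by (simp add: divide_le_eq)
  qed
  have v: "(Re z)\<^sup>2 / (axA W)\<^sup>2 + (Im z)\<^sup>2 / (axB W)\<^sup>2 = (p / axA W)\<^sup>2 * c\<^sup>2 + (q / axB W)\<^sup>2 * s\<^sup>2"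
    by (simp add: z power_mult_distrib power_divide)
  show "cmod u < 1" if "hlev (sph z) < W"
  proof (rule ccontr)
    assume "\<not> cmod u < 1"
    then have "\<rho> \<ge> 1" by (simp add: \<rho>_def)
    then have "axA W \<le> p" "axB W \<le> q"
      using pd lo F \<rho> by (smt (verit) divide_nonneg_pos mult_nonneg_nonneg)+
    then have "1 \<le> (p / axA W)\<^sup>2" "1 \<le> (q / axB W)\<^sup>2" using AB by (simp_all add: one_le_power)
    then have "1 * c\<^sup>2 + 1 * s\<^sup>2 \<le> (p / axA W)\<^sup>2 * c\<^sup>2 + (q / axB W)\<^sup>2 * s\<^sup>2"
      by (intro add_mono mult_right_mono) auto
    then show False using hlev_compare(1)[OF W, of z] that v cs by simp
  qed
  show "cmod u > 1" if "hlev (sph z) > W"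
  proof (rule ccontr)
    assume "\<not> cmod u > 1"
    then have "\<rho> \<le> 1" by (simp add: \<rho>_def)
    then have "(\<rho> - 1) * (al W - be W / \<rho>) \<le> 0" "(\<rho> - 1) * (al W + be W / \<rho>) \<le> 0"
      using lo F \<rho> by (auto intro!: mult_nonpos_nonneg add_nonneg_nonneg)
    then have "p \<le> axA W" "q \<le> axB W" using pd by linarith+
    then have "(p / axA W)\<^sup>2 \<le> 1" "(q / axB W)\<^sup>2 \<le> 1" using AB p0 q0 by (simp_all add: power_le_one)
    then have "(p / axA W)\<^sup>2 * c\<^sup>2 + (q / axB W)\<^sup>2 * s\<^sup>2 \<le> 1 * c\<^sup>2 + 1 * s\<^sup>2"
      by (intro add_mono mult_right_mono) auto
    then show False using hlev_compare(2)[OF W, of z] that v cs by simp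
  qed
qed

end

section \<open>Logarithmic integrals along parametrized curves\<close>

text \<open>\<open>e\<close> is the part of the kernel that depends on the curve only. It is kept
  abstract: every relation compares two points, and there it cancels.\<close>

lemma curve_potential:
  assumes [measurable]: "P \<in> borel_measurable borel" "g \<in> borel_measurable borel" and P: "\<And>t. 0 \<le> P t"
    and tot: "has_bochner_integral uiv P 1"
    and E: "has_bochner_integral uiv (\<lambda>t. ln (1 + (cmod (g t))\<^sup>2) / 2 * P t) e"
    and L: "has_bochner_integral uiv (\<lambda>t. ln (cmod (z - g t)) * P t) L"
    and ne: "AE t in uiv. g t \<noteq> z"
  shows "(\<integral>\<^sup>+t. ennreal (P t) * skernel (sph z) (sph (g t)) \<partial>uiv) = ennreal (ln (1 + (cmod z)\<^sup>2) / 2 + e - L)"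
    and "0 \<le> ln (1 + (cmod z)\<^sup>2) / 2 + e - L"
proof -
  let ?c = "ln (1 + (cmod z)\<^sup>2) / 2"
  have "has_bochner_integral uiv (\<lambda>t. ?c * P t + ln (1 + (cmod (g t))\<^sup>2) / 2 * P t - ln (cmod (z - g t)) * P t) (?c * 1 + e - L)"
    by (intro has_bochner_integral_diff has_bochner_integral_add has_bochner_integral_mult_right tot E L)
  moreover have "(\<lambda>t. ?c * P t + ln (1 + (cmod (g t))\<^sup>2) / 2 * P t - ln (cmod (z - g t)) * P t) = (\<lambda>t. P t * kplane z (g t))"
    by (simp add: kplane_def fun_eq_iff algebra_simps)
  ultimately have K: "has_bochner_integral uiv (\<lambda>t. P t * kplane z (g t)) (?c + e - L)" by simp
  have nn: "AE t in uiv. 0 \<le> P t * kplane z (g t)"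
    using ne by eventually_elim (use P kplane_nonneg in \<open>metis mult_nonneg_nonneg\<close>)
  have "(\<integral>\<^sup>+t. ennreal (P t) * skernel (sph z) (sph (g t)) \<partial>uiv) = (\<integral>\<^sup>+t. ennreal (P t * kplane z (g t)) \<partial>uiv)"
    using ne by (intro nn_integral_cong_AE, eventually_elim) (metis skernel_sph ennreal_mult' P)
  also have "\<dots> = ennreal (?c + e - L)"
    using K nn by (subst nn_integral_eq_integral) (auto simp: has_bochner_integral_iff)
  finally show "(\<integral>\<^sup>+t. ennreal (P t) * skernel (sph z) (sph (g t)) \<partial>uiv) = ennreal (?c + e - L)" .
  show "0 \<le> ?c + e - L"
    using integral_nonneg_AE[OF nn] unfolding has_bochner_integral_integral_eq[OF K] .
qed

lemma has_bochner_integral_uiv_continuous: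
  fixes f :: "real \<Rightarrow> real"
  assumes "continuous_on UNIV f"
  shows "has_bochner_integral uiv f (integral {0..1} f)"
  by (rule has_bochner_integral_uiv)
    (use assms in \<open>auto intro: continuous_on_subset integrable_integral integrable_continuous_real borel_measurable_continuous_onI\<close>)

lemma continuous_poisson2:
  assumes "0 \<le> M" "M < 1"
  shows "continuous_on UNIV (\<lambda>t. poisson2 M (circ t))"
proof -
  have "(circ t)\<^sup>2 + of_real M \<noteq> 0" for t
    using poisson2_pos[OF assms, of "circ t"] by (auto simp: poisson2_def)
  then show ?thesis unfolding poisson2_def by (intro continuous_intros) auto
qed

text \<open>The Blaschke factor (w + M) / (1 + M w) preserves both the disk and its exterior. With w
  a square of a Joukowski preimage this resolves the maxima in the potentials.\<close>

lemma blaschke_compare: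
  assumes M: "0 \<le> M" "M < 1"
  shows "cmod w \<le> 1 \<Longrightarrow> cmod (w + of_real M) \<le> cmod (1 + of_real M * w)"
    and "1 \<le> cmod w \<Longrightarrow> cmod (1 + of_real M * w) \<le> cmod (w + of_real M)"
proof -
  have k: "(cmod (1 + of_real M * w))\<^sup>2 - (cmod (w + of_real M))\<^sup>2 = (1 - M\<^sup>2) * (1 - (cmod w)\<^sup>2)"
    unfolding cmod_power2 by (simp add: power2_eq_square algebra_simps)
  have m: "0 \<le> 1 - M\<^sup>2" using M by (simp add: power_le_one)
  show "cmod (w + of_real M) \<le> cmod (1 + of_real M * w)" if "cmod w \<le> 1"
  proof (rule power2_le_imp_le)
    have "0 \<le> (1 - M\<^sup>2) * (1 - (cmod w)\<^sup>2)" using that m by (intro mult_nonneg_nonneg) (simp_all add: power_le_one)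
    then show "(cmod (w + of_real M))\<^sup>2 \<le> (cmod (1 + of_real M * w))\<^sup>2" unfolding k[symmetric] by simp
  qed simp
  show "cmod (1 + of_real M * w) \<le> cmod (w + of_real M)" if "1 \<le> cmod w"
  proof (rule power2_le_imp_le)
    have "(1 - M\<^sup>2) * (1 - (cmod w)\<^sup>2) \<le> 0" using that m by (intro mult_nonneg_nonpos) (simp_all add: one_le_power)
    then show "(cmod (1 + of_real M * w))\<^sup>2 \<le> (cmod (w + of_real M))\<^sup>2" unfolding k[symmetric] by simp
  qed simp
qed

lemma AE_circ_factor:
  assumes "\<And>t. g t = z \<Longrightarrow> circ t = u \<or> circ t = v"
  shows "AE t in uiv. g t \<noteq> z"
  using AE_circ_neq[of u] AE_circ_neq[of v] by eventually_elim (use assms in blast)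

lemma log_two_factors:
  assumes M: "0 \<le> M" "M < 1" and [measurable]: "g \<in> borel_measurable borel"
    and k: "0 < k" "\<And>t. cmod (z - g t) = k * cmod (circ t - u) * cmod (circ t - v)"
  shows "has_bochner_integral uiv (\<lambda>t. ln (cmod (z - g t)) * poisson2 M (circ t))
    (ln k + ln (max (cmod (1 + of_real M * u\<^sup>2)) (cmod (u\<^sup>2 + of_real M))) / 2
     + ln (max (cmod (1 + of_real M * v\<^sup>2)) (cmod (v\<^sup>2 + of_real M))) / 2)"
proof -
  have "has_bochner_integral uiv (\<lambda>t. ln k * poisson2 M (circ t) + ln (cmod (circ t - u)) * poisson2 M (circ t)
      + ln (cmod (circ t - v)) * poisson2 M (circ t))
    (ln k * 1 + ln (max (cmod (1 + of_real M * u\<^sup>2)) (cmod (u\<^sup>2 + of_real M))) / 2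
     + ln (max (cmod (1 + of_real M * v\<^sup>2)) (cmod (v\<^sup>2 + of_real M))) / 2)"
    by (intro has_bochner_integral_add has_bochner_integral_mult_right poisson2_total log_poisson2_diff M)
  then have h: "has_bochner_integral uiv (\<lambda>t. ln k * poisson2 M (circ t) + ln (cmod (circ t - u)) * poisson2 M (circ t)
      + ln (cmod (circ t - v)) * poisson2 M (circ t))
    (ln k + ln (max (cmod (1 + of_real M * u\<^sup>2)) (cmod (u\<^sup>2 + of_real M))) / 2
     + ln (max (cmod (1 + of_real M * v\<^sup>2)) (cmod (v\<^sup>2 + of_real M))) / 2)" by simp
  have ae: "AE t in uiv. ln (cmod (z - g t)) * poisson2 M (circ t) = ln k * poisson2 M (circ t) + ln (cmod (circ t - u)) * poisson2 M (circ t)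
      + ln (cmod (circ t - v)) * poisson2 M (circ t)"
    using AE_circ_neq[of u] AE_circ_neq[of v]
  proof eventually_elim
    case (elim t)
    then have p: "0 < cmod (circ t - u)" "0 < cmod (circ t - v)" by simp_all
    have "ln (cmod (z - g t)) = ln k + ln (cmod (circ t - u)) + ln (cmod (circ t - v))"
      unfolding k(2) using p k(1) by (simp only: ln_mult_pos mult_pos_pos)
    then show ?case by (simp only: distrib_right)
  qed
  show ?thesis by (rule has_bochner_integral_cong_AE[THEN iffD2, OF _ _ ae h]) measurable
qed

context ellipse_family
begin

definition leaf :: "real \<Rightarrow> real^3 \<Rightarrow> ennreal" where
  "leaf W x = (\<integral>\<^sup>+t. ennreal (poisson2 (pM W) (circ t)) * skernel x (sph (gam W t)) \<partial>uiv)"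
text \<open>Rescale the Joukowski parameter by sqrt (be / al), so that the unit circle is folded
  onto the segment between the foci +-\<open>cr W\<close>. Then \<open>mA\<close> and
  \<open>mB\<close> are the squared moduli of the points of the disk that lie over +-i/b and
  +-ib.\<close>

definition mA :: "real \<Rightarrow> real" where "mA W = al W / (be W * (eta W)\<^sup>2)"
definition mB :: "real \<Rightarrow> real" where "mB W = be W / (al W * (eta W)\<^sup>2)"
definition cr :: "real \<Rightarrow> real" where "cr W = 2 * sqrt (al W * be W)"
text \<open>The potential of the measure to which the leaf of level \<open>W\<close> can be swept: it lives on the segment
  between the foci and, up to a constant, has the same potential outside of the ellipse.\<close>

definition shadow :: "real \<Rightarrow> real^3 \<Rightarrow> ennreal" where
  "shadow W x = (\<integral>\<^sup>+t. ennreal ((poisson2 (mA W) (circ t) + poisson2 (mB W) (circ t)) / 2)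
     * skernel x (line_pt (cr W * Re (circ t))) \<partial>uiv)"

lemma mAB:
  assumes W: "0 < W" "W < Wmax"
  shows "0 < mB W" "mB W < mA W" "mA W < 1" "mB W < 1" "0 < mA W" "mA W * (be W / al W) = pM W" "mB W = pM W * (be W / al W)"
proof -
  note F = al_be[OF W]
  have e: "0 < (eta W)\<^sup>2" using F by simp
  show "0 < mB W" using F e by (simp add: mB_def)
  have "be W / (al W * (eta W)\<^sup>2) < be W / (be W * (eta W)\<^sup>2)"
    using F e by (intro divide_strict_left_mono mult_strict_right_mono) auto
  also have "\<dots> < al W / (be W * (eta W)\<^sup>2)" using F e by (intro divide_strict_right_mono) auto
  finally show "mB W < mA W" by (simp add: mA_def mB_def)
  have "al W / eta W < be W * eta W" using F(7) b by (smt (verit) zero_less_divide_1_iff)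
  then have "al W < be W * eta W * eta W" using F(4) by (simp add: divide_less_eq)
  then show "mA W < 1" using F e unfolding mA_def by (simp add: divide_less_eq power2_eq_square mult.assoc)
  then show "mB W < 1" "0 < mA W" using \<open>mB W < mA W\<close> \<open>0 < mB W\<close> by linarith+
  show "mA W * (be W / al W) = pM W" "mB W = pM W * (be W / al W)" using F e by (simp_all add: mA_def mB_def field_simps)
qed

definition leaf_log :: "real \<Rightarrow> complex \<Rightarrow> complex \<Rightarrow> real" where
  "leaf_log W u v = ln (al W) + ln (max (cmod (1 + of_real (pM W) * u\<^sup>2)) (cmod (u\<^sup>2 + of_real (pM W)))) / 2
     + ln (cmod (1 + of_real (pM W) * v\<^sup>2)) / 2"
text \<open>The logarithmic integral for the combination of the two kernels with weights
  \<open>c1\<close> and \<open>c2\<close> on the focal segment. The weights are 1/2 and 1/2 for the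
  shadow of a leaf, and 1 + a and -a for the equilibrium measure.\<close>

definition line_log :: "real \<Rightarrow> real \<Rightarrow> real \<Rightarrow> complex \<Rightarrow> complex \<Rightarrow> real" where
  "line_log c1 c2 W u v = ln (al W) + c1 * (ln (cmod (u\<^sup>2 + of_real (pM W))) - ln (cmod u))
     + c2 * (ln (cmod u) + ln (cmod (1 + of_real (pM W) * v\<^sup>2)))"

lemma continuous_gam: "continuous_on UNIV (gam W)"
  unfolding gam_def[abs_def] by (intro continuous_intros continuous_on_circ)

lemma leaf_potential:
  assumes W: "0 < W" "W < Wmax"
  obtains e where "\<And>z u v. rts W z u v \<Longrightarrow> leaf W (sph z) = ennreal (ln (1 + (cmod z)\<^sup>2) / 2 + e - leaf_log W u v)"
    and "\<And>z u v. rts W z u v \<Longrightarrow> 0 \<le> ln (1 + (cmod z)\<^sup>2) / 2 + e - leaf_log W u v"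
proof -
  note M = W_facts(12,13)[OF W]
  define P where "P = (\<lambda>t. poisson2 (pM W) (circ t))"
  have cP: "continuous_on UNIV P" unfolding P_def by (rule continuous_poisson2[OF M])
  have c: "continuous_on UNIV (\<lambda>t. ln (1 + (cmod (gam W t))\<^sup>2) / 2 * P t)"
    by (intro continuous_intros cP continuous_gam) (auto simp: less_imp_neq[symmetric])
  note E = has_bochner_integral_uiv_continuous[OF c]
  have pos: "0 \<le> P t" for t unfolding P_def using poisson2_pos[OF M, of "circ t"] by simp
  have tot: "has_bochner_integral uiv P 1" unfolding P_def by (rule poisson2_total[OF M])
  have mm[measurable]: "P \<in> borel_measurable borel" "gam W \<in> borel_measurable borel" using cP continuous_gam by (auto intro: borel_measurable_continuous_onI)
  have main: "leaf W (sph z) = ennreal (ln (1 + (cmod z)\<^sup>2) / 2 + integral {0..1} (\<lambda>t. ln (1 + (cmod (gam W t))\<^sup>2) / 2 * P t) -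
      leaf_log W u v) \<and>
     0 \<le> ln (1 + (cmod z)\<^sup>2) / 2 + integral {0..1} (\<lambda>t. ln (1 + (cmod (gam W t))\<^sup>2) / 2 * P t) -
      leaf_log W u v"
    if r: "rts W z u v" for z u v
  proof -
    note R = rts_facts[OF W r] and A = al_be[OF W]
    have d: "z - gam W t = - (of_real (al W) / circ t) * (circ t - u) * (circ t - v)" for t
      unfolding gam_eq by (rule R(7)) simp
    have dn: "cmod (z - gam W t) = al W * cmod (circ t - u) * cmod (circ t - v)" for t
      unfolding d using A(3) by (simp add: norm_mult norm_divide)
    have ne: "AE t in uiv. gam W t \<noteq> z"
      by (rule AE_circ_factor[of _ _ u v]) (use dn A(3) in \<open>metis mult_eq_0_iff norm_eq_zero right_minus_eq less_irrefl\<close>)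
    have "(cmod v)\<^sup>2 \<le> 1" using R(3) by (simp add: power_le_one)
    then have "cmod (v\<^sup>2 + of_real (pM W)) \<le> cmod (1 + of_real (pM W) * v\<^sup>2)"
      by (intro blaschke_compare(1) M) (simp add: norm_power)
    then have mx: "max (cmod (1 + of_real (pM W) * v\<^sup>2)) (cmod (v\<^sup>2 + of_real (pM W))) = cmod (1 + of_real (pM W) * v\<^sup>2)" by simp
    have L: "has_bochner_integral uiv (\<lambda>t. ln (cmod (z - gam W t)) * P t) (leaf_log W u v)"
      using log_two_factors[OF M mm(2) A(3) dn] unfolding mx P_def leaf_log_def .
    show ?thesis
      using curve_potential[OF mm pos tot E L ne] unfolding leaf_def P_def by (rule conjI)
  qed
  show ?thesis by (rule that[OF main[THEN conjunct1] main[THEN conjunct2]])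
qed

text \<open>After division by k = sqrt (be / al), one preimage is never inside of the unit circle
  and the other never outside, whatever z is. So the maxima are resolved in the same way in the
  whole plane, and u v = k^2 merges the two factors.\<close>

lemma line_potential:
  assumes W: "0 < W" "W < Wmax" and M: "0 \<le> M" "M < 1" and r: "rts W z u v"
  shows "has_bochner_integral uiv (\<lambda>t. ln (cmod (z - of_real (cr W * Re (circ t)))) * poisson2 M (circ t))
     (ln (al W) + ln (cmod (u\<^sup>2 + of_real (M * (be W / al W)))) - ln (cmod u))"
    and "AE t in uiv. of_real (cr W * Re (circ t)) \<noteq> z"
proof -
  note R = rts_facts[OF W r] and A = al_be[OF W]
  define q where "q = be W / al W"
  define k where "k = sqrt q"
  have q: "0 < q" and k: "0 < k" and kk: "k * k = q" using A by (simp_all add: q_def k_def)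
  have ak: "sqrt (al W * be W) = al W * k"
  proof (rule real_sqrt_unique)
    have "(al W * k)\<^sup>2 = al W * al W * (k * k)" by (simp add: power2_eq_square)
    then show "(al W * k)\<^sup>2 = al W * be W" unfolding kk q_def using A by simp
    show "0 \<le> al W * k" using A k by simp
  qed
  have kc: "complex_of_real k \<noteq> 0" using k by simp
  have uv: "u * v = of_real k * of_real k" using r unfolding of_real_mult[symmetric] kk rts_def q_def by simp
  have z: "z = of_real (al W) * (u + v)" using r A by (simp add: rts_def)
  have d: "z - of_real (cr W * Re (circ t)) = - (of_real (al W * k) / circ t) * (circ t - u / of_real k) * (circ t - v / of_real k)" for t
  proof -
    have "complex_of_real (2 * Re (circ t)) = circ t + 1 / circ t"
      using complex_add_cnj[of "circ t"] by (simp add: cnj_circ)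
    then have c: "complex_of_real (cr W * Re (circ t)) = of_real (al W) * of_real k * (circ t + 1 / circ t)"
      unfolding cr_def ak by (metis (no_types, opaque_lifting) mult.assoc mult.commute of_real_mult)
    have e: "(circ t - u / of_real k) * (circ t - v / of_real k) = (circ t)\<^sup>2 - (u + v) * circ t / of_real k + 1"
    proof -
      have "(circ t - u / of_real k) * (circ t - v / of_real k) = (circ t)\<^sup>2 - (u + v) * circ t / of_real k + (u * v) / (of_real k * of_real k)"
        by (simp add: power2_eq_square algebra_simps add_divide_distrib)
      then show ?thesis unfolding uv using kc by simp
    qed
    show ?thesis unfolding c z mult.assoc e using kc by (simp add: power2_eq_square field_simps)
  qed
  have alk: "0 < al W * k" using A k by simp
  have dn: "cmod (z - of_real (cr W * Re (circ t))) = al W * k * cmod (circ t - u / of_real k) * cmod (circ t - v / of_real k)" for t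
    unfolding d norm_mult norm_minus_cancel norm_divide norm_circ norm_of_real using A(3) k by simp
  show "AE t in uiv. of_real (cr W * Re (circ t)) \<noteq> z"
    by (rule AE_circ_factor[of _ _ "u / of_real k" "v / of_real k"]) (use dn alk in \<open>metis mult_eq_0_iff norm_eq_zero right_minus_eq less_irrefl\<close>)
  have [measurable]: "(\<lambda>t. complex_of_real (cr W * Re (circ t))) \<in> borel_measurable borel" by measurable
  have qu: "q \<le> (cmod u)\<^sup>2" "(cmod v)\<^sup>2 \<le> q" using R(4,5) by (simp_all add: q_def)
  have ku: "cmod ((u / of_real k)\<^sup>2) = (cmod u)\<^sup>2 / q" and kv: "cmod ((v / of_real k)\<^sup>2) = (cmod v)\<^sup>2 / q"
    unfolding power_divide norm_divide norm_power norm_of_real power2_abs using kk by (simp_all add: power2_eq_square)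
  have m1: "max (cmod (1 + of_real M * (u / of_real k)\<^sup>2)) (cmod ((u / of_real k)\<^sup>2 + of_real M)) = cmod ((u / of_real k)\<^sup>2 + of_real M)"
    by (rule max_absorb2[OF blaschke_compare(2)[OF M]]) (use ku qu q in simp)
  have m2: "max (cmod (1 + of_real M * (v / of_real k)\<^sup>2)) (cmod ((v / of_real k)\<^sup>2 + of_real M)) = cmod (1 + of_real M * (v / of_real k)\<^sup>2)"
    by (rule max_absorb1[OF blaschke_compare(1)[OF M]]) (use kv qu q in simp)
  define N where "N = cmod (u\<^sup>2 + of_real (M * q))"
  have N: "0 < N"
  proof -
    have "M * q < q" using M q by simp
    also have "q \<le> cmod (u\<^sup>2)" using qu by (simp add: norm_power)
    finally have l: "\<bar>M * q\<bar> < cmod (u\<^sup>2)" using M q by simp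
    have "u\<^sup>2 \<noteq> - of_real (M * q)"
    proof
      assume "u\<^sup>2 = - of_real (M * q)"
      then have "cmod (u\<^sup>2) = \<bar>M * q\<bar>" by (simp only: norm_minus_cancel norm_of_real)
      with l show False by linarith
    qed
    then show ?thesis unfolding N_def by (simp add: eq_neg_iff_add_eq_0)
  qed
  have kkc: "complex_of_real k * of_real k = of_real q" unfolding of_real_mult[symmetric] kk ..
  have n1: "cmod ((u / of_real k)\<^sup>2 + of_real M) = N / q"
  proof -
    have "(u / of_real k)\<^sup>2 + of_real M = (u\<^sup>2 + of_real (M * q)) / of_real q"
      unfolding power_divide power2_eq_square kkc using q by (simp add: add_divide_distrib kkc)
    then have "cmod ((u / of_real k)\<^sup>2 + of_real M) = N / \<bar>q\<bar>" by (simp only: norm_divide norm_of_real N_def)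
    then show ?thesis using q by simp
  qed
  have n2: "cmod (1 + of_real M * (v / of_real k)\<^sup>2) = N / (cmod u)\<^sup>2"
  proof -
    have v: "v = of_real q / u" using uv R(1) unfolding kkc by (simp add: field_simps)
    have "of_real M * (v / of_real k)\<^sup>2 = of_real M * of_real q / u\<^sup>2"
      unfolding v power_divide kkc[folded power2_eq_square] using q by (simp add: power2_eq_square)
    then have "1 + of_real M * (v / of_real k)\<^sup>2 = (u\<^sup>2 + of_real (M * q)) / u\<^sup>2"
      using R(1) by (simp add: add_divide_distrib)
    then show ?thesis by (simp only: norm_divide norm_power N_def)
  qed
  have uu: "0 < cmod u" using R(1) by simp
  have lk: "ln k = ln q / 2" using q by (simp add: k_def ln_sqrt)
  have fin: "ln (al W * k) + ln (N / q) / 2 + ln (N / (cmod u)\<^sup>2) / 2 = ln (al W) + ln N - ln (cmod u)"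
    using A(3) k q N uu by (simp add: ln_mult_pos ln_div ln_realpow lk field_simps)
  have mg: "(\<lambda>t. complex_of_real (cr W * Re (circ t))) \<in> borel_measurable borel" by measurable
  show "has_bochner_integral uiv (\<lambda>t. ln (cmod (z - of_real (cr W * Re (circ t)))) * poisson2 M (circ t))
     (ln (al W) + ln (cmod (u\<^sup>2 + of_real (M * (be W / al W)))) - ln (cmod u))"
    using log_two_factors[OF M mg alk dn] unfolding m1 m2 unfolding n1 n2 fin unfolding N_def q_def .
qed

lemma line_spot:
  assumes W: "0 < W" "W < Wmax" and c: "c1 + c2 = 1"
    and pos: "\<And>t. 0 \<le> c1 * poisson2 (mA W) (circ t) + c2 * poisson2 (mB W) (circ t)"
  obtains e where "\<And>z u v. rts W z u v \<Longrightarrow>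
      (\<integral>\<^sup>+t. ennreal (c1 * poisson2 (mA W) (circ t) + c2 * poisson2 (mB W) (circ t))
         * skernel (sph z) (line_pt (cr W * Re (circ t))) \<partial>uiv) = ennreal (ln (1 + (cmod z)\<^sup>2) / 2 + e - line_log c1 c2 W u v)"
    and "\<And>z u v. rts W z u v \<Longrightarrow> 0 \<le> ln (1 + (cmod z)\<^sup>2) / 2 + e - line_log c1 c2 W u v"
    and "has_bochner_integral uiv (\<lambda>t. c1 * poisson2 (mA W) (circ t) + c2 * poisson2 (mB W) (circ t)) 1"
proof -
  note m = mAB[OF W]
  have A: "0 \<le> mA W" "mA W < 1" and B: "0 \<le> mB W" "mB W < 1" using m by linarith+
  define P where "P = (\<lambda>t. c1 * poisson2 (mA W) (circ t) + c2 * poisson2 (mB W) (circ t))"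
  define g where "g = (\<lambda>t. complex_of_real (cr W * Re (circ t)))"
  have cP: "continuous_on UNIV P" unfolding P_def by (intro continuous_intros continuous_poisson2 A B)
  have cg: "continuous_on UNIV g" unfolding g_def by (intro continuous_intros continuous_on_circ)
  have cE: "continuous_on UNIV (\<lambda>t. ln (1 + (cmod (g t))\<^sup>2) / 2 * P t)"
    by (intro continuous_intros cP cg) (auto simp: less_imp_neq[symmetric])
  note E = has_bochner_integral_uiv_continuous[OF cE]
  have pos': "0 \<le> P t" for t unfolding P_def by (rule pos)
  have "has_bochner_integral uiv P (c1 * 1 + c2 * 1)" unfolding P_def
    by (intro has_bochner_integral_add has_bochner_integral_mult_right poisson2_total A B)
  then have tot: "has_bochner_integral uiv P 1" using c by simp
  have mm: "P \<in> borel_measurable borel" "g \<in> borel_measurable borel" using cP cg by (auto intro: borel_measurable_continuous_onI)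
  define e where "e = integral {0..1} (\<lambda>t. ln (1 + (cmod (g t))\<^sup>2) / 2 * P t)"
  have main: "(\<integral>\<^sup>+t. ennreal (P t) * skernel (sph z) (line_pt (cr W * Re (circ t))) \<partial>uiv) = ennreal (ln (1 + (cmod z)\<^sup>2) / 2 + e - line_log c1 c2 W u v) \<and>
     0 \<le> ln (1 + (cmod z)\<^sup>2) / 2 + e - line_log c1 c2 W u v"
    if r: "rts W z u v" for z u v
  proof -
    note R = rts_facts[OF W r]
    have uv: "of_real (be W / al W) = u * v" using r by (simp only: rts_def)
    have "u\<^sup>2 + of_real (mB W * (be W / al W)) = u\<^sup>2 * (1 + of_real (pM W) * v\<^sup>2)"
      unfolding m(7) of_real_mult uv by (simp add: power2_eq_square algebra_simps)
    then have nB: "cmod (u\<^sup>2 + of_real (mB W * (be W / al W))) = (cmod u)\<^sup>2 * cmod (1 + of_real (pM W) * v\<^sup>2)"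
      by (simp only: norm_mult norm_power)
    have p: "0 < cmod (1 + of_real (pM W) * v\<^sup>2)"
    proof -
      have "cmod (of_real (pM W) * v\<^sup>2) < 1"
      proof -
        have "pM W * (cmod v)\<^sup>2 \<le> pM W * 1" using R(3) W_facts(12)[OF W] by (intro mult_left_mono) (auto simp: power_le_one)
        then show ?thesis using W_facts(12,13)[OF W] by (simp add: norm_mult norm_power)
      qed
      then have "of_real (pM W) * v\<^sup>2 \<noteq> - 1" by (metis norm_minus_cancel norm_one less_irrefl)
      then show ?thesis by (simp add: eq_neg_iff_add_eq_0 add.commute)
    qed
    have u: "0 < cmod u" using R(1) by simp
    have lB: "ln (al W) + ln (cmod (u\<^sup>2 + of_real (mB W * (be W / al W)))) - ln (cmod u) = ln (al W) + (ln (cmod u) + ln (cmod (1 + of_real (pM W) * v\<^sup>2)))"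
      unfolding nB using p u by (simp add: ln_mult_pos ln_realpow)
    have "has_bochner_integral uiv (\<lambda>t. c1 * (ln (cmod (z - g t)) * poisson2 (mA W) (circ t)) + c2 * (ln (cmod (z - g t)) * poisson2 (mB W) (circ t)))
      (c1 * (ln (al W) + ln (cmod (u\<^sup>2 + of_real (pM W))) - ln (cmod u)) + c2 * (ln (al W) + (ln (cmod u) + ln (cmod (1 + of_real (pM W) * v\<^sup>2)))))"
      unfolding lB[symmetric] unfolding m(6)[symmetric] unfolding g_def
      by (intro has_bochner_integral_add has_bochner_integral_mult_right line_potential(1)[OF W A r] line_potential(1)[OF W B r])
    moreover have "(\<lambda>t. c1 * (ln (cmod (z - g t)) * poisson2 (mA W) (circ t)) + c2 * (ln (cmod (z - g t)) * poisson2 (mB W) (circ t)))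
       = (\<lambda>t. ln (cmod (z - g t)) * P t)" by (simp add: P_def fun_eq_iff algebra_simps)
    moreover have "c1 * (X + Y - Z) + c2 * (X + T) = X + c1 * (Y - Z) + c2 * T" for X Y Z T
    proof -
      have c2: "c2 = 1 - c1" using c by simp
      show ?thesis unfolding c2 by (simp add: algebra_simps)
    qed
    ultimately have L: "has_bochner_integral uiv (\<lambda>t. ln (cmod (z - g t)) * P t) (line_log c1 c2 W u v)"
      unfolding line_log_def by simp
    have ne: "AE t in uiv. g t \<noteq> z" unfolding g_def by (rule line_potential(2)[OF W A r])
    show ?thesis using curve_potential[OF mm pos' tot E L ne] unfolding e_def line_pt_def g_def by (rule conjI)
  qed
  show ?thesis
    by (rule that[OF main[THEN conjunct1, unfolded P_def] main[THEN conjunct2] tot[unfolded P_def]])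
qed

section \<open>Sweeping relations of a single leaf\<close>

text \<open>The charges lie outside of every leaf, so that the upper one can serve as reference
  point for the relations in the exterior.\<close>

lemma hlev_pole: "Wmax < hlev (sph (\<i> * of_real b))" "Wmax < hlev (sph (- (\<i> * of_real b)))"
proof -
  have b0: "0 < b" using b by simp
  have "2 * ch = b + 1 / b" using ch_sh by linarith
  then have "1 + b\<^sup>2 = 2 * ch * b" using b0 by (simp add: power2_eq_square field_simps)
  then have e: "kk * b\<^sup>2 / ((cc - 1) * (1 + b\<^sup>2)) = b / (2 * sh)"
    unfolding sh2[symmetric] kk_def using ch_sh b0 by (simp add: power2_eq_square)
  have "2 * sh * sh < ch * b"
  proof -
    have "sh * sh < ch * ch" using ch_sh by (intro mult_strict_mono) auto
    moreover have "sh * sh < ch * sh" using ch_sh by simp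
    moreover have "ch * b = ch * ch + ch * sh" using ch_sh(5) by (simp add: distrib_left[symmetric])
    ultimately show ?thesis by simp
  qed
  then have l: "Wmax < b / (2 * sh)" unfolding Wmax(2) using ch_sh by (simp add: field_simps)
  show "Wmax < hlev (sph (\<i> * of_real b))" "Wmax < hlev (sph (- (\<i> * of_real b)))"
    unfolding hlev_sph using l b0 by (simp_all add: e norm_mult)
qed

lemma hlev_0: "hlev (sph 0) = 0" by (simp add: hlev_sph)

lemma pole_kernels:
  assumes "z \<noteq> \<i> * of_real b" "z \<noteq> - (\<i> * of_real b)"
  shows "ennreal (1 / 2) * (skernel (sph z) (sph (\<i> * of_real b)) + skernel (sph z) (sph (- (\<i> * of_real b))))
     = ennreal ((ln (1 + (cmod z)\<^sup>2) + ln (1 + b\<^sup>2) - ln (cmod (z\<^sup>2 + (of_real b)\<^sup>2))) / 2)"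
    "0 \<le> (ln (1 + (cmod z)\<^sup>2) + ln (1 + b\<^sup>2) - ln (cmod (z\<^sup>2 + (of_real b)\<^sup>2))) / 2"
    "0 < cmod (z\<^sup>2 + (of_real b)\<^sup>2)"
proof -
  have f: "(z - \<i> * of_real b) * (z + \<i> * of_real b) = z\<^sup>2 + (of_real b)\<^sup>2"
    by (simp add: power2_eq_square algebra_simps)
  have n: "0 < cmod (z - \<i> * of_real b)" "0 < cmod (z + \<i> * of_real b)"
    using assms by (auto simp: add_eq_0_iff2)
  show "0 < cmod (z\<^sup>2 + (of_real b)\<^sup>2)" unfolding f[symmetric] norm_mult by (rule mult_pos_pos[OF n])
  have l: "ln (cmod (z\<^sup>2 + (of_real b)\<^sup>2)) = ln (cmod (z - \<i> * of_real b)) + ln (cmod (z + \<i> * of_real b))"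
    unfolding f[symmetric] norm_mult by (rule ln_mult_pos[OF n])
  have k: "kplane z (\<i> * of_real b) + kplane z (- (\<i> * of_real b)) = ln (1 + (cmod z)\<^sup>2) + ln (1 + b\<^sup>2) - ln (cmod (z\<^sup>2 + (of_real b)\<^sup>2))"
    unfolding kplane_def l by (simp add: norm_mult)
  have nn: "0 \<le> kplane z (\<i> * of_real b)" "0 \<le> kplane z (- (\<i> * of_real b))" using assms by (auto intro!: kplane_nonneg)
  have s: "skernel (sph z) (sph (\<i> * of_real b)) + skernel (sph z) (sph (- (\<i> * of_real b)))
     = ennreal (kplane z (\<i> * of_real b) + kplane z (- (\<i> * of_real b)))"
    unfolding skernel_sph[OF assms(1)] skernel_sph[OF assms(2)] by (rule ennreal_plus[OF nn, symmetric])
  have nns: "0 \<le> kplane z (\<i> * of_real b) + kplane z (- (\<i> * of_real b))" by (rule add_nonneg_nonneg[OF nn])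
  show "ennreal (1 / 2) * (skernel (sph z) (sph (\<i> * of_real b)) + skernel (sph z) (sph (- (\<i> * of_real b))))
     = ennreal ((ln (1 + (cmod z)\<^sup>2) + ln (1 + b\<^sup>2) - ln (cmod (z\<^sup>2 + (of_real b)\<^sup>2))) / 2)"
    "0 \<le> (ln (1 + (cmod z)\<^sup>2) + ln (1 + b\<^sup>2) - ln (cmod (z\<^sup>2 + (of_real b)\<^sup>2))) / 2"
    unfolding s k[symmetric] by (subst ennreal_mult'[symmetric], simp, simp) (use nns in simp)
qed

lemma ln_pole_product:
  assumes W: "0 < W" "W < Wmax" and r: "rts W z u v" and z: "0 < cmod (z\<^sup>2 + (of_real b)\<^sup>2)"
  shows "ln (cmod (z\<^sup>2 + (of_real b)\<^sup>2)) / 2 - ln (eta W) = ln (al W) + ln (cmod (1 + of_real (pM W) * u\<^sup>2)) / 2 + ln (cmod (1 + of_real (pM W) * v\<^sup>2)) / 2"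
    "0 < cmod (1 + of_real (pM W) * u\<^sup>2)"
proof -
  note A = al_be[OF W]
  have e: "cmod (z\<^sup>2 + (of_real b)\<^sup>2) = ((al W)\<^sup>2 * (eta W)\<^sup>2) * cmod (1 + of_real (pM W) * u\<^sup>2) * cmod (1 + of_real (pM W) * v\<^sup>2)"
    unfolding rts_facts(8)[OF W r] norm_mult norm_of_real by simp
  have p: "0 < cmod (1 + of_real (pM W) * u\<^sup>2)" "0 < cmod (1 + of_real (pM W) * v\<^sup>2)"
    using z unfolding e by (auto simp: zero_less_mult_iff)
  then show "0 < cmod (1 + of_real (pM W) * u\<^sup>2)" by simp
  have q: "0 < (al W)\<^sup>2" "0 < (eta W)\<^sup>2" "0 < eta W" using A by simp_all
  have "ln (cmod (z\<^sup>2 + (of_real b)\<^sup>2)) = 2 * ln (al W) + 2 * ln (eta W) + ln (cmod (1 + of_real (pM W) * u\<^sup>2)) + ln (cmod (1 + of_real (pM W) * v\<^sup>2))"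
    unfolding e using p q A(3) by (simp only: ln_mult_pos mult_pos_pos ln_realpow of_nat_numeral)
  then show "ln (cmod (z\<^sup>2 + (of_real b)\<^sup>2)) / 2 - ln (eta W) = ln (al W) + ln (cmod (1 + of_real (pM W) * u\<^sup>2)) / 2 + ln (cmod (1 + of_real (pM W) * v\<^sup>2)) / 2"
    by (simp add: field_simps)
qed

text \<open>Inside of the leaf the maximum in \<open>leaf_log\<close> is \<bar>1 + M u^2\<bar>, and
  its product with \<bar>1 + M v^2\<bar> is a multiple of \<bar>z^2 + b^2\<bar>, the potential of
  the two charges. Elsewhere the maximum can only be larger, hence the potential smaller. The
  reference point 0 is the centre of all leaves.\<close>

lemma leaf_balance:
  assumes W: "0 < W" "W < Wmax"
  defines "K \<equiv> \<lambda>z. ennreal (1 / 2) * (skernel (sph z) (sph (\<i> * of_real b)) + skernel (sph z) (sph (- (\<i> * of_real b))))"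
  shows "leaf W (sph z) + K 0 \<le> leaf W (sph 0) + K z"
    and "hlev (sph z) < W \<Longrightarrow> leaf W (sph z) + K 0 = leaf W (sph 0) + K z"
proof -
  note M = W_facts(12,13)[OF W]
  obtain e where e: "\<And>z u v. rts W z u v \<Longrightarrow> leaf W (sph z) = ennreal (ln (1 + (cmod z)\<^sup>2) / 2 + e - leaf_log W u v)"
    and e0: "\<And>z u v. rts W z u v \<Longrightarrow> 0 \<le> ln (1 + (cmod z)\<^sup>2) / 2 + e - leaf_log W u v"
    using leaf_potential[OF W] by blast
  define B where "B z = ln (cmod (z\<^sup>2 + (of_real b)\<^sup>2))" for z :: complex
  define N where "N z = ln (1 + (cmod z)\<^sup>2)" for z :: complex
  have inner: "leaf W (sph z) = ennreal (N z / 2 + e - (B z / 2 - ln (eta W)))" "0 \<le> N z / 2 + e - (B z / 2 - ln (eta W))"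
    if z: "0 < cmod (z\<^sup>2 + (of_real b)\<^sup>2)" and h: "hlev (sph z) < W" for z
  proof -
    obtain u v where r: "rts W z u v" using rts_exist[OF W] .
    have "cmod (u\<^sup>2) \<le> 1" using rts_level(1)[OF W r h] by (simp add: norm_power power_le_one)
    then have m: "max (cmod (1 + of_real (pM W) * u\<^sup>2)) (cmod (u\<^sup>2 + of_real (pM W))) = cmod (1 + of_real (pM W) * u\<^sup>2)"
      by (rule max_absorb1[OF blaschke_compare(1)[OF M]])
    show "leaf W (sph z) = ennreal (N z / 2 + e - (B z / 2 - ln (eta W)))" "0 \<le> N z / 2 + e - (B z / 2 - ln (eta W))"
      using e[OF r] e0[OF r] unfolding leaf_log_def m ln_pole_product(1)[OF W r z, symmetric] B_def N_def .
  qed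
  have le: "\<exists>x. leaf W (sph z) = ennreal x \<and> 0 \<le> x \<and> x \<le> N z / 2 + e - (B z / 2 - ln (eta W))"
    if z: "0 < cmod (z\<^sup>2 + (of_real b)\<^sup>2)" for z
  proof -
    obtain u v where r: "rts W z u v" using rts_exist[OF W] .
    note L = ln_pole_product[OF W r z]
    have "ln (cmod (1 + of_real (pM W) * u\<^sup>2)) \<le> ln (max (cmod (1 + of_real (pM W) * u\<^sup>2)) (cmod (u\<^sup>2 + of_real (pM W))))"
      by (rule ln_mono) (use L(2) in simp_all)
    then have "B z / 2 - ln (eta W) \<le> ln (al W) + ln (max (cmod (1 + of_real (pM W) * u\<^sup>2)) (cmod (u\<^sup>2 + of_real (pM W)))) / 2 + ln (cmod (1 + of_real (pM W) * v\<^sup>2)) / 2"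
      unfolding B_def L(1) by (intro add_right_mono add_left_mono divide_right_mono) auto
    then show ?thesis using e[OF r] e0[OF r] unfolding N_def leaf_log_def by (intro exI conjI) (assumption, assumption, linarith)
  qed
  have b0: "complex_of_real b \<noteq> 0" using b by simp
  then have z0: "(0::complex) \<noteq> \<i> * of_real b" "(0::complex) \<noteq> - (\<i> * of_real b)" by simp_all
  note K0 = pole_kernels[OF z0]
  have h0: "hlev (sph 0) < W" using W by (simp add: hlev_0)
  have fin: "N z / 2 + e - (B z / 2 - ln (eta W)) + (N 0 + ln (1 + b\<^sup>2) - B 0) / 2
     = N 0 / 2 + e - (B 0 / 2 - ln (eta W)) + (N z + ln (1 + b\<^sup>2) - B z) / 2" for z
    by (simp add: field_simps)
  show "leaf W (sph z) + K 0 \<le> leaf W (sph 0) + K z"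
  proof (cases "z = \<i> * of_real b \<or> z = - (\<i> * of_real b)")
    case True
    then have "K z = \<top>" by (auto simp: K_def ennreal_mult_eq_top_iff)
    then show ?thesis by simp
  next
    case False
    then have z: "z \<noteq> \<i> * of_real b" "z \<noteq> - (\<i> * of_real b)" by auto
    note Kz = pole_kernels[OF z]
    obtain x where x: "leaf W (sph z) = ennreal x" "0 \<le> x" "x \<le> N z / 2 + e - (B z / 2 - ln (eta W))"
      using le[OF Kz(3)] by auto
    show ?thesis
      unfolding K_def Kz(1) K0(1) x(1) inner(1)[OF K0(3) h0]
      unfolding ennreal_plus[OF x(2) K0(2), symmetric] ennreal_plus[OF inner(2)[OF K0(3) h0] Kz(2), symmetric]
      using x(3) fin[of z] unfolding N_def B_def by (intro ennreal_leI) linarith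
  qed
  show "leaf W (sph z) + K 0 = leaf W (sph 0) + K z" if h: "hlev (sph z) < W"
  proof -
    have z: "z \<noteq> \<i> * of_real b" "z \<noteq> - (\<i> * of_real b)" using hlev_pole h W by auto
    note Kz = pole_kernels[OF z]
    show ?thesis
      unfolding K_def Kz(1) K0(1) inner(1)[OF Kz(3) h] inner(1)[OF K0(3) h0]
      unfolding ennreal_plus[OF inner(2)[OF Kz(3) h] K0(2), symmetric] ennreal_plus[OF inner(2)[OF K0(3) h0] Kz(2), symmetric]
      unfolding N_def B_def by (rule arg_cong[where f = ennreal, OF fin[of z, unfolded N_def B_def]])
  qed
qed

text \<open>Outside of the leaf the maximum in \<open>leaf_log\<close> is \<bar>u^2 + M\<bar>, and
  \<open>leaf_log\<close> coincides with \<open>line_log (1/2) (1/2)\<close>, where the terms ln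
  \<bar>u\<bar> cancel. Elsewhere the maximum is at least that large, and the leaf potential can
  only drop.\<close>

lemma shadow_balance:
  assumes W: "0 < W" "W < Wmax"
  defines "p \<equiv> sph (\<i> * of_real b)"
  shows "shadow W p + leaf W (sph z) \<le> shadow W (sph z) + leaf W p"
    and "W < hlev (sph z) \<Longrightarrow> shadow W p + leaf W (sph z) = shadow W (sph z) + leaf W p"
proof -
  note M = W_facts(12,13)[OF W] and m = mAB[OF W]
  obtain e where e: "\<And>z u v. rts W z u v \<Longrightarrow> leaf W (sph z) = ennreal (ln (1 + (cmod z)\<^sup>2) / 2 + e - leaf_log W u v)"
    and e0: "\<And>z u v. rts W z u v \<Longrightarrow> 0 \<le> ln (1 + (cmod z)\<^sup>2) / 2 + e - leaf_log W u v"
    using leaf_potential[OF W] by blast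
  have A: "0 \<le> mA W" "mA W < 1" and B: "0 \<le> mB W" "mB W < 1" using m by linarith+
  have pos: "0 \<le> 1 / 2 * poisson2 (mA W) (circ t) + 1 / 2 * poisson2 (mB W) (circ t)" for t
    using poisson2_pos[OF A, of "circ t"] poisson2_pos[OF B, of "circ t"] by simp
  have half: "(1/2::real) + 1/2 = 1" by simp
  obtain f where f: "\<And>z u v. rts W z u v \<Longrightarrow>
      (\<integral>\<^sup>+t. ennreal (1 / 2 * poisson2 (mA W) (circ t) + 1 / 2 * poisson2 (mB W) (circ t))
         * skernel (sph z) (line_pt (cr W * Re (circ t))) \<partial>uiv) = ennreal (ln (1 + (cmod z)\<^sup>2) / 2 + f - line_log (1 / 2) (1 / 2) W u v)"
    and f0: "\<And>z u v. rts W z u v \<Longrightarrow> 0 \<le> ln (1 + (cmod z)\<^sup>2) / 2 + f - line_log (1 / 2) (1 / 2) W u v"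
  proof (rule line_spot[OF W half pos])
    fix e
    assume "\<And>z u v. rts W z u v \<Longrightarrow>
      (\<integral>\<^sup>+t. ennreal (1 / 2 * poisson2 (mA W) (circ t) + 1 / 2 * poisson2 (mB W) (circ t))
         * skernel (sph z) (line_pt (cr W * Re (circ t))) \<partial>uiv) = ennreal (ln (1 + (cmod z)\<^sup>2) / 2 + e - line_log (1 / 2) (1 / 2) W u v)"
      "\<And>z u v. rts W z u v \<Longrightarrow> 0 \<le> ln (1 + (cmod z)\<^sup>2) / 2 + e - line_log (1 / 2) (1 / 2) W u v"
    then show thesis by (rule that)
  qed
  have sh: "shadow W x = (\<integral>\<^sup>+t. ennreal (1 / 2 * poisson2 (mA W) (circ t) + 1 / 2 * poisson2 (mB W) (circ t))
         * skernel x (line_pt (cr W * Re (circ t))) \<partial>uiv)" for x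
    unfolding shadow_def by (simp add: add_divide_distrib)
  have le: "\<exists>x y. leaf W (sph z) = ennreal x \<and> shadow W (sph z) = ennreal y \<and> 0 \<le> x \<and> 0 \<le> y \<and> x - y \<le> e - f \<and> (W < hlev (sph z) \<longrightarrow> x - y = e - f)" for z
  proof -
    obtain u v where r: "rts W z u v" using rts_exist[OF W] .
    let ?C = "cmod (u\<^sup>2 + of_real (pM W))" and ?B = "cmod (1 + of_real (pM W) * u\<^sup>2)"
    have C: "0 < ?C"
    proof -
      have "be W / al W \<le> cmod (u\<^sup>2)" using rts_facts(4)[OF W r] by (simp add: norm_power)
      moreover have "pM W < be W / al W"
        unfolding m(6)[symmetric] using mult_strict_right_mono[OF m(3), of "be W / al W"] al_be(1,3)[OF W] by simp
      ultimately have l: "\<bar>pM W\<bar> < cmod (u\<^sup>2)" using M by linarith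
      have "u\<^sup>2 \<noteq> - of_real (pM W)"
      proof
        assume "u\<^sup>2 = - of_real (pM W)"
        then have "cmod (u\<^sup>2) = \<bar>pM W\<bar>" by (simp only: norm_minus_cancel norm_of_real)
        with l show False by linarith
      qed
      then show ?thesis by (simp add: eq_neg_iff_add_eq_0)
    qed
    have m1: "ln ?C \<le> ln (max ?B ?C)" using C by (intro ln_mono) auto
    have m2: "ln (max ?B ?C) = ln ?C" if h: "W < hlev (sph z)"
    proof -
      have "1 \<le> cmod (u\<^sup>2)" using rts_level(2)[OF W r h] by (simp add: norm_power one_le_power)
      then show ?thesis by (simp only: max_absorb2[OF blaschke_compare(2)[OF M]])
    qed
    have ar: "(N / 2 + e - (A + m / 2 + d / 2)) - (N / 2 + f - (A + 1 / 2 * (c - l) + 1 / 2 * (l + d))) = e - f + (c - m) / 2" for N A m d c l :: real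
      by (simp add: field_simps)
    show ?thesis
    proof (rule exI, rule exI, intro conjI impI)
      show "leaf W (sph z) = ennreal (ln (1 + (cmod z)\<^sup>2) / 2 + e - (ln (al W) + ln (max ?B ?C) / 2 + ln (cmod (1 + of_real (pM W) * v\<^sup>2)) / 2))"
        by (rule e[OF r, unfolded leaf_log_def])
      show "shadow W (sph z) = ennreal (ln (1 + (cmod z)\<^sup>2) / 2 + f -
        (ln (al W) + 1 / 2 * (ln ?C - ln (cmod u)) + 1 / 2 * (ln (cmod u) + ln (cmod (1 + of_real (pM W) * v\<^sup>2)))))"
        unfolding sh by (rule f[OF r, unfolded line_log_def])
    next
      have "x \<le> y \<Longrightarrow> E + (x - y) / 2 \<le> E" for x y E :: real by simp
      from this[OF m1] show "(ln (1 + (cmod z)\<^sup>2) / 2 + e - (ln (al W) + ln (max ?B ?C) / 2 + ln (cmod (1 + of_real (pM W) * v\<^sup>2)) / 2))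
        - (ln (1 + (cmod z)\<^sup>2) / 2 + f - (ln (al W) + 1 / 2 * (ln ?C - ln (cmod u)) + 1 / 2 * (ln (cmod u) + ln (cmod (1 + of_real (pM W) * v\<^sup>2))))) \<le> e - f"
        unfolding ar .
    next
      assume h: "W < hlev (sph z)"
      show "(ln (1 + (cmod z)\<^sup>2) / 2 + e - (ln (al W) + ln (max ?B ?C) / 2 + ln (cmod (1 + of_real (pM W) * v\<^sup>2)) / 2))
        - (ln (1 + (cmod z)\<^sup>2) / 2 + f - (ln (al W) + 1 / 2 * (ln ?C - ln (cmod u)) + 1 / 2 * (ln (cmod u) + ln (cmod (1 + of_real (pM W) * v\<^sup>2))))) = e - f"
        unfolding ar m2[OF h] by simp
    qed (rule e0[OF r, unfolded leaf_log_def] f0[OF r, unfolded line_log_def])+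
  qed
  obtain x y where xy: "leaf W (sph z) = ennreal x" "shadow W (sph z) = ennreal y" "0 \<le> x" "0 \<le> y" "x - y \<le> e - f" "W < hlev (sph z) \<longrightarrow> x - y = e - f"
    using le by blast
  have "W < hlev p" unfolding p_def using hlev_pole(1) W by linarith
  then obtain x' y' where xy': "leaf W p = ennreal x'" "shadow W p = ennreal y'" "0 \<le> x'" "0 \<le> y'" "x' - y' = e - f"
    using le[of "\<i> * of_real b"] unfolding p_def by blast
  note P = ennreal_plus[OF xy'(4) xy(3), symmetric] ennreal_plus[OF xy(4) xy'(3), symmetric]
  show "shadow W p + leaf W (sph z) \<le> shadow W (sph z) + leaf W p"
    unfolding xy(1,2) xy'(1,2) P by (rule ennreal_leI) (use xy xy' in linarith)
  show "shadow W p + leaf W (sph z) = shadow W (sph z) + leaf W p" if "W < hlev (sph z)"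
  proof -
    have "y' + x = y + x'" using xy xy' that by linarith
    then show ?thesis unfolding xy(1,2) xy'(1,2) P by simp
  qed
qed

end

section \<open>The equilibrium measure on the line\<close>

text \<open>The cosine is injective on half a turn only; both halves of the circle contribute the
  same integral \<open>J\<close>.\<close>

lemma arcsine_law:
  assumes r: "0 < r" and [measurable]: "h \<in> borel_measurable borel"
  shows "(\<integral>\<^sup>+t. h (r * Re (circ t)) \<partial>uiv) = (\<integral>\<^sup>+x. indicator {- r<..<r} x * ennreal (1 / (pi * sqrt (r\<^sup>2 - x\<^sup>2))) * h x \<partial>lborel)"
proof -
  have m1: "(\<lambda>t. h (r * cos (2 * pi * t)) * indicator {0..1} t) \<in> borel_measurable borel" by measurable
  have m2: "(\<lambda>s. h (- (r * cos (pi * s))) * indicator {0..1} (- s)) \<in> borel_measurable borel" by measurable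
  define J where "J = (\<integral>\<^sup>+s. h (- (r * cos (pi * s))) * indicator {0..1} s \<partial>lborel)"
  have "(\<integral>\<^sup>+t. h (r * Re (circ t)) \<partial>uiv) = (\<integral>\<^sup>+t. h (r * cos (2 * pi * t)) * indicator {0..1} t \<partial>lborel)"
    by (subst nn_integral_uiv) (auto simp: circ_cis)
  \<comment> \<open>Shifted by half a turn and rescaled, the parameter s runs over [-1, 1], and the
    point becomes -r cos (pi s), which increases on [0, 1] as the substitution rule
    requires.\<close>
  also have "\<dots> = ennreal \<bar>1 / 2\<bar> * (\<integral>\<^sup>+s. h (r * cos (2 * pi * (1 / 2 + 1 / 2 * s))) * indicator {0..1} (1 / 2 + 1 / 2 * s) \<partial>lborel)"
    by (rule nn_integral_real_affine[OF m1]) simp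
  also have "(\<integral>\<^sup>+s. h (r * cos (2 * pi * (1 / 2 + 1 / 2 * s))) * indicator {0..1} (1 / 2 + 1 / 2 * s) \<partial>lborel)
      = (\<integral>\<^sup>+s. h (- (r * cos (pi * s))) * indicator {0..1} s + h (- (r * cos (pi * s))) * indicator {0..1} (- s) \<partial>lborel)"
  proof (rule nn_integral_cong_AE)
    show "AE s in lborel. h (r * cos (2 * pi * (1 / 2 + 1 / 2 * s))) * indicator {0..1} (1 / 2 + 1 / 2 * s)
      = h (- (r * cos (pi * s))) * indicator {0..1} s + h (- (r * cos (pi * s))) * indicator {0..1} (- s)"
      using AE_lborel_singleton[of 0]
    proof eventually_elim
      case (elim s)
      have "2 * pi * (1 / 2 + 1 / 2 * s) = pi * s + pi" by (simp add: field_simps)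
      then have "cos (2 * pi * (1 / 2 + 1 / 2 * s)) = - cos (pi * s)" by (simp only: cos_periodic_pi)
      then show ?case using elim by (auto simp: indicator_def)
    qed
  qed
  also have "\<dots> = J + (\<integral>\<^sup>+s. h (- (r * cos (pi * s))) * indicator {0..1} (- s) \<partial>lborel)"
    unfolding J_def by (rule nn_integral_add) measurable
  also have "(\<integral>\<^sup>+s. h (- (r * cos (pi * s))) * indicator {0..1} (- s) \<partial>lborel)
      = ennreal \<bar>- 1\<bar> * (\<integral>\<^sup>+s. h (- (r * cos (pi * (0 + - 1 * s)))) * indicator {0..1} (- (0 + - 1 * s)) \<partial>lborel)"
    by (rule nn_integral_real_affine[OF m2]) simp
  also have "\<dots> = J" by (simp add: J_def)
  also have "ennreal \<bar>1 / 2\<bar> * (J + J) = J"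
  proof -
    have "ennreal \<bar>1 / 2\<bar> * (J + J) = (ennreal (1 / 2) * 2) * J" by (simp only: mult_2[symmetric] mult.assoc) simp
    also have "ennreal (1 / 2) * 2 = 1" by (subst ennreal_numeral[symmetric], subst ennreal_mult'[symmetric]) simp_all
    finally show ?thesis by simp
  qed
  also have "J = (\<integral>\<^sup>+s. (ennreal (1 / (pi * sqrt (r\<^sup>2 - (- (r * cos (pi * s)))\<^sup>2))) * h (- (r * cos (pi * s)))) * ennreal (r * (sin (pi * s) * pi)) * indicator {0..1} s \<partial>lborel)"
    unfolding J_def
  proof (rule nn_integral_cong_AE)
    show "AE s in lborel. h (- (r * cos (pi * s))) * indicator {0..1} s = (ennreal (1 / (pi * sqrt (r\<^sup>2 - (- (r * cos (pi * s)))\<^sup>2))) * h (- (r * cos (pi * s)))) * ennreal (r * (sin (pi * s) * pi)) * indicator {0..1} s"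
      using AE_lborel_singleton[of 0] AE_lborel_singleton[of 1]
    proof eventually_elim
      case (elim s)
      show ?case
      proof (cases "0 < s \<and> s < 1")
        case True
        then have sn: "0 < sin (pi * s)" by (intro sin_gt_zero) auto
        have "r\<^sup>2 - (- (r * cos (pi * s)))\<^sup>2 = (r * sin (pi * s))\<^sup>2"
          by (simp add: power_mult_distrib sin_squared_eq algebra_simps)
        then have sq: "sqrt (r\<^sup>2 - (- (r * cos (pi * s)))\<^sup>2) = r * sin (pi * s)" using r sn by simp
        have o: "ennreal (1 / (pi * (r * sin (pi * s)))) * ennreal (r * (sin (pi * s) * pi)) = 1"
          using r sn by (simp add: ennreal_mult'[symmetric])
        have "(ennreal (1 / (pi * (r * sin (pi * s)))) * h (- (r * cos (pi * s)))) * ennreal (r * (sin (pi * s) * pi)) * indicator {0..1} s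
          = (ennreal (1 / (pi * (r * sin (pi * s)))) * ennreal (r * (sin (pi * s) * pi))) * h (- (r * cos (pi * s))) * indicator {0..1} s"
          by (simp only: mult_ac)
        then show ?thesis unfolding sq o by simp
      next
        case False
        then show ?thesis using elim by (auto simp: indicator_def)
      qed
    qed
  qed
  also have "\<dots> = (\<integral>\<^sup>+x. (ennreal (1 / (pi * sqrt (r\<^sup>2 - x\<^sup>2))) * h x) * indicator {- (r * cos (pi * 0))..- (r * cos (pi * 1))} x \<partial>lborel)"
    using r by (intro nn_integral_substitution_aux[symmetric])
      (auto intro!: derivative_eq_intros continuous_intros mult_nonneg_nonneg sin_ge_zero mult_left_le)
  also have "\<dots> = (\<integral>\<^sup>+x. indicator {- r<..<r} x * ennreal (1 / (pi * sqrt (r\<^sup>2 - x\<^sup>2))) * h x \<partial>lborel)"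
  proof (rule nn_integral_cong_AE)
    show "AE x in lborel. (ennreal (1 / (pi * sqrt (r\<^sup>2 - x\<^sup>2))) * h x) * indicator {- (r * cos (pi * 0))..- (r * cos (pi * 1))} x
      = indicator {- r<..<r} x * ennreal (1 / (pi * sqrt (r\<^sup>2 - x\<^sup>2))) * h x"
      using AE_lborel_singleton[of r] AE_lborel_singleton[of "- r"]
      by eventually_elim (auto simp: indicator_def)
  qed
  finally show ?thesis .
qed

text \<open>Only continuity of the antiderivative is required at the ends, so the integrand may be
  unbounded there, as an inverse square root is.\<close>

lemma nn_integral_FTC_open:
  fixes f F :: "real \<Rightarrow> real"
  assumes ab: "a < b" and c: "continuous_on {a..b} F"
    and d: "\<And>x. a < x \<Longrightarrow> x < b \<Longrightarrow> (F has_real_derivative f x) (at x)"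
    and f: "\<And>x. a < x \<Longrightarrow> x < b \<Longrightarrow> isCont f x" "\<And>x. a < x \<Longrightarrow> x < b \<Longrightarrow> 0 \<le> f x"
  shows "(\<integral>\<^sup>+x. indicator {a<..<b} x * ennreal (f x) \<partial>lborel) = ennreal (F b - F a)"
proof -
  have A: "((F \<circ> real_of_ereal) \<longlongrightarrow> F a) (at_right (ereal a))"
    unfolding ereal_tendsto_simps using c ab by (auto simp: continuous_on_Icc_at_rightD)
  have B: "((F \<circ> real_of_ereal) \<longlongrightarrow> F b) (at_left (ereal b))"
    unfolding ereal_tendsto_simps using c ab by (auto simp: continuous_on_Icc_at_leftD)
  have lt: "ereal a < ereal b" using ab by simp
  have i: "set_integrable lborel (einterval (ereal a) (ereal b)) f" "(LBINT x=ereal a..ereal b. f x) = F b - F a"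
    by (rule interval_integral_FTC_nonneg[OF lt _ _ _ A B]; use d f in simp)+
  have ii: "integrable lborel (\<lambda>x. indicator {a<..<b} x * f x)" "(\<integral>x. indicator {a<..<b} x * f x \<partial>lborel) = F b - F a"
    using i ab by (simp_all add: set_integrable_def interval_lebesgue_integral_def set_lebesgue_integral_def)
  have "(\<integral>\<^sup>+x. indicator {a<..<b} x * ennreal (f x) \<partial>lborel) = (\<integral>\<^sup>+x. ennreal (indicator {a<..<b} x * f x) \<partial>lborel)"
    by (intro nn_integral_cong) (auto simp: indicator_def)
  also have "\<dots> = ennreal (F b - F a)"
    unfolding ii(2)[symmetric] using f(2) by (intro nn_integral_eq_integral ii) (auto simp: indicator_def)
  finally show ?thesis .
qed

lemma poisson2_quotient:
  assumes "0 < y" "y < x"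
  shows "poisson2 (y / x) (circ t) = (x - y) * (x + y) / ((x - y)\<^sup>2 + 4 * (x * y) * (Re (circ t))\<^sup>2)"
proof -
  define c where "c = (Re (circ t))\<^sup>2"
  have i: "(Im (circ t))\<^sup>2 = 1 - c" using circ_sq[of t] by (simp add: c_def)
  define M where "M = y / x"
  have "(cmod ((circ t)\<^sup>2 + of_real M))\<^sup>2 = ((Re (circ t))\<^sup>2 - (Im (circ t))\<^sup>2 + M)\<^sup>2 + 4 * (Re (circ t))\<^sup>2 * (Im (circ t))\<^sup>2"
    unfolding cmod_power2 by (simp add: power2_eq_square algebra_simps)
  also have "\<dots> = (1 - M)\<^sup>2 + 4 * M * c"
    unfolding i c_def[symmetric] by (simp add: power2_eq_square algebra_simps)
  finally have d: "(cmod ((circ t)\<^sup>2 + of_real M))\<^sup>2 = (1 - M)\<^sup>2 + 4 * M * c" .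
  have "(1 - M)\<^sup>2 + 4 * M * c = ((x - y)\<^sup>2 + 4 * (x * y) * c) / x\<^sup>2" "1 - M\<^sup>2 = (x - y) * (x + y) / x\<^sup>2"
    using assms by (simp_all add: M_def power2_eq_square field_simps)
  then show ?thesis using assms unfolding poisson2_def M_def[symmetric] d c_def[symmetric] by simp
qed

context ellipse_family
begin

section \<open>The density on the line as a function of the level\<close>

text \<open>The equilibrium measure for the charge with W = 1 / (1 + 2 a), multiplied by W, has the
  density 2 sqrt (max 0 (qf W x)) / (pi AB x); \<open>dq\<close> is the derivative of
  \<open>qf\<close> in the level.\<close>

definition qf :: "real \<Rightarrow> real \<Rightarrow> real" where
  "qf W x = kk * W - (kk - cc * W) * (kk - (cc - 1) * W) * x\<^sup>2"
definition dq :: "real \<Rightarrow> real \<Rightarrow> real" where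
  "dq W x = kk + (cc * (kk - (cc - 1) * W) + (cc - 1) * (kk - cc * W)) * x\<^sup>2"
definition AB :: "real \<Rightarrow> real" where
  "AB x = (x\<^sup>2 + (1 / b)\<^sup>2) * (x\<^sup>2 + b\<^sup>2)"

lemma AB_pos: "0 < AB x"
  using b by (simp add: AB_def add_nonneg_pos)

lemma W_lin:
  assumes "0 \<le> W" "W \<le> Wmax"
  shows "0 \<le> kk - cc * W" "0 < kk - (cc - 1) * W"
proof -
  have "cc * W \<le> cc * Wmax" using assms cc_gt by (intro mult_left_mono) auto
  also have "cc * Wmax = kk" using cc_gt by (simp add: Wmax_def)
  finally show 1: "0 \<le> kk - cc * W" by simp
  show "0 < kk - (cc - 1) * W"
  proof (cases "W = 0")
    case True
    then show ?thesis using kk_pos by simp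
  next
    case False
    then have "0 < W" using assms by simp
    then show ?thesis using 1 by (simp add: algebra_simps)
  qed
qed

lemma dq_pos: "0 \<le> W \<Longrightarrow> W \<le> Wmax \<Longrightarrow> 0 < dq W x"
  unfolding dq_def using W_lin[of W] cc_gt kk_pos by (intro add_pos_nonneg mult_nonneg_nonneg add_nonneg_nonneg) auto

lemma qf_deriv: "((\<lambda>W. qf W x) has_real_derivative dq W x) (at W)"
  unfolding qf_def dq_def by (auto intro!: derivative_eq_intros simp: algebra_simps)

lemma qf_mono:
  assumes "0 \<le> W'" "W' < W" "W \<le> Wmax"
  shows "qf W' x < qf W x"
proof (rule DERIV_pos_imp_increasing[OF assms(2)])
  fix w assume "W' \<le> w" "w \<le> W"
  then show "\<exists>y. ((\<lambda>W. qf W x) has_real_derivative y) (at w) \<and> 0 < y"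
    using qf_deriv[of x w] dq_pos[of w x] assms by (intro exI[of _ "dq w x"]) auto
qed

text \<open>The integrand is the derivative of 2 sqrt (qf). For fixed x, \<open>qf\<close> increases
  in the level: x belongs to the focal segments from the level w on at which \<open>qf\<close>
  vanishes, and since it vanishes there the entry of x contributes no boundary term.\<close>

lemma qf_level_integral:
  assumes W0: "0 < W0" "W0 < Wmax"
  shows "(\<integral>\<^sup>+W. indicator {0<..<W0} W * (indicator {W. 0 < qf W x} W * ennreal (dq W x / sqrt (qf W x))) \<partial>lborel)
    = ennreal (2 * sqrt (max 0 (qf W0 x)))"
proof (cases "0 < qf W0 x")
  case False
  have "(\<integral>\<^sup>+W. indicator {0<..<W0} W * (indicator {W. 0 < qf W x} W * ennreal (dq W x / sqrt (qf W x))) \<partial>lborel)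
    = (\<integral>\<^sup>+W. 0 \<partial>(lborel :: real measure))"
  proof (intro nn_integral_cong)
    fix W
    show "indicator {0<..<W0} W * (indicator {W. 0 < qf W x} W * ennreal (dq W x / sqrt (qf W x))) = 0"
      using qf_mono[of W W0 x] W0 False by (auto simp: indicator_def)
  qed
  then show ?thesis using False by simp
next
  case True
  have c: "continuous_on S (\<lambda>W. qf W x)" for S unfolding qf_def by (intro continuous_intros)
  \<comment> \<open>At level 0 the value is -(kk x)^2, the nonpositive end for the intermediate
    value theorem.\<close>
  have "\<exists>w\<ge>0. w \<le> W0 \<and> qf w x = 0"
    by (rule IVT'[of "\<lambda>W. qf W x"]) (use True W0 c in \<open>auto simp: qf_def\<close>)
  then obtain w where w: "0 \<le> w" "w \<le> W0" "qf w x = 0" by auto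
  then have wl: "w < W0" using True by (cases "w = W0") auto
  have pos: "0 < qf W x \<longleftrightarrow> w < W" if "0 < W" "W < W0" for W
    using qf_mono[of w W x] qf_mono[of W w x] w that W0 by (cases W w rule: linorder_cases) auto
  have "(\<integral>\<^sup>+W. indicator {0<..<W0} W * (indicator {W. 0 < qf W x} W * ennreal (dq W x / sqrt (qf W x))) \<partial>lborel)
    = (\<integral>\<^sup>+W. indicator {w<..<W0} W * ennreal (dq W x / sqrt (qf W x)) \<partial>lborel)"
    using pos w by (intro nn_integral_cong) (auto simp: indicator_def)
  also have "\<dots> = ennreal (2 * sqrt (qf W0 x) - 2 * sqrt (qf w x))"
  proof (rule nn_integral_FTC_open[OF wl])
    show "continuous_on {w..W0} (\<lambda>W. 2 * sqrt (qf W x))" by (intro continuous_intros c)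
    fix W assume W: "w < W" "W < W0"
    then have p: "0 < qf W x" using pos w by auto
    show "((\<lambda>W. 2 * sqrt (qf W x)) has_real_derivative dq W x / sqrt (qf W x)) (at W)"
      using p by (auto intro!: derivative_eq_intros qf_deriv simp: field_simps)
    show "isCont (\<lambda>W. dq W x / sqrt (qf W x)) W"
      using p unfolding qf_def dq_def by (intro continuous_intros) auto
    show "0 \<le> dq W x / sqrt (qf W x)" using p dq_pos[of W x] W w W0 by simp
  qed
  finally show ?thesis using True w by simp
qed

text \<open>The third item shows that \<open>qf W\<close> is positive exactly between the foci. The
  last two are the factors that \<open>poisson2_quotient\<close> leaves next to 1/b and b.\<close>

lemma cr_facts:
  assumes W: "0 < W" "W < Wmax"
  shows "0 < cr W" "(cr W)\<^sup>2 = 4 * (al W * be W)" "qf W x = (W * (rS W * rT W))\<^sup>2 * ((cr W)\<^sup>2 - x\<^sup>2)"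
    "W * ss W = kk - cc * W" "W * (1 + ss W) = kk - (cc - 1) * W"
    "be W * eta W + al W / eta W = (ch + ss W / b) / (rS W * rT W)"
    "al W * eta W + be W / eta W = (ch + b * ss W) / (rS W * rT W)"
proof -
  note F = W_facts[OF W] and A = al_be[OF W]
  have T: "0 < rT W" using F by linarith
  have p: "0 < al W * be W" using A by simp
  then show "0 < cr W" "(cr W)\<^sup>2 = 4 * (al W * be W)" by (simp_all add: cr_def power_mult_distrib)
  have "4 * (al W * be W) = (axA W)\<^sup>2 - (axB W)\<^sup>2"
    unfolding A(8,9) by (simp add: power2_eq_square algebra_simps)
  also have "\<dots> = (cc + ss W) / (ss W * (1 + ss W))"
    unfolding F(9,10) using F(1) by (simp add: field_simps)
  finally have c2: "(cr W)\<^sup>2 = (cc + ss W) / (ss W * (1 + ss W))" using \<open>(cr W)\<^sup>2 = 4 * (al W * be W)\<close> by simp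
  show s: "W * ss W = kk - cc * W" using W by (simp add: ss_def field_simps)
  then show s1: "W * (1 + ss W) = kk - (cc - 1) * W" by (simp add: algebra_simps)
  have "(W * (rS W * rT W))\<^sup>2 = (W * ss W) * (W * (1 + ss W))"
    unfolding power_mult_distrib F(5,6) by (simp add: power2_eq_square)
  moreover have "(W * ss W) * (W * (1 + ss W)) * (cr W)\<^sup>2 = W * (W * ss W + cc * W)"
  proof -
    have "ss W * (1 + ss W) * (cr W)\<^sup>2 = cc + ss W" unfolding c2 using F(1) by simp
    moreover have "(W * ss W) * (W * (1 + ss W)) * (cr W)\<^sup>2 = W * W * (ss W * (1 + ss W) * (cr W)\<^sup>2)" by simp
    ultimately show ?thesis by (simp add: algebra_simps)
  qed
  moreover have "W * (W * ss W + cc * W) = kk * W" unfolding s by simp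
  ultimately show "qf W x = (W * (rS W * rT W))\<^sup>2 * ((cr W)\<^sup>2 - x\<^sup>2)"
    unfolding qf_def s[symmetric] s1[symmetric] by (simp add: algebra_simps)
  have e: "(rT W - rS W) * eta W = 1" using F(5,6) by (simp add: eta_def power2_eq_square algebra_simps)
  then have ie: "X / eta W = X * (rT W - rS W)" for X using A(4) by (simp add: field_simps)
  have "be W * eta W + al W * (rT W - rS W) = axA W * rT W - axB W * rS W"
    unfolding A(8,9) eta_def by (simp add: algebra_simps)
  also have "\<dots> = (ch * (rT W)\<^sup>2 - sh * (rS W)\<^sup>2) / (rS W * rT W)"
    using F(3) T by (simp add: axA_def axB_def power2_eq_square field_simps)
  also have "ch * (rT W)\<^sup>2 - sh * (rS W)\<^sup>2 = ch + ss W * (ch - sh)" unfolding F(5,6) by (simp add: algebra_simps)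
  finally show "be W * eta W + al W / eta W = (ch + ss W / b) / (rS W * rT W)"
    unfolding ie ch_sh(6) by simp
  have "al W * eta W + be W * (rT W - rS W) = axA W * rT W + axB W * rS W"
    unfolding A(8,9) eta_def by (simp add: algebra_simps)
  also have "\<dots> = (ch * (rT W)\<^sup>2 + sh * (rS W)\<^sup>2) / (rS W * rT W)"
    using F(3) T by (simp add: axA_def axB_def power2_eq_square field_simps)
  also have "ch * (rT W)\<^sup>2 + sh * (rS W)\<^sup>2 = ch + ss W * (ch + sh)" unfolding F(5,6) by (simp add: algebra_simps)
  finally show "al W * eta W + be W / eta W = (ch + b * ss W) / (rS W * rT W)"
    unfolding ie ch_sh(5) by (simp add: mult.commute)
qed

text \<open>In the variable x both kernels are rational with denominators x^2 + 1/b^2 and x^2 + b^2.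
  The weights (1 + W)/2 and -(1 - W)/2 make the common numerator a multiple of
  \<open>(cr W)^2 - x^2\<close>, so this density vanishes at the ends of the segment; with equal
  weights the numerator is \<open>dq\<close>.\<close>

lemma line_densities:
  assumes W: "0 < W" "W < Wmax"
  defines "x \<equiv> \<lambda>t. cr W * Re (circ t)"
  shows "(1 + W) / 2 * poisson2 (mA W) (circ t) - (1 - W) / 2 * poisson2 (mB W) (circ t)
      = 2 * (W * (rS W * rT W)) * ((cr W)\<^sup>2 - (x t)\<^sup>2) / AB (x t)"
    and "(poisson2 (mA W) (circ t) + poisson2 (mB W) (circ t)) / 2 = dq W (x t) / (W * (rS W * rT W) * AB (x t))"
proof -
  note F = W_facts[OF W] and A = al_be[OF W] and C = cr_facts[OF W]
  have T: "0 < rT W" using F by linarith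
  define D where "D = rS W * rT W"
  have D: "0 < D" "D\<^sup>2 = ss W * (1 + ss W)" using F(3) T by (simp_all add: D_def power_mult_distrib F(5,6))
  define X where "X = (x t)\<^sup>2"
  \<comment> \<open>With a name for 1/b, the relation b i = 1 keeps the identities below
    polynomial.\<close>
  define i where "i = 1 / b"
  have X: "0 \<le> X" by (simp add: X_def)
  have bi: "b * i = 1" "b + i = 2 * ch" "b - i = 2 * sh" using b ch_sh(5,6) by (simp_all add: i_def)
  have b2: "b\<^sup>2 + i\<^sup>2 = 4 * cc - 2" "b\<^sup>2 - i\<^sup>2 = 4 * kk"
  proof -
    have "b\<^sup>2 + i\<^sup>2 = (b + i)\<^sup>2 - 2 * (b * i)" by (simp add: power2_eq_square algebra_simps)
    then show "b\<^sup>2 + i\<^sup>2 = 4 * cc - 2" unfolding bi by (simp add: cc_def power_mult_distrib)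
    have "b\<^sup>2 - i\<^sup>2 = (b + i) * (b - i)" by (simp add: power2_eq_square algebra_simps)
    then show "b\<^sup>2 - i\<^sup>2 = 4 * kk" unfolding bi by (simp add: kk_def)
  qed
  have c4: "4 * (al W * be W) * (Re (circ t))\<^sup>2 = X" unfolding C(2)[symmetric] X_def x_def by (simp add: power_mult_distrib)
  have e0: "0 < eta W" using A(4) by simp
  have si: "ss W / b = ss W * i" by (simp add: i_def)
  have pA: "poisson2 (mA W) (circ t) = i * ((ch + ss W * i) / D) / (X + i\<^sup>2)"
  proof -
    have "al W / eta W < be W * eta W" using A(7) b by (smt (verit) zero_less_divide_1_iff)
    then have "poisson2 ((al W / eta W) / (be W * eta W)) (circ t) = (be W * eta W - al W / eta W) * (be W * eta W + al W / eta W)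
        / ((be W * eta W - al W / eta W)\<^sup>2 + 4 * (be W * eta W * (al W / eta W)) * (Re (circ t))\<^sup>2)"
      using A e0 by (intro poisson2_quotient) simp_all
    moreover have "mA W = (al W / eta W) / (be W * eta W)" by (simp add: mA_def power2_eq_square)
    moreover have "be W * eta W * (al W / eta W) = al W * be W" using e0 by simp
    ultimately show ?thesis unfolding A(7) C(6) si i_def[symmetric] by (simp only: c4 D_def add.commute)
  qed
  have pB: "poisson2 (mB W) (circ t) = b * ((ch + b * ss W) / D) / (X + b\<^sup>2)"
  proof -
    have "be W / eta W < al W * eta W" using A(6) b by linarith
    then have "poisson2 ((be W / eta W) / (al W * eta W)) (circ t) = (al W * eta W - be W / eta W) * (al W * eta W + be W / eta W)
        / ((al W * eta W - be W / eta W)\<^sup>2 + 4 * (al W * eta W * (be W / eta W)) * (Re (circ t))\<^sup>2)"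
      using A e0 by (intro poisson2_quotient) simp_all
    moreover have "mB W = (be W / eta W) / (al W * eta W)" by (simp add: mB_def power2_eq_square)
    moreover have "al W * eta W * (be W / eta W) = al W * be W" using e0 by simp
    ultimately show ?thesis unfolding A(6) C(7) by (simp only: c4 D_def add.commute)
  qed
  have i0: "0 < i" "0 < b" using b by (simp_all add: i_def)
  have n: "0 < X + i\<^sup>2" "0 < X + b\<^sup>2" using X i0 by (simp_all add: add_nonneg_pos)
  have ab: "AB (x t) = (X + i\<^sup>2) * (X + b\<^sup>2)" by (simp add: AB_def X_def i_def)
  define s where "s = ss W"
  have ks: "kk = W * s + cc * W" using C(4) by (simp add: s_def)
  have sum: "P * (i * ((ch + s * i) / D) / (X + i\<^sup>2)) + Q * (b * ((ch + b * s) / D) / (X + b\<^sup>2))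
     = (P * (i * (ch + s * i)) * (X + b\<^sup>2) + Q * (b * (ch + b * s)) * (X + i\<^sup>2)) / (D * ((X + i\<^sup>2) * (X + b\<^sup>2)))" for P Q
  proof -
    have "P * (i * (A / D) / M) + Q * (b * (B / D) / N) = (P * (i * A) * N + Q * (b * B) * M) / (D * (M * N))"
      if "0 < M" "0 < N" for A B M N
      using that D(1) by (simp add: add_divide_distrib)
    from this[OF n] show ?thesis .
  qed
  have n1: "(1 + W) * (i * (ch + s * i)) * (X + b\<^sup>2) + - (1 - W) * (b * (ch + b * s)) * (X + i\<^sup>2)
     = 4 * W * (cc + s) - 4 * W * (s * (1 + s)) * X"
  proof -
    have "(1 + W) * (i * (ch + s * i)) * (X + b\<^sup>2) + - (1 - W) * (b * (ch + b * s)) * (X + i\<^sup>2)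
      = X * (ch * (W * (b + i) - (b - i)) + s * (W * (b\<^sup>2 + i\<^sup>2) - (b\<^sup>2 - i\<^sup>2)))
        + (ch * (b * (b * i) - i * (b * i) + W * (b * (b * i) + i * (b * i))) + 2 * W * s * (b * i)\<^sup>2)"
      by (simp add: power2_eq_square algebra_simps)
    also have "ch * (W * (b + i) - (b - i)) = 2 * cc * W - 2 * kk"
      unfolding bi by (simp add: cc_def kk_def power2_eq_square algebra_simps)
    also have "ch * (b * (b * i) - i * (b * i) + W * (b * (b * i) + i * (b * i))) = 2 * kk + 2 * W * cc"
      unfolding bi(1) mult_1_right bi(2,3) by (simp add: cc_def kk_def power2_eq_square algebra_simps)
    also have "X * (2 * cc * W - 2 * kk + s * (W * (b\<^sup>2 + i\<^sup>2) - (b\<^sup>2 - i\<^sup>2))) + (2 * kk + 2 * W * cc + 2 * W * s * (b * i)\<^sup>2)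
      = X * (2 * cc * W - 2 * kk + s * (W * (4 * cc - 2) - 4 * kk)) + (2 * kk + 2 * W * cc + 2 * W * s)"
      unfolding b2 bi by simp
    also have "\<dots> = 4 * W * (cc + s) - 4 * W * (s * (1 + s)) * X"
      unfolding ks by (simp add: algebra_simps)
    finally show ?thesis .
  qed
  have n2: "W * (1 * (i * (ch + s * i)) * (X + b\<^sup>2) + 1 * (b * (ch + b * s)) * (X + i\<^sup>2)) = 2 * dq W (x t)"
  proof -
    have "1 * (i * (ch + s * i)) * (X + b\<^sup>2) + 1 * (b * (ch + b * s)) * (X + i\<^sup>2)
      = X * (ch * (b + i) + s * (b\<^sup>2 + i\<^sup>2)) + (ch * (b * (b * i) + i * (b * i)) + 2 * s * (b * i)\<^sup>2)"
      by (simp add: power2_eq_square algebra_simps)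
    also have "\<dots> = X * (2 * cc + s * (4 * cc - 2)) + (2 * cc + 2 * s)"
      unfolding b2 bi(1) mult_1_right bi(2) by (simp add: cc_def power2_eq_square)
    finally have r: "1 * (i * (ch + s * i)) * (X + b\<^sup>2) + 1 * (b * (ch + b * s)) * (X + i\<^sup>2) = X * (2 * cc + s * (4 * cc - 2)) + (2 * cc + 2 * s)" .
    show ?thesis unfolding r dq_def X_def[symmetric] ks by (simp add: algebra_simps)
  qed
  have cr2: "D\<^sup>2 * ((cr W)\<^sup>2 - X) = cc + s - s * (1 + s) * X"
  proof -
    have "W\<^sup>2 * (D\<^sup>2 * ((cr W)\<^sup>2 - X)) = qf W (x t)" using C(3)[of "x t"] by (simp add: D_def X_def power_mult_distrib)
    also have "\<dots> = W\<^sup>2 * (cc + s - s * (1 + s) * X)"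
      unfolding qf_def C(4,5)[symmetric] X_def[symmetric] s_def[symmetric] ks by (simp add: power2_eq_square algebra_simps)
    finally show ?thesis using W by simp
  qed
  have "(1 + W) / 2 * poisson2 (mA W) (circ t) - (1 - W) / 2 * poisson2 (mB W) (circ t)
    = ((1 + W) * (i * ((ch + s * i) / D) / (X + i\<^sup>2)) + - (1 - W) * (b * ((ch + b * s) / D) / (X + b\<^sup>2))) / 2"
    (is "_ = ?R")
  proof -
    have "(1 + W) / 2 * U - (1 - W) / 2 * V = ((1 + W) * U + - (1 - W) * V) / 2" for U V :: real
      by (simp add: field_simps)
    then show ?thesis unfolding pA pB s_def .
  qed
  also have "\<dots> = (4 * W * (D\<^sup>2 * ((cr W)\<^sup>2 - X))) / (D * ((X + i\<^sup>2) * (X + b\<^sup>2))) / 2"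
    unfolding sum n1 cr2 by (simp add: algebra_simps)
  also have "\<dots> = 2 * (W * D) * ((cr W)\<^sup>2 - X) / ((X + i\<^sup>2) * (X + b\<^sup>2))"
  proof -
    have "(4 * W * (D\<^sup>2 * Y)) / (D * Z) / 2 = 2 * (W * D) * Y / Z" for Y Z using D(1) by (simp add: power2_eq_square)
    then show ?thesis .
  qed
  finally show "(1 + W) / 2 * poisson2 (mA W) (circ t) - (1 - W) / 2 * poisson2 (mB W) (circ t)
      = 2 * (W * (rS W * rT W)) * ((cr W)\<^sup>2 - (x t)\<^sup>2) / AB (x t)"
    unfolding ab D_def X_def .
  have "(poisson2 (mA W) (circ t) + poisson2 (mB W) (circ t)) / 2
    = (1 * (i * ((ch + s * i) / D) / (X + i\<^sup>2)) + 1 * (b * ((ch + b * s) / D) / (X + b\<^sup>2))) / 2"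
    unfolding pA pB s_def by simp
  also have "\<dots> = (W * (1 * (i * (ch + s * i)) * (X + b\<^sup>2) + 1 * (b * (ch + b * s)) * (X + i\<^sup>2))) / (W * D * ((X + i\<^sup>2) * (X + b\<^sup>2))) / 2"
    unfolding sum using W by simp
  also have "\<dots> = dq W (x t) / (W * D * ((X + i\<^sup>2) * (X + b\<^sup>2)))" unfolding n2 by simp
  finally show "(poisson2 (mA W) (circ t) + poisson2 (mB W) (circ t)) / 2 = dq W (x t) / (W * (rS W * rT W) * AB (x t))"
    unfolding ab D_def .
qed

end

text \<open>The expression vanishes at y = 1. In the form chosen for the derivative of ln (1 + q y)
  - ln (q + y), the balance gives both terms the same numerator, and the denominators differ only in
  the coefficient q / (1 + q)^2 of (y - 1)^2, which increases in q on (0, 1).\<close>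

lemma balanced_quotient_log:
  fixes a m n y :: real
  assumes m: "0 < m" "m < n" "n < 1" and a: "0 < a" and bal: "(1 + a) * ((1 - n) / (1 + n)) = a * ((1 - m) / (1 + m))" and y: "1 \<le> y"
  shows "0 \<le> (1 + a) * ln ((1 + n * y) / (n + y)) - a * ln ((1 + m * y) / (m + y))"
proof -
  let ?h = "\<lambda>y. (1 + a) * (ln (1 + n * y) - ln (n + y)) - a * (ln (1 + m * y) - ln (m + y))"
  have d: "((\<lambda>y. ln (1 + q * y) - ln (q + y)) has_real_derivative - ((1 - q) / (1 + q) / (y + q / (1 + q)\<^sup>2 * (y - 1)\<^sup>2))) (at y)"
    if q: "0 < q" "q < 1" and y: "1 \<le> y" for q y
  proof -
    have p: "0 < 1 + q * y" "0 < q + y" using q y by (auto intro!: add_pos_nonneg)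
    have e: "q / (1 + q * y) - 1 / (q + y) = - ((1 - q) / (1 + q) / (y + q / (1 + q)\<^sup>2 * (y - 1)\<^sup>2))"
    proof -
      have "q / (1 + q * y) - 1 / (q + y) = (q * (q + y) - (1 + q * y)) / ((1 + q * y) * (q + y))"
        using p by (simp add: diff_frac_eq)
      also have "q * (q + y) - (1 + q * y) = - ((1 - q) * (1 + q))" by (simp add: algebra_simps)
      also have "(1 + q * y) * (q + y) = (1 + q)\<^sup>2 * (y + q / (1 + q)\<^sup>2 * (y - 1)\<^sup>2)"
      proof -
        have "(1 + q)\<^sup>2 * (y + q / (1 + q)\<^sup>2 * (y - 1)\<^sup>2) = (1 + q)\<^sup>2 * y + q * (y - 1)\<^sup>2" using q by (simp add: distrib_left)
        also have "\<dots> = (1 + q * y) * (q + y)" by (simp add: power2_eq_square algebra_simps)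
        finally show ?thesis ..
      qed
      finally show ?thesis using q by (simp add: power2_eq_square)
    qed
    show ?thesis unfolding e[symmetric] using p by (auto intro!: derivative_eq_intros simp: field_simps)
  qed
  have n: "0 < n" "m < 1" using m by simp_all
  define \<kappa> where "\<kappa> = a * ((1 - m) / (1 + m))"
  have k0: "0 \<le> \<kappa>" using a m n by (simp add: \<kappa>_def)
  have cmp: "m / (1 + m)\<^sup>2 \<le> n / (1 + n)\<^sup>2"
  proof -
    have "0 \<le> (n - m) * (1 - n * m)" using m n by (intro mult_nonneg_nonneg) (auto simp: mult_le_one)
    then have "m * (1 + n)\<^sup>2 \<le> n * (1 + m)\<^sup>2" by (simp add: power2_eq_square algebra_simps)
    then show ?thesis using m n by (simp add: divide_le_eq le_divide_eq)
  qed
  have "?h 1 \<le> ?h y"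
  proof (rule DERIV_nonneg_imp_nondecreasing[OF y])
    fix x :: real assume x: "1 \<le> x" "x \<le> y"
    have "m / (1 + m)\<^sup>2 * (x - 1)\<^sup>2 \<le> n / (1 + n)\<^sup>2 * (x - 1)\<^sup>2" by (rule mult_right_mono[OF cmp]) simp
    moreover have "0 \<le> m / (1 + m)\<^sup>2 * (x - 1)\<^sup>2" using m by simp
    ultimately have "\<kappa> / (x + n / (1 + n)\<^sup>2 * (x - 1)\<^sup>2) \<le> \<kappa> / (x + m / (1 + m)\<^sup>2 * (x - 1)\<^sup>2)"
      using x k0 by (intro divide_left_mono) (auto intro!: mult_pos_pos)
    moreover have "(?h has_real_derivative (1 + a) * - ((1 - n) / (1 + n) / (x + n / (1 + n)\<^sup>2 * (x - 1)\<^sup>2))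
        - a * - ((1 - m) / (1 + m) / (x + m / (1 + m)\<^sup>2 * (x - 1)\<^sup>2))) (at x)"
      by (intro DERIV_diff DERIV_cmult d n m x)
    moreover have "(1 + a) * - ((1 - n) / (1 + n) / X) - a * - ((1 - m) / (1 + m) / Y) = \<kappa> / Y - \<kappa> / X" for X Y
    proof -
      have "(1 + a) * - ((1 - n) / (1 + n) / X) = - ((1 + a) * ((1 - n) / (1 + n)) / X)" by simp
      then show ?thesis unfolding bal \<kappa>_def by simp
    qed
    ultimately show "\<exists>z. (?h has_real_derivative z) (at x) \<and> 0 \<le> z" by (intro exI conjI) (assumption, simp)
  qed
  moreover have "?h 1 = 0" by (simp add: add.commute)
  moreover have "ln ((1 + q * y) / (q + y)) = ln (1 + q * y) - ln (q + y)" if "0 < q" for q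
    using that y by (intro ln_divide_pos) (auto intro!: add_pos_nonneg)
  ultimately show ?thesis using m n by simp
qed

context ellipse_family
begin

lemma measurable_shape [measurable]:
  "eta \<in> borel_measurable borel" "al \<in> borel_measurable borel" "be \<in> borel_measurable borel" "cr \<in> borel_measurable borel"
  "mA \<in> borel_measurable borel" "mB \<in> borel_measurable borel"
  unfolding eta_def[abs_def] al_def[abs_def] be_def[abs_def] cr_def[abs_def] mA_def[abs_def] mB_def[abs_def] by measurable

text \<open>By \<open>arcsine_law\<close> the left side has the density 2 sqrt (qf) / (pi AB) at the
  level W0, and the leaf of level W contributes dq / (pi AB sqrt (qf)), the derivative in the level.
  After exchanging the integrals on the right, \<open>qf_level_integral\<close> matches the two for
  each x.\<close>

lemma line_identity:
  assumes W0: "0 < W0" "W0 < Wmax" and [measurable]: "f \<in> borel_measurable borel"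
  shows "(\<integral>\<^sup>+t. ennreal ((1 + W0) / 2 * poisson2 (mA W0) (circ t) - (1 - W0) / 2 * poisson2 (mB W0) (circ t)) * f (cr W0 * Re (circ t)) \<partial>uiv)
    = (\<integral>\<^sup>+W. indicator {0<..<W0} W * (\<integral>\<^sup>+t. ennreal ((poisson2 (mA W) (circ t) + poisson2 (mB W) (circ t)) / 2) * f (cr W * Re (circ t)) \<partial>uiv) \<partial>lborel)"
proof -
  have [measurable]: "AB \<in> borel_measurable borel" unfolding AB_def[abs_def] by measurable
  have qm [measurable]: "(\<lambda>(W, x). qf W x) \<in> borel_measurable (borel \<Otimes>\<^sub>M borel)" "(\<lambda>(W, x). dq W x) \<in> borel_measurable (borel \<Otimes>\<^sub>M borel)"
    unfolding qf_def dq_def by measurable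
  have qm1 [measurable]: "qf W \<in> borel_measurable borel" "dq W \<in> borel_measurable borel" for W
    unfolding qf_def[abs_def] dq_def[abs_def] by measurable
  have qm2 [measurable]: "(\<lambda>W. qf W x) \<in> borel_measurable borel" "(\<lambda>W. dq W x) \<in> borel_measurable borel" for x
    unfolding qf_def[abs_def] dq_def[abs_def] by measurable
  let ?g = "\<lambda>x. ennreal (1 / (pi * AB x)) * f x"
  have core: "0 < W * (rS W * rT W)" "\<And>x. 0 < qf W x \<longleftrightarrow> x \<in> {- cr W<..<cr W}"
     "\<And>x. x \<in> {- cr W<..<cr W} \<Longrightarrow> sqrt (qf W x) = W * (rS W * rT W) * sqrt ((cr W)\<^sup>2 - x\<^sup>2) \<and> 0 < sqrt ((cr W)\<^sup>2 - x\<^sup>2)"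
    if W: "0 < W" "W < Wmax" for W
  proof -
    note F = W_facts[OF W] and C = cr_facts[OF W]
    have "0 < rT W" using F by linarith
    then show k: "0 < W * (rS W * rT W)" using F(3) W by simp
    have sq: "0 < (cr W)\<^sup>2 - x\<^sup>2 \<longleftrightarrow> x \<in> {- cr W<..<cr W}" for x
    proof -
      have "x\<^sup>2 < (cr W)\<^sup>2 \<longleftrightarrow> \<bar>x\<bar> < cr W"
        unfolding not_le[symmetric] abs_le_square_iff[symmetric] using C(1) by simp
      then show ?thesis by auto
    qed
    show "0 < qf W x \<longleftrightarrow> x \<in> {- cr W<..<cr W}" for x
    proof -
      have "0 < c * d \<longleftrightarrow> 0 < d" if "0 < c" for c d :: real using that by (simp add: zero_less_mult_iff)
      then show ?thesis unfolding C(3) sq[symmetric] using k by (metis zero_less_power)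
    qed
    show "sqrt (qf W x) = W * (rS W * rT W) * sqrt ((cr W)\<^sup>2 - x\<^sup>2) \<and> 0 < sqrt ((cr W)\<^sup>2 - x\<^sup>2)" if "x \<in> {- cr W<..<cr W}" for x
      using that unfolding sq[symmetric] C(3) real_sqrt_mult using k by simp
  qed
  have inner: "(\<integral>\<^sup>+t. ennreal ((poisson2 (mA W) (circ t) + poisson2 (mB W) (circ t)) / 2) * f (cr W * Re (circ t)) \<partial>uiv)
      = (\<integral>\<^sup>+x. indicator {W. 0 < qf W x} W * ennreal (dq W x / sqrt (qf W x)) * ?g x \<partial>lborel)"
    if W: "0 < W" "W < Wmax" for W
  proof -
    note C = cr_facts[OF W] and K = core[OF W]
    let ?h = "\<lambda>x. ennreal (dq W x / (W * (rS W * rT W) * AB x)) * f x"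
    have "(\<integral>\<^sup>+t. ennreal ((poisson2 (mA W) (circ t) + poisson2 (mB W) (circ t)) / 2) * f (cr W * Re (circ t)) \<partial>uiv)
      = (\<integral>\<^sup>+t. ?h (cr W * Re (circ t)) \<partial>uiv)"
      unfolding line_densities(2)[OF W] ..
    also have "\<dots> = (\<integral>\<^sup>+x. indicator {- cr W<..<cr W} x * ennreal (1 / (pi * sqrt ((cr W)\<^sup>2 - x\<^sup>2))) * ?h x \<partial>lborel)"
      by (rule arcsine_law[OF C(1)]) measurable
    also have "\<dots> = (\<integral>\<^sup>+x. indicator {W. 0 < qf W x} W * ennreal (dq W x / sqrt (qf W x)) * ?g x \<partial>lborel)"
    proof (rule nn_integral_cong)
      fix x
      show "indicator {- cr W<..<cr W} x * ennreal (1 / (pi * sqrt ((cr W)\<^sup>2 - x\<^sup>2))) * ?h x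
        = indicator {W. 0 < qf W x} W * ennreal (dq W x / sqrt (qf W x)) * ?g x"
      proof (cases "x \<in> {- cr W<..<cr W}")
        case True
        note S = K(3)[OF True]
        have d: "0 \<le> dq W x" using dq_pos[of W x] W by simp
        have "ennreal (1 / (pi * sqrt ((cr W)\<^sup>2 - x\<^sup>2))) * ennreal (dq W x / (W * (rS W * rT W) * AB x))
          = ennreal (dq W x / sqrt (qf W x)) * ennreal (1 / (pi * AB x))"
          unfolding S[THEN conjunct1] using S K(1) d AB_pos[of x]
          by (simp add: ennreal_mult'[symmetric] mult_ac)
        then have "ennreal (1 / (pi * sqrt ((cr W)\<^sup>2 - x\<^sup>2))) * ?h x = ennreal (dq W x / sqrt (qf W x)) * ?g x"
          by (simp only: mult.assoc[symmetric])
        then show ?thesis using True K(2)[of x] by simp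
      next
        case False
        then show ?thesis using K(2)[of x] by simp
      qed
    qed
    finally show ?thesis .
  qed
  have "(\<integral>\<^sup>+t. ennreal ((1 + W0) / 2 * poisson2 (mA W0) (circ t) - (1 - W0) / 2 * poisson2 (mB W0) (circ t)) * f (cr W0 * Re (circ t)) \<partial>uiv)
    = (\<integral>\<^sup>+x. ennreal (2 * sqrt (max 0 (qf W0 x))) * ?g x \<partial>lborel)"
  proof -
    note C = cr_facts[OF W0] and K = core[OF W0]
    let ?h = "\<lambda>x. ennreal (2 * (W0 * (rS W0 * rT W0)) * ((cr W0)\<^sup>2 - x\<^sup>2) / AB x) * f x"
    have "(\<integral>\<^sup>+t. ennreal ((1 + W0) / 2 * poisson2 (mA W0) (circ t) - (1 - W0) / 2 * poisson2 (mB W0) (circ t)) * f (cr W0 * Re (circ t)) \<partial>uiv)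
      = (\<integral>\<^sup>+t. ?h (cr W0 * Re (circ t)) \<partial>uiv)"
      unfolding line_densities(1)[OF W0] ..
    also have "\<dots> = (\<integral>\<^sup>+x. indicator {- cr W0<..<cr W0} x * ennreal (1 / (pi * sqrt ((cr W0)\<^sup>2 - x\<^sup>2))) * ?h x \<partial>lborel)"
      by (rule arcsine_law[OF C(1)]) measurable
    also have "\<dots> = (\<integral>\<^sup>+x. ennreal (2 * sqrt (max 0 (qf W0 x))) * ?g x \<partial>lborel)"
    proof (rule nn_integral_cong)
      fix x
      show "indicator {- cr W0<..<cr W0} x * ennreal (1 / (pi * sqrt ((cr W0)\<^sup>2 - x\<^sup>2))) * ?h x = ennreal (2 * sqrt (max 0 (qf W0 x))) * ?g x"
      proof (cases "x \<in> {- cr W0<..<cr W0}")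
        case True
        note S = K(3)[OF True]
        have p: "max 0 (qf W0 x) = qf W0 x" using True K(2)[of x] by simp
        have q: "(cr W0)\<^sup>2 - x\<^sup>2 = sqrt ((cr W0)\<^sup>2 - x\<^sup>2) * sqrt ((cr W0)\<^sup>2 - x\<^sup>2)" using S by simp
        define z where "z = sqrt ((cr W0)\<^sup>2 - x\<^sup>2)"
        have "ennreal (1 / (pi * z)) * ennreal (2 * (W0 * (rS W0 * rT W0)) * (z * z) / AB x)
          = ennreal (2 * (W0 * (rS W0 * rT W0) * z)) * ennreal (1 / (pi * AB x))"
          using S K(1) AB_pos[of x] unfolding z_def[symmetric]
          by (simp add: ennreal_mult'[symmetric] mult_ac)
        then have "ennreal (1 / (pi * sqrt ((cr W0)\<^sup>2 - x\<^sup>2))) * ennreal (2 * (W0 * (rS W0 * rT W0)) * ((cr W0)\<^sup>2 - x\<^sup>2) / AB x)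
          = ennreal (2 * sqrt (qf W0 x)) * ennreal (1 / (pi * AB x))"
          unfolding S[THEN conjunct1] z_def q[symmetric] .
        then have "ennreal (1 / (pi * sqrt ((cr W0)\<^sup>2 - x\<^sup>2))) * ?h x = ennreal (2 * sqrt (max 0 (qf W0 x))) * ?g x"
          unfolding p by (simp only: mult.assoc[symmetric])
        then show ?thesis using True by simp
      next
        case False
        then have "\<not> 0 < qf W0 x" using K(2)[of x] by blast
        then have "max 0 (qf W0 x) = 0" by simp
        then show ?thesis using False by simp
      qed
    qed
    finally show ?thesis .
  qed
  also have "\<dots> = (\<integral>\<^sup>+x. \<integral>\<^sup>+W. indicator {0<..<W0} W * (indicator {W. 0 < qf W x} W * ennreal (dq W x / sqrt (qf W x)) * ?g x) \<partial>lborel \<partial>lborel)"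
  proof (rule nn_integral_cong)
    fix x
    have "ennreal (2 * sqrt (max 0 (qf W0 x))) * ?g x
      = (\<integral>\<^sup>+W. indicator {0<..<W0} W * (indicator {W. 0 < qf W x} W * ennreal (dq W x / sqrt (qf W x))) \<partial>lborel) * ?g x"
      unfolding qf_level_integral[OF W0] ..
    also have "\<dots> = (\<integral>\<^sup>+W. indicator {0<..<W0} W * (indicator {W. 0 < qf W x} W * ennreal (dq W x / sqrt (qf W x))) * ?g x \<partial>lborel)"
      by (rule nn_integral_multc[symmetric]) measurable
    finally show "ennreal (2 * sqrt (max 0 (qf W0 x))) * ?g x
      = (\<integral>\<^sup>+W. indicator {0<..<W0} W * (indicator {W. 0 < qf W x} W * ennreal (dq W x / sqrt (qf W x)) * ?g x) \<partial>lborel)"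
      by (simp only: mult.assoc)
  qed
  also have "\<dots> = (\<integral>\<^sup>+W. \<integral>\<^sup>+x. indicator {0<..<W0} W * (indicator {W. 0 < qf W x} W * ennreal (dq W x / sqrt (qf W x)) * ?g x) \<partial>lborel \<partial>lborel)"
  proof (rule lborel_pair.Fubini')
    have "(\<lambda>(W, x). indicator {0<..<W0} W * (indicator {p. 0 < qf (fst p) (snd p)} (W, x) * ennreal (dq W x / sqrt (qf W x)) * ?g x)) \<in> borel_measurable (lborel \<Otimes>\<^sub>M lborel)"
      unfolding qf_def dq_def by measurable
    then show "(\<lambda>(W, x). indicator {0<..<W0} W * (indicator {W. 0 < qf W x} W * ennreal (dq W x / sqrt (qf W x)) * ?g x)) \<in> borel_measurable (lborel \<Otimes>\<^sub>M lborel)"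
      by (simp add: indicator_def)
  qed
  also have "\<dots> = (\<integral>\<^sup>+W. indicator {0<..<W0} W * (\<integral>\<^sup>+t. ennreal ((poisson2 (mA W) (circ t) + poisson2 (mB W) (circ t)) / 2) * f (cr W * Re (circ t)) \<partial>uiv) \<partial>lborel)"
  proof (rule nn_integral_cong)
    fix W
    show "(\<integral>\<^sup>+x. indicator {0<..<W0} W * (indicator {W. 0 < qf W x} W * ennreal (dq W x / sqrt (qf W x)) * ?g x) \<partial>lborel)
      = indicator {0<..<W0} W * (\<integral>\<^sup>+t. ennreal ((poisson2 (mA W) (circ t) + poisson2 (mB W) (circ t)) / 2) * f (cr W * Re (circ t)) \<partial>uiv)"
      using inner[of W] W0 by (cases "W \<in> {0<..<W0}") auto
  qed
  finally show ?thesis .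
qed

end

section \<open>The level and the line measure determined by the charge\<close>

locale joined_caps = ellipse_family b for b +
  fixes a :: real
  assumes a: "0 < a" and joined: "1 + a < a * b\<^sup>2"
begin

definition W0 :: real where "W0 = 1 / (1 + 2 * a)"

text \<open>The hypothesis \<open>joined\<close> amounts to \<open>W0 < Wmax\<close>: D fits into
  the strip. The two halves are the weights of \<open>line_densities\<close> in terms of a.\<close>

lemma W0: "0 < W0" "W0 < Wmax" "(1 + W0) / 2 = W0 * (1 + a)" "(1 - W0) / 2 = W0 * a" "W0 < 1"
proof -
  show "0 < W0" "(1 + W0) / 2 = W0 * (1 + a)" "(1 - W0) / 2 = W0 * a" "W0 < 1"
    using a by (simp_all add: W0_def field_simps)
  have "ch - sh < 2 * a * sh"
  proof -
    have b0: "0 < b" using b by simp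
    have "1 < a * (b * b - 1)" using joined by (simp add: power2_eq_square algebra_simps)
    also have "a * (b * b - 1) = b * (a * (b - 1 / b))" using b0 by (simp add: field_simps)
    finally have "1 / b < a * (b - 1 / b)" using b0 by (simp add: divide_less_eq mult.commute)
    also have "b - 1 / b = 2 * sh" using ch_sh(5,6) by linarith
    finally show ?thesis unfolding ch_sh(6) by simp
  qed
  then have "ch < sh * (1 + 2 * a)" by (simp add: algebra_simps)
  then show "W0 < Wmax" unfolding Wmax(2) W0_def using a ch_sh by (simp add: divide_less_eq less_divide_eq mult.commute)
qed

text \<open>The sweep of weight 1 + a at +-i/b and -a at +-ib onto the focal segment, in the circle
  parameter. The second summand is added with coefficient -a to match the form of
  \<open>line_spot\<close>.\<close>

definition dens :: "real \<Rightarrow> real" where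
  "dens t = (1 + a) * poisson2 (mA W0) (circ t) + - a * poisson2 (mB W0) (circ t)"

lemma W0_dens: "W0 * dens t = (1 + W0) / 2 * poisson2 (mA W0) (circ t) - (1 - W0) / 2 * poisson2 (mB W0) (circ t)"
  unfolding W0(3,4) dens_def by (simp add: algebra_simps)

lemma dens_nonneg: "0 \<le> dens t"
proof -
  note C = cr_facts[OF W0(1,2)] and F = W_facts[OF W0(1,2)]
  have "0 < rT W0" using F by linarith
  then have k: "0 \<le> 2 * (W0 * (rS W0 * rT W0))" using F(3) W0(1) by simp
  have "(Re (circ t))\<^sup>2 \<le> 1" using circ_sq[of t] by (smt (verit) zero_le_power2)
  then have "(cr W0 * Re (circ t))\<^sup>2 \<le> (cr W0)\<^sup>2" unfolding power_mult_distrib by (rule mult_left_le) simp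
  then have "0 \<le> W0 * dens t"
    unfolding W0_dens line_densities(1)[OF W0(1,2)] by (intro divide_nonneg_pos[OF mult_nonneg_nonneg[OF k] AB_pos]) simp
  then show ?thesis using W0(1) by (simp add: zero_le_mult_iff)
qed

text \<open>The parameter 0 belongs to the end \<open>cr W0\<close> of the segment, where the
  density vanishes by \<open>line_densities\<close>. This is the balance that
  \<open>balanced_quotient_log\<close> requires.\<close>

lemma dens_balance: "(1 + a) * ((1 - mA W0) / (1 + mA W0)) = a * ((1 - mB W0) / (1 + mB W0))"
proof -
  have p: "poisson2 M (circ 0) = (1 - M) / (1 + M)" if "0 < M" for M
  proof -
    have "1 - M\<^sup>2 = (1 - M) * (1 + M)" by (simp add: power2_eq_square algebra_simps)
    moreover have "cmod ((circ 0)\<^sup>2 + of_real M) = 1 + M"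
    proof -
      have "(circ 0)\<^sup>2 + of_real M = of_real (1 + M)" by (simp add: circ_def)
      then show ?thesis using that by (simp only: norm_of_real)
    qed
    ultimately show ?thesis using that by (simp add: poisson2_def power2_eq_square)
  qed
  have "W0 * dens 0 = 0" unfolding W0_dens line_densities(1)[OF W0(1,2)] by (simp add: circ_def)
  then have "dens 0 = 0" using W0(1) by simp
  then show ?thesis unfolding dens_def using p mAB(1,5)[OF W0(1,2)] by simp
qed

lemma measurable_dens [measurable]: "dens \<in> borel_measurable borel"
  unfolding dens_def[abs_def] by measurable

text \<open>Multiplied by \<^const>\<open>W0\<close>, this is the sum of the swept leaves inside of \<open>D\<close>
  (\<open>spot_line_law_shadow\<close> below).\<close>

definition line_law :: "real measure" where
  "line_law = distr (density uiv (\<lambda>t. ennreal (dens t))) borel (\<lambda>t. cr W0 * Re (circ t))"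

lemma nn_integral_line_law:
  assumes [measurable]: "f \<in> borel_measurable borel"
  shows "(\<integral>\<^sup>+x. f x \<partial>line_law) = (\<integral>\<^sup>+t. ennreal (dens t) * f (cr W0 * Re (circ t)) \<partial>uiv)"
  unfolding line_law_def by (subst nn_integral_distr) (auto simp: nn_integral_density)

lemma sum_one: "(1 + a) + - a = 1" by simp

lemma prob_on_line_law: "prob_on UNIV line_law"
proof -
  have hb: "has_bochner_integral uiv dens 1"
    unfolding dens_def[abs_def] using line_spot[OF W0(1,2) sum_one dens_nonneg[unfolded dens_def]] by metis
  have "(\<integral>\<^sup>+t. ennreal (dens t) \<partial>uiv) = ennreal 1"
    using hb dens_nonneg by (subst nn_integral_eq_integral) (auto simp: has_bochner_integral_iff)
  then interpret prob_space "density uiv (\<lambda>t. ennreal (dens t))"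
    by (intro prob_spaceI) (simp add: emeasure_density)
  have "prob_space line_law" unfolding line_law_def by (rule prob_space_distr) simp
  then interpret C: prob_space line_law .
  show ?thesis using C.emeasure_space_1 C.prob_space_axioms by (simp add: prob_on_def line_law_def)
qed

lemma spot_line_law: "spot (distr line_law borel line_pt) x = (\<integral>\<^sup>+t. ennreal (dens t) * skernel x (line_pt (cr W0 * Re (circ t))) \<partial>uiv)"
proof -
  have "spot (distr line_law borel line_pt) x = (\<integral>\<^sup>+y. skernel x (line_pt y) \<partial>line_law)"
    unfolding spot_def by (subst nn_integral_distr) (auto simp: line_law_def)
  also have "\<dots> = (\<integral>\<^sup>+t. ennreal (dens t) * skernel x (line_pt (cr W0 * Re (circ t))) \<partial>uiv)"
    by (rule nn_integral_line_law) measurable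
  finally show ?thesis .
qed

lemma spot_line_law_shadow:
  "ennreal W0 * spot (distr line_law borel line_pt) x = (\<integral>\<^sup>+W. indicator {0<..<W0} W * shadow W x \<partial>lborel)"
proof -
  have "ennreal W0 * spot (distr line_law borel line_pt) x
    = (\<integral>\<^sup>+t. ennreal W0 * (ennreal (dens t) * skernel x (line_pt (cr W0 * Re (circ t)))) \<partial>uiv)"
    unfolding spot_line_law by (rule nn_integral_cmult[symmetric]) measurable
  also have "\<dots> = (\<integral>\<^sup>+t. ennreal ((1 + W0) / 2 * poisson2 (mA W0) (circ t) - (1 - W0) / 2 * poisson2 (mB W0) (circ t)) * skernel x (line_pt (cr W0 * Re (circ t))) \<partial>uiv)"
    unfolding W0_dens[symmetric] using dens_nonneg W0(1) by (simp add: ennreal_mult mult.assoc)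
  also have "\<dots> = (\<integral>\<^sup>+W. indicator {0<..<W0} W * shadow W x \<partial>lborel)"
    unfolding shadow_def by (rule line_identity[OF W0(1,2), of "\<lambda>y. skernel x (line_pt y)"]) measurable
  finally show ?thesis .
qed

text \<open>On the segment the preimages are conjugate, their moduli agree and all terms but
  \<open>c0\<close> cancel. If the moduli differ, the preimages are real, and \<open>G - c0\<close>
  is half the expression in \<open>balanced_quotient_log\<close>.\<close>

lemma field_gap:
  fixes x :: real
  assumes r: "rts W0 (of_real x) u v"
  defines "G \<equiv> ext_field a b x - line_log (1 + a) (- a) W0 u v"
    and "c0 \<equiv> ln (eta W0) + (1 + 2 * a) * (ln (be W0 / al W0) / 2)"
  shows "c0 \<le> G" "x\<^sup>2 \<le> (cr W0)\<^sup>2 \<Longrightarrow> G = c0"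
proof -
  note W = W0(1,2)
  note R = rts_facts[OF W r] and A = al_be[OF W] and m = mAB[OF W] and F = W_facts[OF W]
  define q where "q = be W0 / al W0"
  have q: "0 < q" "q < 1" using A by (simp_all add: q_def)
  define M where "M = pM W0"
  have M: "0 < M" "M < 1" using F by (simp_all add: M_def)
  define nu where "nu = cmod u"
  define nv where "nv = cmod v"
  define A1 where "A1 = cmod (of_real M + u\<^sup>2)"
  define A2 where "A2 = cmod (of_real M + v\<^sup>2)"
  define B1 where "B1 = cmod (1 + of_real M * u\<^sup>2)"
  define B2 where "B2 = cmod (1 + of_real M * v\<^sup>2)"
  have b0: "0 < 1 / b" "0 < b" using b by simp_all
  have k: "0 < (al W0)\<^sup>2 * (eta W0)\<^sup>2" using A by simp
  have e1: "x\<^sup>2 + (1 / b)\<^sup>2 = (al W0)\<^sup>2 * (eta W0)\<^sup>2 * A1 * A2"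
  proof -
    have "cmod (of_real (x\<^sup>2 + (1 / b)\<^sup>2)) = (al W0)\<^sup>2 * (eta W0)\<^sup>2 * A1 * A2"
      unfolding of_real_add of_real_power unfolding R(9) unfolding norm_mult norm_of_real A1_def A2_def M_def using k by simp
    then show ?thesis unfolding norm_of_real by simp
  qed
  have e2: "x\<^sup>2 + b\<^sup>2 = (al W0)\<^sup>2 * (eta W0)\<^sup>2 * B1 * B2"
  proof -
    have "cmod (of_real (x\<^sup>2 + b\<^sup>2)) = (al W0)\<^sup>2 * (eta W0)\<^sup>2 * B1 * B2"
      unfolding of_real_add of_real_power unfolding R(8) unfolding norm_mult norm_of_real B1_def B2_def M_def using k by simp
    then show ?thesis unfolding norm_of_real by simp
  qed
  have "0 < x\<^sup>2 + (1 / b)\<^sup>2" "0 < x\<^sup>2 + b\<^sup>2" using b0 by (simp_all add: add_nonneg_pos)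
  then have pos: "0 < A1" "0 < A2" "0 < B1" "0 < B2"
    unfolding e1 e2 by (auto simp: A1_def A2_def B1_def B2_def)
  have nu: "0 < nu" using R(1) by (simp add: nu_def)
  have p: "0 < (al W0)\<^sup>2" "0 < (eta W0)\<^sup>2" "0 < eta W0" using A by simp_all
  have l1: "ln (x\<^sup>2 + (1 / b)\<^sup>2) = 2 * ln (al W0) + 2 * ln (eta W0) + ln A1 + ln A2"
    unfolding e1 using pos p A(3) by (simp only: ln_mult_pos mult_pos_pos ln_realpow of_nat_numeral)
  have l2: "ln (x\<^sup>2 + b\<^sup>2) = 2 * ln (al W0) + 2 * ln (eta W0) + ln B1 + ln B2"
    unfolding e2 using pos p A(3) by (simp only: ln_mult_pos mult_pos_pos ln_realpow of_nat_numeral)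
  have G: "G - c0 = (1 + a) * ((ln A2 - ln A1) / 2 + ln nu - ln q / 2) - a * ((ln B1 - ln B2) / 2 - ln nu + ln q / 2)"
  proof -
    have i: "1 / b\<^sup>2 = (1 / b)\<^sup>2" by (simp add: power_divide)
    have A1': "cmod (u\<^sup>2 + of_real (pM W0)) = A1" by (simp add: A1_def M_def add.commute)
    have B2': "cmod (1 + of_real (pM W0) * v\<^sup>2) = B2" by (simp add: B2_def M_def)
    show ?thesis
      unfolding G_def line_log_def c0_def ext_field_def i l1 l2 A1' B2' nu_def[symmetric] q_def[symmetric] by (simp add: field_simps)
  qed
  have uvn: "nu * nv = q"
  proof -
    have "u * v = of_real q" using r by (simp only: rts_def q_def)
    then have "cmod (u * v) = \<bar>q\<bar>" by (simp only: norm_of_real)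
    then show ?thesis using q by (simp add: nu_def nv_def norm_mult)
  qed
  have eqcase: "G = c0" if "nu = nv"
  proof -
    have nq: "nu * nu = q" using uvn that by simp
    have "v = cnj u"
    proof -
      have "u * cnj u = of_real q" unfolding complex_norm_square[symmetric] using nq by (simp add: nu_def power2_eq_square)
      also have "\<dots> = u * v" using r by (simp only: rts_def q_def)
      finally show ?thesis using R(1) by simp
    qed
    then have "A2 = A1" "B2 = B1"
    proof -
      have "cmod (cnj (of_real M + u\<^sup>2)) = cmod (of_real M + u\<^sup>2)" "cmod (cnj (1 + of_real M * u\<^sup>2)) = cmod (1 + of_real M * u\<^sup>2)"
        by (rule complex_mod_cnj)+
      then show "A2 = A1" "B2 = B1" using \<open>v = cnj u\<close> by (simp_all add: A1_def A2_def B1_def B2_def)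
    qed
    moreover have "ln q = 2 * ln nu" unfolding nq[symmetric] using nu by (simp add: ln_mult_pos)
    ultimately have "G - c0 = 0" unfolding G by simp
    then show ?thesis by simp
  qed
  \<comment> \<open>Sum and product of the preimages are real, so they are both real or conjugate to
    each other; conjugates have equal moduli.\<close>
  have realcase: "Im u = 0 \<and> Im v = 0" if "nu \<noteq> nv"
  proof -
    have s: "u + v = of_real (x / al W0)" "u * v = of_real q" using r by (simp_all add: rts_def q_def)
    have im: "Im u + Im v = 0" using arg_cong[OF s(1), of Im] by simp
    have "Re u * Im v + Im u * Re v = 0" using arg_cong[OF s(2), of Im] by simp
    moreover have iv: "Im v = - Im u" using im by linarith
    ultimately have "Im u * (Re v - Re u) = 0" by (simp add: algebra_simps)
    moreover have "Re v \<noteq> Re u \<or> Im u = 0"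
    proof (rule ccontr)
      assume "\<not> (Re v \<noteq> Re u \<or> Im u = 0)"
      then have "v = cnj u" using iv by (simp add: complex_eq_iff)
      then show False using that by (simp add: nu_def nv_def)
    qed
    ultimately show ?thesis using iv by auto
  qed
  \<comment> \<open>The squared modulus of the larger preimage relative to the circle over the
    segment; y = 1 means that z lies on the segment.\<close>
  define y where "y = nu\<^sup>2 / q"
  have y1: "1 \<le> y" using R(4) q by (simp add: y_def nu_def q_def[symmetric])
  have v2: "nv\<^sup>2 = q / y" "nu\<^sup>2 = q * y"
  proof -
    have "nv = q / nu" using uvn nu by (simp add: field_simps)
    then show "nv\<^sup>2 = q / y" "nu\<^sup>2 = q * y" using q nu by (simp_all add: y_def power_divide power2_eq_square)
  qed
  show "c0 \<le> G"
  proof (cases "nu = nv")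
    case True
    then show ?thesis using eqcase by simp
  next
    case False
    have sq: "u\<^sup>2 = of_real (q * y)" "v\<^sup>2 = of_real (q / y)"
    proof -
      have w: "w\<^sup>2 = of_real ((cmod w)\<^sup>2)" if "Im w = 0" for w
        unfolding cmod_power2 using that by (simp add: complex_eq_iff power2_eq_square)
      show "u\<^sup>2 = of_real (q * y)" "v\<^sup>2 = of_real (q / y)"
        unfolding v2[symmetric] nu_def nv_def
        by (rule w[OF realcase[OF False, THEN conjunct1]] w[OF realcase[OF False, THEN conjunct2]])+
    qed
    have mM: "M = mA W0 * q" "mB W0 = M * q" using m by (simp_all add: M_def q_def)
    have y0: "0 < y" using y1 by simp
    have nn: "cmod (of_real s + of_real t) = s + t" if "0 < s" "0 < t" for s t
      unfolding of_real_add[symmetric] norm_of_real using that by simp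
    have qy: "0 < q * y" "0 < q / y" using q y0 by simp_all
    have a1: "A1 = q * (mA W0 + y)" unfolding A1_def sq unfolding nn[OF M(1) qy(1)] unfolding mM(1) by (simp add: algebra_simps)
    have a2: "A2 = q * (1 + mA W0 * y) / y" unfolding A2_def sq unfolding nn[OF M(1) qy(2)] unfolding mM(1) using y0 by (simp add: field_simps)
    have b1: "B1 = 1 + mB W0 * y"
    proof -
      have "1 + of_real M * of_real (q * y) = complex_of_real (1 + mB W0 * y)" unfolding mM(2) by simp
      then have "B1 = \<bar>1 + mB W0 * y\<bar>" unfolding B1_def sq by (simp only: norm_of_real)
      then show ?thesis using mult_pos_pos[OF m(1) y0] by simp
    qed
    have b2: "B2 = (mB W0 + y) / y"
    proof -
      have "1 + of_real M * of_real (q / y) = complex_of_real (1 + mB W0 / y)" unfolding mM(2) by simp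
      then have "B2 = \<bar>1 + mB W0 / y\<bar>" unfolding B2_def sq by (simp only: norm_of_real)
      also have "\<dots> = 1 + mB W0 / y" using divide_pos_pos[OF m(1) y0] by simp
      finally show ?thesis using y0 by (simp add: field_simps)
    qed
    have pp: "0 < mA W0 + y" "0 < 1 + mA W0 * y" "0 < mB W0 + y" "0 < 1 + mB W0 * y"
      using m(1,5) y0 by (simp_all add: add_pos_pos)
    have ly: "2 * ln nu = ln q + ln y"
    proof -
      have "ln (nu\<^sup>2) = ln (q * y)" unfolding v2 ..
      then show ?thesis using nu q y0 by (simp only: ln_realpow ln_mult_pos of_nat_numeral)
    qed
    have la: "ln A2 - ln A1 = ln (1 + mA W0 * y) - ln (mA W0 + y) - ln y"
      unfolding a1 a2 using pp q y0 by (simp add: ln_mult_pos ln_divide_pos)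
    have lb: "ln B1 - ln B2 = ln (1 + mB W0 * y) - ln (mB W0 + y) + ln y"
      unfolding b1 b2 using pp y0 by (simp add: ln_divide_pos)
    have "0 \<le> (1 + a) * ln ((1 + mA W0 * y) / (mA W0 + y)) - a * ln ((1 + mB W0 * y) / (mB W0 + y))"
      by (rule balanced_quotient_log[OF m(1,2,3) a dens_balance y1])
    also have "\<dots> = 2 * (G - c0)"
    proof -
      have "ln nu = (ln q + ln y) / 2" using ly by simp
      then show ?thesis unfolding G la lb using pp by (simp add: ln_divide_pos field_simps)
    qed
    finally show ?thesis by simp
  qed
  show "G = c0" if x: "x\<^sup>2 \<le> (cr W0)\<^sup>2"
  proof (rule ccontr)
    assume "G \<noteq> c0"
    then have ne: "nu \<noteq> nv" using eqcase by auto
    have s: "u + v = of_real (x / al W0)" "u * v = of_real q" using r by (simp_all add: rts_def q_def)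
    have re: "u = of_real (Re u)" "v = of_real (Re v)" using realcase[OF ne] by (simp_all add: complex_eq_iff)
    have "Re u + Re v = x / al W0" using arg_cong[OF s(1), of Re] by simp
    moreover have uv: "Re u * Re v = q" using arg_cong[OF s(2), of Re] realcase[OF ne] by simp
    moreover have "(Re u - Re v)\<^sup>2 = (Re u + Re v)\<^sup>2 - 4 * (Re u * Re v)" by (simp add: power2_eq_square algebra_simps)
    ultimately have "(Re u - Re v)\<^sup>2 = (x / al W0)\<^sup>2 - 4 * q" by simp
    also have "\<dots> \<le> 0"
    proof -
      have "x\<^sup>2 / (al W0)\<^sup>2 \<le> (cr W0)\<^sup>2 / (al W0)\<^sup>2" using x by (rule divide_right_mono) simp
      also have "\<dots> = 4 * q" unfolding cr_facts(2)[OF W] q_def using A(3) by (simp add: power2_eq_square)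
      finally show ?thesis by (simp add: power_divide)
    qed
    finally have "Re u = Re v" by simp
    then show False using ne re by (metis nu_def nv_def)
  qed
qed

lemma line_law_equilibrium: "line_equilibrium (ext_field a b) = line_law"
proof -
  note W = W0(1,2)
  obtain e where spot: "\<And>z u v. rts W0 z u v \<Longrightarrow>
      spot (distr line_law borel line_pt) (sph z) = ennreal (ln (1 + (cmod z)\<^sup>2) / 2 + e - line_log (1 + a) (- a) W0 u v)"
    and nn: "\<And>z u v. rts W0 z u v \<Longrightarrow> 0 \<le> ln (1 + (cmod z)\<^sup>2) / 2 + e - line_log (1 + a) (- a) W0 u v"
  proof (rule line_spot[OF W sum_one dens_nonneg[unfolded dens_def], folded dens_def, folded spot_line_law])
    fix e
    assume "\<And>z u v. rts W0 z u v \<Longrightarrow>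
      spot (distr line_law borel line_pt) (sph z) = ennreal (ln (1 + (cmod z)\<^sup>2) / 2 + e - line_log (1 + a) (- a) W0 u v)"
      "\<And>z u v. rts W0 z u v \<Longrightarrow> 0 \<le> ln (1 + (cmod z)\<^sup>2) / 2 + e - line_log (1 + a) (- a) W0 u v"
    then show thesis by (rule that)
  qed
  define c0 where "c0 = ln (eta W0) + (1 + 2 * a) * (ln (be W0 / al W0) / 2)"
  define c where "c = (1 + 2 * a) * ln b"
  have c: "0 \<le> ext_field a b x - ln (1 + x\<^sup>2) / 2 + c" for x
    unfolding c_def using b a by (intro ext_field_bound) auto
  have val: "\<exists>G\<ge>c0. (x\<^sup>2 \<le> (cr W0)\<^sup>2 \<longrightarrow> G = c0) \<and>
      spot (distr line_law borel line_pt) (line_pt x) + ennreal (ext_field a b x - ln (1 + x\<^sup>2) / 2 + c) = ennreal (e + G + c)" for x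
  proof -
    obtain u v where r: "rts W0 (of_real x) u v" using rts_exist[OF W] .
    define G where "G = ext_field a b x - line_log (1 + a) (- a) W0 u v"
    note g = field_gap[OF r, folded c0_def G_def]
    have n: "(cmod (of_real x))\<^sup>2 = x\<^sup>2" by simp
    have "spot (distr line_law borel line_pt) (line_pt x) + ennreal (ext_field a b x - ln (1 + x\<^sup>2) / 2 + c) = ennreal (e + G + c)"
      unfolding line_pt_def spot[OF r] unfolding n ennreal_plus[OF nn[OF r, unfolded n] c, symmetric] G_def
      by (rule arg_cong[where f = ennreal]) simp
    then show ?thesis using g by blast
  qed
  show ?thesis
  proof (rule line_equilibrium_eqI[OF prob_on_line_law measurable_ext_field c])
    fix x
    obtain G where G: "c0 \<le> G" "spot (distr line_law borel line_pt) (line_pt x) + ennreal (ext_field a b x - ln (1 + x\<^sup>2) / 2 + c) = ennreal (e + G + c)"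
      using val[of x] by auto
    show "ennreal (e + c0 + c) \<le> spot (distr line_law borel line_pt) (line_pt x) + ennreal (ext_field a b x - ln (1 + x\<^sup>2) / 2 + c)"
      unfolding G(2) using G(1) by (intro ennreal_leI) simp
  next
    have sup: "AE x in line_law. x\<^sup>2 \<le> (cr W0)\<^sup>2"
    proof -
      have "(cr W0 * Re (circ t))\<^sup>2 \<le> (cr W0)\<^sup>2" for t
      proof -
        have "(Re (circ t))\<^sup>2 \<le> 1" using circ_sq[of t] by (smt (verit) zero_le_power2)
        then show ?thesis unfolding power_mult_distrib by (rule mult_left_le) simp
      qed
      then show ?thesis unfolding line_law_def by (subst AE_distr_iff) auto
    qed
    then show "AE x in line_law. spot (distr line_law borel line_pt) (line_pt x) + ennreal (ext_field a b x - ln (1 + x\<^sup>2) / 2 + c) = ennreal (e + c0 + c)"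
    proof eventually_elim
      case (elim x)
      then show ?case using val[of x] by auto
    qed
  qed
qed

end

section \<open>Joined caps\<close>

text \<open>This sums the relations of single leaves over a range of levels. The reference terms
  gain the factor B - A, the total mass of these leaves.\<close>

lemma interval_relation:
  fixes f g :: "real \<Rightarrow> ennreal"
  assumes [measurable]: "f \<in> borel_measurable borel" "g \<in> borel_measurable borel" and AB: "A \<le> B"
  shows "(\<And>W. A < W \<Longrightarrow> W < B \<Longrightarrow> f W + c \<le> g W + d) \<Longrightarrow>
      (\<integral>\<^sup>+W. indicator {A<..<B} W * f W \<partial>lborel) + ennreal (B - A) * c \<le> (\<integral>\<^sup>+W. indicator {A<..<B} W * g W \<partial>lborel) + ennreal (B - A) * d"
    and "(\<And>W. A < W \<Longrightarrow> W < B \<Longrightarrow> f W + c = g W + d) \<Longrightarrow>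
      (\<integral>\<^sup>+W. indicator {A<..<B} W * f W \<partial>lborel) + ennreal (B - A) * c = (\<integral>\<^sup>+W. indicator {A<..<B} W * g W \<partial>lborel) + ennreal (B - A) * d"
proof -
  have e: "(\<integral>\<^sup>+W. indicator {A<..<B} W * h W \<partial>lborel) + ennreal (B - A) * k = (\<integral>\<^sup>+W. indicator {A<..<B} W * (h W + k) \<partial>lborel)"
    if [measurable]: "h \<in> borel_measurable borel" for h :: "real \<Rightarrow> ennreal" and k
  proof -
    have "ennreal (B - A) * k = (\<integral>\<^sup>+W. indicator {A<..<B} W * k \<partial>lborel)"
      using AB by (subst nn_integral_multc) auto
    then show ?thesis by (simp add: nn_integral_add[symmetric] distrib_left)
  qed
  show "(\<integral>\<^sup>+W. indicator {A<..<B} W * f W \<partial>lborel) + ennreal (B - A) * c \<le> (\<integral>\<^sup>+W. indicator {A<..<B} W * g W \<partial>lborel) + ennreal (B - A) * d"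
    if "\<And>W. A < W \<Longrightarrow> W < B \<Longrightarrow> f W + c \<le> g W + d"
    unfolding e[OF assms(1)] e[OF assms(2)] using that by (intro nn_integral_mono) (auto simp: indicator_def)
  show "(\<integral>\<^sup>+W. indicator {A<..<B} W * f W \<partial>lborel) + ennreal (B - A) * c = (\<integral>\<^sup>+W. indicator {A<..<B} W * g W \<partial>lborel) + ennreal (B - A) * d"
    if "\<And>W. A < W \<Longrightarrow> W < B \<Longrightarrow> f W + c = g W + d"
    unfolding e[OF assms(1)] e[OF assms(2)] using that by (intro nn_integral_cong) (auto simp: indicator_def)
qed

context ellipse_family
begin

lemma measurable_leaf [measurable]: "(\<lambda>W. leaf W x) \<in> borel_measurable borel"
  unfolding leaf_def by measurable

lemma measurable_shadow [measurable]: "(\<lambda>W. shadow W x) \<in> borel_measurable borel"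
  unfolding shadow_def by measurable

lemma height_pos:
  assumes "y \<in> S2" "y \<noteq> axis 3 1"
  shows "0 < 1 - y $ 3"
proof (rule ccontr)
  assume "\<not> 0 < 1 - y $ 3"
  moreover have "y $ 3 \<le> 1" using component_le_norm_cart[of y 3] assms by simp
  ultimately have "y $ 3 = 1" by simp
  then have "y = axis 3 1"
    using assms(1) unfolding S2_iff by (auto simp: vec_eq_iff forall_3 axis_def add_nonneg_eq_0_iff)
  with assms show False by simp
qed

text \<open>Planar points have imaginary part \<open>y $ 2 / (1 - y $ 3)\<close>, and all claims
  compare it with +-\<open>sh\<close>. The height \<sigma> is that of the north pole over either
  centre, so both circles pass through infinity and appear as the parallel boundary lines of the
  strip.\<close>

lemma strip_caps:
  assumes y: "y \<in> S2" "y \<noteq> axis 3 1"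
  defines "\<sigma> \<equiv> (1 + Wmax) / 2"
  shows "hlev y < Wmax \<longleftrightarrow> \<bar>y $ 2\<bar> < sh * (1 - y $ 3)"
    and "\<sigma> < half_inner y (sph (\<i> * of_real b)) \<longleftrightarrow> sh * (1 - y $ 3) < y $ 2"
    and "half_inner y (sph (\<i> * of_real b)) = \<sigma> \<longleftrightarrow> y $ 2 = sh * (1 - y $ 3)"
    and "\<sigma> < half_inner y (sph (- (\<i> * of_real b))) \<longleftrightarrow> sh * (1 - y $ 3) < - y $ 2"
    and "half_inner y (sph (- (\<i> * of_real b))) = \<sigma> \<longleftrightarrow> - y $ 2 = sh * (1 - y $ 3)"
proof -
  define d where "d = 1 - y $ 3"
  have d: "0 < d" unfolding d_def by (rule height_pos[OF y])
  have b0: "0 < b" using b by simp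
  have "2 * ch = b + 1 / b" "2 * sh = b - 1 / b" using ch_sh by linarith+
  then have bb: "b\<^sup>2 + 1 = 2 * ch * b" "b\<^sup>2 - 1 = 2 * sh * b" using b0 by (simp_all add: power2_eq_square field_simps)
  have r: "2 * b / (b\<^sup>2 + 1) = 1 / ch" "(b\<^sup>2 - 1) / (b\<^sup>2 + 1) = Wmax"
    unfolding bb Wmax(2) using b0 ch_sh by simp_all
  have r': "2 * - b / ((- b)\<^sup>2 + 1) = - (1 / ch)" using r(1) by simp
  have e: "- (\<i> * complex_of_real b) = \<i> * of_real (- b)" by simp
  have h1: "half_inner y (sph (\<i> * of_real b)) - \<sigma> = (y $ 2 - sh * d) / (2 * ch)"
    unfolding half_inner_sph_imag r \<sigma>_def d_def Wmax(2) using ch_sh(1) by (simp add: field_simps)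
  have h2: "half_inner y (sph (- (\<i> * of_real b))) - \<sigma> = (- y $ 2 - sh * d) / (2 * ch)"
    unfolding e half_inner_sph_imag r' unfolding power2_minus r \<sigma>_def d_def Wmax(2) using ch_sh(1) by (simp add: field_simps)
  have gen: "\<sigma> < h \<longleftrightarrow> k < u" "h = \<sigma> \<longleftrightarrow> u = k" if "h - \<sigma> = (u - k) / (2 * ch)" for h u k
  proof -
    have "\<sigma> < h \<longleftrightarrow> 0 < h - \<sigma>" "h = \<sigma> \<longleftrightarrow> h - \<sigma> = 0" by simp_all
    then show "\<sigma> < h \<longleftrightarrow> k < u" "h = \<sigma> \<longleftrightarrow> u = k" unfolding that using ch_sh(1) by (simp_all add: zero_less_divide_iff)
  qed
  show "\<sigma> < half_inner y (sph (\<i> * of_real b)) \<longleftrightarrow> sh * (1 - y $ 3) < y $ 2"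
    "half_inner y (sph (\<i> * of_real b)) = \<sigma> \<longleftrightarrow> y $ 2 = sh * (1 - y $ 3)"
    unfolding d_def[symmetric] by (rule gen[OF h1])+
  show "\<sigma> < half_inner y (sph (- (\<i> * of_real b))) \<longleftrightarrow> sh * (1 - y $ 3) < - y $ 2"
    "half_inner y (sph (- (\<i> * of_real b))) = \<sigma> \<longleftrightarrow> - y $ 2 = sh * (1 - y $ 3)"
    unfolding d_def[symmetric] by (rule gen[OF h2])+
  define Y where "Y = (y $ 2)\<^sup>2"
  have y1: "(y $ 1)\<^sup>2 = 2 * d - d\<^sup>2 - Y"
    using y(1) unfolding S2_iff Y_def d_def by (simp add: power2_eq_square algebra_simps)
  have "hlev y - Wmax = kk / (2 * cc * d) * (Y / sh\<^sup>2 - d\<^sup>2)"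
    unfolding hlev_def Wmax_def y1 Y_def[symmetric] d_def[symmetric] sh2 using d cc_gt
    by (simp add: divide_simps) (simp add: algebra_simps power2_eq_square)
  moreover have "0 < kk / (2 * cc * d)" using kk_pos cc_gt d by simp
  ultimately have "hlev y < Wmax \<longleftrightarrow> Y / sh\<^sup>2 - d\<^sup>2 < 0"
    by (smt (verit) mult_nonneg_nonneg mult_pos_neg)
  also have "\<dots> \<longleftrightarrow> Y < (sh * d)\<^sup>2" using ch_sh(2) by (simp add: divide_less_eq power_mult_distrib mult.commute)
  also have "\<dots> \<longleftrightarrow> \<bar>y $ 2\<bar> < sh * d"
    unfolding Y_def not_le[symmetric] abs_le_square_iff[symmetric] using ch_sh(2) d by simp
  finally show "hlev y < Wmax \<longleftrightarrow> \<bar>y $ 2\<bar> < sh * (1 - y $ 3)" unfolding d_def .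
qed

lemma foliation_strip:
  assumes [measurable]: "F \<in> borel_measurable borel" and W: "0 \<le> A" "A < B" "B \<le> Wmax"
  shows "(\<integral>\<^sup>+y. indicator {y. A < hlev y \<and> hlev y < B} y * F y \<partial>surface_measure)
    = (\<integral>\<^sup>+W. indicator {A<..<B} W * (\<integral>\<^sup>+t. ennreal (poisson2 (pM W) (circ t)) * F (sph (gam W t)) \<partial>uiv) \<partial>lborel)"
proof -
  have "(\<integral>\<^sup>+y. indicator {y. A < hlev y \<and> hlev y < B} y * F y \<partial>surface_measure)
    = (\<integral>\<^sup>+y. indicator {y. hlev y < Wmax} y * (indicator {y. A < hlev y \<and> hlev y < B} y * F y) \<partial>surface_measure)"
    using W by (intro nn_integral_cong) (auto simp: indicator_def)
  also have "\<dots> = (\<integral>\<^sup>+W. indicator {0<..<Wmax} W * (\<integral>\<^sup>+t. ennreal (poisson2 (pM W) (circ t)) * (indicator {y. A < hlev y \<and> hlev y < B} (sph (gam W t)) * F (sph (gam W t))) \<partial>uiv) \<partial>lborel)"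
    by (rule foliation) measurable
  also have "\<dots> = (\<integral>\<^sup>+W. indicator {A<..<B} W * (\<integral>\<^sup>+t. ennreal (poisson2 (pM W) (circ t)) * F (sph (gam W t)) \<partial>uiv) \<partial>lborel)"
  proof (rule nn_integral_cong)
    fix V
    show "indicator {0<..<Wmax} V * (\<integral>\<^sup>+t. ennreal (poisson2 (pM V) (circ t)) * (indicator {y. A < hlev y \<and> hlev y < B} (sph (gam V t)) * F (sph (gam V t))) \<partial>uiv)
      = indicator {A<..<B} V * (\<integral>\<^sup>+t. ennreal (poisson2 (pM V) (circ t)) * F (sph (gam V t)) \<partial>uiv)"
    proof (cases "0 < V \<and> V < Wmax")
      case True
      then have "indicator {y. A < hlev y \<and> hlev y < B} (sph (gam V t)) = (indicator {A<..<B} V :: ennreal)" for t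
        using arch_gam(3)[of V t] by (simp add: indicator_def)
      then show ?thesis using True by (cases "V \<in> {A<..<B}") simp_all
    next
      case False
      then show ?thesis using W by (auto simp: indicator_def)
    qed
  qed
  finally show ?thesis .
qed

end

context joined_caps
begin

text \<open>The factor \<open>1 - y $ 3\<close> clears the denominator of \<open>hlev\<close>: the
  sign off the pole is unchanged, and the function is continuous as \<open>reduction\<close>
  demands. At the north pole it is zero, so the pole belongs to neither region.\<close>

definition levH :: "real^3 \<Rightarrow> real" where
  "levH y = kk / 2 * ((y $ 1)\<^sup>2 / cc + (y $ 2)\<^sup>2 / (cc - 1)) - W0 * (1 - y $ 3)"

lemma levH_sign:
  assumes "y \<in> S2" "y \<noteq> axis 3 1"
  shows "levH y < 0 \<longleftrightarrow> hlev y < W0" "levH y > 0 \<longleftrightarrow> W0 < hlev y" "levH y = 0 \<longleftrightarrow> hlev y = W0"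
proof -
  note d = height_pos[OF assms]
  have "X / e * e = X" if "0 < e" for X e :: real using that by simp
  from this[OF d] have "levH y = (hlev y - W0) * (1 - y $ 3)" by (simp only: levH_def hlev_def left_diff_distrib)
  then show "levH y < 0 \<longleftrightarrow> hlev y < W0" "levH y > 0 \<longleftrightarrow> W0 < hlev y" "levH y = 0 \<longleftrightarrow> hlev y = W0"
    using d by (simp_all add: mult_less_0_iff zero_less_mult_iff)
qed

lemma joined_main:
  fixes p1 p2 :: "real^3" and \<sigma> \<sigma>' :: "(real^3) measure" and D :: "(real^3) set"
  defines "p1 \<equiv> sph (\<i> * of_real b)" and "p2 \<equiv> sph (- (\<i> * of_real b))"
    and "\<sigma> \<equiv> measure_plus (scale_measure (ennreal a) (return borel p1)) (scale_measure (ennreal a) (return borel p2))"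
    and "D \<equiv> measure_support (sphere_equilibrium \<sigma>)"
    and "\<sigma>' \<equiv> scale_measure (ennreal (1 / (2 * a)))
      (distr (line_equilibrium (ext_field a b)) borel (\<lambda>x. inv_stereo (Some (of_real x))))"
  shows "sphere_equilibrium \<sigma>' = uniform_measure surface_measure (closure (S2 - D))
    \<and> is_arg_min (weighted_energy (log_potential \<sigma>')) (prob_on S2) (uniform_measure surface_measure (closure (S2 - D)))"
proof -
  note W = W0(1,2)
  have p: "p1 \<in> S2" "p2 \<in> S2" unfolding p1_def p2_def by (rule sph_in_S2)+
  define x0 where "x0 = sph 0"
  have b0: "complex_of_real b \<noteq> 0" using b by simp
  have x0: "x0 \<in> S2" "x0 \<noteq> p1" "x0 \<noteq> p2"
    unfolding x0_def p1_def p2_def by (rule sph_in_S2) (use b0 in simp_all)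
  define s where "s = (1 + Wmax) / 2"
  have Wm1: "0 < Wmax" "Wmax < 1" using Wmax ch_sh by simp_all
  have s: "0 \<le> s" "s < 1" "1 - s = (1 - Wmax) / 2" using Wm1 by (simp_all add: s_def field_simps)
  let ?C1 = "{y. s < half_inner y p1}" and ?C2 = "{y. s < half_inner y p2}"
  let ?N = "{x \<in> S2. levH x < 0}" and ?P = "{x \<in> S2. levH x > 0}"
  let ?S = "{y. W0 < hlev y \<and> hlev y < Wmax}"
  note S = surface_measure_prob_on
  interpret S: prob_space surface_measure by (rule prob_on_S2[OF S])
  have Hc: "continuous_on UNIV levH" unfolding levH_def[abs_def] by (intro continuous_intros) (use cc_gt in auto)
  have [measurable]: "levH \<in> borel_measurable borel" using Hc by (rule borel_measurable_continuous_onI)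
  have circle: "AE y in surface_measure. half_inner y q \<noteq> c" if "q \<in> S2" for q c
    using emeasure_circle[OF that, of c] by (intro AE_I[of _ _ "{y. half_inner y q = c}"]) auto
  have ax: "axis 3 1 \<in> S2" unfolding S2_iff by (simp add: axis_def)
  \<comment> \<open>At the north pole division by zero gives \<open>hlev\<close> the misleading
    value 0; the pole is excluded as a null set.\<close>
  have aS: "AE y in surface_measure. y \<in> S2 \<and> y \<noteq> axis 3 1"
    using prob_on_S2(4)[OF S] circle[OF ax, of 1]
  proof eventually_elim
    case (elim y)
    then show ?case using ax by (auto simp: half_inner_def S2_iff[symmetric] norm_eq_1)
  qed
  \<comment> \<open>In the disintegration a single level is met by only one leaf, and the levels are
    integrated by Lebesgue measure.\<close>
  have lev: "AE y in surface_measure. hlev y \<noteq> W0"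
  proof -
    have "(\<integral>\<^sup>+y. indicator {y. hlev y < Wmax} y * indicator {y. hlev y = W0} y \<partial>surface_measure)
      = (\<integral>\<^sup>+V. indicator {0<..<Wmax} V * (\<integral>\<^sup>+t. ennreal (poisson2 (pM V) (circ t)) * indicator {y. hlev y = W0} (sph (gam V t)) \<partial>uiv) \<partial>lborel)"
      by (rule foliation) measurable
    also have "\<dots> = (\<integral>\<^sup>+V. 0 \<partial>(lborel :: real measure))"
    proof (rule nn_integral_cong_AE)
      show "AE V in lborel. indicator {0<..<Wmax} V * (\<integral>\<^sup>+t. ennreal (poisson2 (pM V) (circ t)) * indicator {y. hlev y = W0} (sph (gam V t)) \<partial>uiv) = 0"
        using AE_lborel_singleton[of W0]
      proof eventually_elim
        case (elim V)
        show ?case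
        proof (cases "0 < V \<and> V < Wmax")
          case True
          then have "indicator {y. hlev y = W0} (sph (gam V t)) = (0 :: ennreal)" for t
            using arch_gam(3)[of V t] elim by (simp add: indicator_def)
          then show ?thesis by simp
        next
          case False
          then show ?thesis by (auto simp: indicator_def)
        qed
      qed
    qed
    finally have "(\<integral>\<^sup>+y. indicator {y. hlev y < Wmax} y * indicator {y. hlev y = W0} y \<partial>surface_measure) = 0" by simp
    moreover have "(\<integral>\<^sup>+y. indicator {y. hlev y < Wmax} y * indicator {y. hlev y = W0} y \<partial>surface_measure) = (\<integral>\<^sup>+y. indicator {y. hlev y = W0} y \<partial>surface_measure)"
      using W by (intro nn_integral_cong) (auto simp: indicator_def)
    ultimately have "emeasure surface_measure {y. hlev y = W0} = 0" by simp
    then show ?thesis by (intro AE_I[of _ _ "{y. hlev y = W0}"]) auto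
  qed
  have H0: "emeasure surface_measure {x \<in> S2. levH x = 0} = 0"
  proof -
    have "AE y in surface_measure. y \<notin> {x \<in> S2. levH x = 0}"
      using aS lev by eventually_elim (simp add: levH_sign)
    then show ?thesis by (subst (asm) AE_iff_measurable[OF _ refl]) auto
  qed
  \<comment> \<open>It suffices to discard the great circle \<open>y $ 2 = 0\<close>, which is the
    circle at height 1/2 over the image of i.\<close>
  have pos_lev: "AE y in surface_measure. 0 < hlev y"
  proof -
    have n0: "AE y in surface_measure. half_inner y (sph \<i>) \<noteq> 1 / 2" using circle[OF sph_in_S2[of \<i>], of "1 / 2"] .
    show ?thesis using aS n0
    proof eventually_elim
      case (elim y)
      have y2: "y $ 2 \<noteq> 0" using elim half_inner_sph_imag[of y 1] by simp
      then have "0 < (y $ 2)\<^sup>2 / (cc - 1)" using cc_gt by simp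
      moreover have "0 \<le> (y $ 1)\<^sup>2 / cc" using cc_gt by simp
      ultimately have "0 < kk / 2 * ((y $ 1)\<^sup>2 / cc + (y $ 2)\<^sup>2 / (cc - 1))" using kk_pos by simp
      then show ?case unfolding hlev_def using height_pos[of y] elim by simp
    qed
  qed
  have UN: "(\<integral>\<^sup>+y. indicator ?N y * F y \<partial>surface_measure)
      = (\<integral>\<^sup>+V. indicator {0<..<W0} V * (\<integral>\<^sup>+t. ennreal (poisson2 (pM V) (circ t)) * F (sph (gam V t)) \<partial>uiv) \<partial>lborel)"
    if [measurable]: "F \<in> borel_measurable borel" for F
  proof -
    have "(\<integral>\<^sup>+y. indicator ?N y * F y \<partial>surface_measure) = (\<integral>\<^sup>+y. indicator {y. 0 < hlev y \<and> hlev y < W0} y * F y \<partial>surface_measure)"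
      using aS pos_lev by (intro nn_integral_cong_AE, eventually_elim) (simp add: indicator_def levH_sign)
    also have "\<dots> = (\<integral>\<^sup>+V. indicator {0<..<W0} V * (\<integral>\<^sup>+t. ennreal (poisson2 (pM V) (circ t)) * F (sph (gam V t)) \<partial>uiv) \<partial>lborel)"
      using W by (intro foliation_strip) auto
    finally show ?thesis .
  qed
  have HN: "emeasure surface_measure ?N = ennreal W0"
  proof -
    have "emeasure surface_measure ?N = (\<integral>\<^sup>+y. indicator ?N y * 1 \<partial>surface_measure)"
      by simp
    also have "\<dots> = (\<integral>\<^sup>+V. indicator {0<..<W0} V * (\<integral>\<^sup>+t. ennreal (poisson2 (pM V) (circ t)) * 1 \<partial>uiv) \<partial>lborel)"
      by (rule UN) measurable
    also have "\<dots> = (\<integral>\<^sup>+V. indicator {0<..<W0} V \<partial>lborel)"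
    proof (rule nn_integral_cong)
      fix V
      show "indicator {0<..<W0} V * (\<integral>\<^sup>+t. ennreal (poisson2 (pM V) (circ t)) * 1 \<partial>uiv) = indicator {0<..<W0} V"
      proof (cases "V \<in> {0<..<W0}")
        case True
        then have V: "0 < V" "V < Wmax" using W by auto
        note M = W_facts(12,13)[OF V]
        have "(\<integral>\<^sup>+t. ennreal (poisson2 (pM V) (circ t)) \<partial>uiv) = ennreal 1"
          using poisson2_total[OF M] poisson2_pos[OF M, OF norm_circ]
          by (subst nn_integral_eq_integral) (auto simp: has_bochner_integral_iff less_imp_le)
        then show ?thesis by simp
      next
        case False
        then show ?thesis by simp
      qed
    qed
    also have "\<dots> = ennreal W0" using W by simp
    finally show ?thesis .
  qed
  have uN: "upot ?N x = (\<integral>\<^sup>+V. indicator {0<..<W0} V * leaf V x \<partial>lborel)" for x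
    unfolding upot_def leaf_def by (rule UN) measurable
  have uP: "upot ?P x = (\<integral>\<^sup>+V. indicator {W0<..<Wmax} V * leaf V x \<partial>lborel) + upot ?C1 x + upot ?C2 x" for x
  proof -
    have ae: "AE y in surface_measure. y \<in> S2 \<and> y \<noteq> axis 3 1 \<and> half_inner y p1 \<noteq> s \<and> half_inner y p2 \<noteq> s"
      using aS circle[OF p(1), of s] circle[OF p(2), of s] by eventually_elim auto
    have "upot ?P x = (\<integral>\<^sup>+y. indicator ?S y * skernel x y + indicator ?C1 y * skernel x y + indicator ?C2 y * skernel x y \<partial>surface_measure)"
      unfolding upot_def using ae
    proof (intro nn_integral_cong_AE, eventually_elim)
      case (elim y)
      then have y: "y \<in> S2" "y \<noteq> axis 3 1" by auto
      note G = strip_caps[OF y, folded p1_def p2_def s_def]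
      have d: "0 < sh * (1 - y $ 3)" using height_pos[OF y] ch_sh(2) by simp
      have 1: "\<not> (hlev y < Wmax \<and> s < half_inner y p1)" "\<not> (hlev y < Wmax \<and> s < half_inner y p2)" "\<not> (s < half_inner y p1 \<and> s < half_inner y p2)"
        "hlev y < Wmax \<or> s < half_inner y p1 \<or> s < half_inner y p2"
        using elim unfolding G(1,2,4) unfolding G(3,5) using d by linarith+
      have "indicator ?P y = (indicator ?S y + indicator ?C1 y + indicator ?C2 y :: ennreal)"
        using 1 W levH_sign(2)[OF y] y by (auto simp: indicator_def)
      then show ?case by (simp add: distrib_right)
    qed
    also have "\<dots> = (\<integral>\<^sup>+y. indicator ?S y * skernel x y \<partial>surface_measure) + upot ?C1 x + upot ?C2 x"
    proof -
      have m: "(\<lambda>y. indicator ?S y * skernel x y) \<in> borel_measurable surface_measure"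
        "(\<lambda>y. indicator ?C1 y * skernel x y) \<in> borel_measurable surface_measure"
        "(\<lambda>y. indicator ?C2 y * skernel x y) \<in> borel_measurable surface_measure"
        by measurable
      show ?thesis
        unfolding upot_def nn_integral_add[OF borel_measurable_add[OF m(1,2)] m(3)] nn_integral_add[OF m(1,2)] ..
    qed
    also have "(\<integral>\<^sup>+y. indicator ?S y * skernel x y \<partial>surface_measure) = (\<integral>\<^sup>+V. indicator {W0<..<Wmax} V * leaf V x \<partial>lborel)"
      unfolding leaf_def using W by (intro foliation_strip) auto
    finally show ?thesis .
  qed
  define K where "K x = ennreal (1 / 2) * (skernel x p1 + skernel x p2)" for x
  \<comment> \<open>Each charge a W0 is made up of half the mass \<open>Wmax - W0\<close> of the
    leaves between D and the caps, and of the mass \<open>1 - s = (1 - Wmax) / 2\<close> of its own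
    cap.\<close>
  have split: "ennreal (a * W0) * (skernel x p1 + skernel x p2)
      = ennreal (Wmax - W0) * K x + ennreal (1 - s) * skernel x p1 + ennreal (1 - s) * skernel x p2" for x
  proof -
    have "a * W0 = (Wmax - W0) * (1 / 2) + (1 - s)" unfolding s(3) using W0(4) by (simp add: field_simps)
    then have "ennreal (a * W0) = ennreal (Wmax - W0) * ennreal (1 / 2) + ennreal (1 - s)"
      using W s by (simp only: ennreal_mult[symmetric] ennreal_plus[symmetric]) simp
    then show ?thesis by (simp only: K_def distrib_right distrib_left mult.assoc add_ac)
  qed
  have r0: "half_inner x0 p1 \<le> s" "half_inner x0 p2 \<le> s"
  proof -
    have y: "x0 \<noteq> axis 3 1"
    proof
      assume "x0 = axis 3 1"
      then have "sph 0 $ 3 = (axis 3 1 :: real^3) $ 3" unfolding x0_def by simp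
      then show False by (simp add: sph_nth axis_def)
    qed
    have "x0 $ 2 = 0" unfolding x0_def by (simp add: sph_nth)
    moreover have "0 < sh * (1 - x0 $ 3)" using height_pos[OF x0(1) y] ch_sh(2) by simp
    ultimately show "half_inner x0 p1 \<le> s" "half_inner x0 p2 \<le> s"
      using strip_caps(2,4)[OF x0(1) y, folded p1_def p2_def s_def] by linarith+
  qed
  note cap1 = cap_balayage[OF _ p(1) x0(1) s(1,2) r0(1)] and cap2 = cap_balayage[OF _ p(2) x0(1) s(1,2) r0(2)]
  have I: "upot ?P x + ennreal (a * W0) * (skernel x0 p1 + skernel x0 p2) \<le> upot ?P x0 + ennreal (a * W0) * (skernel x p1 + skernel x p2)"
    and I': "levH x < 0 \<Longrightarrow> upot ?P x + ennreal (a * W0) * (skernel x0 p1 + skernel x0 p2) = upot ?P x0 + ennreal (a * W0) * (skernel x p1 + skernel x p2)"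
    if x: "x \<in> S2" "x \<notin> {axis 3 1}" for x
  proof -
    obtain z where z: "x = sph z" using sph_surj[of x] x by auto
    have Wle: "W0 \<le> Wmax" using W by simp
    let ?L = "\<lambda>x. \<integral>\<^sup>+V. indicator {W0<..<Wmax} V * leaf V x \<partial>lborel"
    have L: "?L x + ennreal (Wmax - W0) * K x0 \<le> ?L x0 + ennreal (Wmax - W0) * K x"
    proof (rule interval_relation(1)[OF measurable_leaf measurable_leaf Wle])
      fix V assume "W0 < V" "V < Wmax"
      then show "leaf V x + K x0 \<le> leaf V x0 + K x"
        unfolding K_def z x0_def p1_def p2_def using W by (intro leaf_balance(1)) auto
    qed
    have re: "(l + u + v) + (k + m + n) = (l + k) + (u + m) + (v + n)" for l u v k m n :: ennreal
      by (simp only: add_ac)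
    show "upot ?P x + ennreal (a * W0) * (skernel x0 p1 + skernel x0 p2) \<le> upot ?P x0 + ennreal (a * W0) * (skernel x p1 + skernel x p2)"
      unfolding uP split re by (intro add_mono L cap1(1) cap2(1) x)
    show "upot ?P x + ennreal (a * W0) * (skernel x0 p1 + skernel x0 p2) = upot ?P x0 + ennreal (a * W0) * (skernel x p1 + skernel x p2)"
      if h: "levH x < 0"
    proof -
      have y: "x \<in> S2" "x \<noteq> axis 3 1" using x by auto
      have hx: "hlev x < W0" using levH_sign(1)[OF y] h by simp
      \<comment> \<open>A point of level below W0 lies inside of every leaf with V > W0, where the
        leaf relation is an equality.\<close>
      have L: "?L x + ennreal (Wmax - W0) * K x0 = ?L x0 + ennreal (Wmax - W0) * K x"
      proof (rule interval_relation(2)[OF measurable_leaf measurable_leaf Wle])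
        fix V assume "W0 < V" "V < Wmax"
        then show "leaf V x + K x0 = leaf V x0 + K x"
          unfolding K_def z x0_def p1_def p2_def using W hx by (intro leaf_balance(2)) (auto simp: z)
      qed
      have "\<bar>x $ 2\<bar> < sh * (1 - x $ 3)" using strip_caps(1)[OF y] hx W by simp
      then have "half_inner x p1 \<le> s" "half_inner x p2 \<le> s"
        using strip_caps(2,4)[OF y, folded p1_def p2_def s_def] by linarith+
      then show ?thesis unfolding uP split re by (simp only: L cap1(2)[OF y(1)] cap2(2)[OF y(1)])
    qed
  qed
  have II: "ennreal W0 * spot (distr line_law borel line_pt) p1 + upot ?N x \<le> ennreal W0 * spot (distr line_law borel line_pt) x + upot ?N p1"
    and II': "levH x > 0 \<Longrightarrow> ennreal W0 * spot (distr line_law borel line_pt) p1 + upot ?N x = ennreal W0 * spot (distr line_law borel line_pt) x + upot ?N p1"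
    if x: "x \<in> S2" "x \<notin> {axis 3 1}" for x
  proof -
    obtain z where z: "x = sph z" using sph_surj[of x] x by auto
    have add: "(\<integral>\<^sup>+V. indicator {0<..<W0} V * shadow V u \<partial>lborel) + (\<integral>\<^sup>+V. indicator {0<..<W0} V * leaf V v \<partial>lborel)
      = (\<integral>\<^sup>+V. indicator {0<..<W0} V * (shadow V u + leaf V v) \<partial>lborel)" for u v
      by (simp add: nn_integral_add[symmetric] distrib_left)
    show "ennreal W0 * spot (distr line_law borel line_pt) p1 + upot ?N x \<le> ennreal W0 * spot (distr line_law borel line_pt) x + upot ?N p1"
      unfolding spot_line_law_shadow uN add z p1_def
      using W shadow_balance(1) by (intro nn_integral_mono) (auto simp: indicator_def)
    show "ennreal W0 * spot (distr line_law borel line_pt) p1 + upot ?N x = ennreal W0 * spot (distr line_law borel line_pt) x + upot ?N p1"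
      if h: "levH x > 0"
    proof -
      \<comment> \<open>Such a point lies outside of all the leaves that make up D, so every shadow
        relation is an equality.\<close>
      have "W0 < hlev x" using levH_sign(2)[of x] h x by simp
      then show ?thesis
        unfolding spot_line_law_shadow uN add z p1_def
        using W shadow_balance(2) by (intro nn_integral_cong) (auto simp: indicator_def)
    qed
  qed
  have fin: "spot (distr line_law borel line_pt) p1 < \<top>"
  proof -
    obtain u v where r: "rts W0 (\<i> * of_real b) u v" using rts_exist[OF W] .
    show ?thesis
    proof (rule line_spot[OF W sum_one dens_nonneg[unfolded dens_def], folded dens_def, folded spot_line_law])
      fix e
      assume e: "\<And>z u v. rts W0 z u v \<Longrightarrow>
        spot (distr line_law borel line_pt) (sph z) = ennreal (ln (1 + (cmod z)\<^sup>2) / 2 + e - line_log (1 + a) (- a) W0 u v)"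
      show ?thesis unfolding p1_def e[OF r] by (rule ennreal_less_top)
    qed
  qed
  show ?thesis
    unfolding \<sigma>_def D_def \<sigma>'_def
    by (rule reduction[where a=a and H=levH and Z="{axis 3 1}" and \<rho>=line_law and ?x0.0=x0 and ?x1.0=p1, folded W0_def])
      (rule a p x0 Hc H0 HN prob_on_line_law line_law_equilibrium fin finite.insertI finite.emptyI | (rule II' II I' I; assumption))+
qed

end

theorem corollary1p3:
  fixes a b :: real and p1 p2 :: "real^3" and \<sigma> \<sigma>' :: "(real^3) measure"
    and V :: "real \<Rightarrow> real" and D D' :: "(real^3) set" and Q' :: "real^3 \<Rightarrow> ereal"
  assumes "b \<ge> 1" and "a > 0"
    and "p1 \<in> S2" and "stereo p1 = Some (\<i> * of_real b)"
    and "p2 \<in> S2" and "stereo p2 = Some (- \<i> * of_real b)"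
  defines "\<sigma> \<equiv> measure_plus (scale_measure (ennreal a) (return borel p1))
                             (scale_measure (ennreal a) (return borel p2))"
    and "D \<equiv> measure_support (sphere_equilibrium \<sigma>)"
    and "V \<equiv> (\<lambda>x. (1 + a) / 2 * ln (x\<^sup>2 + 1 / b\<^sup>2) - a / 2 * ln (x\<^sup>2 + b\<^sup>2))"
    and "\<sigma>' \<equiv> scale_measure (ennreal (1 / (2 * a)))
                  (distr (line_equilibrium V) borel (\<lambda>x. inv_stereo (Some (of_real x))))"
    and "Q' \<equiv> log_potential \<sigma>'"
    and "D' \<equiv> closure (S2 - D)"
  shows "sphere_equilibrium \<sigma>' = uniform_measure surface_measure D'
         \<and> is_arg_min (weighted_energy Q') (prob_on S2) (uniform_measure surface_measure D')"
proof -
  have p: "p1 = sph (\<i> * of_real b)" "p2 = sph (- (\<i> * of_real b))"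
  proof -
    have inj: "inj_on stereo S2" using bij_betw_stereo by (rule bij_betw_imp_inj_on)
    show "p1 = sph (\<i> * of_real b)" "p2 = sph (- (\<i> * of_real b))"
      using assms(3-6) by (auto intro!: inj_onD[OF inj] simp: stereo_sph simp del: sph_eq_iff intro: sph_in_S2)
  qed
  have V: "V = ext_field a b" by (simp add: V_def ext_field_def fun_eq_iff)
  show ?thesis
  \<comment> \<open>In the boundary case the caps touch at infinity; the difference of Cauchy
    densities is still nonnegative there, so it belongs to the separated case.\<close>
  proof (cases "a * b\<^sup>2 \<le> 1 + a")
    case True
    from separated_caps[OF assms(1,2) True] show ?thesis
      unfolding Q'_def D'_def \<sigma>'_def D_def \<sigma>_def V p .
  next
    case False
    \<comment> \<open>For b = 1 the condition of the separated case holds for every a, so the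
      ellipses are needed only where \<open>sh\<close> is positive.\<close>
    have "1 < b"
    proof (rule ccontr)
      assume "\<not> 1 < b"
      then have "b = 1" using assms(1) by simp
      with False show False by simp
    qed
    then interpret joined_caps b a
      using False assms(2) by unfold_locales simp_all
    from joined_main show ?thesis
      unfolding Q'_def D'_def \<sigma>'_def D_def \<sigma>_def V p .
  qed
qed

end
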